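(* Let $1<p\leq 2$. (i) If $E\subset\ell_p$ and $S_{E,p}(\mathscr{G})<\infty$ for some multiresolution family $\mathscr{G}$ for $E$ with inflation factor $A_{\mathscr{G}}\geq 240$, then $E$ is contained in a curve $\Gamma$ in $\ell_p$ with $\mathcal{H}^1(\Gamma)\leq C(p,A_{\mathscr{G}})\,S_{E,p}(\mathscr{G})$. (ii) If $\Sigma\subset\ell_p$ is connected and $\mathscr{H}$ is a multiresolution family for $\Sigma$ with inflation factor $A_{\mathscr{H}}>1$, then $S_{\Sigma,2}(\mathscr{H})\leq C(p,A_{\mathscr{H}})\,\mathcal{H}^1(\Sigma)$. Let $2\leq p<\infty$. (iii) If $E\subset\ell_p$ and $S_{E,2}(\mathscr{G})<\infty$ for some multiresolution family $\mathscr{G}$ for $E$ with inflation factor $A_{\mathscr{G}}\geq 240$, then $E$ is contained in a curve $\Gamma$ in $\ell_p$ with $\mathcal{H}^1(\Gamma)\leq C(p,A_{\mathscr{G}})\,S_{E,2}(\mathscr{G})$. (iv) If $\Sigma\subset\ell_p$ is connected and $\mathscr{H}$ is a multiresolution family for $\Sigma$ with inflation factor $A_{\mathscr{H}}>1$, then $S_{\Sigma,p}(\mathscr{H})\leq C(p,A_{\mathscr{H}})\,\mathcal{H}^1(\Sigma)$. Here $C(\cdot)$ denotes finite constants depending only on the indicated parameters.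
   Context: All Banach spaces are real. $\ell_p$ is the Banach space of $p$-summable real sequences with norm $|x|_p=(\sum_i|x_i|^p)^{1/p}$. For a Banach space $\mathbb{X}$, a nonempty set $E\subset\mathbb{X}$ and a set $Q\subset\mathbb{X}$ of positive diameter, the Jones beta number is $\beta_E(Q)=\inf_L\sup_{x\in E\cap Q}\mathrm{dist}(x,L)/\mathrm{diam}\,Q$ if $E\cap Q\neq\emptyset$, where $L$ ranges over all one-dimensional affine subspaces (lines) of $\mathbb{X}$, and $\beta_E(Q)=0$ if $E\cap Q=\emptyset$. For $\rho>0$, a $\rho$-net for $E$ is a set $X\subset E$ such that $|y-z|\geq\rho$ for all distinct $y,z\in X$ and $\mathrm{dist}(x,X)<\rho$ for all $x\in E$. A multiresolution family for $E$ with inflation factor $A>1$ is the collection of closed balls $\mathscr{G}=\{B(x,A2^{-k}):x\in X_k,\ k\in\mathbb{Z}\}$ (indexed by the pairs $(k,x)$), where $(X_k)_{k\in\mathbb{Z}}$ is a nested family ($X_k\subset X_{k+1}$) and each $X_k$ is a $2^{-k}$-net for $E$. For $0<r<\infty$, $S_{E,r}(\mathscr{G})=\mathrm{diam}\,E+\sum_{Q\in\mathscr{G}}\beta_E(Q)^r\,\mathrm{diam}\,Q$. A curve is the image of a continuous map from $[0,1]$; $\mathcal{H}^1$ is one-dimensional Hausdorff measure. *)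

theory Defs
  imports "HOL-Analysis.Analysis"
begin

type_synonym seq = "nat \<Rightarrow> real"

definition lp :: "real \<Rightarrow> seq set" where
  "lp p = {x. summable (\<lambda>i. \<bar>x i\<bar> powr p)}"

definition lpnorm :: "real \<Rightarrow> seq \<Rightarrow> real" where
  "lpnorm p x = (\<Sum>i. \<bar>x i\<bar> powr p) powr (1 / p)"

text \<open>Diameter (possibly infinite); the diameter of the empty set is 0.\<close>
definition lpdiam :: "real \<Rightarrow> seq set \<Rightarrow> ennreal" where
  "lpdiam p S = (SUP x\<in>S. SUP y\<in>S. ennreal (lpnorm p (\<lambda>i. x i - y i)))"

definition lpcball :: "real \<Rightarrow> seq \<Rightarrow> real \<Rightarrow> seq set" where
  "lpcball p x r = {y \<in> lp p. lpnorm p (\<lambda>i. y i - x i) \<le> r}"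

definition lplines :: "real \<Rightarrow> seq set set" where
  "lplines p = {{(\<lambda>i. a i + t * v i) | t. True} | a v. a \<in> lp p \<and> v \<in> lp p \<and> v \<noteq> (\<lambda>i. 0)}"

definition lpsetdist :: "real \<Rightarrow> seq \<Rightarrow> seq set \<Rightarrow> real" where
  "lpsetdist p x L = Inf ((\<lambda>y. lpnorm p (\<lambda>i. x i - y i)) ` L)"

text \<open>Jones beta number (used for bounded sets Q of positive diameter, e.g. balls).\<close>
definition beta :: "real \<Rightarrow> seq set \<Rightarrow> seq set \<Rightarrow> real" where
  "beta p E Q = (if E \<inter> Q = {} then 0
      else (INF L\<in>lplines p. SUP x\<in>E \<inter> Q. lpsetdist p x L) / enn2real (lpdiam p Q))"

definition is_net :: "real \<Rightarrow> real \<Rightarrow> seq set \<Rightarrow> seq set \<Rightarrow> bool" where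
  "is_net p \<rho> E X \<longleftrightarrow> X \<subseteq> E \<and>
     (\<forall>y\<in>X. \<forall>z\<in>X. y \<noteq> z \<longrightarrow> lpnorm p (\<lambda>i. y i - z i) \<ge> \<rho>) \<and>
     (\<forall>x\<in>E. \<exists>y\<in>X. lpnorm p (\<lambda>i. x i - y i) < \<rho>)"

text \<open>A multiresolution family is determined by the nested nets X_k and the
  inflation factor A; it consists of the balls B(x, A 2^-k), x in X_k, indexed by (k,x).\<close>
definition multires_nets :: "real \<Rightarrow> seq set \<Rightarrow> (int \<Rightarrow> seq set) \<Rightarrow> bool" where
  "multires_nets p E X \<longleftrightarrow> (\<forall>k. X k \<subseteq> X (k + 1)) \<and>
     (\<forall>k. is_net p (2 powr (- real_of_int k)) E (X k))"

definition Sfun :: "real \<Rightarrow> real \<Rightarrow> seq set \<Rightarrow> (int \<Rightarrow> seq set) \<Rightarrow> real \<Rightarrow> ennreal" where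
  "Sfun p r E X A = lpdiam p E +
     infsum (\<lambda>(k, x). ennreal (beta p E (lpcball p x (A * 2 powr (- real_of_int k))) powr r)
                      * lpdiam p (lpcball p x (A * 2 powr (- real_of_int k))))
            {(k, x). x \<in> X k}"

definition lp_curve :: "real \<Rightarrow> seq set \<Rightarrow> bool" where
  "lp_curve p \<Gamma> \<longleftrightarrow> (\<exists>\<gamma>. \<gamma> ` {0..1} \<subseteq> lp p \<and> \<Gamma> = \<gamma> ` {0..1} \<and>
     (\<forall>t\<in>{0..1::real}. \<forall>e>0. \<exists>d>0. \<forall>s\<in>{0..1}. \<bar>s - t\<bar> < d \<longrightarrow> lpnorm p (\<lambda>i. \<gamma> s i - \<gamma> t i) < e))"

definition lp_open :: "real \<Rightarrow> seq set \<Rightarrow> bool" where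
  "lp_open p U \<longleftrightarrow> U \<subseteq> lp p \<and> (\<forall>x\<in>U. \<exists>e>0. {y \<in> lp p. lpnorm p (\<lambda>i. y i - x i) < e} \<subseteq> U)"

definition lp_connected :: "real \<Rightarrow> seq set \<Rightarrow> bool" where
  "lp_connected p S \<longleftrightarrow> \<not> (\<exists>U V. lp_open p U \<and> lp_open p V \<and> S \<subseteq> U \<union> V \<and>
      U \<inter> V \<inter> S = {} \<and> U \<inter> S \<noteq> {} \<and> V \<inter> S \<noteq> {})"

definition H1_delta :: "real \<Rightarrow> real \<Rightarrow> seq set \<Rightarrow> ennreal" where
  "H1_delta p \<delta> S = (INF U\<in>{U :: nat \<Rightarrow> seq set. S \<subseteq> (\<Union>i. U i) \<and>
       (\<forall>i. U i \<subseteq> lp p \<and> lpdiam p (U i) \<le> ennreal \<delta>)}. (\<Sum>i. lpdiam p (U i)))"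

definition H1 :: "real \<Rightarrow> seq set \<Rightarrow> ennreal" where
  "H1 p S = (SUP \<delta>\<in>{0<..}. H1_delta p \<delta> S)"

end

theory Submission
 imports Defs "HOL-Library.Function_Algebras" "HOL-Library.Diagonal_Subsequence"
begin

text \<open>Sufficiency. Near a net point with small beta number the set is close to a line, and uniform
 smoothness of power type $q$ bounds the excess $|a-z|+|z-b|-|a-b|$ of a point $z$ between $a$ and $b$
 by $C\beta^q 2^{-k}$. Refining the nets scale by scale, a new point next to a flat point is inserted into
 the edge that it splits, which costs the excess, and a new point next to any other point is joined to
 its nearest neighbour, which costs $2^{-k}\le C\beta^q 2^{-k}$. A potential controls the end points of
 the graph. Tours of these spanning graphs have length at most a multiple of $S$, and the theorem of
 Arzela and Ascoli gives the curve.

 Necessity. A connected set of finite measure lies on a Lipschitz curve of comparable length.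
 In nested partitions of the curve into arcs of diameter about $2^{-j}$, uniform convexity of power
 type $s$ bounds the $s$-th powers of the deviations of arcs from their chords, and of the angles between
 consecutive chords, by the growth of the inscribed polygons, which telescopes. If a ball of radius
 $R$ has beta number $\beta$ although the arc through its center is much straighter, then the curve has a
 point at distance about $\beta R$ from that arc. Merging the members of a cover that meet the arc or a
 small ball around this point shows that the Hausdorff content at scale $R$ is smaller than the
 content at scale $\beta R$ by a multiple of $\beta R$. These gains telescope as well, and the same
 merging disposes of the balls that contain too many net points.\<close>

section \<open>Normed spaces and convexity\<close>

text \<open>The exponents come from the geometry of the space: \<open>lp p\<close> is uniformly
  smooth of power type min(p, 2) and uniformly convex of power type max(p, 2), so the two directions
  use the same exponent only for p = 2. The obstacle is infinite dimension. A ball may contain any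
  number of separated points and bounded sets need not be totally bounded, so neither finiteness of
  the nets nor a bound on the net points in a ball can be read off the space. For sufficiency,
  flatness supplies both, because points near a line are ordered along it. For necessity, finite
  measure bounds the nets, and the content of the curve pays for crowded balls. In the growth of the
  graphs the delicate places are the ends of strands. An end may be extended at every scale without
  any excess to pay for it. The extensions at one end add up to at most a multiple of the scale at
  which this end arose, and that amount is set aside once as its reserve; the reserve of a new point
  is smaller the farther it lies from the old net, so each extension is covered by the drop in
  reserve.\<close>

instantiation "fun" :: (type, real_vector) real_vector
begin

definition scaleR_fun :: "real \<Rightarrow> ('a \<Rightarrow> 'b) \<Rightarrow> 'a \<Rightarrow> 'b"
 where "scaleR_fun c f = (\<lambda>x. c *\<^sub>R f x)"

instance
 by standard (auto simp: scaleR_fun_def fun_eq_iff algebra_simps)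

end

lemma scaleR_fun_apply [simp]: "(c *\<^sub>R f) x = c *\<^sub>R f x"
 by (simp add: scaleR_fun_def)

locale normed_on =
 fixes V :: "'a::real_vector set" and N :: "'a \<Rightarrow> real"
 assumes V_subspace: "subspace V"
  and N_nonneg [simp]: "0 \<le> N x"
  and N_minus [simp]: "N (- x) = N x"
  and N_eq_0: "x \<in> V \<Longrightarrow> N x = 0 \<longleftrightarrow> x = 0"
  and N_scale: "x \<in> V \<Longrightarrow> N (c *\<^sub>R x) = \<bar>c\<bar> * N x"
  and N_triangle: "x \<in> V \<Longrightarrow> y \<in> V \<Longrightarrow> N (x + y) \<le> N x + N y"
begin

lemma closed_add [simp]: "x \<in> V \<Longrightarrow> y \<in> V \<Longrightarrow> x + y \<in> V"
 and closed_diff [simp]: "x \<in> V \<Longrightarrow> y \<in> V \<Longrightarrow> x - y \<in> V"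
 and closed_scale [simp]: "x \<in> V \<Longrightarrow> c *\<^sub>R x \<in> V"
 and closed_zero [simp]: "0 \<in> V"
 using V_subspace by (auto simp: subspace_add subspace_diff subspace_scale subspace_0)

lemma N_zero [simp]: "N 0 = 0"
 using N_eq_0 by simp

lemma N_commute: "N (x - y) = N (y - x)"
 by (metis N_minus minus_diff_eq)

lemma N_diff_triangle: "x \<in> V \<Longrightarrow> y \<in> V \<Longrightarrow> z \<in> V \<Longrightarrow> N (x - z) \<le> N (x - y) + N (y - z)"
 using N_triangle[of "x - y" "y - z"] by simp

lemma N_diff_abs: "x \<in> V \<Longrightarrow> y \<in> V \<Longrightarrow> \<bar>N x - N y\<bar> \<le> N (x - y)"
 using N_triangle[of "x - y" y] N_triangle[of "y - x" x] by (simp add: N_commute[of x y])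

sublocale Metric_space V "\<lambda>x y. N (x - y)"
 by unfold_locales (auto simp: N_commute N_eq_0 N_diff_triangle)

section \<open>Distance to a segment\<close>

definition sdist :: "'a \<Rightarrow> 'a \<Rightarrow> 'a \<Rightarrow> real"
 where "sdist z a b = Inf ((\<lambda>l. N (z - (a + l *\<^sub>R (b - a)))) ` {0..1})"

lemma sdist_attained:
 assumes "z \<in> V" "a \<in> V" "b \<in> V"
 obtains l where "0 \<le> l" "l \<le> 1" "sdist z a b = N (z - (a + l *\<^sub>R (b - a)))"
proof -
 let ?f = "\<lambda>l. N (z - (a + l *\<^sub>R (b - a)))"
 have "continuous_on {0..1::real} ?f"
 proof (rule lipschitz_on_continuous_on, rule lipschitz_onI)
  fix l m :: real
  have "\<bar>?f l - ?f m\<bar> \<le> N ((z - (a + l *\<^sub>R (b - a))) - (z - (a + m *\<^sub>R (b - a))))"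
   by (rule N_diff_abs) (use assms in auto)
  also have "(z - (a + l *\<^sub>R (b - a))) - (z - (a + m *\<^sub>R (b - a))) = (m - l) *\<^sub>R (b - a)"
   by (simp add: algebra_simps)
  also have "N \<dots> = N (b - a) * dist l m" using assms by (simp add: N_scale dist_real_def abs_minus_commute)
  finally show "dist (?f l) (?f m) \<le> N (b - a) * dist l m" by (simp add: dist_real_def)
 qed auto
 then obtain l where l: "l \<in> {0..1}" "\<And>m. m \<in> {0..1} \<Longrightarrow> ?f l \<le> ?f m"
  using continuous_attains_inf[of "{0..1::real}" ?f] by auto
 have "sdist z a b = ?f l" unfolding sdist_def by (rule cInf_eq_minimum) (use l in auto)
 with l show ?thesis by (intro that[of l]) auto
qed

lemma sdist_le: "0 \<le> l \<Longrightarrow> l \<le> 1 \<Longrightarrow> sdist z a b \<le> N (z - (a + l *\<^sub>R (b - a)))"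
 unfolding sdist_def by (rule cInf_lower) (auto intro!: bdd_belowI[of _ 0])

lemma sdist_nonneg [simp]: "0 \<le> sdist z a b"
 unfolding sdist_def by (rule cInf_greatest) auto

lemma sdist_le_left: "sdist z a b \<le> N (z - a)" and sdist_le_right: "sdist z a b \<le> N (b - z)"
 using sdist_le[of 0 z a b] sdist_le[of 1 z a b] by (auto simp: N_commute)

lemma sdist_ends [simp]: "sdist a a b = 0" "sdist b a b = 0"
 using sdist_le_left[of a a b] sdist_le_right[of b a b] by (auto simp: order_antisym)

lemma sdist_triangle:
 assumes "z \<in> V" "z' \<in> V" "a \<in> V" "b \<in> V"
 shows "sdist z a b \<le> N (z - z') + sdist z' a b"
proof -
 obtain l where l: "0 \<le> l" "l \<le> 1" "sdist z' a b = N (z' - (a + l *\<^sub>R (b - a)))"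
  using sdist_attained assms by metis
 have "sdist z a b \<le> N (z - (a + l *\<^sub>R (b - a)))" using l by (intro sdist_le)
 also have "\<dots> \<le> N (z - z') + N (z' - (a + l *\<^sub>R (b - a)))" by (rule N_diff_triangle) (use assms in auto)
 finally show ?thesis using l by simp
qed

text \<open>The corresponding convex combination of two nearest points is a competitor, so
  neighbourhoods of a segment are convex.\<close>

lemma sdist_convex:
 assumes "z \<in> V" "z' \<in> V" "a \<in> V" "b \<in> V" "0 \<le> m" "m \<le> 1"
  and "sdist z a b \<le> q" "sdist z' a b \<le> q"
 shows "sdist (z + m *\<^sub>R (z' - z)) a b \<le> q"
proof -
 obtain l where l: "0 \<le> l" "l \<le> 1" "sdist z a b = N (z - (a + l *\<^sub>R (b - a)))"
  using sdist_attained assms by metis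
 obtain l' where l': "0 \<le> l'" "l' \<le> 1" "sdist z' a b = N (z' - (a + l' *\<^sub>R (b - a)))"
  using sdist_attained assms by metis
 let ?k = "(1 - m) * l + m * l'"
 have "?k \<le> (1 - m) * 1 + m * 1" using assms l l' by (intro add_mono mult_left_mono) auto
 then have k: "0 \<le> ?k" "?k \<le> 1" using assms l l' by auto
 have "sdist (z + m *\<^sub>R (z' - z)) a b \<le> N (z + m *\<^sub>R (z' - z) - (a + ?k *\<^sub>R (b - a)))"
  using k by (rule sdist_le)
 also have "z + m *\<^sub>R (z' - z) - (a + ?k *\<^sub>R (b - a)) =
   (1 - m) *\<^sub>R (z - (a + l *\<^sub>R (b - a))) + m *\<^sub>R (z' - (a + l' *\<^sub>R (b - a)))"
  by (simp add: algebra_simps)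
 also have "N \<dots> \<le> N ((1 - m) *\<^sub>R (z - (a + l *\<^sub>R (b - a)))) + N (m *\<^sub>R (z' - (a + l' *\<^sub>R (b - a))))"
  by (rule N_triangle) (use assms in auto)
 also have "\<dots> = (1 - m) * sdist z a b + m * sdist z' a b" using assms l l' by (simp add: N_scale)
 also have "\<dots> \<le> (1 - m) * q + m * q" using assms by (intro add_mono mult_left_mono) auto
 finally show ?thesis by (simp add: algebra_simps)
qed

text \<open>If both ends of [a, b] lie in the q-neighbourhood of [u, w], then so does the whole of
  [a, b] by convexity. This is how deviations from chords are compared between consecutive scales
  and between neighbouring arcs.\<close>

lemma sdist_transfer:
 assumes "z \<in> V" "a \<in> V" "b \<in> V" "u \<in> V" "w \<in> V"
  and "sdist a u w \<le> q" "sdist b u w \<le> q"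
 shows "sdist z u w \<le> sdist z a b + q"
proof -
 obtain l where l: "0 \<le> l" "l \<le> 1" "sdist z a b = N (z - (a + l *\<^sub>R (b - a)))"
  using sdist_attained assms by metis
 have "sdist z u w \<le> N (z - (a + l *\<^sub>R (b - a))) + sdist (a + l *\<^sub>R (b - a)) u w"
  by (rule sdist_triangle) (use assms in auto)
 also have "sdist (a + l *\<^sub>R (b - a)) u w \<le> q" by (rule sdist_convex) (use assms l in auto)
 finally show ?thesis using l by simp
qed

section \<open>Directions of vectors\<close>

definition dir :: "'a \<Rightarrow> 'a"
 where "dir x = (1 / N x) *\<^sub>R x"

lemma dir_in [simp]: "x \<in> V \<Longrightarrow> dir x \<in> V"
 by (simp add: dir_def)

lemma N_dir: "x \<in> V \<Longrightarrow> x \<noteq> 0 \<Longrightarrow> N (dir x) = 1"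
 by (simp add: dir_def N_scale N_eq_0)

lemma N_dir_le: "x \<in> V \<Longrightarrow> N (dir x) \<le> 1"
 by (cases "x = 0") (auto simp: N_dir, simp add: dir_def)

lemma scale_dir: "x \<in> V \<Longrightarrow> N x *\<^sub>R dir x = x"
 by (cases "x = 0") (auto simp: dir_def N_eq_0)

lemma dir_scale: "x \<in> V \<Longrightarrow> c > 0 \<Longrightarrow> dir (c *\<^sub>R x) = dir x"
 by (simp add: dir_def N_scale)

lemma N_dir_diff_le: "x \<in> V \<Longrightarrow> y \<in> V \<Longrightarrow> N (dir x - dir y) \<le> 2"
 using N_triangle[of "dir x" "- dir y"] N_dir_le[of x] N_dir_le[of y]
  subspace_neg[OF V_subspace, of "dir y"] by simp

text \<open>After multiplication by N x, the difference of directions splits into x - y and a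
  multiple of y of norm |N x - N y|.\<close>

lemma dir_perturb:
 assumes "x \<in> V" "y \<in> V" "y \<noteq> 0"
 shows "N x * N (dir x - dir y) \<le> 2 * N (x - y)"
proof (cases "x = 0")
 case False
 have Nx: "N x > 0" "N y > 0" using assms False N_nonneg[of x] N_nonneg[of y] by (auto simp: N_eq_0 less_le)
 have "N x * N (dir x - dir y) = N (N x *\<^sub>R (dir x - dir y))" using assms by (simp add: N_scale)
 also have "N x *\<^sub>R (dir x - dir y) = (x - y) + (1 - N x / N y) *\<^sub>R y"
  using Nx by (simp add: dir_def algebra_simps)
 also have "N \<dots> \<le> N (x - y) + \<bar>1 - N x / N y\<bar> * N y"
  using N_triangle[of "x - y" "(1 - N x / N y) *\<^sub>R y"] assms by (simp add: N_scale)
 also have "\<bar>1 - N x / N y\<bar> * N y = \<bar>N y - N x\<bar>" using Nx by (simp add: abs_if field_simps split: if_splits)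
 also have "\<dots> \<le> N (x - y)" using N_diff_abs[of y x] assms by (simp add: N_commute)
 finally show ?thesis by simp
qed simp

text \<open>The competitor divides [a, b] in the ratio of the distances of z to its ends. Its
  distance to z is half the harmonic mean of these distances, times the difference of the
  directions.\<close>

lemma sdist_dir:
 assumes "z \<in> V" "a \<in> V" "b \<in> V"
 shows "sdist z a b \<le> min (N (z - a)) (N (b - z)) * N (dir (z - a) - dir (b - z))"
proof (cases "z = a \<or> z = b")
 case True
 then show ?thesis by auto
next
 case False
 define x y where "x = z - a" and "y = b - z"
 have xy: "x \<in> V" "y \<in> V" "x \<noteq> 0" "y \<noteq> 0" using assms False by (auto simp: x_def y_def)
 then have pos: "N x > 0" "N y > 0" using N_nonneg[of x] N_nonneg[of y] by (auto simp: N_eq_0 less_le)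
 let ?l = "N x / (N x + N y)"
 have l: "0 \<le> ?l" "?l \<le> 1" using pos by (auto simp: field_simps)
 have eq: "z - (a + ?l *\<^sub>R (b - a)) = (N x * N y / (N x + N y)) *\<^sub>R (dir x - dir y)"
 proof -
  have "z - (a + ?l *\<^sub>R (b - a)) = (1 - ?l) *\<^sub>R x - ?l *\<^sub>R y" by (simp add: x_def y_def algebra_simps)
  also have "1 - ?l = N y / (N x + N y)" using pos by (simp add: field_simps)
  also have "(N y / (N x + N y)) *\<^sub>R x - ?l *\<^sub>R y
    = (N y / (N x + N y)) *\<^sub>R (N x *\<^sub>R dir x) - ?l *\<^sub>R (N y *\<^sub>R dir y)"
   by (simp only: scale_dir[OF xy(1)] scale_dir[OF xy(2)])
  finally show ?thesis by (simp add: algebra_simps)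
 qed
 have "sdist z a b \<le> N (z - (a + ?l *\<^sub>R (b - a)))" using l by (rule sdist_le)
 also have "\<dots> = (N x * N y / (N x + N y)) * N (dir x - dir y)"
  unfolding eq using xy pos by (simp add: N_scale)
 also have "N x * N y / (N x + N y) \<le> min (N x) (N y)" using pos by (auto simp: min_def field_simps)
 finally show ?thesis by (simp add: x_def y_def mult_right_mono)
qed

end

section \<open>Excess in the triangle inequality under uniform convexity\<close>

locale unif_convex_on = normed_on +
 fixes s cU :: real
 assumes s_ge: "s \<ge> 2" and cU_pos: "cU > 0"
  and unit_convex: "x \<in> V \<Longrightarrow> y \<in> V \<Longrightarrow> N x = 1 \<Longrightarrow> N y = 1 \<Longrightarrow>
   N (x + y) \<le> 2 - cU * N (x - y) powr s"
begin

text \<open>The surplus of the longer vector is split off along its own direction. What remains are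
  two vectors of equal norm, to which \<open>unit_convex\<close> applies after scaling.\<close>

lemma excess_dir:
 assumes "x \<in> V" "y \<in> V" "x \<noteq> 0" "y \<noteq> 0"
 shows "cU * min (N x) (N y) * N (dir x - dir y) powr s \<le> N x + N y - N (x + y)"
proof -
 have *: "cU * N x * N (dir x - dir y) powr s \<le> N x + N y - N (x + y)"
  if xy: "x \<in> V" "y \<in> V" "x \<noteq> 0" "y \<noteq> 0" and le: "N x \<le> N y" for x y
 proof -
  have "x + y = N x *\<^sub>R (dir x + dir y) + (N y - N x) *\<^sub>R dir y"
   using scale_dir[OF xy(1)] scale_dir[OF xy(2)] by (simp add: algebra_simps)
  then have "N (x + y) \<le> N (N x *\<^sub>R (dir x + dir y)) + N ((N y - N x) *\<^sub>R dir y)"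
   using N_triangle[of "N x *\<^sub>R (dir x + dir y)" "(N y - N x) *\<^sub>R dir y"] xy by simp
  also have "\<dots> = N x * N (dir x + dir y) + (N y - N x)" using xy le by (simp add: N_scale N_dir)
  also have "N x * N (dir x + dir y) \<le> N x * (2 - cU * N (dir x - dir y) powr s)"
   using xy by (intro mult_left_mono unit_convex) (auto simp: N_dir)
  finally show ?thesis by (simp add: algebra_simps)
 qed
 show ?thesis
 proof (cases "N x \<le> N y")
  case True
  then show ?thesis using *[OF assms True] by (simp add: min_def)
 next
  case False
  then show ?thesis using *[of y x] assms by (simp add: min_def N_commute[of "dir x"] add.commute)
 qed
qed

text \<open>With m the smaller of the two distances, the deviation is at most m times the difference
  of directions, whereas the excess controls m times its s-th power; the missing factor is m^(s -
  1).\<close>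

lemma excess_sdist:
 assumes "z \<in> V" "a \<in> V" "b \<in> V" "N (z - a) \<le> \<rho>" "N (b - z) \<le> \<rho>"
 shows "cU * sdist z a b powr s \<le> \<rho> powr (s - 1) * (N (z - a) + N (b - z) - N (b - a))"
proof (cases "z = a \<or> z = b")
 case True
 have "N (b - a) \<le> N (z - a) + N (b - z)" using N_diff_triangle[of b z a] assms by simp
 then show ?thesis using True by auto
next
 case False
 define x y where "x = z - a" and "y = b - z"
 have xy: "x \<in> V" "y \<in> V" "x \<noteq> 0" "y \<noteq> 0" "x + y = b - a" using assms False by (auto simp: x_def y_def)
 define m where "m = min (N x) (N y)"
 have m: "m > 0" "m \<le> \<rho>" using xy assms N_nonneg[of x] N_nonneg[of y]
  by (auto simp: m_def N_eq_0 less_le x_def[symmetric] y_def[symmetric] min_def)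
 have ex: "cU * m * N (dir x - dir y) powr s \<le> N x + N y - N (b - a)"
  using excess_dir[of x y] xy by (simp add: m_def)
 have "sdist z a b powr s \<le> (m * N (dir x - dir y)) powr s"
  using sdist_dir[of z a b] assms s_ge by (intro powr_mono2) (auto simp: x_def y_def m_def)
 also have "\<dots> = m powr (s - 1) * (m * N (dir x - dir y) powr s)" using m by (simp add: powr_mult powr_diff)
 finally have "cU * sdist z a b powr s \<le> m powr (s - 1) * (cU * m * N (dir x - dir y) powr s)"
  using cU_pos by (simp add: mult.assoc mult.left_commute)
 also have "\<dots> \<le> \<rho> powr (s - 1) * (N x + N y - N (b - a))"
  using m s_ge cU_pos by (intro mult_mono powr_mono2 ex) auto
 finally show ?thesis by (simp add: x_def y_def)
qed

end

section \<open>Excess in the triangle inequality under uniform smoothness\<close>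

locale unif_smooth_on = normed_on +
 fixes q cS :: real
 assumes q_gt: "q > 1" and cS_nonneg: "cS \<ge> 0"
  and smooth: "w \<in> V \<Longrightarrow> e \<in> V \<Longrightarrow> N w > 0 \<Longrightarrow>
   N (w + e) + N (w - e) \<le> 2 * N w + cS * N e powr q * N w powr (1 - q)"
begin

text \<open>The longer piece is written (1 - t) w = t w + (1 - 2 t) w, and smoothness is applied to
  w with the perturbation e / t. Scaling back by t produces the power (t N w)^(1 - q).\<close>

lemma smooth_half:
 assumes "w \<in> V" "e \<in> V" "N w > 0" "0 < t" "t \<le> 1/2"
 shows "N (t *\<^sub>R w + e) + N ((1 - t) *\<^sub>R w - e) \<le> N w + cS * N e powr q * (t * N w) powr (1 - q)"
proof -
 let ?q = "(1 / t) *\<^sub>R e"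
 let ?k = "t / (1 - t)"
 have "N (t *\<^sub>R w + e) = N (t *\<^sub>R (w + ?q))" using assms by (simp add: algebra_simps)
 also have "\<dots> = t * N (w + ?q)" using assms by (subst N_scale) auto
 finally have 1: "N (t *\<^sub>R w + e) = t * N (w + ?q)" .
 have "(1 - t) *\<^sub>R w - e = t *\<^sub>R (w - ?q) + (1 - 2 * t) *\<^sub>R w"
  using assms by (simp add: algebra_simps) (metis scaleR_add_left mult_2_right mult.commute)
 then have 2: "N ((1 - t) *\<^sub>R w - e) \<le> t * N (w - ?q) + (1 - 2 * t) * N w"
  using N_triangle[of "t *\<^sub>R (w - ?q)" "(1 - 2 * t) *\<^sub>R w"] assms by (simp add: N_scale)
 have "N (w + ?q) + N (w - ?q) \<le> 2 * N w + cS * N ?q powr q * N w powr (1 - q)"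
  using assms by (intro smooth) auto
 then have "t * (N (w + ?q) + N (w - ?q)) \<le> t * (2 * N w + cS * N ?q powr q * N w powr (1 - q))"
  using assms by (intro mult_left_mono) auto
 also have "\<dots> = 2 * t * N w + cS * N e powr q * (t * (1/t) powr q * N w powr (1 - q))"
  using assms by (simp add: N_scale powr_mult powr_divide algebra_simps)
 also have "t * (1/t) powr q = t powr (1 - q)" using assms by (simp add: powr_divide powr_diff)
 finally show ?thesis using 1 2 assms by (simp add: powr_mult algebra_simps)
qed

lemma smooth_excess:
 assumes "w \<in> V" "e \<in> V" "N w > 0" "0 < t" "t < 1"
 shows "N (t *\<^sub>R w + e) + N ((1 - t) *\<^sub>R w - e)
  \<le> N w + cS * N e powr q * (min t (1 - t) * N w) powr (1 - q)"
proof (cases "t \<le> 1/2")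
 case True
 then show ?thesis using smooth_half[of w e t] assms by (simp add: min_def)
next
 case False
 then show ?thesis using smooth_half[of w "- e" "1 - t"] assms subspace_neg[OF V_subspace, of e]
  by (simp add: min_def add.commute)
qed

end

section \<open>Flat sets and the length potential\<close>

context Metric_space
begin

text \<open>Betweenness expressed by distances alone, so that no line has to be chosen in order to
  state it. On flat separated sets it becomes the order along the line
  (\<open>chart_btw\<close>).\<close>

definition btw :: "'a \<Rightarrow> 'a \<Rightarrow> 'a \<Rightarrow> bool"
 where "btw z a b \<longleftrightarrow> d a z < d a b \<and> d z b < d a b"

lemma btw_sym: "btw z a b \<longleftrightarrow> btw z b a"
 by (auto simp: btw_def commute)

lemma not_btw_ends [simp]: "\<not> btw a a b" "\<not> btw b a b"
 by (auto simp: btw_def)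

text \<open>Everything that the graph construction uses of a small beta number: an approximate
  coordinate on the ball of radius 240 r, which is the origin of the lower bound for the inflation
  factor, and a bound on the price of inserting a point between two others. The rest of the
  construction is purely metric.\<close>

definition flat :: "'a set \<Rightarrow> 'a \<Rightarrow> real \<Rightarrow> real \<Rightarrow> bool"
 where "flat E y r \<theta> \<longleftrightarrow>
  (\<exists>\<pi>::'a \<Rightarrow> real. \<forall>u\<in>E. \<forall>v\<in>E. d y u \<le> 240 * r \<longrightarrow> d y v \<le> 240 * r \<longrightarrow>
   \<bar>d u v - \<bar>\<pi> u - \<pi> v\<bar>\<bar> \<le> r / 10) \<and>
  (\<forall>a\<in>E. \<forall>z\<in>E. \<forall>b\<in>E. d y a \<le> 240 * r \<longrightarrow> d y z \<le> 240 * r \<longrightarrow> d y b \<le> 240 * r \<longrightarrow>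
   r \<le> d a z \<longrightarrow> r \<le> d z b \<longrightarrow> btw z a b \<longrightarrow> d a z + d z b - d a b \<le> \<theta>)"

definition separated :: "real \<Rightarrow> 'a set \<Rightarrow> bool"
 where "separated r S \<longleftrightarrow> (\<forall>x\<in>S. \<forall>y\<in>S. x \<noteq> y \<longrightarrow> r \<le> d x y)"

lemma separated_subset: "separated r S \<Longrightarrow> T \<subseteq> S \<Longrightarrow> separated r T"
 unfolding separated_def by blast

definition chart :: "'a set \<Rightarrow> ('a \<Rightarrow> real) \<Rightarrow> real \<Rightarrow> bool"
 where "chart S \<pi> r \<longleftrightarrow> (\<forall>u\<in>S. \<forall>v\<in>S. \<bar>d u v - \<bar>\<pi> u - \<pi> v\<bar>\<bar> \<le> r / 10)"

text \<open>Distances between distinct points are at least r and coordinates err by at most r / 10,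
  so comparing distances and comparing coordinates cannot give different answers.\<close>

lemma chart_btw:
 fixes \<pi> :: "'a \<Rightarrow> real"
 assumes ch: "chart S \<pi> r"
  and sep: "separated r S" and r: "r > 0"
  and S: "z \<in> S" "a \<in> S" "b \<in> S" "a \<noteq> b"
 shows "btw z a b \<longleftrightarrow> (\<pi> a < \<pi> z \<and> \<pi> z < \<pi> b) \<or> (\<pi> b < \<pi> z \<and> \<pi> z < \<pi> a)"
proof (cases "z = a \<or> z = b")
 case True
 then show ?thesis by auto
next
 case False
 have "r \<le> d a z" "r \<le> d z b" "r \<le> d a b" using sep S False by (auto simp: separated_def)
 moreover have "\<bar>d a z - \<bar>\<pi> a - \<pi> z\<bar>\<bar> \<le> r / 10" "\<bar>d z b - \<bar>\<pi> z - \<pi> b\<bar>\<bar> \<le> r / 10"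
  "\<bar>d a b - \<bar>\<pi> a - \<pi> b\<bar>\<bar> \<le> r / 10" using ch S by (auto simp: chart_def)
 ultimately have *: "r \<le> A" "r \<le> B" "r \<le> C" "\<bar>A - \<bar>p - q\<bar>\<bar> \<le> r / 10"
   "\<bar>B - \<bar>q - t\<bar>\<bar> \<le> r / 10" "\<bar>C - \<bar>p - t\<bar>\<bar> \<le> r / 10"
  if "A = d a z" "B = d z b" "C = d a b" "p = \<pi> a" "q = \<pi> z" "t = \<pi> b" for A B C p q t using that by auto
 have "A < C \<and> B < C \<longleftrightarrow> (p < q \<and> q < t) \<or> (t < q \<and> q < p)"
  if "A = d a z" "B = d z b" "C = d a b" "p = \<pi> a" "q = \<pi> z" "t = \<pi> b" for A B C p q t
 proof -
  note h = *[OF that] r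
  consider "p < q" "q < t" | "t < q" "q < p" | "q \<le> p" "q \<le> t" | "p \<le> q" "t \<le> q" by linarith
  then show ?thesis
  proof cases
   case 1
   then have "A < C" "B < C" using h by linarith+
   then show ?thesis using 1 by simp
  next
   case 2
   then have "A < C" "B < C" using h by linarith+
   then show ?thesis using 2 by simp
  next
   case 3
   have "\<not> (A < C \<and> B < C)" using 3 h by linarith
   then show ?thesis using 3 by auto
  next
   case 4
   have "\<not> (A < C \<and> B < C)" using 4 h by linarith
   then show ?thesis using 4 by auto
  qed
 qed
 then show ?thesis unfolding btw_def by blast
qed

lemma chart_inj:
 fixes \<pi> :: "'a \<Rightarrow> real"
 assumes ch: "chart S \<pi> r"
  and sep: "separated r S" and r: "r > 0"
  and S: "a \<in> S" "b \<in> S" "a \<noteq> b"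
 shows "9 / 10 * r \<le> \<bar>\<pi> a - \<pi> b\<bar>"
proof -
 have "r \<le> d a b" "\<bar>d a b - \<bar>\<pi> a - \<pi> b\<bar>\<bar> \<le> r / 10" using sep ch S by (auto simp: separated_def chart_def)
 then show ?thesis by linarith
qed

text \<open>As no point of F lies between the ends of an edge, edges near a flat point join
  neighbours in the order along the line, and degree at most 2 makes the graph look like strands.
  Edges are kept in both orientations, so \<open>wt\<close> counts every length twice.\<close>

definition live :: "'a set \<Rightarrow> real \<Rightarrow> ('a \<times> 'a) set \<Rightarrow> bool"
 where "live F m L \<longleftrightarrow> finite L \<and> sym L \<and> L \<subseteq> F \<times> F \<and>
  (\<forall>a b. (a, b) \<in> L \<longrightarrow> a \<noteq> b \<and> d a b \<le> m \<and> (\<forall>z\<in>F. \<not> btw z a b)) \<and>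
  (\<forall>x\<in>F. card (L `` {x}) \<le> 2)"

definition wt :: "('a \<times> 'a) set \<Rightarrow> real"
 where "wt L = (\<Sum>(a, b)\<in>L. d a b)"

text \<open>Points of degree below 2 carry a reserve that pays for the edges added at later stages.\<close>

definition pot :: "'a set \<Rightarrow> ('a \<Rightarrow> real) \<Rightarrow> ('a \<times> 'a) set \<Rightarrow> real"
 where "pot F om L = wt L / 2 + (\<Sum>x\<in>F. (2 - real (card (L `` {x}))) * om x)"

lemma wt_nonneg [simp]: "0 \<le> wt L"
 unfolding wt_def by (rule sum_nonneg) auto

lemma live_isolated:
 assumes "live F m L" "y \<notin> F" "\<And>a b. (a, b) \<in> L \<Longrightarrow> \<not> btw y a b" "finite F"
 shows "live (insert y F) m L" "pot (insert y F) om L = pot F om L + 2 * om y"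
proof -
 have e: "L `` {y} = {}" using assms by (auto simp: live_def)
 then show "live (insert y F) m L" using assms unfolding live_def by auto
 show "pot (insert y F) om L = pot F om L + 2 * om y" using assms e by (simp add: pot_def)
qed

text \<open>The degrees of a and b stay the same and y gets degree 2, so the reserves do not change
  and the only cost is the excess at y. The bound m \<le> 100 r keeps the ends of all edges involved
  inside the ball on which the chart is valid.\<close>

lemma live_split:
 assumes L: "live F m L" and F: "finite F" "F \<subseteq> E" "y \<in> E" "y \<notin> F"
  and ab: "(a, b) \<in> L" "btw y a b"
  and r: "r > 0" and m: "m \<le> 100 * r" and sep: "separated r (insert y F)"
  and fl: "flat E y r \<theta>" and E: "E \<subseteq> M"
 defines "L' \<equiv> L - {(a, b), (b, a)} \<union> {(a, y), (y, a), (y, b), (b, y)}"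
 shows "live (insert y F) m L'" "pot (insert y F) om L' \<le> pot F om L + \<theta>"
proof -
 have symL: "sym L" and LF: "L \<subseteq> F \<times> F" and finL: "finite L"
  and Lp: "\<And>a b. (a, b) \<in> L \<Longrightarrow> a \<noteq> b \<and> d a b \<le> m \<and> (\<forall>z\<in>F. \<not> btw z a b)"
  and deg: "\<And>x. x \<in> F \<Longrightarrow> card (L `` {x}) \<le> 2" using L by (auto simp: live_def)
 have ba: "(b, a) \<in> L" using symL ab by (auto simp: sym_def)
 have abF: "a \<in> F" "b \<in> F" "a \<noteq> b" "d a b \<le> m" using Lp ab LF by auto
 have ya: "y \<noteq> a" "y \<noteq> b" using F abF by auto
 obtain \<pi> :: "'a \<Rightarrow> real" where \<pi>: "\<And>u v. u \<in> E \<Longrightarrow> v \<in> E \<Longrightarrow> d y u \<le> 240 * r \<Longrightarrow> d y v \<le> 240 * r \<Longrightarrow>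
   \<bar>d u v - \<bar>\<pi> u - \<pi> v\<bar>\<bar> \<le> r / 10"
  using fl unfolding flat_def by meson
 define S where "S = {u \<in> insert y F. d y u \<le> 240 * r}"
 have SE: "S \<subseteq> E" using F by (auto simp: S_def)
 have ch: "chart S \<pi> r" using \<pi> SE by (auto simp: S_def chart_def)
 have sepS: "separated r S" using sep by (rule separated_subset) (auto simp: S_def)
 note bt = chart_btw[OF ch sepS r]
 note inj = chart_inj[OF ch sepS r]
 have dd: "d y a \<le> m" "d y b \<le> m" "d a y \<le> m" using ab abF by (auto simp: btw_def commute)
 have inM: "u \<in> M" if "u \<in> insert y F" for u using that F E by auto
 have ball: "u \<in> S" if "u \<in> insert y F" "d v u \<le> m" "d y v \<le> m" "v \<in> insert y F" for u v
  using triangle[of y v u] that m r inM by (auto simp: S_def)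
 have yS: "y \<in> S" using F E r inM[of y] by (auto simp: S_def)
 have aS: "a \<in> S" "b \<in> S" using dd abF m r by (auto simp: S_def)
 \<comment> \<open>In the coordinate order a point between y and one of a, b also lies between a and
   b.\<close>
 have new: "\<not> btw z x y" if "z \<in> insert y F" "x \<in> {a, b}" for z x
 proof
  assume z: "btw z x y"
  then have "z \<noteq> y" "z \<in> F" using that by auto
  have "z \<in> S" using z that dd m r \<open>z \<in> F\<close> abF ya by (auto simp: S_def btw_def commute)
  have xy: "x \<noteq> y" "x \<in> S" using that ya aS by auto
  have "btw z a b" using bt[OF \<open>z \<in> S\<close> xy(2) yS xy(1)] z bt[OF yS aS(1) aS(2) abF(3)] ab(2) that
    bt[OF \<open>z \<in> S\<close> aS(1) aS(2) abF(3)] by auto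
  then show False using Lp ab \<open>z \<in> F\<close> by auto
 qed
 \<comment> \<open>Two different edges with y in their interior overlap in the coordinate order, so
   an end of one lies inside the other; \<open>live\<close> excludes this.\<close>
 have old: "\<not> btw y a' b'" if "(a', b') \<in> L" "(a', b') \<noteq> (a, b)" "(a', b') \<noteq> (b, a)" for a' b'
 proof
  assume y: "btw y a' b'"
  have ab': "a' \<in> F" "b' \<in> F" "a' \<noteq> b'" "d a' b' \<le> m" using Lp that LF by auto
  have dd': "d y a' \<le> m" "d y b' \<le> m" using y ab' by (auto simp: btw_def commute)
  have S': "a' \<in> S" "b' \<in> S" using dd' ab' m r by (auto simp: S_def)
  have no: "\<not> btw a a' b'" "\<not> btw b a' b'" "\<not> btw a' a b" "\<not> btw b' a b" using Lp that ab ab' abF by auto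
  have neq: "u = v" if "\<pi> u = \<pi> v" "u \<in> S" "v \<in> S" for u v using inj[of u v] that r by (cases "u = v") auto
  have "\<pi> a \<noteq> \<pi> a' \<or> \<pi> b \<noteq> \<pi> b'" "\<pi> a \<noteq> \<pi> b' \<or> \<pi> b \<noteq> \<pi> a'"
   using neq[of a a'] neq[of b b'] neq[of a b'] neq[of b a'] S' aS that by auto
  then show False using y no bt[OF yS S' ab'(3)] bt[OF yS aS abF(3)] ab(2)
    bt[OF aS(1) S' ab'(3)] bt[OF aS(2) S' ab'(3)] bt[OF S'(1) aS abF(3)] bt[OF S'(2) aS abF(3)]
   by (smt (verit))
 qed
 have im: "L' `` {y} = {a, b}" "L' `` {a} = insert y (L `` {a} - {b})"
  "L' `` {b} = insert y (L `` {b} - {a})"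
  "\<And>x. x \<noteq> y \<Longrightarrow> x \<noteq> a \<Longrightarrow> x \<noteq> b \<Longrightarrow> L' `` {x} = L `` {x}" using LF F ya abF by (auto simp: L'_def)
 have finI: "finite (L `` {x})" for x using finL by (rule finite_Image)
 have c: "card (L' `` {y}) = 2" "\<And>x. x \<in> F \<Longrightarrow> card (L' `` {x}) = card (L `` {x})"
 proof -
  show "card (L' `` {y}) = 2" using im abF by simp
  fix x assume x: "x \<in> F"
  have *: "card (insert y (L `` {u} - {v})) = card (L `` {u})" if "(u, v) \<in> L" for u v
  proof -
   have "y \<notin> L `` {u} - {v}" using LF F by auto
   then have "card (insert y (L `` {u} - {v})) = Suc (card (L `` {u} - {v}))" using finI by simp
   also have "\<dots> = card (L `` {u})" using that finI[of u] by (intro card_Suc_Diff1) auto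
   finally show ?thesis .
  qed
  show "card (L' `` {x}) = card (L `` {x})"
  proof (cases "x = a \<or> x = b")
   case True
   then show ?thesis using *[OF ab(1)] *[OF ba] im(2,3) by auto
  next
   case False
   then have "x \<noteq> y" using x F by auto
   then show ?thesis using im(4)[of x] False by auto
  qed
 qed
 show "live (insert y F) m L'" unfolding live_def
 proof (intro conjI allI impI ballI)
  show "finite L'" using finL by (auto simp: L'_def)
  show "sym L'" using symL by (auto simp: L'_def sym_def)
  show "L' \<subseteq> insert y F \<times> insert y F" using LF abF by (auto simp: L'_def)
  show "u \<noteq> v" if "(u, v) \<in> L'" for u v using that Lp ya by (auto simp: L'_def)
  show "d u v \<le> m" if "(u, v) \<in> L'" for u v using that Lp dd by (auto simp: L'_def commute)
  show "\<not> btw z u v" if "(u, v) \<in> L'" "z \<in> insert y F" for u v z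
   using that Lp new[of z] old[of u v] by (auto simp: L'_def btw_sym[of _ y])
  show "card (L' `` {x}) \<le> 2" if "x \<in> insert y F" for x using that c deg by auto
 qed
 have "wt L' = wt (L - {(a, b), (b, a)}) + wt {(a, y), (y, a), (y, b), (b, y)}"
  unfolding wt_def L'_def using finL LF F by (intro sum.union_disjoint) auto
 also have "wt {(a, y), (y, a), (y, b), (b, y)} = 2 * (d a y + d y b)"
  using ya abF by (simp add: wt_def commute)
 also have "wt (L - {(a, b), (b, a)}) = wt L - wt {(a, b), (b, a)}"
  unfolding wt_def using finL ab ba by (intro sum_diff) auto
 also have "wt {(a, b), (b, a)} = 2 * d a b" using abF by (simp add: wt_def commute)
 finally have wt': "wt L' / 2 = wt L / 2 + (d a y + d y b - d a b)" by simp
 have "d a y + d y b - d a b \<le> \<theta>"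
 proof -
  have "r \<le> d a y" "r \<le> d y b" using sep abF ya by (auto simp: separated_def)
  then show ?thesis using fl aS yS SE ab(2) unfolding flat_def S_def by blast
 qed
 moreover have "(\<Sum>x\<in>insert y F. (2 - real (card (L' `` {x}))) * om x) =
   (\<Sum>x\<in>F. (2 - real (card (L `` {x}))) * om x)"
  using F c by simp
 ultimately show "pot (insert y F) om L' \<le> pot F om L + \<theta>" using wt' by (simp add: pot_def)
qed

text \<open>Among A and the points between A and y, the one nearest to y, called a, has no point of
  F between itself and y. Since no edge contains y, all edges at a lead away from y, and of two such
  edges one would contain the end of the other. Hence a has degree at most 1, and one share
  \<open>om a\<close> of its reserve becomes free for the new edge.\<close>

lemma live_attach:
 assumes L: "live F m L" and F: "finite F" "F \<subseteq> E" "y \<in> E" "y \<notin> F"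
  and no: "\<And>a b. (a, b) \<in> L \<Longrightarrow> \<not> btw y a b"
  and A: "A \<in> F" "d A y \<le> 2 * r" "2 * r \<le> m"
  and r: "r > 0" and m: "m \<le> 100 * r" and sep: "separated r (insert y F)"
  and fl: "flat E y r \<theta>" and E: "E \<subseteq> M" and \<theta>: "\<theta> \<ge> 0"
 obtains a where "a \<in> F" "a = A \<or> d A a + d a y - d A y \<le> \<theta>"
  "live (insert y F) m (L \<union> {(a, y), (y, a)})"
  "pot (insert y F) om (L \<union> {(a, y), (y, a)}) = pot F om L + d a y + om y - om a"
proof -
 have symL: "sym L" and LF: "L \<subseteq> F \<times> F" and finL: "finite L"
  and Lp: "\<And>a b. (a, b) \<in> L \<Longrightarrow> a \<noteq> b \<and> d a b \<le> m \<and> (\<forall>z\<in>F. \<not> btw z a b)"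
  and deg: "\<And>x. x \<in> F \<Longrightarrow> card (L `` {x}) \<le> 2" using L by (auto simp: live_def)
 obtain \<pi> :: "'a \<Rightarrow> real" where \<pi>: "\<And>u v. u \<in> E \<Longrightarrow> v \<in> E \<Longrightarrow> d y u \<le> 240 * r \<Longrightarrow> d y v \<le> 240 * r \<Longrightarrow>
   \<bar>d u v - \<bar>\<pi> u - \<pi> v\<bar>\<bar> \<le> r / 10"
  using fl unfolding flat_def by meson
 define S where "S = {u \<in> insert y F. d y u \<le> 240 * r}"
 have SE: "S \<subseteq> E" using F by (auto simp: S_def)
 have ch: "chart S \<pi> r" using \<pi> SE by (auto simp: S_def chart_def)
 have sepS: "separated r S" using sep by (rule separated_subset) (auto simp: S_def)
 note bt = chart_btw[OF ch sepS r]
 have inM: "u \<in> M" if "u \<in> insert y F" for u using that F E by auto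
 have yS: "y \<in> S" using F E r inM[of y] by (auto simp: S_def)
 define K where "K = {c \<in> F. c = A \<or> btw c A y}"
 have "A \<in> K" "finite K" using A F by (auto simp: K_def)
 then obtain a where a: "a \<in> K" and amin: "\<And>c. c \<in> K \<Longrightarrow> d a y \<le> d c y"
  using arg_min_if_finite[of K "\<lambda>c. d c y"] by (metis empty_iff linorder_not_le)
 have aF: "a \<in> F" "a \<noteq> y" "A \<noteq> y" using a A F by (auto simp: K_def)
 have day: "d a y \<le> 2 * r" using amin[OF \<open>A \<in> K\<close>] A by simp
 have AS: "A \<in> S" "a \<in> S" using A aF day r by (auto simp: S_def commute)
 have Aa: "a = A \<or> btw a A y" using a by (auto simp: K_def)
 have nb: False if "c \<in> F" "btw c a y" for c
 proof -
  have "c \<in> S" using that day r by (auto simp: S_def btw_def commute)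
  then have "c \<in> K" using that Aa bt[OF AS(2) AS(1) yS aF(3)] bt[OF _ AS(2) yS aF(2), of c]
    bt[OF _ AS(1) yS aF(3), of c] by (auto simp: K_def)
  from amin[OF this] that show False by (simp add: btw_def)
 qed
 have side: "(\<pi> b - \<pi> a) * (\<pi> y - \<pi> a) < 0 \<and> b \<in> S" if "(a, b) \<in> L" for b
 proof -
  have b: "b \<in> F" "b \<noteq> a" "b \<noteq> y" "d a b \<le> m" using that Lp LF F by auto
  have "d y b \<le> d y a + d a b" using triangle[of y a b] inM aF b by auto
  then have bS: "b \<in> S" using b day m r by (auto simp: S_def commute)
  have inj: "\<pi> u \<noteq> \<pi> v" if "u \<in> S" "v \<in> S" "u \<noteq> v" for u v using chart_inj[OF ch sepS r that] r by auto
  have "\<not> btw b a y" "\<not> btw y a b" using nb b no that by auto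
  then have "\<not> ((\<pi> a < \<pi> b \<and> \<pi> a < \<pi> y) \<or> (\<pi> a > \<pi> b \<and> \<pi> a > \<pi> y))"
   using bt[OF bS AS(2) yS aF(2)] bt[OF yS AS(2) bS b(2)[symmetric]] inj[OF bS yS b(3)] by auto
  then show ?thesis using inj[OF bS AS(2) b(2)] inj[OF AS(2) yS aF(2)] bS by (auto simp: mult_less_0_iff)
 qed
 have finI: "finite (L `` {x})" for x using finL by (rule finite_Image)
 have dega: "card (L `` {a}) \<le> 1"
 proof (rule ccontr)
  assume "\<not> ?thesis"
  then have "card (L `` {a}) \<ge> 2" by simp
  then obtain T where T: "T \<subseteq> L `` {a}" "card T = 2" using obtain_subset_with_card_n by metis
  then obtain b c where bc: "b \<in> L `` {a}" "c \<in> L `` {a}" "b \<noteq> c" unfolding card_2_iff by auto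
  then have s: "(\<pi> b - \<pi> a) * (\<pi> y - \<pi> a) < 0" "b \<in> S" "(\<pi> c - \<pi> a) * (\<pi> y - \<pi> a) < 0" "c \<in> S"
   using side by auto
  have inj: "\<pi> b \<noteq> \<pi> c" using chart_inj[OF ch sepS r s(2,4)] bc r by auto
  have ne: "a \<noteq> b" "a \<noteq> c" using bc Lp by auto
  have "btw b a c \<or> btw c a b" using bt[OF s(2) AS(2) s(4) ne(2)] bt[OF s(4) AS(2) s(2) ne(1)] s inj
   by (auto simp: mult_less_0_iff)
  then show False using Lp bc LF by blast
 qed
 let ?L = "L \<union> {(a, y), (y, a)}"
 have im: "?L `` {y} = {a}" "?L `` {a} = insert y (L `` {a})"
  "\<And>x. x \<noteq> y \<Longrightarrow> x \<noteq> a \<Longrightarrow> ?L `` {x} = L `` {x}" using LF F aF by auto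
 have ca: "card (?L `` {a}) = Suc (card (L `` {a}))"
  using im finI LF F by (subst im) (auto intro!: card_insert_disjoint)
 have 1: "live (insert y F) m ?L" unfolding live_def
 proof (intro conjI allI impI ballI)
  show "finite ?L" using finL by auto
  show "sym ?L" using symL by (auto simp: sym_def)
  show "?L \<subseteq> insert y F \<times> insert y F" using LF aF by auto
  show "u \<noteq> v" if "(u, v) \<in> ?L" for u v using that Lp aF by auto
  show "d u v \<le> m" if "(u, v) \<in> ?L" for u v using that Lp day A by (auto simp: commute)
  show "\<not> btw z u v" if "(u, v) \<in> ?L" "z \<in> insert y F" for u v z
   using that Lp no nb by (auto simp: btw_sym[of _ y])
  show "card (?L `` {x}) \<le> 2" if "x \<in> insert y F" for x
   using that dega ca im deg by (cases "x = a"; cases "x = y") auto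
 qed
 have "wt ?L = wt L + wt {(a, y), (y, a)}"
  unfolding wt_def using finL LF F by (intro sum.union_disjoint) auto
 also have "wt {(a, y), (y, a)} = 2 * d a y" using aF by (simp add: wt_def commute)
 finally have wt': "wt ?L / 2 = wt L / 2 + d a y" by simp
 have "(\<Sum>x\<in>insert y F. (2 - real (card (?L `` {x}))) * om x) =
   om y + ((2 - real (card (?L `` {a}))) * om a + (\<Sum>x\<in>F - {a}. (2 - real (card (?L `` {x}))) * om x))"
  using F im(1) by (simp add: sum.remove[OF F(1) aF(1)])
 also have "(\<Sum>x\<in>F - {a}. (2 - real (card (?L `` {x}))) * om x) = (\<Sum>x\<in>F - {a}. (2 - real (card (L `` {x}))) * om x)"
  using F by (intro sum.cong refl) (subst im(3), auto)
 also have "om y + ((2 - real (card (?L `` {a}))) * om a + \<dots>) = om y - om a + (\<Sum>x\<in>F. (2 - real (card (L `` {x}))) * om x)"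
  unfolding ca by (simp add: sum.remove[OF F(1) aF(1)] algebra_simps)
 finally have 2: "pot (insert y F) om ?L = pot F om L + d a y + om y - om a" using wt' by (simp add: pot_def)
 have 3: "a = A \<or> d A a + d a y - d A y \<le> \<theta>"
 proof (cases "a = A")
  case False
  then have "btw a A y" using Aa by simp
  moreover have "r \<le> d A a" "r \<le> d a y" using sep A aF False by (auto simp: separated_def)
  ultimately show ?thesis using fl AS yS SE unfolding flat_def S_def by blast
 qed simp
 show ?thesis using that[OF aF(1) 3 1 2] .
qed

text \<open>Each removed orientation lowers the degree of its first end by one and therefore brings
  back one reserve there.\<close>

lemma live_demote:
 assumes L: "live F m L" and D: "D \<subseteq> L" "sym D" and F: "finite F"
 shows "live F m (L - D)"
  "pot F om (L - D) = pot F om L - wt D / 2 + (\<Sum>(a, b)\<in>D. om a)"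
proof -
 have finL: "finite L" and LF: "L \<subseteq> F \<times> F" using L by (auto simp: live_def)
 have finI: "finite (R `` {x})" if "R \<subseteq> L" for R x using finite_subset[OF that finL] by (rule finite_Image)
 have im: "(L - D) `` {x} = L `` {x} - D `` {x}" for x by auto
 have le: "card ((L - D) `` {x}) \<le> card (L `` {x})" for x by (intro card_mono finI) auto
 show "live F m (L - D)" unfolding live_def
 proof (intro conjI)
  show "sym (L - D)" using L D by (auto simp: live_def sym_def)
  show "\<forall>x\<in>F. card ((L - D) `` {x}) \<le> 2" using L unfolding live_def by (meson le order_trans)
 qed (use L in \<open>auto simp: live_def\<close>)
 have c: "real (card ((L - D) `` {x})) = real (card (L `` {x})) - real (card (D `` {x}))" for x
 proof -
  have "D `` {x} \<subseteq> L `` {x}" using D by auto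
  then show ?thesis using finI[OF order_refl, of x] finI[OF D(1), of x]
   by (simp add: im card_Diff_subset card_mono of_nat_diff)
 qed
 have "(\<Sum>x\<in>F. (2 - real (card ((L - D) `` {x}))) * om x) =
   (\<Sum>x\<in>F. (2 - real (card (L `` {x}))) * om x) + (\<Sum>x\<in>F. real (card (D `` {x})) * om x)"
  unfolding c by (simp add: algebra_simps sum.distrib sum_subtractf)
 also have "(\<Sum>x\<in>F. real (card (D `` {x})) * om x) = (\<Sum>x\<in>F. \<Sum>b\<in>D `` {x}. om x)" by simp
 also have "\<dots> = (\<Sum>(a, b)\<in>Sigma F (\<lambda>x. D `` {x}). om a)" using F finI[OF D(1)] by (subst sum.Sigma) auto
 also have "Sigma F (\<lambda>x. D `` {x}) = D" using D LF by auto
 finally have 1: "(\<Sum>x\<in>F. (2 - real (card ((L - D) `` {x}))) * om x) =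
   (\<Sum>x\<in>F. (2 - real (card (L `` {x}))) * om x) + (\<Sum>(a, b)\<in>D. om a)" .
 have "wt (L - D) = wt L - wt D" unfolding wt_def using finL D by (intro sum_diff) auto
 then show "pot F om (L - D) = pot F om L - wt D / 2 + (\<Sum>(a, b)\<in>D. om a)" using 1 by (simp add: pot_def)
qed

lemma live_drop:
 assumes "live F m L" "N \<subseteq> F" "\<And>x. x \<in> N \<Longrightarrow> L `` {x} = {}" "finite F" "\<And>x. x \<in> N \<Longrightarrow> 0 \<le> om x"
 shows "live (F - N) m L" "pot (F - N) om L \<le> pot F om L"
proof -
 have symL: "sym L" using assms by (simp add: live_def)
 then have "(a, b) \<in> L \<Longrightarrow> a \<notin> N \<and> b \<notin> N" for a b using assms(3) by (force simp: sym_def)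
 then show "live (F - N) m L" using assms unfolding live_def by blast
 have "(\<Sum>x\<in>F. (2 - real (card (L `` {x}))) * om x) =
  (\<Sum>x\<in>F - N. (2 - real (card (L `` {x}))) * om x) + (\<Sum>x\<in>N. (2 - real (card (L `` {x}))) * om x)"
  using assms by (intro sum.subset_diff) auto
 moreover have "0 \<le> (\<Sum>x\<in>N. (2 - real (card (L `` {x}))) * om x)" using assms by (intro sum_nonneg) auto
 ultimately show "pot (F - N) om L \<le> pot F om L" by (simp add: pot_def)
qed

end

section \<open>Spanning graphs of nets\<close>

definition conn :: "'a set \<Rightarrow> ('a \<times> 'a) set \<Rightarrow> bool"
 where "conn W R \<longleftrightarrow> (\<forall>x\<in>W. \<forall>y\<in>W. (x, y) \<in> R\<^sup>*)"

lemma conn_mono: "conn W R \<Longrightarrow> R \<subseteq> R'\<^sup>* \<Longrightarrow> conn W R'"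
 unfolding conn_def by (meson rtrancl_subset_rtrancl subsetD)

lemma conn_insert:
 assumes "conn W R" "a \<in> W" "(a, y) \<in> R\<^sup>*" "(y, a) \<in> R\<^sup>*"
 shows "conn (insert y W) R"
 unfolding conn_def using assms by (auto simp: conn_def intro: rtrancl_trans)

context Metric_space
begin

text \<open>The edges in P are permanent: later stages only add to P. They enter with half their
  length and live edges with all of it, so retiring a live edge releases half of its length. For an
  edge longer than 16 r this exceeds the two reserves of 4 r that its ends get back.\<close>

definition state :: "'a set \<Rightarrow> 'a set \<Rightarrow> 'a set \<Rightarrow> ('a \<Rightarrow> real) \<Rightarrow> real \<Rightarrow> real \<Rightarrow> bool"
 where "state E V F om m B \<longleftrightarrow> finite V \<and> V \<subseteq> E \<and> F \<subseteq> V \<and>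
  (\<exists>L P. live F m L \<and> finite P \<and> P \<subseteq> V \<times> V \<and> sym P \<and> conn V (L \<union> P) \<and>
   pot F om L + wt P / 4 \<le> B)"

lemma stateI:
 assumes "finite V" "V \<subseteq> E" "F \<subseteq> V" "live F m L" "finite P" "P \<subseteq> V \<times> V" "sym P"
  "conn V (L \<union> P)" "pot F om L + wt P / 4 \<le> B"
 shows "state E V F om m B"
 using assms unfolding state_def by blast

lemma wt_insert_edge: "finite P \<Longrightarrow> wt (P \<union> {(a, b), (b, a)}) \<le> wt P + 2 * d a b"
proof -
 assume P: "finite P"
 have *: "wt (insert (u, v) Q) \<le> d u v + wt Q" if "finite Q" for Q u v
  unfolding wt_def using that by (cases "(u, v) \<in> Q") (auto simp: insert_absorb)
 have "P \<union> {(a, b), (b, a)} = insert (a, b) (insert (b, a) P)" by auto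
 then show ?thesis using *[of "insert (b, a) P" a b] *[of P b a] P by (simp add: commute)
qed

lemma wt_Un_le: "finite A \<Longrightarrow> finite B \<Longrightarrow> wt (A \<union> B) \<le> wt A + wt B"
 unfolding wt_def by (subst sum_Un) (auto intro!: sum_nonneg)

lemma state_mono: "state E V F om m B \<Longrightarrow> B \<le> B' \<Longrightarrow> state E V F om m B'"
 unfolding state_def by (meson order_trans)

lemma state_add_nonflat:
 assumes "state E V F om m B" "A \<in> V" "y \<in> E"
 shows "state E (insert y V) F om m (B + d y A / 2)"
proof -
 obtain L P where LP: "live F m L" "finite P" "P \<subseteq> V \<times> V" "sym P" "conn V (L \<union> P)"
  "pot F om L + wt P / 4 \<le> B" and V: "finite V" "V \<subseteq> E" "F \<subseteq> V" using assms(1) by (auto simp: state_def)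
 let ?P = "P \<union> {(y, A), (A, y)}"
 have "conn V (L \<union> ?P)" using LP(5) by (rule conn_mono) auto
 then have "conn (insert y V) (L \<union> ?P)" using assms(2) by (rule conn_insert) auto
 moreover have "pot F om L + wt ?P / 4 \<le> B + d y A / 2" using wt_insert_edge[OF LP(2), of y A] LP by simp
 ultimately show ?thesis
  using LP V assms by (intro stateI[where L=L and P="?P"] sym_Un) (auto simp: sym_def[of "{_, _}"])
qed

lemma conn_split:
 assumes "conn V (L \<union> P)"
 shows "conn V ((L - {(a, b), (b, a)} \<union> {(a, y), (y, a), (y, b), (b, y)}) \<union> P)" (is "conn V ?R")
 using assms
proof (rule conn_mono)
 have "(a, y) \<in> ?R" "(y, b) \<in> ?R" "(b, y) \<in> ?R" "(y, a) \<in> ?R" by auto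
 then have "(a, b) \<in> ?R\<^sup>*" "(b, a) \<in> ?R\<^sup>*" by (meson r_into_rtrancl rtrancl_into_rtrancl)+
 then show "L \<union> P \<subseteq> ?R\<^sup>*" by auto
qed

text \<open>This serves points of the graph that become flat. The graph is already connected, so y
  only has to enter the live part: through the edge that contains it, or isolated with two
  reserves.\<close>

lemma state_add_old:
 assumes st: "state E V F om m B" and y: "y \<in> V" "y \<notin> F"
  and r: "r > 0" and m: "m \<le> 100 * r" and sep: "separated r V"
  and fl: "flat E y r \<theta>" and E: "E \<subseteq> M" and \<theta>: "\<theta> \<ge> 0" and om: "om y \<ge> 0"
 shows "state E V (insert y F) om m (B + \<theta> + 2 * om y)"
proof -
 obtain L P where LP: "live F m L" "finite P" "P \<subseteq> V \<times> V" "sym P" "conn V (L \<union> P)"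
  "pot F om L + wt P / 4 \<le> B" and V: "finite V" "V \<subseteq> E" "F \<subseteq> V" using assms(1) by (auto simp: state_def)
 have finF: "finite F" using V finite_subset by blast
 have sepF: "separated r (insert y F)" using sep by (rule separated_subset) (use V y in auto)
 show ?thesis
 proof (cases "\<exists>a b. (a, b) \<in> L \<and> btw y a b")
  case True
  then obtain a b where ab: "(a, b) \<in> L" "btw y a b" by auto
  have FE: "F \<subseteq> E" "y \<in> E" using V y by auto
  note sp = live_split[OF LP(1) finF FE y(2) ab r m sepF fl E]
  show ?thesis
  proof (rule stateI[OF V(1,2) _ sp(1) LP(2,3,4) conn_split[OF LP(5)]])
   show "insert y F \<subseteq> V" using V y by auto
   show "pot (insert y F) om (L - {(a, b), (b, a)} \<union> {(a, y), (y, a), (y, b), (b, y)}) + wt P / 4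
     \<le> B + \<theta> + 2 * om y"
    using sp(2)[of om] LP(6) om by linarith
  qed
 next
  case False
  then have no: "\<And>a b. (a, b) \<in> L \<Longrightarrow> \<not> btw y a b" by auto
  note sp = live_isolated[OF LP(1) y(2) no finF]
  show ?thesis
  proof (rule stateI[OF V(1,2) _ sp(1) LP(2,3,4,5)])
   show "insert y F \<subseteq> V" using V y by auto
   show "pot (insert y F) om L + wt P / 4 \<le> B + \<theta> + 2 * om y" using sp(2)[of om] LP(6) \<theta> by linarith
  qed
 qed
qed

text \<open>With reserves 4 r - \<rho>, attaching y to a costs d a y - \<rho> y + \<rho> a. Since
  \<rho> y = d y A and \<rho> a \<le> d a A, this is at most the excess of a between A and y, so the
  extension is free up to \<theta>. If A is outside F there is no reserve to draw on; then y is left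
  isolated in the live part and hung on A by a permanent edge, for less than 9 r.\<close>

lemma state_add_new:
 assumes st: "state E V F om m B" and y: "y \<in> E" "y \<notin> V" and A: "A \<in> V" "d y A \<le> 2 * r" "2 * r \<le> m"
  and r: "r > 0" and m: "m \<le> 100 * r" and sep: "separated r (insert y V)"
  and fl: "flat E y r \<theta>" and E: "E \<subseteq> M" and \<theta>: "\<theta> \<ge> 0"
  and om: "\<And>x. om x = 4 * r - \<rho> x" and \<rho>: "\<And>x. x \<in> V \<Longrightarrow> \<rho> x \<le> d x A" "\<rho> y = d y A" "\<rho> A = 0"
 shows "state E (insert y V) (insert y F) om m (B + \<theta> + (if A \<in> F then 0 else 9 * r))"
proof -
 obtain L P where LP: "live F m L" "finite P" "P \<subseteq> V \<times> V" "sym P" "conn V (L \<union> P)"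
  "pot F om L + wt P / 4 \<le> B" and V: "finite V" "V \<subseteq> E" "F \<subseteq> V" using assms(1) by (auto simp: state_def)
 have finF: "finite F" using V finite_subset by blast
 have FE: "F \<subseteq> E" and yF: "y \<notin> F" using V y by auto
 have sepF: "separated r (insert y F)" using sep by (rule separated_subset) (use V y in auto)
 have Vy: "finite (insert y V)" "insert y V \<subseteq> E" "insert y F \<subseteq> insert y V" "P \<subseteq> insert y V \<times> insert y V"
  using V y LP by auto
 have if0: "0 \<le> (if A \<in> F then 0 else 9 * r)" using r by auto
 show ?thesis
 proof (cases "\<exists>a b. (a, b) \<in> L \<and> btw y a b")
  case True
  then obtain a b where ab: "(a, b) \<in> L" "btw y a b" by auto
  let ?L = "L - {(a, b), (b, a)} \<union> {(a, y), (y, a), (y, b), (b, y)}"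
  note sp = live_split[OF LP(1) finF FE y(1) yF ab r m sepF fl E]
  have "a \<in> V" using LP(1) ab V by (auto simp: live_def)
  then have "conn (insert y V) (?L \<union> P)" by (intro conn_insert[OF conn_split[OF LP(5)], of a]) auto
  moreover have "pot (insert y F) om ?L + wt P / 4 \<le> B + \<theta> + (if A \<in> F then 0 else 9 * r)"
   using sp(2)[of om] LP(6) if0 by linarith
  ultimately show ?thesis by (rule stateI[OF Vy(1-3) sp(1) LP(2) Vy(4) LP(4)])
 next
  case False
  then have no: "\<And>a b. (a, b) \<in> L \<Longrightarrow> \<not> btw y a b" by auto
  show ?thesis
  proof (cases "A \<in> F")
   case True
   have "d A y \<le> 2 * r" using A by (simp add: commute)
   from live_attach[OF LP(1) finF FE y(1) yF no True this A(3) r m sepF fl E \<theta>, where om=om]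
   obtain a where a: "a \<in> F" "a = A \<or> d A a + d a y - d A y \<le> \<theta>"
    "live (insert y F) m (L \<union> {(a, y), (y, a)})"
    "pot (insert y F) om (L \<union> {(a, y), (y, a)}) = pot F om L + d a y + om y - om a" by blast
   let ?L = "L \<union> {(a, y), (y, a)}"
   have "conn V (?L \<union> P)" using LP(5) by (rule conn_mono) auto
   then have "conn (insert y V) (?L \<union> P)" using a(1) V by (intro conn_insert[where a=a]) auto
   moreover
   have "d a y + om y - om a \<le> \<theta>"
   proof (cases "a = A")
    case True
    then show ?thesis using om \<rho> \<theta> by (simp add: commute)
   next
    case False
    then have "d A a + d a y - d A y \<le> \<theta>" using a by simp
    moreover have "\<rho> a \<le> d A a" using \<rho>(1)[of a] a V by (auto simp: commute)
    ultimately show ?thesis using om \<rho> by (simp add: commute)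
   qed
   then have "pot (insert y F) om ?L + wt P / 4 \<le> B + \<theta> + (if A \<in> F then 0 else 9 * r)"
    using a(4) LP(6) if0 by linarith
   ultimately show ?thesis by (intro stateI[OF Vy(1-3) a(3) LP(2) Vy(4) LP(4)])
  next
   case nF: False
   note sp = live_isolated[OF LP(1) yF no finF]
   let ?P = "P \<union> {(y, A), (A, y)}"
   have "conn V (L \<union> ?P)" using LP(5) by (rule conn_mono) auto
   then have "conn (insert y V) (L \<union> ?P)" using A(1) by (rule conn_insert) auto
   moreover have "pot (insert y F) om L + wt ?P / 4 \<le> B + \<theta> + 9 * r"
    using wt_insert_edge[OF LP(2), of y A] LP(6) sp(2)[of om] om[of y] \<rho>(2) A(2) \<theta>
     nonneg[of y A] by linarith
   moreover have "finite ?P" "?P \<subseteq> insert y V \<times> insert y V" "sym ?P"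
    using LP(2) Vy(4) A(1) by (auto intro!: sym_Un[OF LP(4)] simp: sym_def[of "{_, _}"] simp del: Un_insert_right)
   ultimately show ?thesis using nF by (intro stateI[OF Vy(1-3) sp(1), of ?P]) auto
  qed
 qed
qed

text \<open>At most two edges meet each point of N, so at most 4 card N orientations are lost on its
  account, and each returns a reserve of 4 r. All other removed edges are longer than 16 r and pay
  for themselves.\<close>

lemma state_demote:
 assumes st: "state E V F (\<lambda>_. 4 * r) m B" and N: "N \<subseteq> F" and r: "r > 0"
 shows "state E V (F - N) (\<lambda>_. 4 * r) (16 * r) (B + 16 * r * card N)"
proof -
 obtain L P where LP: "live F m L" "finite P" "P \<subseteq> V \<times> V" "sym P" "conn V (L \<union> P)"
  "pot F (\<lambda>_. 4 * r) L + wt P / 4 \<le> B" and V: "finite V" "V \<subseteq> E" "F \<subseteq> V"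
  using assms(1) by (auto simp: state_def)
 have finF: "finite F" using V(3,1) by (rule finite_subset)
 have finN: "finite N" using N finF by (rule finite_subset)
 have finL: "finite L" and symL: "sym L" and LF: "L \<subseteq> F \<times> F"
  and deg: "\<And>x. x \<in> F \<Longrightarrow> card (L `` {x}) \<le> 2" using LP(1) by (auto simp: live_def)
 define D1 where "D1 = {(a, b) \<in> L. a \<in> N \<or> b \<in> N}"
 define D where "D = {(a, b) \<in> L. a \<in> N \<or> b \<in> N \<or> d a b > 16 * r}"
 have D: "D \<subseteq> L" by (auto simp: D_def)
 have symD': "sym D"
 proof (rule symI)
  fix a b assume ab: "(a, b) \<in> D"
  then have "(a, b) \<in> L" by (simp add: D_def)
  then have "(b, a) \<in> L" by (rule symD[OF symL])
  then show "(b, a) \<in> D" using ab by (auto simp: D_def commute)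
 qed
 have finD: "finite D" "finite D1" using finL finite_subset[OF D finL] finite_subset[of D1 L] by (auto simp: D1_def)
 note dm = live_demote[OF LP(1) D symD' finF]
 have cD1: "card D1 \<le> 4 * card N"
 proof -
  have c: "card (Sigma N (\<lambda>x. L `` {x})) \<le> 2 * card N"
  proof -
   have "card (Sigma N (\<lambda>x. L `` {x})) = (\<Sum>x\<in>N. card (L `` {x}))"
    using finN finL by (intro card_SigmaI) auto
   also have "\<dots> \<le> (\<Sum>x\<in>N. 2)" using deg N by (intro sum_mono) auto
   finally show ?thesis by simp
  qed
  have "D1 \<subseteq> Sigma N (\<lambda>x. L `` {x}) \<union> (Sigma N (\<lambda>x. L `` {x}))\<inverse>"
  proof
   fix e assume e: "e \<in> D1"
   obtain a b where ab: "e = (a, b)" by force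
   have "(a, b) \<in> L" using e ab by (simp add: D1_def)
   then have "(b, a) \<in> L" by (rule symD[OF symL])
   then show "e \<in> Sigma N (\<lambda>x. L `` {x}) \<union> (Sigma N (\<lambda>x. L `` {x}))\<inverse>" using e ab by (auto simp: D1_def)
  qed
  then have "card D1 \<le> card (Sigma N (\<lambda>x. L `` {x}) \<union> (Sigma N (\<lambda>x. L `` {x}))\<inverse>)"
   using finN finL by (intro card_mono) auto
  also have "\<dots> \<le> card (Sigma N (\<lambda>x. L `` {x})) + card ((Sigma N (\<lambda>x. L `` {x}))\<inverse>)" by (rule card_Un_le)
  finally show ?thesis using c by simp
 qed
 have "(\<Sum>(a, b)\<in>D. 4 * r) - wt D / 4 = (\<Sum>(a, b)\<in>D. 4 * r - d a b / 4)"
  by (simp add: wt_def sum_subtractf sum_divide_distrib case_prod_beta)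
 also have "\<dots> \<le> (\<Sum>e\<in>D. if e \<in> D1 then 4 * r else 0)" using r by (intro sum_mono) (auto simp: D_def D1_def)
 also have "\<dots> = (\<Sum>e\<in>D1. 4 * r)" by (rule sum.mono_neutral_cong_right) (use finD in \<open>auto simp: D_def D1_def\<close>)
 also have "\<dots> = 4 * r * card D1" by simp
 also have "\<dots> \<le> 4 * r * (4 * card N)" using r cD1 by (intro mult_left_mono) linarith+
 finally have gain: "(\<Sum>(a, b)\<in>D. 4 * r) - wt D / 4 \<le> 16 * r * card N" by simp
 have liv: "live F (16 * r) (L - D)" using dm(1) unfolding live_def by (auto simp: D_def not_less)
 have emp: "(L - D) `` {x} = {}" if "x \<in> N" for x using that by (auto simp: D_def)
 note dr = live_drop[OF liv N emp finF, of "\<lambda>_. 4 * r"]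
 have fin: "finite P" "finite D" using LP finD by auto
 have "pot (F - N) (\<lambda>_. 4 * r) (L - D) + wt (P \<union> D) / 4 \<le> B + 16 * r * card N"
  using dr(2) dm(2)[of "\<lambda>_. 4 * r"] wt_Un_le[OF fin] gain LP(6) r by simp
 moreover have "conn V (L - D \<union> (P \<union> D))" using LP(5) by (rule conn_mono) auto
 moreover have "P \<union> D \<subseteq> V \<times> V" using LP(3) D LF V(3) by blast
 moreover have "finite (P \<union> D)" "sym (P \<union> D)" "F - N \<subseteq> V" using fin V sym_Un[OF LP(4) symD'] by auto
 ultimately show ?thesis using r by (intro stateI[OF V(1,2) _ dr(1), of "P \<union> D"]) auto
qed

lemma state_weight_mono:
 assumes st: "state E V F om m B" and om: "\<And>x. x \<in> F \<Longrightarrow> om' x \<le> om x"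
 shows "state E V F om' m B"
proof -
 obtain L P where LP: "live F m L" "finite P" "P \<subseteq> V \<times> V" "sym P" "conn V (L \<union> P)"
  "pot F om L + wt P / 4 \<le> B" and V: "finite V" "V \<subseteq> E" "F \<subseteq> V" using assms(1) by (auto simp: state_def)
 have "pot F om' L \<le> pot F om L"
  unfolding pot_def using om LP(1) by (intro add_left_mono sum_mono mult_left_mono) (auto simp: live_def)
 then show ?thesis using LP V by (intro stateI[OF V LP(1-5)]) linarith
qed

text \<open>Coordinates differ from that of y by at most 4.1 r and from each other by at least 0.9
  r. In units of 0.9 r their integer parts are therefore distinct and lie between -5 and 5.\<close>

lemma flat_card_le:
 assumes "finite T" "T \<subseteq> E" "separated r T" "y \<in> T" "flat E y r \<theta>" "r > 0"
  and "\<And>u. u \<in> T \<Longrightarrow> d y u \<le> 4 * r" "E \<subseteq> M"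
 shows "card T \<le> 11"
proof -
 obtain \<pi> :: "'a \<Rightarrow> real" where \<pi>: "\<And>u v. u \<in> E \<Longrightarrow> v \<in> E \<Longrightarrow> d y u \<le> 240 * r \<Longrightarrow> d y v \<le> 240 * r \<Longrightarrow>
   \<bar>d u v - \<bar>\<pi> u - \<pi> v\<bar>\<bar> \<le> r / 10"
  using assms(5) unfolding flat_def by meson
 have ch: "chart T \<pi> r" unfolding chart_def
 proof (intro ballI)
  fix u v assume uv: "u \<in> T" "v \<in> T"
  have "d y u \<le> 240 * r" "d y v \<le> 240 * r" using assms(7)[OF uv(1)] assms(7)[OF uv(2)] assms(6) by linarith+
  then show "\<bar>d u v - \<bar>\<pi> u - \<pi> v\<bar>\<bar> \<le> r / 10" using \<pi>[of u v] uv assms(2) by auto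
 qed
 define g where "g u = \<lfloor>(\<pi> u - \<pi> y) / (9 / 10 * r)\<rfloor>" for u
 have "inj_on g T"
 proof (rule inj_onI, rule ccontr)
  fix u v assume uv: "u \<in> T" "v \<in> T" "g u = g v" "u \<noteq> v"
  have "9 / 10 * r \<le> \<bar>\<pi> u - \<pi> v\<bar>" by (rule chart_inj[OF ch assms(3,6) uv(1,2,4)])
  moreover have "1 \<le> \<bar>x / c\<bar>" if "c \<le> \<bar>x\<bar>" "c > 0" for x c :: real using that by (simp add: abs_divide)
  ultimately have "1 \<le> \<bar>(\<pi> u - \<pi> v) / (9 / 10 * r)\<bar>"
   using assms(6) by (metis mult_pos_pos zero_less_divide_iff zero_less_numeral)
  also have "(\<pi> u - \<pi> v) / (9 / 10 * r) = (\<pi> u - \<pi> y) / (9 / 10 * r) - (\<pi> v - \<pi> y) / (9 / 10 * r)"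
   by (simp add: diff_divide_distrib)
  finally have "1 \<le> \<bar>(\<pi> u - \<pi> y) / (9 / 10 * r) - (\<pi> v - \<pi> y) / (9 / 10 * r)\<bar>" .
  moreover have "\<bar>(\<pi> u - \<pi> y) / (9 / 10 * r) - (\<pi> v - \<pi> y) / (9 / 10 * r)\<bar> < 1"
   using uv(3) unfolding g_def by linarith
  ultimately show False by simp
 qed
 moreover have "g ` T \<subseteq> {-5..5}"
 proof
  fix i assume "i \<in> g ` T"
  then obtain u where u: "u \<in> T" "i = g u" by auto
  have "\<bar>d u y - \<bar>\<pi> u - \<pi> y\<bar>\<bar> \<le> r / 10" using ch u assms by (auto simp: chart_def)
  then have "\<bar>\<pi> u - \<pi> y\<bar> \<le> 41 / 10 * r" using assms(7)[OF u(1)] commute[of y u] by linarith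
  moreover have "\<bar>x / (9 / 10 * r)\<bar> \<le> 41 / 9" if "\<bar>x\<bar> \<le> 41 / 10 * r" for x
   using that assms(6) unfolding abs_divide by (simp add: divide_le_eq)
  ultimately have "\<bar>(\<pi> u - \<pi> y) / (9 / 10 * r)\<bar> \<le> 41 / 9" by blast
  moreover have "i = \<lfloor>(\<pi> u - \<pi> y) / (9 / 10 * r)\<rfloor>" using u by (simp only: g_def)
  moreover have "\<lfloor>x\<rfloor> \<in> {-5..5}" if "\<bar>x\<bar> \<le> 41 / 9" for x :: real using that by (auto simp: abs_le_iff)
  ultimately show "i \<in> {-5..5}" by blast
 qed
 ultimately have "card T \<le> card {-5..5::int}" by (metis card_inj_on_le finite_atLeastAtMost_int)
 then show ?thesis by simp
qed

end

text \<open>Only a nonnegative cost \<theta> is attached to every net point. A cost below \<epsilon>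
  r guarantees flatness, and a point of larger cost can pay for anything of size r.\<close>

locale net_tower = Metric_space +
 fixes E :: "'a set" and X :: "nat \<Rightarrow> 'a set" and r :: "nat \<Rightarrow> real" and \<theta> :: "nat \<Rightarrow> 'a \<Rightarrow> real" and \<epsilon> :: real and x0 :: 'a
 assumes EM: "E \<subseteq> M" and X_fin: "finite (X j)" and X_E: "X j \<subseteq> E" and X_mono: "X j \<subseteq> X (Suc j)"
  and X_sep: "separated (r j) (X j)" and X_near: "y \<in> X (Suc j) \<Longrightarrow> \<exists>x\<in>X j. d y x < r j"
  and r_pos: "r j > 0" and r_half: "r j = 2 * r (Suc j)"
  and \<theta>_nonneg: "\<theta> j x \<ge> 0" and eps: "0 < \<epsilon>"
  and flat: "x \<in> X j \<Longrightarrow> \<theta> j x < \<epsilon> * r j \<Longrightarrow> flat E x (r j) (\<theta> j x)"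
  and X0: "X 0 = {x0}"
begin

definition fl :: "nat \<Rightarrow> 'a set"
 where "fl j = {x \<in> X j. \<theta> j x < \<epsilon> * r j}"

definition \<Theta> :: "nat \<Rightarrow> real"
 where "\<Theta> j = (\<Sum>x\<in>X j. \<theta> j x)"

lemma \<Theta>_nonneg: "0 \<le> \<Theta> j"
 unfolding \<Theta>_def by (rule sum_nonneg) (simp add: \<theta>_nonneg)

lemma card_nonflat: "S \<subseteq> X j - fl j \<Longrightarrow> r j * card S \<le> \<Theta> j / \<epsilon>"
proof -
 assume S: "S \<subseteq> X j - fl j"
 have "(\<Sum>x\<in>S. \<epsilon> * r j) \<le> (\<Sum>x\<in>S. \<theta> j x)" using S by (intro sum_mono) (auto simp: fl_def not_less)
 also have "\<dots> \<le> \<Theta> j" unfolding \<Theta>_def using S X_fin by (intro sum_mono2) (auto simp: \<theta>_nonneg)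
 finally show ?thesis using eps by (simp add: field_simps)
qed

lemma \<theta>_sum_le: "S \<subseteq> X j \<Longrightarrow> (\<Sum>x\<in>S. \<theta> j x) \<le> \<Theta> j"
 unfolding \<Theta>_def using X_fin by (intro sum_mono2) (auto simp: \<theta>_nonneg)

text \<open>Every expense is either a cost \<theta> or a multiple of r charged to a point that fails
  the flatness test at scale j or j + 1, which is why both \<Theta> j and \<Theta> (Suc j) appear.
  The reserve 2 r j of the old scale is 4 r (Suc j), so it passes to the new scale
  unchanged.\<close>

lemma phase:
 assumes st: "state E (X j) (fl j) (\<lambda>_. 2 * r j) (16 * r j) B"
 shows "state E (X (Suc j)) (fl (Suc j)) (\<lambda>_. 2 * r (Suc j)) (16 * r (Suc j))
  (B + (2 + 130 / \<epsilon>) * (\<Theta> j + \<Theta> (Suc j)))"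
proof -
 let ?r = "r (Suc j)"
 have rp: "?r > 0" by (rule r_pos)
 define N where "N = fl j - fl (Suc j)"
 have st1: "state E (X j) (fl j) (\<lambda>_. 4 * ?r) (16 * r j) B" using st by (simp add: r_half[of j])
 have "state E (X j) (fl j - N) (\<lambda>_. 4 * ?r) (16 * ?r) (B + 16 * ?r * card N)"
  by (rule state_demote[OF st1 _ rp]) (auto simp: N_def)
 moreover have "N \<subseteq> X (Suc j) - fl (Suc j)" using X_mono[of j] by (auto simp: N_def fl_def)
 from card_nonflat[OF this] have "16 * ?r * card N \<le> 16 / \<epsilon> * \<Theta> (Suc j)" by simp
 ultimately have st2: "state E (X j) (fl j - N) (\<lambda>_. 4 * ?r) (16 * ?r) (B + 16 / \<epsilon> * \<Theta> (Suc j))"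
  by (auto elim: state_mono)
 have sepj: "separated ?r (X j)" using X_sep[of "Suc j"] by (rule separated_subset) (rule X_mono)
 have grow: "state E (X j) ((fl j - N) \<union> Y) (\<lambda>_. 4 * ?r) (16 * ?r)
   (B + 16 / \<epsilon> * \<Theta> (Suc j) + (\<Sum>y\<in>Y. \<theta> (Suc j) y + 8 * ?r))"
  if "Y \<subseteq> fl (Suc j) \<inter> X j - (fl j - N)" for Y
 proof -
  have "finite Y" using that X_fin[of j] finite_subset by blast
  then show ?thesis using that
  proof (induction Y rule: finite_induct)
   case empty
   then show ?case using st2 by simp
  next
   case (insert y Y)
   have y: "y \<in> X j" "y \<notin> (fl j - N) \<union> Y" "y \<in> fl (Suc j)" using insert by auto
   have "flat E y ?r (\<theta> (Suc j) y)" using y(3) flat[of y "Suc j"] by (auto simp: fl_def)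
   from state_add_old[OF insert.IH y(1,2) rp _ sepj this EM \<theta>_nonneg] insert rp
   show ?case by (simp add: add.assoc add.commute add.left_commute)
  qed
 qed
 define Y where "Y = fl (Suc j) \<inter> X j - (fl j - N)"
 have FY: "(fl j - N) \<union> Y = fl (Suc j) \<inter> X j" by (auto simp: Y_def N_def fl_def)
 have "(\<Sum>y\<in>Y. \<theta> (Suc j) y + 8 * ?r) = (\<Sum>y\<in>Y. \<theta> (Suc j) y) + 4 * (r j * card Y)"
  by (simp add: sum.distrib r_half[of j])
 also have "\<dots> \<le> \<Theta> (Suc j) + 4 * (\<Theta> j / \<epsilon>)"
  by (intro add_mono mult_left_mono \<theta>_sum_le card_nonflat) (auto simp: Y_def N_def fl_def)
 finally have st3: "state E (X j) (fl (Suc j) \<inter> X j) (\<lambda>_. 4 * ?r) (16 * ?r)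
   (B + 16 / \<epsilon> * \<Theta> (Suc j) + (\<Theta> (Suc j) + 4 * (\<Theta> j / \<epsilon>)))"
  using grow[of Y] FY Y_def by (auto elim!: state_mono)
 \<comment> \<open>The distance to the old net. It vanishes on that net, so lowering the reserves by
   it changes nothing until new points arrive.\<close>
 define \<rho> where "\<rho> x = Min ((\<lambda>z. d x z) ` X j)" for x
 have Xne: "X j \<noteq> {}" by (induction j) (use X0 X_mono in auto)
 have \<rho>_le: "\<rho> x \<le> d x z" if "z \<in> X j" for x z unfolding \<rho>_def using X_fin that by (intro Min_le) auto
 have "\<exists>z\<in>X j. \<rho> x = d x z" for x
  using Min_in[of "(\<lambda>z. d x z) ` X j"] X_fin[of j] Xne unfolding \<rho>_def by fastforce
 then obtain nr where nr: "\<And>x. nr x \<in> X j" "\<And>x. \<rho> x = d x (nr x)" by metis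
 have \<rho>0: "\<rho> x = 0" if "x \<in> X j" for x
  using \<rho>_le[OF that, of x] nr[of x] that X_E EM zero[of x x] by (smt (verit) nonneg subsetD)
 have \<rho>_lt: "\<rho> x \<le> 2 * ?r" if "x \<in> X (Suc j)" for x using X_near[OF that] \<rho>_le[of _ x] r_half[of j] by force
 have st4: "state E (X j) (fl (Suc j) \<inter> X j) (\<lambda>x. 4 * ?r - \<rho> x) (16 * ?r)
   (B + 16 / \<epsilon> * \<Theta> (Suc j) + (\<Theta> (Suc j) + 4 * (\<Theta> j / \<epsilon>)))" (is "state _ _ _ _ _ ?B4")
  using st3 by (rule state_weight_mono) (auto simp: \<rho>0)
 define cost where "cost y = \<theta> (Suc j) y + (if y \<in> fl (Suc j) then 0 else ?r)
  + (if y \<in> fl (Suc j) \<and> nr y \<notin> fl (Suc j) then 9 * ?r else 0)" for y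
 have grow2: "state E (X j \<union> Z) (fl (Suc j) \<inter> (X j \<union> Z)) (\<lambda>x. 4 * ?r - \<rho> x) (16 * ?r)
   (?B4 + (\<Sum>y\<in>Z. cost y))"
  if "Z \<subseteq> X (Suc j) - X j" for Z
 proof -
  have "finite Z" using that X_fin[of "Suc j"] finite_subset by blast
  then show ?thesis using that
  proof (induction Z rule: finite_induct)
   case empty
   then show ?case using st4 by simp
  next
   case (insert y Z)
   note IH = insert.IH[OF order_trans[OF _ insert.prems]]
   have st: "state E (X j \<union> Z) (fl (Suc j) \<inter> (X j \<union> Z)) (\<lambda>x. 4 * ?r - \<rho> x) (16 * ?r)
    (?B4 + (\<Sum>y\<in>Z. cost y))" using IH by auto
   have y: "y \<in> E" "y \<notin> X j \<union> Z" "y \<in> X (Suc j)" using insert X_E[of "Suc j"] by auto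
   have A: "nr y \<in> X j \<union> Z" using nr by auto
   have dA: "d y (nr y) \<le> 2 * ?r" using \<rho>_lt[OF y(3)] nr by simp
   show ?case
   proof (cases "y \<in> fl (Suc j)")
    case False
    have F: "fl (Suc j) \<inter> (X j \<union> insert y Z) = fl (Suc j) \<inter> (X j \<union> Z)" using False by auto
    have "d y (nr y) / 2 \<le> cost y" using dA False rp \<theta>_nonneg[of "Suc j" y] by (simp add: cost_def)
    then show ?thesis unfolding F using state_add_nonflat[OF st A y(1)] insert(1,2)
     by (auto elim!: state_mono)
   next
    case True
    have F: "fl (Suc j) \<inter> (X j \<union> insert y Z) = insert y (fl (Suc j) \<inter> (X j \<union> Z))" using True by auto
    have flt: "flat E y ?r (\<theta> (Suc j) y)" using True flat[of y "Suc j"] by (auto simp: fl_def)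
    have sep: "separated ?r (insert y (X j \<union> Z))"
     using X_sep[of "Suc j"] by (rule separated_subset) (use insert.prems X_mono[of j] y in auto)
    let ?c = "if nr y \<in> fl (Suc j) \<inter> (X j \<union> Z) then 0 else 9 * ?r"
    have "state E (insert y (X j \<union> Z)) (insert y (fl (Suc j) \<inter> (X j \<union> Z))) (\<lambda>x. 4 * ?r - \<rho> x) (16 * ?r)
     (?B4 + (\<Sum>y\<in>Z. cost y) + \<theta> (Suc j) y + ?c)"
     by (rule state_add_new[OF st y(1,2) A dA _ rp _ sep flt EM \<theta>_nonneg, where \<rho>=\<rho>])
      (use nr \<rho>_le \<rho>0 rp in auto)
    moreover have "\<theta> (Suc j) y + ?c = cost y" using True A by (simp add: cost_def)
    then have "?B4 + (\<Sum>y\<in>Z. cost y) + \<theta> (Suc j) y + ?c \<le> ?B4 + (\<Sum>y\<in>insert y Z. cost y)"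
     using sum.insert[OF insert(1,2), of cost] by linarith
    ultimately show ?thesis unfolding F unfolding Un_insert_right by (rule state_mono)
   qed
  qed
 qed
 define Z where "Z = X (Suc j) - X j"
 have XZ: "X j \<union> Z = X (Suc j)" using X_mono[of j] by (auto simp: Z_def)
 have finZ: "finite Z" using X_fin by (auto simp: Z_def)
 have cost: "(\<Sum>y\<in>Z. cost y) \<le> \<Theta> (Suc j) + \<Theta> (Suc j) / \<epsilon> + 99 * (\<Theta> (Suc j) / \<epsilon>)"
 proof -
  have "(\<Sum>y\<in>Z. cost y) = (\<Sum>y\<in>Z. \<theta> (Suc j) y) + (\<Sum>y\<in>Z. if y \<in> fl (Suc j) then 0 else ?r)
    + (\<Sum>y\<in>Z. if y \<in> fl (Suc j) \<and> nr y \<notin> fl (Suc j) then 9 * ?r else 0)"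
   by (simp add: cost_def sum.distrib)
  moreover have "(\<Sum>y\<in>Z. \<theta> (Suc j) y) \<le> \<Theta> (Suc j)" by (rule \<theta>_sum_le) (auto simp: Z_def)
  moreover have "(\<Sum>y\<in>Z. if y \<in> fl (Suc j) then 0 else ?r) \<le> \<Theta> (Suc j) / \<epsilon>"
  proof -
   have "(\<Sum>y\<in>Z. if y \<in> fl (Suc j) then 0 else ?r) = (\<Sum>y\<in>Z - fl (Suc j). ?r)"
    using finZ by (intro sum.mono_neutral_cong_right) auto
   also have "\<dots> = ?r * card (Z - fl (Suc j))" by simp
   also have "\<dots> \<le> \<Theta> (Suc j) / \<epsilon>" by (rule card_nonflat) (auto simp: Z_def)
   finally show ?thesis .
  qed
  moreover have "(\<Sum>y\<in>Z. if y \<in> fl (Suc j) \<and> nr y \<notin> fl (Suc j) then 9 * ?r else 0) \<le> 99 * (\<Theta> (Suc j) / \<epsilon>)"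
  proof -
   define T where "T = {y \<in> Z. y \<in> fl (Suc j) \<and> nr y \<notin> fl (Suc j)}"
   define K where "K = nr ` T"
   have finT: "finite T" using finZ by (auto simp: T_def)
   have K: "K \<subseteq> X (Suc j) - fl (Suc j)" using nr X_mono[of j] by (auto simp: K_def T_def)
   \<comment> \<open>New flat points with the same nearest old point are within 4 r of each other,
     so there are at most 11 of them; the factor 99 is 9 times 11.\<close>
   have *: "card {y \<in> T. nr y = A} \<le> 11" for A
   proof (cases "{y \<in> T. nr y = A} = {}")
    case False
    then obtain y where y: "y \<in> T" "nr y = A" by auto
    show ?thesis
    proof (rule flat_card_le[where E=E and r="?r" and y=y and \<theta>="\<theta> (Suc j) y"])
     show "finite {y \<in> T. nr y = A}" using finT by auto
     show "{y \<in> T. nr y = A} \<subseteq> E" using X_E[of "Suc j"] by (auto simp: T_def Z_def)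
     show "separated ?r {y \<in> T. nr y = A}"
      using X_sep[of "Suc j"] by (rule separated_subset) (auto simp: T_def Z_def)
     show "flat E y ?r (\<theta> (Suc j) y)" using y flat[of y "Suc j"] by (auto simp: T_def fl_def)
     show "d y u \<le> 4 * ?r" if "u \<in> {y \<in> T. nr y = A}" for u
     proof -
      have u: "u \<in> X (Suc j)" "y \<in> X (Suc j)" "nr u = A" using that y by (auto simp: T_def Z_def)
      have "A \<in> X j" using nr y by auto
      then have "d y u \<le> d y A + d A u" using u X_E EM by (intro triangle) auto
      then show ?thesis using \<rho>_lt[OF u(1)] \<rho>_lt[OF u(2)] nr(2)[of u] nr(2)[of y] y u
       by (simp add: commute)
     qed
    qed (use y rp EM in auto)
   next
    case True
    then show ?thesis by (simp only: card.empty)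
   qed
   have "(\<Sum>y\<in>Z. if y \<in> fl (Suc j) \<and> nr y \<notin> fl (Suc j) then 9 * ?r else 0) = (\<Sum>y\<in>T. 9 * ?r)"
    using finZ by (intro sum.mono_neutral_cong_right) (auto simp: T_def)
   also have "\<dots> = 9 * ?r * card T" by simp
   also have "card T = (\<Sum>A\<in>K. card {y \<in> T. nr y = A})"
    using sum.image_gen[OF finT, of "\<lambda>_. 1::nat" nr] by (simp add: K_def)
   also have "9 * ?r * real (\<Sum>A\<in>K. card {y \<in> T. nr y = A}) \<le> 9 * ?r * real (\<Sum>A\<in>K. 11)"
    using rp * by (intro mult_left_mono of_nat_mono sum_mono) auto
   also have "\<dots> = 99 * (?r * card K)" by simp
   also have "\<dots> \<le> 99 * (\<Theta> (Suc j) / \<epsilon>)" using card_nonflat[OF K] by simp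
   finally show ?thesis .
  qed
  ultimately show ?thesis by linarith
 qed
 have st5: "state E (X (Suc j)) (fl (Suc j)) (\<lambda>x. 4 * ?r - \<rho> x) (16 * ?r) (?B4 + (\<Sum>y\<in>Z. cost y))"
 proof -
  have "fl (Suc j) \<inter> (X j \<union> Z) = fl (Suc j)" unfolding XZ by (auto simp: fl_def)
  then show ?thesis using grow2[of Z] XZ by (simp add: Z_def)
 qed
 \<comment> \<open>New points have \<rho> \<le> 2 r, so all reserves are still at least 2 r, the
   value required at the start of the next phase.\<close>
 have st6: "state E (X (Suc j)) (fl (Suc j)) (\<lambda>_. 2 * ?r) (16 * ?r) (?B4 + (\<Sum>y\<in>Z. cost y))"
  using st5 by (rule state_weight_mono) (use \<rho>_lt in \<open>force simp: fl_def\<close>)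
 have "?B4 + (\<Sum>y\<in>Z. cost y) \<le> B + (2 + 130 / \<epsilon>) * (\<Theta> j + \<Theta> (Suc j))"
 proof -
  have "0 \<le> \<Theta> j / \<epsilon>" "0 \<le> \<Theta> (Suc j) / \<epsilon>" "0 \<le> \<Theta> j" using \<Theta>_nonneg eps by auto
  moreover have "(2 + 130 / \<epsilon>) * (\<Theta> j + \<Theta> (Suc j)) =
    2 * \<Theta> j + 2 * \<Theta> (Suc j) + 130 * (\<Theta> j / \<epsilon>) + 130 * (\<Theta> (Suc j) / \<epsilon>)"
   by (simp add: algebra_simps add_divide_distrib)
  ultimately show ?thesis using cost by simp
 qed
 with st6 show ?thesis by (rule state_mono)
qed

text \<open>Each \<Theta> j is charged in the phase before and in the phase after scale j, which
  doubles the constant. The start is at most one point of degree 0 with reserve 2 r 0 on each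
  side.\<close>

lemma tower_state:
 "state E (X n) (fl n) (\<lambda>_. 2 * r n) (16 * r n) (4 * r 0 + (4 + 260 / \<epsilon>) * (\<Sum>j\<le>n. \<Theta> j))"
proof -
 have "state E (X n) (fl n) (\<lambda>_. 2 * r n) (16 * r n)
  (4 * r 0 + (2 + 130 / \<epsilon>) * (2 * (\<Sum>j<n. \<Theta> j) + \<Theta> n))"
 proof (induction n)
  case 0
  have "live (fl 0) (16 * r 0) {}" by (auto simp: live_def)
  moreover have "pot (fl 0) (\<lambda>_. 2 * r 0) {} \<le> 4 * r 0"
  proof -
   have "fl 0 = {} \<or> fl 0 = {x0}" using X0 by (auto simp: fl_def)
   then show ?thesis using r_pos[of 0] by (auto simp: pot_def wt_def)
  qed
  moreover have "0 \<le> (2 + 130 / \<epsilon>) * (2 * (\<Sum>j<0. \<Theta> j) + \<Theta> 0)" using eps \<Theta>_nonneg[of 0] by auto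
  ultimately show ?case unfolding state_def using X_fin[of 0] X_E[of 0] X0
   by (intro conjI exI[of _ "{}"]) (auto simp: fl_def conn_def wt_def sym_def)
 next
  case (Suc n)
  have *: "K * (2 * S + a) + K * (a + b) = K * (2 * (S + a) + b)" for K S a b :: real
   by (simp add: algebra_simps)
  have eq: "4 * r 0 + (2 + 130 / \<epsilon>) * (2 * (\<Sum>j<n. \<Theta> j) + \<Theta> n) + (2 + 130 / \<epsilon>) * (\<Theta> n + \<Theta> (Suc n))
   = 4 * r 0 + (2 + 130 / \<epsilon>) * (2 * (\<Sum>j<Suc n. \<Theta> j) + \<Theta> (Suc n))"
   using *[of "2 + 130 / \<epsilon>" "\<Sum>j<n. \<Theta> j" "\<Theta> n" "\<Theta> (Suc n)"] by simp
  show ?case using phase[OF Suc] by (simp only: eq)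
 qed
 moreover have "4 * r 0 + (2 + 130 / \<epsilon>) * (2 * (\<Sum>j<n. \<Theta> j) + \<Theta> n) \<le> 4 * r 0 + (4 + 260 / \<epsilon>) * (\<Sum>j\<le>n. \<Theta> j)"
 proof -
  have "(2 + 130 / \<epsilon>) * (2 * (\<Sum>j<n. \<Theta> j) + \<Theta> n) \<le> (2 + 130 / \<epsilon>) * (2 * (\<Sum>j\<le>n. \<Theta> j))"
   using eps \<Theta>_nonneg[of n] by (intro mult_left_mono) (auto simp: lessThan_Suc_atMost[symmetric])
  also have "\<dots> = (2 * (2 + 130 / \<epsilon>)) * (\<Sum>j\<le>n. \<Theta> j)" by (simp only: mult_ac)
  also have "2 * (2 + 130 / \<epsilon>) = 4 + 260 / \<epsilon>" by simp
  finally show ?thesis by (rule add_left_mono)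
 qed
 ultimately show ?thesis by (rule state_mono)
qed

lemma spanning_graph:
 obtains R where "finite R" "sym R" "R \<subseteq> X n \<times> X n" "conn (X n) R"
  "wt R \<le> 16 * r 0 + 4 * (4 + 260 / \<epsilon>) * (\<Sum>j\<le>n. \<Theta> j)"
proof -
 let ?B = "4 * r 0 + (4 + 260 / \<epsilon>) * (\<Sum>j\<le>n. \<Theta> j)"
 obtain L P where LP: "live (fl n) (16 * r n) L" "finite P" "P \<subseteq> X n \<times> X n" "sym P" "conn (X n) (L \<union> P)"
  "pot (fl n) (\<lambda>_. 2 * r n) L + wt P / 4 \<le> ?B" and F: "fl n \<subseteq> X n"
  using tower_state[of n] by (auto simp: state_def)
 have L: "finite L" "sym L" "L \<subseteq> fl n \<times> fl n" using LP(1) by (auto simp: live_def)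
 have "0 \<le> (\<Sum>x\<in>fl n. (2 - real (card (L `` {x}))) * (2 * r n))"
  using LP(1) r_pos[of n] by (intro sum_nonneg mult_nonneg_nonneg) (auto simp: live_def)
 then have "wt L / 2 + wt P / 4 \<le> ?B" using LP(6) by (simp add: pot_def)
 moreover have "wt (L \<union> P) \<le> 4 * B" if "wt L / 2 + wt P / 4 \<le> B" for B
  using that wt_Un_le[OF L(1) LP(2)] wt_nonneg[of L] wt_nonneg[of P] by linarith
 ultimately have "wt (L \<union> P) \<le> 4 * ?B" by blast
 moreover have "sym (L \<union> P)" using L LP by (auto simp: sym_def)
 moreover have "L \<union> P \<subseteq> X n \<times> X n" using L(3) F LP(3) by blast
 ultimately show ?thesis using that[of "L \<union> P"] L LP by (simp add: algebra_simps)
qed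

end

section \<open>From graphs to curves\<close>

context normed_on
begin

section \<open>Closed walks through the vertices of a graph\<close>

fun wlen :: "'a list \<Rightarrow> real" where
 "wlen [] = 0"
| "wlen [x] = 0"
| "wlen (x # y # zs) = N (x - y) + wlen (y # zs)"

lemma wlen_append: "wlen (as @ u # bs) = wlen (as @ [u]) + wlen (u # bs)"
proof (induction as)
 case (Cons a as)
 then show ?case by (cases as) auto
qed simp

lemma wlen_nonneg [simp]: "0 \<le> wlen ws"
 by (induction ws rule: wlen.induct) auto

lemma rtrancl_exit_edge:
 "(x, y) \<in> R\<^sup>* \<Longrightarrow> x \<in> S \<Longrightarrow> y \<notin> S \<Longrightarrow> \<exists>u v. (u, v) \<in> R \<and> u \<in> S \<and> v \<notin> S"
 by (induction rule: rtrancl_induct) auto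

text \<open>A walk that misses a vertex can be left along some edge (u, v). The detour u, v, u
  traverses this edge in both orientations, which is exactly what \<open>wt\<close> counts.\<close>

lemma tour_extend:
 assumes R: "finite R" "sym R" "R \<subseteq> W \<times> W" "conn W R" and W: "finite W"
  and ws: "ws \<noteq> []" "set ws \<subseteq> W" "wlen ws \<le> wt (R \<inter> (set ws \<times> set ws))"
 shows "\<exists>ws'. ws' \<noteq> [] \<and> set ws' = W \<and> wlen ws' \<le> wt R"
 using ws
proof (induction "card (W - set ws)" arbitrary: ws rule: less_induct)
 case less
 show ?case
 proof (cases "set ws = W")
  case True
  have "wt (R \<inter> (set ws \<times> set ws)) \<le> wt R" unfolding wt_def using R by (intro sum_mono2) auto
  then show ?thesis using less.prems True by (intro exI[of _ ws]) auto
 next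
  case False
  then obtain y where y: "y \<in> W" "y \<notin> set ws" using less.prems by auto
  have "(hd ws, y) \<in> R\<^sup>*" using R(4) y(1) less.prems(1,2) hd_in_set[of ws] unfolding conn_def by blast
  from rtrancl_exit_edge[OF this _ y(2)] less.prems(1)
  obtain u v where uv: "(u, v) \<in> R" "u \<in> set ws" "v \<notin> set ws" by auto
  then have vW: "v \<in> W" using R by auto
  obtain as bs where ab: "ws = as @ u # bs" using uv(2) by (meson split_list)
  let ?ws = "as @ u # v # u # bs"
  have set': "set ?ws = insert v (set ws)" using ab by auto
  have len: "wlen ?ws = wlen ws + 2 * N (u - v)"
   unfolding ab using wlen_append[of as u "v # u # bs"] wlen_append[of as u bs]
   by (simp add: N_commute[of v u])
  have ne: "(u, v) \<noteq> (v, u)" using uv by auto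
  have "wt (R \<inter> (set ws \<times> set ws)) + 2 * N (u - v)
    = wt (R \<inter> (set ws \<times> set ws)) + wt {(u, v), (v, u)}"
   using ne by (simp add: wt_def N_commute[of v u])
  also have "\<dots> = wt (R \<inter> (set ws \<times> set ws) \<union> {(u, v), (v, u)})"
   unfolding wt_def using R uv by (intro sum.union_disjoint[symmetric]) auto
  also have "\<dots> \<le> wt (R \<inter> (set ?ws \<times> set ?ws))"
   unfolding wt_def set' using R uv by (intro sum_mono2) (auto simp: sym_def)
  finally have w: "wlen ?ws \<le> wt (R \<inter> (set ?ws \<times> set ?ws))" using len less.prems by linarith
  have "card (W - set ?ws) < card (W - set ws)"
   unfolding set' using W uv vW by (intro psubset_card_mono) auto
  then show ?thesis
  proof (rule less.hyps)
   show "set ?ws \<subseteq> W" unfolding set' using vW less.prems by auto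
  qed (use w in blast)+
 qed
qed

lemma tour:
 assumes "finite R" "sym R" "R \<subseteq> W \<times> W" "conn W R" "finite W" "W \<noteq> {}"
 obtains ws where "ws \<noteq> []" "set ws = W" "wlen ws \<le> wt R"
proof -
 obtain x where "x \<in> W" using assms by auto
 then show ?thesis using tour_extend[OF assms(1-5), of "[x]"] that by auto
qed

text \<open>Curves are 1-Lipschitz maps on the whole line, so gluing and passing to limits need no
  conditions on the domain; length is the length of the parameter interval that is used.\<close>

definition lip :: "(real \<Rightarrow> 'a) \<Rightarrow> bool"
 where "lip g \<longleftrightarrow> range g \<subseteq> V \<and> (\<forall>s t. N (g s - g t) \<le> \<bar>s - t\<bar>)"

definition segs :: "'a set \<Rightarrow> 'a set"
 where "segs S = {a + l *\<^sub>R (b - a) |a b l. a \<in> S \<and> b \<in> S \<and> 0 \<le> l \<and> l \<le> 1}"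

lemma segsI: "a \<in> S \<Longrightarrow> b \<in> S \<Longrightarrow> 0 \<le> l \<Longrightarrow> l \<le> 1 \<Longrightarrow> a + l *\<^sub>R (b - a) \<in> segs S"
 unfolding segs_def by blast

lemma segs_mono: "S \<subseteq> T \<Longrightarrow> segs S \<subseteq> segs T"
 unfolding segs_def by blast

lemma segs_V: "S \<subseteq> V \<Longrightarrow> segs S \<subseteq> V"
 unfolding segs_def by (auto simp: subset_eq)

lemma lip_glue:
 assumes f: "\<And>s t. s \<le> c \<Longrightarrow> t \<le> c \<Longrightarrow> N (f s - f t) \<le> \<bar>s - t\<bar>" "\<And>t. f t \<in> V"
  and g: "lip g" and eq: "f c = g 0"
 shows "lip (\<lambda>t. if t \<le> c then f t else g (t - c))" (is "lip ?h")
proof -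
 have gV: "g t \<in> V" for t using g by (auto simp: lip_def)
 have *: "N (?h s - ?h t) \<le> \<bar>s - t\<bar>" if "s \<le> t" for s t
 proof -
  consider "t \<le> c" | "c < s" | "s \<le> c" "c < t" using \<open>s \<le> t\<close> by linarith
  then show ?thesis
  proof cases
   case 1
   then have "s \<le> c" using \<open>s \<le> t\<close> by simp
   then show ?thesis using f(1)[of s t] 1 by simp
  next
   case 2
   then have "?h s = g (s - c)" "?h t = g (t - c)" using \<open>s \<le> t\<close> by auto
   moreover have "N (g (s - c) - g (t - c)) \<le> \<bar>(s - c) - (t - c)\<bar>" using g unfolding lip_def by blast
   ultimately show ?thesis by simp
  next
   case 3
   have "N (f s - g (t - c)) \<le> N (f s - f c) + N (g 0 - g (t - c))"
    using N_diff_triangle[of "f s" "f c" "g (t - c)"] f gV eq by simp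
   also have "\<dots> \<le> \<bar>s - c\<bar> + \<bar>0 - (t - c)\<bar>"
   proof (rule add_mono)
    show "N (f s - f c) \<le> \<bar>s - c\<bar>" using f(1)[of s c] 3 by simp
    show "N (g 0 - g (t - c)) \<le> \<bar>0 - (t - c)\<bar>" using g unfolding lip_def by blast
   qed
   finally show ?thesis using 3 by auto
  qed
 qed
 have "N (?h s - ?h t) \<le> \<bar>s - t\<bar>" for s t
  using *[of s t] *[of t s] by (cases "s \<le> t") (auto simp: N_commute abs_minus_commute)
 then show ?thesis using f gV by (auto simp: lip_def)
qed

text \<open>Edges are traversed at unit speed, and an edge of length 0 is skipped because the
  parametrization divides by its length. The condition for t \<le> 0 fixes the starting point, so
  that a further edge can be glued in front.\<close>

lemma polygon:
 assumes "ws \<noteq> []" "set ws \<subseteq> V"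
 shows "\<exists>g. lip g \<and> range g \<subseteq> segs (set ws) \<and> set ws \<subseteq> g ` {0..wlen ws} \<and> (\<forall>t\<le>0. g t = hd ws)"
 using assms
proof (induction ws rule: wlen.induct)
 case (2 x)
 have "x \<in> segs {x}" using segsI[of x "{x}" x 0] by simp
 then show ?case using 2 by (intro exI[of _ "\<lambda>_. x"]) (auto simp: lip_def)
next
 case (3 x y zs)
 then obtain g where g: "lip g" "range g \<subseteq> segs (set (y # zs))" "set (y # zs) \<subseteq> g ` {0..wlen (y # zs)}"
  "\<And>t. t \<le> 0 \<Longrightarrow> g t = y" by auto
 have xy: "x \<in> V" "y \<in> V" using 3 by auto
 define c where "c = N (x - y)"
 show ?case
 proof (cases "c = 0")
  case True
  then have "x = y" using N_eq_0[of "x - y"] xy by (simp add: c_def)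
  then show ?thesis using g by (intro exI[of _ g]) auto
 next
  case False
  then have c: "c > 0" using N_nonneg[of "x - y"] by (simp add: c_def less_le)
  define f where "f t = x + (min c (max 0 t) / c) *\<^sub>R (y - x)" for t
  let ?h = "\<lambda>t. if t \<le> c then f t else g (t - c)"
  have fV: "f t \<in> V" for t using xy by (auto simp: f_def)
  have lf: "N (f s - f t) \<le> \<bar>s - t\<bar>" for s t
  proof -
   have "f s - f t = ((min c (max 0 s) - min c (max 0 t)) / c) *\<^sub>R (y - x)"
    by (simp add: f_def algebra_simps diff_divide_distrib)
   then have "N (f s - f t) = \<bar>min c (max 0 s) - min c (max 0 t)\<bar> / c * c"
    using xy c by (simp add: N_scale c_def N_commute[of y x])
   also have "\<dots> \<le> \<bar>s - t\<bar>" using c by auto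
   finally show ?thesis .
  qed
  have fc: "f c = g 0" using c g by (simp add: f_def)
  have L: "lip ?h" by (rule lip_glue) (use lf fV g fc in auto)
  have "f t \<in> segs (set (x # y # zs))" for t
   unfolding f_def using c by (intro segsI) (auto simp: field_simps)
  moreover have "g t \<in> segs (set (x # y # zs))" for t
  proof -
   have "segs (set (y # zs)) \<subseteq> segs (set (x # y # zs))" by (rule segs_mono) auto
   then show ?thesis using g(2) by blast
  qed
  ultimately have R: "range ?h \<subseteq> segs (set (x # y # zs))" by (auto simp del: list.set)
  have h0: "?h t = x" if "t \<le> 0" for t using that c by (simp add: f_def)
  have "w \<in> ?h ` {0..wlen (x # y # zs)}" if w: "w \<in> set (x # y # zs)" for w
  proof (cases "w = x")
   case True
   have "?h 0 = x" using h0 by simp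
   then show ?thesis using True c by (intro image_eqI[of _ _ 0]) (auto simp: c_def[symmetric])
  next
   case False
   then obtain t where t: "0 \<le> t" "t \<le> wlen (y # zs)" "w = g t" using w g(3) by force
   have "?h (t + c) = w" using t fc by (cases "t = 0") auto
   then show ?thesis using t c by (intro image_eqI[of _ _ "t + c"]) (auto simp: c_def[symmetric])
  qed
  then show ?thesis using L R h0 by (intro exI[of _ ?h]) auto
 qed
qed auto

text \<open>In infinite dimension bounded polygons need not have a convergent subsequence, so they
  need a common totally bounded range. The union of all segments between points of E is one: pass to
  a subsequence along which both ends and the parameter are Cauchy.\<close>

lemma segs_totally_bounded:
 assumes tb: "mtotally_bounded S"
 shows "mtotally_bounded (segs S)"
proof -
 have SV: "S \<subseteq> V" using tb by (simp add: mtotally_bounded_sequentially)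
 obtain B where B: "\<And>x y. x \<in> S \<Longrightarrow> y \<in> S \<Longrightarrow> N (x - y) \<le> B"
  using mtotally_bounded_imp_mbounded[OF tb] by (auto simp: mbounded_alt)
 have "\<exists>r. strict_mono r \<and> MCauchy (\<sigma> \<circ> r)" if \<sigma>: "range \<sigma> \<subseteq> segs S" for \<sigma> :: "nat \<Rightarrow> 'a"
 proof -
  have "\<forall>n. \<exists>a b l. a \<in> S \<and> b \<in> S \<and> 0 \<le> l \<and> l \<le> 1 \<and> \<sigma> n = a + l *\<^sub>R (b - a)"
   using \<sigma> by (fastforce simp: segs_def)
  then obtain a b and l :: "nat \<Rightarrow> real" where ab: "\<And>n. a n \<in> S" "\<And>n. b n \<in> S" "\<And>n. 0 \<le> l n" "\<And>n. l n \<le> 1"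
   "\<And>n. \<sigma> n = a n + l n *\<^sub>R (b n - a n)" by metis
  have seq: "\<exists>r. strict_mono r \<and> MCauchy (f \<circ> r)" if "range f \<subseteq> S" for f :: "nat \<Rightarrow> 'a"
   using tb that by (auto simp: mtotally_bounded_sequentially)
  obtain r1 where r1: "strict_mono r1" "MCauchy (a \<circ> r1)" using seq[of a] ab by auto
  obtain r2 where r2: "strict_mono r2" "MCauchy (b \<circ> r1 \<circ> r2)" using seq[of "b \<circ> r1"] ab by auto
  have "seq_compact {0..1::real}" by (simp add: compact_imp_seq_compact)
  moreover have "\<forall>n. (l \<circ> r1 \<circ> r2) n \<in> {0..1}" using ab(3,4) by simp
  ultimately obtain r3 l0 where r3: "strict_mono r3" "((l \<circ> r1 \<circ> r2) \<circ> r3) \<longlonglongrightarrow> l0" by (rule seq_compactE)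
  define r where "r = r1 \<circ> r2 \<circ> r3"
  have r: "strict_mono r" using r1 r2 r3 by (auto simp: r_def strict_mono_def)
  have Ca: "MCauchy (a \<circ> r)" using MCauchy_subsequence[OF _ r1(2), of "r2 \<circ> r3"] r2 r3
   by (simp add: r_def comp_assoc strict_mono_o)
  have Cb: "MCauchy (b \<circ> r)" using MCauchy_subsequence[OF r3(1) r2(2)] by (simp add: r_def comp_assoc)
  have Cl: "Cauchy (l \<circ> r)" using r3(2) by (simp add: r_def comp_assoc LIMSEQ_imp_Cauchy)
  have "MCauchy (\<sigma> \<circ> r)" unfolding MCauchy_def
  proof (intro conjI allI impI)
   have "a n \<in> V" "b n \<in> V" for n using ab(1,2)[of n] SV by auto
   then show "range (\<sigma> \<circ> r) \<subseteq> V" by (auto simp: ab(5))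
   fix e :: real assume e: "e > 0"
   have B0: "B \<ge> 0" using B[OF ab(1)[of 0] ab(1)[of 0]] by simp
   obtain n1 where n1: "\<And>n m. n \<ge> n1 \<Longrightarrow> m \<ge> n1 \<Longrightarrow> N (a (r n) - a (r m)) < e / 3"
    using Ca e unfolding MCauchy_def by (metis comp_apply zero_less_divide_iff zero_less_numeral)
   obtain n2 where n2: "\<And>n m. n \<ge> n2 \<Longrightarrow> m \<ge> n2 \<Longrightarrow> N (b (r n) - b (r m)) < e / 3"
    using Cb e unfolding MCauchy_def by (metis comp_apply zero_less_divide_iff zero_less_numeral)
   have "e / (3 * (B + 1)) > 0" using e B0 by simp
   then obtain n3 where n3: "\<And>n m. n \<ge> n3 \<Longrightarrow> m \<ge> n3 \<Longrightarrow> \<bar>l (r n) - l (r m)\<bar> < e / (3 * (B + 1))"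
    using Cl unfolding Cauchy_def dist_real_def by (metis comp_apply)
   show "\<exists>M. \<forall>n n'. M \<le> n \<longrightarrow> M \<le> n' \<longrightarrow> N ((\<sigma> \<circ> r) n - (\<sigma> \<circ> r) n') < e"
   proof (intro exI[of _ "max n1 (max n2 n3)"] allI impI)
    fix n m assume nm: "max n1 (max n2 n3) \<le> n" "max n1 (max n2 n3) \<le> m"
    let ?a = "a (r n)" and ?a' = "a (r m)" and ?b = "b (r n)" and ?b' = "b (r m)"
     and ?l = "l (r n)" and ?l' = "l (r m)"
    have inV: "?a \<in> V" "?a' \<in> V" "?b \<in> V" "?b' \<in> V" using ab SV by auto
    have "(\<sigma> \<circ> r) n - (\<sigma> \<circ> r) m = ((1 - ?l) *\<^sub>R (?a - ?a') + ?l *\<^sub>R (?b - ?b')) + (?l - ?l') *\<^sub>R (?b' - ?a')"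
     by (simp add: ab(5) algebra_simps)
    also have "N \<dots> \<le> (N ((1 - ?l) *\<^sub>R (?a - ?a')) + N (?l *\<^sub>R (?b - ?b'))) + N ((?l - ?l') *\<^sub>R (?b' - ?a'))"
     using inV by (intro order_trans[OF N_triangle] add_mono N_triangle order_refl) auto
    also have "\<dots> = (1 - ?l) * N (?a - ?a') + ?l * N (?b - ?b') + \<bar>?l - ?l'\<bar> * N (?b' - ?a')"
     using inV ab(3,4)[of "r n"] by (simp add: N_scale)
    also have "\<dots> \<le> 1 * N (?a - ?a') + 1 * N (?b - ?b') + e / (3 * (B + 1)) * (B + 1)"
    proof (intro add_mono mult_right_mono mult_mono)
     show "\<bar>?l - ?l'\<bar> \<le> e / (3 * (B + 1))" using n3[of n m] nm by simp
     show "N (?b' - ?a') \<le> B + 1" using B[OF ab(2) ab(1), of "r m" "r m"] by simp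
    qed (use ab(3,4)[of "r n"] e B0 in auto)
    also have "e / (3 * (B + 1)) * (B + 1) = e / 3" using B0 by (simp add: field_simps)
    finally show "N ((\<sigma> \<circ> r) n - (\<sigma> \<circ> r) m) < e" using n1[of n m] n2[of n m] nm by simp
   qed
  qed
  then show ?thesis using r by blast
 qed
 then show ?thesis using segs_V[OF SV] by (simp add: mtotally_bounded_sequentially)
qed

text \<open>A diagonal subsequence is Cauchy at all rationals, hence everywhere by the common
  Lipschitz bound, and completeness provides the limit. A point x of E is approached at times in
  [0, L]; at a limit point of these times the limit curve passes exactly through x.\<close>

lemma arzela_ascoli:
 assumes mc: "mcomplete" and tb: "mtotally_bounded K"
  and g: "\<And>n. lip (g n)" "\<And>n. range (g n) \<subseteq> K"
  and visit: "\<And>x. x \<in> E \<Longrightarrow> \<exists>t. (\<forall>n. t n \<in> {0..L}) \<and> (\<lambda>n. N (g n (t n) - x)) \<longlonglongrightarrow> 0"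
  and EV: "E \<subseteq> V"
 obtains h where "lip h" "E \<subseteq> h ` {0..L}"
proof -
 define q :: "nat \<Rightarrow> real" where "q = from_nat_into \<rat>"
 have q: "range q = \<rat>" unfolding q_def by (rule range_from_nat_into[OF _ countable_rat]) (use Rats_0 in auto)
 have gV: "g n t \<in> V" for n t using g(1)[of n] by (auto simp: lip_def)
 have gl: "N (g n s - g n t) \<le> \<bar>s - t\<bar>" for n s t using g(1)[of n] by (auto simp: lip_def)
 interpret subseqs "\<lambda>k s. MCauchy (\<lambda>i. g (s i) (q k))"
 proof
  fix k and s :: "nat \<Rightarrow> nat"
  let ?s = "\<lambda>i. g (s i) (q k)"
  have "range ?s \<subseteq> K" using g(2) by (auto simp: image_subset_iff)
  then obtain r' where "strict_mono r'" "MCauchy (?s \<circ> r')"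
   using tb unfolding mtotally_bounded_sequentially by metis
  then show "\<exists>r'. strict_mono r' \<and> MCauchy (\<lambda>i. g ((s \<circ> r') i) (q k))" by (auto simp: comp_def)
 qed
 have Dq: "MCauchy (\<lambda>i. g ((diagseq \<circ> (+) (Suc k)) i) (q k))" for k
 proof (rule diagseq_holds)
  fix r s :: "nat \<Rightarrow> nat" and n
  assume "strict_mono r" "MCauchy (\<lambda>i. g (s i) (q n))"
  from MCauchy_subsequence[OF this] show "MCauchy (\<lambda>i. g ((s \<circ> r) i) (q n))" by (simp add: comp_def)
 qed
 define D where "D = diagseq"
 have Dm: "strict_mono D" unfolding D_def by (rule subseq_diagseq)
 have Cau: "\<exists>M. \<forall>i\<ge>M. \<forall>j\<ge>M. N (g (D i) t - g (D j) t) < e" if "e > 0" for t e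
 proof -
  have "t < t + e / 4" using that by simp
  from Rats_dense_in_real[OF this] obtain p where p: "p \<in> \<rat>" "t < p" "p < t + e / 4" by blast
  have "p \<in> range q" using p(1) q by simp
  then obtain k where k: "p = q k" by (rule rangeE)
  have "e / 4 > 0" using that by simp
  then obtain M where M: "\<forall>i j. M \<le> i \<longrightarrow> M \<le> j \<longrightarrow> N (g (D (Suc k + i)) p - g (D (Suc k + j)) p) < e / 4"
   using Dq[of k] unfolding MCauchy_def D_def k comp_def by blast
  show ?thesis
  proof (intro exI[of _ "M + Suc k"] allI impI)
   fix i j assume ij: "i \<ge> M + Suc k" "j \<ge> M + Suc k"
   have "N (g (D i) p - g (D j) p) < e / 4" using M[rule_format, of "i - Suc k" "j - Suc k"] ij by simp
   moreover have "N (g (D i) t - g (D j) t) \<le> N (g (D i) t - g (D i) p) + N (g (D i) p - g (D j) t)"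
     "N (g (D i) p - g (D j) t) \<le> N (g (D i) p - g (D j) p) + N (g (D j) p - g (D j) t)"
    by (rule N_diff_triangle; simp add: gV)+
   moreover have "N (g (D i) t - g (D i) p) \<le> e / 4" "N (g (D j) p - g (D j) t) \<le> e / 4"
    using gl[of "D i" t p] gl[of "D j" p t] p by auto
   ultimately show "N (g (D i) t - g (D j) t) < e" using that by linarith
  qed
 qed
 have "\<exists>x\<in>V. (\<lambda>i. N (g (D i) t - x)) \<longlonglongrightarrow> 0" for t
 proof -
  have "MCauchy (\<lambda>i. g (D i) t)" unfolding MCauchy_def using Cau gV by (auto simp: image_subset_iff)
  then obtain x where "limitin mtopology (\<lambda>i. g (D i) t) x sequentially"
   using mc unfolding mcomplete_def by blast
  then show ?thesis by (auto simp: limitin_metric_dist_null)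
 qed
 then obtain h where h: "\<And>t. h t \<in> V" "\<And>t. (\<lambda>i. N (g (D i) t - h t)) \<longlonglongrightarrow> 0" by metis
 have hl: "N (h s - h t) \<le> \<bar>s - t\<bar>" for s t
 proof (rule LIMSEQ_le_const)
  show "(\<lambda>i. N (g (D i) s - h s) + \<bar>s - t\<bar> + N (g (D i) t - h t)) \<longlonglongrightarrow> \<bar>s - t\<bar>"
   using tendsto_add[OF tendsto_add[OF h(2)[of s] tendsto_const] h(2)[of t], of "\<bar>s - t\<bar>"] by simp
  have "N (h s - h t) \<le> N (g (D i) s - h s) + \<bar>s - t\<bar> + N (g (D i) t - h t)" for i
  proof -
   have "N (h s - h t) \<le> N (h s - g (D i) s) + N (g (D i) s - h t)"
    by (rule N_diff_triangle) (use gV h in auto)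
   moreover have "N (g (D i) s - h t) \<le> N (g (D i) s - g (D i) t) + N (g (D i) t - h t)"
    by (rule N_diff_triangle) (use gV h in auto)
   ultimately show ?thesis using gl[of "D i" s t] N_commute[of "h s" "g (D i) s"] by linarith
  qed
  then show "\<exists>M. \<forall>i\<ge>M. N (h s - h t) \<le> N (g (D i) s - h s) + \<bar>s - t\<bar> + N (g (D i) t - h t)" by blast
 qed
 have "lip h" using h hl by (auto simp: lip_def)
 moreover have "E \<subseteq> h ` {0..L}"
 proof
  fix x assume xE: "x \<in> E"
  then obtain t where t: "\<And>n. t n \<in> {0..L}" "(\<lambda>n. N (g n (t n) - x)) \<longlonglongrightarrow> 0" using visit by blast
  have "seq_compact {0..L}" by (simp add: compact_imp_seq_compact)
  moreover have "\<forall>n. (t \<circ> D) n \<in> {0..L}" using t(1) by simp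
  ultimately obtain t0 r where r0: "t0 \<in> {0..L}" "strict_mono r" "((t \<circ> D) \<circ> r) \<longlonglongrightarrow> t0" by (rule seq_compactE)
  note r = r0(2,1,3)
  have xV: "x \<in> V" using xE EV by auto
  have "N (h t0 - x) \<le> 0"
  proof (rule LIMSEQ_le_const)
   let ?f = "\<lambda>i. N (g (D (r i)) t0 - h t0) + \<bar>t (D (r i)) - t0\<bar> + N (g (D (r i)) (t (D (r i))) - x)"
   have l1: "(\<lambda>i. N (g (D (r i)) t0 - h t0)) \<longlonglongrightarrow> 0"
    using LIMSEQ_subseq_LIMSEQ[OF h(2)[of t0] r(1)] by (simp add: comp_def)
   have l2: "(\<lambda>i. \<bar>t (D (r i)) - t0\<bar>) \<longlonglongrightarrow> 0"
    using tendsto_rabs_zero[OF LIM_zero[OF r(3)]] by (simp add: comp_def)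
   have l3: "(\<lambda>i. N (g (D (r i)) (t (D (r i))) - x)) \<longlonglongrightarrow> 0"
    using LIMSEQ_subseq_LIMSEQ[OF t(2), of "D \<circ> r"] Dm r(1) by (simp add: comp_def strict_mono_def)
   show "?f \<longlonglongrightarrow> 0" using tendsto_add[OF tendsto_add[OF l1 l2] l3] by simp
   have "N (h t0 - x) \<le> ?f i" for i
   proof -
    let ?n = "D (r i)"
    have "N (h t0 - x) \<le> N (h t0 - g ?n t0) + N (g ?n t0 - x)"
     by (rule N_diff_triangle) (use gV h xV in auto)
    moreover have "N (g ?n t0 - x) \<le> N (g ?n t0 - g ?n (t ?n)) + N (g ?n (t ?n) - x)"
     by (rule N_diff_triangle) (use gV xV in auto)
    ultimately show ?thesis using gl[of ?n t0 "t ?n"]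
     by (simp add: N_commute[of "h t0"] abs_minus_commute[of t0])
   qed
   then show "\<exists>M. \<forall>i\<ge>M. N (h t0 - x) \<le> ?f i" by auto
  qed
  then have "h t0 = x" using N_eq_0[of "h t0 - x"] h xV by (auto simp: order_antisym)
  then show "x \<in> h ` {0..L}" using r by auto
 qed
 ultimately show ?thesis by (rule that)
qed

lemma curve_through_nets:
 assumes mc: "mcomplete" and EV: "E \<subseteq> V" and tb: "mtotally_bounded E"
  and X: "\<And>n. finite (X n)" "\<And>n. X n \<subseteq> E" "\<And>n. X n \<noteq> {}"
  and near: "\<And>n x. x \<in> E \<Longrightarrow> \<exists>y\<in>X n. N (y - x) < \<delta> n" and \<delta>: "\<delta> \<longlonglongrightarrow> 0"
  and R: "\<And>n. \<exists>R. finite R \<and> sym R \<and> R \<subseteq> X n \<times> X n \<and> conn (X n) R \<and> wt R \<le> L"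
 obtains h where "lip h" "E \<subseteq> h ` {0..L}"
proof -
 have "\<exists>g. lip g \<and> range g \<subseteq> segs E \<and> X n \<subseteq> g ` {0..L}" for n
 proof -
  obtain R where R': "finite R" "sym R" "R \<subseteq> X n \<times> X n" "conn (X n) R" "wt R \<le> L" using R[of n] by auto
  obtain ws where ws: "ws \<noteq> []" "set ws = X n" "wlen ws \<le> wt R" by (rule tour[OF R'(1-4) X(1,3)])
  have "set ws \<subseteq> V" using ws X(2)[of n] EV by auto
  from polygon[OF ws(1) this]
  obtain g where g: "lip g" "range g \<subseteq> segs (set ws)" "set ws \<subseteq> g ` {0..wlen ws}" by auto
  have "segs (set ws) \<subseteq> segs E" using ws X by (intro segs_mono) auto
  moreover have "g ` {0..wlen ws} \<subseteq> g ` {0..L}" using ws R' by (intro image_mono) auto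
  ultimately show ?thesis using g ws by (intro exI[of _ g]) auto
 qed
 then obtain g where g: "\<And>n. lip (g n)" "\<And>n. range (g n) \<subseteq> segs E" "\<And>n. X n \<subseteq> g n ` {0..L}" by metis
 show ?thesis
 proof (rule arzela_ascoli[OF mc segs_totally_bounded[OF tb] g(1,2) _ EV])
  fix x assume x: "x \<in> E"
  have "\<exists>t. t \<in> {0..L} \<and> N (g n t - x) < \<delta> n" for n
   using near[OF x, of n] g(3)[of n] by (metis (no_types, lifting) imageE subsetD)
  then obtain t where t: "\<And>n. t n \<in> {0..L}" "\<And>n. N (g n (t n) - x) < \<delta> n" by metis
  have "(\<lambda>n. N (g n (t n) - x)) \<longlonglongrightarrow> 0"
   by (rule tendsto_sandwich[OF _ _ tendsto_const \<delta>]) (use t in \<open>auto intro!: always_eventually less_imp_le\<close>)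
  then show "\<exists>t. (\<forall>n. t n \<in> {0..L}) \<and> (\<lambda>n. N (g n (t n) - x)) \<longlonglongrightarrow> 0" using t by blast
 qed (rule that)
qed

end

section \<open>Scalar inequalities\<close>

text \<open>Convexity of t^p at u / a and v / b with the weights a / (a + b) and b / (a + b). Summed
  over the coordinates, with a and b slightly above the two norms, it becomes Minkowski's
  inequality.\<close>

lemma powr_add_weighted:
 fixes u v a b p :: real
 assumes "p \<ge> 1" "a > 0" "b > 0" "u \<ge> 0" "v \<ge> 0"
 shows "(u + v) powr p \<le> (a + b) powr (p - 1) * (a powr (1 - p) * u powr p + b powr (1 - p) * v powr p)"
proof -
 have one: "w powr p \<le> (a + b) powr (p - 1) * (c powr (1 - p) * w powr p)"
  if "0 < c" "c \<le> a + b" for w c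
 proof -
  have "1 = c powr (p - 1) * c powr (1 - p)" using that by (simp add: powr_add[symmetric])
  also have "\<dots> \<le> (a + b) powr (p - 1) * c powr (1 - p)"
   using that assms by (intro mult_right_mono powr_mono2) auto
  finally have "1 * w powr p \<le> (a + b) powr (p - 1) * c powr (1 - p) * w powr p"
   by (rule mult_right_mono) simp
  then show ?thesis by (simp add: mult.assoc)
 qed
 consider "u = 0" | "v = 0" | "u > 0" "v > 0" using assms by linarith
 then show ?thesis
 proof cases
  case 1
  then show ?thesis using one[of b v] assms by simp
 next
  case 2
  then show ?thesis using one[of a u] assms by simp
 next
  case 3
  define t where "t = b / (a + b)"
  have t: "0 \<le> t" "t \<le> 1" "1 - t = a / (a + b)" using assms by (auto simp: t_def field_simps)
  have eq: "(1 - t) *\<^sub>R (u / a) + t *\<^sub>R (v / b) = (u + v) / (a + b)"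
   unfolding t(3) unfolding t_def using assms by (simp add: add_divide_distrib)
  have "((u + v) / (a + b)) powr p \<le> (1 - t) * (u / a) powr p + t * (v / b) powr p"
   using convex_onD[OF powr_convex[OF assms(1)] t(1,2), of "u / a" "v / b"] 3 assms unfolding eq by simp
  then have "(a + b) powr p * ((u + v) / (a + b)) powr p
    \<le> (a + b) powr p * ((1 - t) * (u / a) powr p + t * (v / b) powr p)"
   by (rule mult_left_mono) simp
  also have "(a + b) powr p * ((u + v) / (a + b)) powr p = (u + v) powr p"
   using 3 assms by (simp add: powr_divide)
  also have "(1 - t) * (u / a) powr p = (a powr (1 - p) * u powr p) / (a + b)"
   unfolding t(3) using 3 assms by (simp add: powr_divide powr_diff)
  also have "t * (v / b) powr p = (b powr (1 - p) * v powr p) / (a + b)"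
   unfolding t_def using 3 assms by (simp add: powr_divide powr_diff)
  also have "(a + b) powr p * ((a powr (1 - p) * u powr p) / (a + b) + (b powr (1 - p) * v powr p) / (a + b))
    = (a + b) powr (p - 1) * (a powr (1 - p) * u powr p + b powr (1 - p) * v powr p)"
  proof -
   have "X * (A / s + B / s) = X / s * (A + B)" for X A B s :: real by (simp add: distrib_left add_divide_distrib)
   moreover have "(a + b) powr (p - 1) = (a + b) powr p / (a + b)" using assms by (simp add: powr_diff)
   ultimately show ?thesis by simp
  qed
  finally show ?thesis .
 qed
qed

lemma powr_add_le: "p \<ge> 1 \<Longrightarrow> u \<ge> 0 \<Longrightarrow> v \<ge> 0 \<Longrightarrow> (u + v) powr p \<le> 2 powr (p - 1) * (u powr p + v powr p)"
 for u v p :: real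
 using powr_add_weighted[of p 1 1 u v] by simp

lemma powr_half_le: "p \<ge> 1 \<Longrightarrow> u \<ge> 0 \<Longrightarrow> v \<ge> 0 \<Longrightarrow> ((u + v) / 2) powr p \<le> (u powr p + v powr p) / 2"
 for u v p :: real
 using powr_add_le[of p u v] by (simp add: powr_divide powr_diff field_simps)

lemma powr_superadd:
 fixes u v p :: real
 assumes "p \<ge> 1" "u \<ge> 0" "v \<ge> 0"
 shows "u powr p + v powr p \<le> (u + v) powr p"
proof -
 have *: "w powr p \<le> w * (u + v) powr (p - 1)" if "0 \<le> w" "w \<le> u + v" for w
 proof -
  have "w powr p = w * w powr (p - 1)" using that powr_mult_base[of w "p - 1"] by simp
  also have "\<dots> \<le> w * (u + v) powr (p - 1)" using that assms by (intro mult_left_mono powr_mono2) auto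
  finally show ?thesis .
 qed
 have "u powr p + v powr p \<le> u * (u + v) powr (p - 1) + v * (u + v) powr (p - 1)"
  using assms by (intro add_mono *) auto
 also have "\<dots> = (u + v) powr p" using powr_mult_base[of "u + v" "p - 1"] assms by (simp add: distrib_right)
 finally show ?thesis .
qed

lemma powr_subadd:
 fixes u v p :: real
 assumes "0 < p" "p \<le> 1" "u \<ge> 0" "v \<ge> 0"
 shows "(u + v) powr p \<le> u powr p + v powr p"
proof -
 have "(u powr p) powr (1/p) + (v powr p) powr (1/p) \<le> (u powr p + v powr p) powr (1/p)"
  using assms by (intro powr_superadd) auto
 then have "u + v \<le> (u powr p + v powr p) powr (1/p)" using assms by (simp add: powr_powr)
 then have "(u + v) powr p \<le> ((u powr p + v powr p) powr (1/p)) powr p"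
  using assms by (intro powr_mono2) auto
 then show ?thesis using assms by (simp add: powr_powr)
qed

lemma powr_half_ge:
 fixes u v p :: real
 assumes "0 < p" "p \<le> 1" "u \<ge> 0" "v \<ge> 0"
 shows "(u powr p + v powr p) / 2 \<le> ((u + v) / 2) powr p"
proof -
 have "((u powr p + v powr p) / 2) powr (1/p) \<le> ((u powr p) powr (1/p) + (v powr p) powr (1/p)) / 2"
  using assms by (intro powr_half_le) auto
 then have "((u powr p + v powr p) / 2) powr (1/p) \<le> (u + v) / 2" using assms by (simp add: powr_powr)
 then have "(((u powr p + v powr p) / 2) powr (1/p)) powr p \<le> ((u + v) / 2) powr p"
  using assms by (intro powr_mono2) auto
 then show ?thesis using assms by (simp add: powr_powr)
qed

text \<open>Bernoulli's inequality, obtained from Young's inequality for t^p and 1.\<close>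

lemma powr_tangent:
 fixes t p :: real
 assumes "p \<ge> 1" "t \<ge> 0"
 shows "1 + p * (t - 1) \<le> t powr p"
proof (cases "t = 0")
 case False
 then have "(t powr p) powr (1/p) * 1 powr (1 - 1/p) \<le> (1/p) * t powr p + (1 - 1/p) * 1"
  using assms by (intro Youngs_inequality_0) auto
 then have "t \<le> t powr p / p + (1 - 1/p)" using assms by (simp add: powr_powr)
 then have "p * t \<le> p * (t powr p / p + (1 - 1/p))" using assms by (intro mult_left_mono) auto
 also have "\<dots> = t powr p + p - 1" using assms by (simp add: distrib_left right_diff_distrib)
 finally show ?thesis by (simp add: algebra_simps)
qed (use assms in auto)

lemma sq_powr: "(x\<^sup>2) powr q = \<bar>x\<bar> powr (2 * q)" for x q :: real
proof -
 have "x\<^sup>2 = \<bar>x\<bar> powr 2" by (cases "x = 0") (auto simp: powr_numeral)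
 then have "(x\<^sup>2) powr q = (\<bar>x\<bar> powr 2) powr q" by (rule arg_cong)
 also have "\<dots> = \<bar>x\<bar> powr (2 * q)" by (rule powr_powr)
 finally show ?thesis .
qed

text \<open>The identity (a + b)^2 + (a - b)^2 = 2 (a^2 + b^2) reduces everything to the power p / 2
  \<ge> 1, which is superadditive and convex.\<close>

lemma clarkson_scalar:
 fixes a b p :: real
 assumes "p \<ge> 2"
 shows "\<bar>a + b\<bar> powr p + \<bar>a - b\<bar> powr p \<le> 2 powr (p - 1) * (\<bar>a\<bar> powr p + \<bar>b\<bar> powr p)"
proof -
 let ?P = "p / 2"
 have "\<bar>a + b\<bar> powr p + \<bar>a - b\<bar> powr p = ((a + b)\<^sup>2) powr ?P + ((a - b)\<^sup>2) powr ?P" by (simp add: sq_powr)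
 also have "\<dots> \<le> ((a + b)\<^sup>2 + (a - b)\<^sup>2) powr ?P" using assms by (intro powr_superadd) auto
 also have "(a + b)\<^sup>2 + (a - b)\<^sup>2 = 2 * (a\<^sup>2 + b\<^sup>2)" by (simp add: power2_eq_square algebra_simps)
 also have "(2 * (a\<^sup>2 + b\<^sup>2)) powr ?P = 2 powr ?P * (a\<^sup>2 + b\<^sup>2) powr ?P" by (rule powr_mult)
 also have "\<dots> \<le> 2 powr ?P * (2 powr (?P - 1) * ((a\<^sup>2) powr ?P + (b\<^sup>2) powr ?P))"
  using assms by (intro mult_left_mono powr_add_le) auto
 also have "\<dots> = (2 powr ?P * 2 powr (?P - 1)) * (\<bar>a\<bar> powr p + \<bar>b\<bar> powr p)" by (simp add: sq_powr)
 also have "(2::real) powr ?P * 2 powr (?P - 1) = 2 powr (p - 1)" by (simp add: powr_add[symmetric])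
 finally show ?thesis .
qed

text \<open>The same identity for squares with p / 2 \<le> 1, where the power is concave and
  subadditive.\<close>

lemma smooth_scalar_le2:
 fixes a b p :: real
 assumes "1 \<le> p" "p \<le> 2"
 shows "\<bar>a + b\<bar> powr p + \<bar>a - b\<bar> powr p \<le> 2 * \<bar>a\<bar> powr p + 2 * \<bar>b\<bar> powr p"
proof -
 let ?P = "p / 2"
 have "(\<bar>a + b\<bar> powr p + \<bar>a - b\<bar> powr p) / 2 = (((a + b)\<^sup>2) powr ?P + ((a - b)\<^sup>2) powr ?P) / 2"
  by (simp add: sq_powr)
 also have "\<dots> \<le> (((a + b)\<^sup>2 + (a - b)\<^sup>2) / 2) powr ?P" using assms by (intro powr_half_ge) auto
 also have "((a + b)\<^sup>2 + (a - b)\<^sup>2) / 2 = a\<^sup>2 + b\<^sup>2" by (simp add: power2_eq_square algebra_simps)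
 also have "\<dots> powr ?P \<le> (a\<^sup>2) powr ?P + (b\<^sup>2) powr ?P" using assms by (intro powr_subadd) auto
 finally show ?thesis by (simp add: sq_powr)
qed

lemma powr_minus_sq_convex:
 fixes p k m :: real
 assumes "k * 2 \<le> p * (p - 1) * m powr (p - 2)" "1 < p" "p \<le> 2" "m > 0"
 shows "convex_on {0<..m} (\<lambda>t. t powr p - k * t\<^sup>2)"
proof (rule f''_ge0_imp_convex)
 fix x assume x: "x \<in> {0<..m}"
 show "((\<lambda>t. t powr p - k * t\<^sup>2) has_real_derivative p * x powr (p - 1) - k * (2 * x)) (at x)"
  using x by (auto intro!: derivative_eq_intros)
 show "((\<lambda>x. p * x powr (p - 1) - k * (2 * x)) has_real_derivative p * ((p - 1) * x powr (p - 2)) - k * 2) (at x)"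
  using x by (auto intro!: derivative_eq_intros)
 have "m powr (p - 2) \<le> x powr (p - 2)" using x assms by (intro powr_mono2') auto
 then have "p * (p - 1) * m powr (p - 2) \<le> p * (p - 1) * x powr (p - 2)"
  using assms by (intro mult_left_mono) auto
 with assms(1) have "k * 2 \<le> p * (p - 1) * x powr (p - 2)" by linarith
 then show "0 \<le> p * ((p - 1) * x powr (p - 2)) - k * 2" by (simp add: mult.assoc)
qed auto

text \<open>For equal signs, the second derivative of t^p on (0, |a| + |b|] is smallest at the right
  end, so t^p minus a suitable quadratic is still convex there. For opposite signs |a - b| is at
  most twice the larger absolute value m, and the right side is at least (1/2 - 2^(-p)) m^p, where p
  > 1 makes the factor positive.\<close>

lemma convex_scalar_le2:
 fixes p :: real
 assumes "1 < p" "p \<le> 2"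
 obtains c where "c > 0" "\<And>a b :: real. c * ((a - b)\<^sup>2 * (\<bar>a\<bar> + \<bar>b\<bar>) powr (p - 2)) \<le>
   (\<bar>a\<bar> powr p + \<bar>b\<bar> powr p) / 2 - \<bar>(a + b) / 2\<bar> powr p"
proof
 define c1 where "c1 = p * (p - 1) / 8"
 define c2 where "c2 = (1/2 - 2 powr (- p)) / 2 powr p"
 define c where "c = min c1 c2"
 have "2 powr (- p) < 2 powr (- 1 :: real)" using assms by (intro powr_less_mono) auto
 then have c2h: "0 < 1/2 - 2 powr (- p)" by (simp add: powr_minus)
 then have "c2 > 0" by (simp add: c2_def)
 moreover have "c1 > 0" using assms by (simp add: c1_def)
 ultimately show c0: "c > 0" by (simp add: c_def)
 have pos: "c * ((a - b)\<^sup>2 * (\<bar>a\<bar> + \<bar>b\<bar>) powr (p - 2)) \<le> (\<bar>a\<bar> powr p + \<bar>b\<bar> powr p) / 2 - \<bar>(a + b) / 2\<bar> powr p"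
  if "a > 0" "b > 0" for a b
 proof -
  define k where "k = p * (p - 1) / 2 * (a + b) powr (p - 2)"
  have cv: "convex_on {0<..a + b} (\<lambda>t. t powr p - k * t\<^sup>2)"
   using that assms by (intro powr_minus_sq_convex) (auto simp: k_def)
  have eq: "(1 - 1/2) *\<^sub>R a + (1/2) *\<^sub>R b = (a + b) / 2" by (simp add: add_divide_distrib)
  have "((1 - 1/2) *\<^sub>R a + (1/2) *\<^sub>R b) powr p - k * ((1 - 1/2) *\<^sub>R a + (1/2) *\<^sub>R b)\<^sup>2
    \<le> (1 - 1/2) * (a powr p - k * a\<^sup>2) + 1/2 * (b powr p - k * b\<^sup>2)"
   using that by (intro convex_onD[OF cv]) auto
  then have h: "((a + b) / 2) powr p - k * ((a + b) / 2)\<^sup>2 \<le> (a powr p - k * a\<^sup>2) / 2 + (b powr p - k * b\<^sup>2) / 2"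
   unfolding eq by simp
  have "k * ((a - b)\<^sup>2 / 4) = k * a\<^sup>2 / 2 + k * b\<^sup>2 / 2 - k * ((a + b) / 2)\<^sup>2"
   by (simp add: power2_eq_square field_simps)
  then have "k * ((a - b)\<^sup>2 / 4) \<le> (a powr p + b powr p) / 2 - ((a + b) / 2) powr p"
   using h by (simp add: diff_divide_distrib add_divide_distrib)
  moreover have "c * ((a - b)\<^sup>2 * (a + b) powr (p - 2)) \<le> c1 * ((a - b)\<^sup>2 * (a + b) powr (p - 2))"
   by (intro mult_right_mono) (auto simp: c_def)
  moreover have "c1 * ((a - b)\<^sup>2 * (a + b) powr (p - 2)) = k * ((a - b)\<^sup>2 / 4)" by (simp add: c1_def k_def)
  ultimately have "c * ((a - b)\<^sup>2 * (a + b) powr (p - 2)) \<le> (a powr p + b powr p) / 2 - ((a + b) / 2) powr p"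
   by linarith
  then show ?thesis using that by simp
 qed
 have opp: "c * ((a + b)\<^sup>2 * (a + b) powr (p - 2)) \<le> (a powr p + b powr p) / 2 - \<bar>(a - b) / 2\<bar> powr p"
  if "a \<ge> 0" "b \<ge> 0" for a b
 proof -
  define m where "m = max a b"
  have "(a + b)\<^sup>2 * (a + b) powr (p - 2) = (a + b) powr p"
  proof (cases "a + b = 0")
   case False
   then have "(a + b)\<^sup>2 = (a + b) powr 2" using that by (simp add: powr_numeral)
   then show ?thesis by (simp add: powr_add[symmetric])
  qed simp
  also have "(a + b) powr p \<le> (2 * m) powr p" using that assms by (intro powr_mono2) (auto simp: m_def)
  also have "\<dots> = 2 powr p * m powr p" by (simp add: powr_mult)
  finally have le: "(a + b)\<^sup>2 * (a + b) powr (p - 2) \<le> 2 powr p * m powr p" .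
  have "c * ((a + b)\<^sup>2 * (a + b) powr (p - 2)) \<le> c2 * (2 powr p * m powr p)"
   by (rule mult_mono[OF _ le]) (use \<open>c2 > 0\<close> in \<open>auto simp: c_def\<close>)
  also have "\<dots> = m powr p / 2 - (m / 2) powr p"
   using that by (simp add: c2_def powr_divide powr_minus m_def algebra_simps divide_simps)
  also have "\<dots> \<le> (a powr p + b powr p) / 2 - \<bar>(a - b) / 2\<bar> powr p"
  proof (intro diff_mono)
   show "m powr p / 2 \<le> (a powr p + b powr p) / 2" by (auto simp: m_def max_def)
   show "\<bar>(a - b) / 2\<bar> powr p \<le> (m / 2) powr p" using that assms by (intro powr_mono2) (auto simp: m_def)
  qed
  finally show ?thesis .
 qed
 show "c * ((a - b)\<^sup>2 * (\<bar>a\<bar> + \<bar>b\<bar>) powr (p - 2)) \<le> (\<bar>a\<bar> powr p + \<bar>b\<bar> powr p) / 2 - \<bar>(a + b) / 2\<bar> powr p" for a b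
 proof -
  consider "a > 0" "b > 0" | "a < 0" "b < 0" | "a \<ge> 0" "b \<le> 0" | "a \<le> 0" "b \<ge> 0" by linarith
  then show ?thesis
  proof cases
   case 1
   then show ?thesis using pos[of a b] by simp
  next
   case 2
   then show ?thesis using pos[of "- a" "- b"] by (simp add: power2_commute[of a b])
  next
   case 3
   then show ?thesis using opp[of a "- b"] by simp
  next
   case 4
   have "\<bar>- a - b\<bar> = \<bar>a + b\<bar>" "\<bar>b + a\<bar> = \<bar>a + b\<bar>" by linarith+
   with 4 show ?thesis using opp[of "- a" b] by (simp add: power2_commute[of a b])
  qed
 qed
qed

text \<open>The two-point inequality behind smoothness of type 2. By homogeneity a = 1. For |b|
  \<ge> 1/2 the estimate (1 + |b|)^2 \<le> 1 + 5 b^2 is enough; for smaller b a bound on the second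
  derivative gives 1 + D b^2, which the tangent of t^(p/2) dominates. The summands 5 and 2 D / p of
  K belong to these two cases.\<close>

lemma smooth_scalar_ge2:
 fixes p :: real
 assumes "p \<ge> 2"
 obtains K where "K \<ge> 0" "\<And>a b :: real. (\<bar>a + b\<bar> powr p + \<bar>a - b\<bar> powr p) / 2 \<le> (a\<^sup>2 + K * b\<^sup>2) powr (p / 2)"
proof
 define D where "D = p * (p - 1) / 2 * (3/2) powr (p - 2)"
 define K where "K = 5 + 2 * D / p"
 have D0: "D \<ge> 0" using assms by (simp add: D_def)
 then have K5: "K \<ge> 5" using assms by (simp add: K_def)
 then show "K \<ge> 0" by simp
 have unit: "(\<bar>1 + b\<bar> powr p + \<bar>1 - b\<bar> powr p) / 2 \<le> (1 + K * b\<^sup>2) powr (p / 2)" for b :: real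
 proof (cases "\<bar>b\<bar> \<ge> 1/2")
  case True
  have "1 * 2 \<le> 2 * \<bar>b\<bar> * 2" using True by simp
  have "\<bar>b\<bar> * 1 \<le> \<bar>b\<bar> * (2 * \<bar>b\<bar>)" using True by (intro mult_left_mono) auto
  then have bb: "\<bar>b\<bar> \<le> 2 * b\<^sup>2" by (simp add: power2_eq_square)
  have "(1 + \<bar>b\<bar>)\<^sup>2 = 1 + 2 * \<bar>b\<bar> + b\<^sup>2" by (simp add: power2_eq_square algebra_simps)
  also have "\<dots> \<le> 1 + 5 * b\<^sup>2" using bb by simp
  also have "\<dots> \<le> 1 + K * b\<^sup>2" using K5 by (intro add_left_mono mult_right_mono) auto
  finally have sq: "(1 + \<bar>b\<bar>)\<^sup>2 \<le> 1 + K * b\<^sup>2" .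
  have "\<bar>1 + b\<bar> powr p \<le> (1 + \<bar>b\<bar>) powr p" "\<bar>1 - b\<bar> powr p \<le> (1 + \<bar>b\<bar>) powr p"
   using assms by (intro powr_mono2; force)+
  moreover have "(1 + \<bar>b\<bar>) powr p = ((1 + \<bar>b\<bar>)\<^sup>2) powr (p / 2)" by (simp add: sq_powr)
  moreover have "\<dots> \<le> (1 + K * b\<^sup>2) powr (p / 2)" using sq assms by (intro powr_mono2) auto
  moreover have "(x + y) / 2 \<le> v" if "x \<le> z" "y \<le> z" "z = w" "w \<le> v" for x y z v w :: real
   using that by simp
  ultimately show ?thesis by metis
 next
  case False
  define g where "g t = D * t\<^sup>2 - t powr p" for t
  have cv: "convex_on {0<..3/2} g" unfolding g_def
  proof (rule f''_ge0_imp_convex)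
   fix x :: real assume x: "x \<in> {0<..3/2}"
   show "((\<lambda>t. D * t\<^sup>2 - t powr p) has_real_derivative D * (2 * x) - p * x powr (p - 1)) (at x)"
    using x by (auto intro!: derivative_eq_intros)
   show "((\<lambda>x. D * (2 * x) - p * x powr (p - 1)) has_real_derivative D * 2 - p * ((p - 1) * x powr (p - 2))) (at x)"
    using x by (auto intro!: derivative_eq_intros)
   have "x powr (p - 2) \<le> (3/2) powr (p - 2)" using x assms by (intro powr_mono2) auto
   then have "p * (p - 1) * x powr (p - 2) \<le> p * (p - 1) * (3/2) powr (p - 2)"
    using assms by (intro mult_left_mono) auto
   then show "0 \<le> D * 2 - p * ((p - 1) * x powr (p - 2))" by (simp add: D_def mult.assoc)
  qed auto
  have eq: "(1 - 1/2) *\<^sub>R (1 + b) + (1/2) *\<^sub>R (1 - b) = 1" by (simp add: field_simps)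
  have "g ((1 - 1/2) *\<^sub>R (1 + b) + (1/2) *\<^sub>R (1 - b)) \<le> (1 - 1/2) * g (1 + b) + (1/2) * g (1 - b)"
   using False by (intro convex_onD[OF cv]) auto
  then have "g 1 \<le> g (1 + b) / 2 + g (1 - b) / 2" unfolding eq by simp
  then have "D - 1 \<le> (D * (1 + b)\<^sup>2 - (1 + b) powr p) / 2 + (D * (1 - b)\<^sup>2 - (1 - b) powr p) / 2"
   by (simp add: g_def)
  moreover have "D * (1 + b)\<^sup>2 / 2 + D * (1 - b)\<^sup>2 / 2 = D + D * b\<^sup>2"
   by (simp add: power2_eq_square field_simps)
  ultimately have 1: "((1 + b) powr p + (1 - b) powr p) / 2 \<le> 1 + D * b\<^sup>2"
   by (simp add: diff_divide_distrib add_divide_distrib)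
  have "1 + D * b\<^sup>2 \<le> 1 + p / 2 * ((1 + K * b\<^sup>2) - 1)" using assms by (simp add: K_def algebra_simps)
  also have "\<dots> \<le> (1 + K * b\<^sup>2) powr (p / 2)" using assms K5 by (intro powr_tangent) auto
  finally show ?thesis using 1 False by (simp add: abs_if split: if_splits)
 qed
 show "(\<bar>a + b\<bar> powr p + \<bar>a - b\<bar> powr p) / 2 \<le> (a\<^sup>2 + K * b\<^sup>2) powr (p / 2)" for a b
 proof (cases "a = 0")
  case True
  have "\<bar>b\<bar> powr p = (1 * b\<^sup>2) powr (p / 2)" by (simp add: sq_powr)
  also have "\<dots> \<le> (K * b\<^sup>2) powr (p / 2)" using K5 assms by (intro powr_mono2 mult_right_mono) auto
  finally show ?thesis using True by simp
 next
  case False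
  define t where "t = b / a"
  have b: "b = a * t" using False by (simp add: t_def)
  have "\<bar>a + b\<bar> powr p = \<bar>a\<bar> powr p * \<bar>1 + t\<bar> powr p" "\<bar>a - b\<bar> powr p = \<bar>a\<bar> powr p * \<bar>1 - t\<bar> powr p"
   unfolding b by (simp_all add: powr_mult[symmetric] abs_mult[symmetric] algebra_simps)
  then have "(\<bar>a + b\<bar> powr p + \<bar>a - b\<bar> powr p) / 2 = \<bar>a\<bar> powr p * ((\<bar>1 + t\<bar> powr p + \<bar>1 - t\<bar> powr p) / 2)"
   by (simp add: algebra_simps)
  also have "\<dots> \<le> \<bar>a\<bar> powr p * (1 + K * t\<^sup>2) powr (p / 2)" by (intro mult_left_mono unit) auto
  also have "\<dots> = (a\<^sup>2) powr (p / 2) * (1 + K * t\<^sup>2) powr (p / 2)" by (simp add: sq_powr)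
  also have "\<dots> = (a\<^sup>2 + K * b\<^sup>2) powr (p / 2)"
   using K5 unfolding b by (simp add: powr_mult[symmetric] power_mult_distrib algebra_simps)
  finally show ?thesis .
 qed
qed

section \<open>The spaces $\ell_p$\<close>

lemma lp_sumI: "x \<in> lp p \<Longrightarrow> summable (\<lambda>i. \<bar>x i\<bar> powr p)"
 by (simp add: lp_def)

lemma lpnorm_nonneg: "0 \<le> lpnorm p x"
 by (simp add: lpnorm_def)

lemma lpnorm_powr:
 assumes "x \<in> lp p" "p > 0"
 shows "lpnorm p x powr p = (\<Sum>i. \<bar>x i\<bar> powr p)"
 using assms suminf_nonneg[OF lp_sumI[OF assms(1)]] by (simp add: lpnorm_def powr_powr)

lemma lpnorm_leI:
 assumes "x \<in> lp p" "p > 0" "(\<Sum>i. \<bar>x i\<bar> powr p) \<le> a powr p" "a \<ge> 0"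
 shows "lpnorm p x \<le> a"
proof -
 have "lpnorm p x \<le> (a powr p) powr (1 / p)"
  unfolding lpnorm_def using assms suminf_nonneg[OF lp_sumI[OF assms(1)]] by (intro powr_mono2) auto
 then show ?thesis using assms by (simp add: powr_powr)
qed

lemma lp_add:
 assumes "x \<in> lp p" "y \<in> lp p" "p \<ge> 1"
 shows "x + y \<in> lp p"
proof -
 have "norm (\<bar>(x + y) i\<bar> powr p) \<le> 2 powr (p - 1) * (\<bar>x i\<bar> powr p + \<bar>y i\<bar> powr p)" for i
 proof -
  have "\<bar>(x + y) i\<bar> powr p \<le> (\<bar>x i\<bar> + \<bar>y i\<bar>) powr p" using assms by (intro powr_mono2) auto
  also have "\<dots> \<le> 2 powr (p - 1) * (\<bar>x i\<bar> powr p + \<bar>y i\<bar> powr p)" using assms by (intro powr_add_le) auto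
  finally show ?thesis by simp
 qed
 then show ?thesis unfolding lp_def mem_Collect_eq
  by (intro summable_comparison_test'[OF summable_mult[OF summable_add[OF lp_sumI[OF assms(1)] lp_sumI[OF assms(2)]]]])
qed

lemma lp_scale: "x \<in> lp p \<Longrightarrow> c *\<^sub>R x \<in> lp p"
 by (simp add: lp_def abs_mult powr_mult summable_mult)

lemma lpnorm_scale:
 assumes "x \<in> lp p" "p > 0"
 shows "lpnorm p (c *\<^sub>R x) = \<bar>c\<bar> * lpnorm p x"
proof -
 have "(\<Sum>i. \<bar>(c *\<^sub>R x) i\<bar> powr p) = \<bar>c\<bar> powr p * (\<Sum>i. \<bar>x i\<bar> powr p)"
  using suminf_mult[OF lp_sumI[OF assms(1)]] by (simp add: abs_mult powr_mult)
 then show ?thesis using assms suminf_nonneg[OF lp_sumI[OF assms(1)]]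
  by (simp add: lpnorm_def powr_mult powr_powr)
qed

lemma lpnorm_triangle:
 assumes x: "x \<in> lp p" and y: "y \<in> lp p" and p: "p \<ge> 1"
 shows "lpnorm p (x + y) \<le> lpnorm p x + lpnorm p y"
proof (rule field_le_epsilon)
 fix e :: real assume e: "e > 0"
 \<comment> \<open>The slack e keeps both weights positive even if a norm is 0.\<close>
 define a b where "a = lpnorm p x + e / 2" and "b = lpnorm p y + e / 2"
 have ab: "a > 0" "b > 0" using e lpnorm_nonneg[of p x] lpnorm_nonneg[of p y] by (auto simp: a_def b_def)
 note sx = lp_sumI[OF x] and sy = lp_sumI[OF y] and sxy = lp_sumI[OF lp_add[OF x y p]]
 have le: "c powr (1 - p) * (\<Sum>i. \<bar>z i\<bar> powr p) \<le> c"
  if "z \<in> lp p" "lpnorm p z \<le> c" "c > 0" for z c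
 proof -
  have "(\<Sum>i. \<bar>z i\<bar> powr p) \<le> c powr p"
   using lpnorm_powr[OF that(1)] p powr_mono2[of p "lpnorm p z" c] that lpnorm_nonneg[of p z] by simp
  then have "c powr (1 - p) * (\<Sum>i. \<bar>z i\<bar> powr p) \<le> c powr (1 - p) * c powr p" by (intro mult_left_mono) auto
  also have "\<dots> = c" using that by (simp add: powr_add[symmetric])
  finally show ?thesis .
 qed
 have "(\<Sum>i. \<bar>(x + y) i\<bar> powr p) \<le>
   (\<Sum>i. (a + b) powr (p - 1) * (a powr (1 - p) * \<bar>x i\<bar> powr p + b powr (1 - p) * \<bar>y i\<bar> powr p))"
 proof (rule suminf_le[OF _ sxy])
  fix i
  have "\<bar>(x + y) i\<bar> powr p \<le> (\<bar>x i\<bar> + \<bar>y i\<bar>) powr p" using p by (intro powr_mono2) auto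
  also have "\<dots> \<le> (a + b) powr (p - 1) * (a powr (1 - p) * \<bar>x i\<bar> powr p + b powr (1 - p) * \<bar>y i\<bar> powr p)"
   using p ab by (intro powr_add_weighted) auto
  finally show "\<bar>(x + y) i\<bar> powr p \<le> (a + b) powr (p - 1) * (a powr (1 - p) * \<bar>x i\<bar> powr p + b powr (1 - p) * \<bar>y i\<bar> powr p)" .
 qed (intro summable_mult summable_add sx sy)
 also have "\<dots> = (a + b) powr (p - 1) * (a powr (1 - p) * (\<Sum>i. \<bar>x i\<bar> powr p) + b powr (1 - p) * (\<Sum>i. \<bar>y i\<bar> powr p))"
  by (rule sums_unique[symmetric]) (intro sums_mult sums_add summable_sums sx sy)
 also have "\<dots> \<le> (a + b) powr (p - 1) * (a + b)"
  using le[OF x] le[OF y] ab e by (intro mult_left_mono add_mono) (auto simp: a_def b_def)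
 also have "\<dots> = (a + b) powr p" using ab powr_mult_base[of "a + b" "p - 1"] by (simp add: mult.commute)
 finally have "lpnorm p (x + y) \<le> a + b" using p ab by (intro lpnorm_leI lp_add x y) auto
 then show "lpnorm p (x + y) \<le> lpnorm p x + lpnorm p y + e" by (simp add: a_def b_def)
qed

lemma lpnorm_eq_0:
 assumes "x \<in> lp p" "p > 0"
 shows "lpnorm p x = 0 \<longleftrightarrow> x = 0"
proof
 assume "lpnorm p x = 0"
 then have "(\<Sum>i. \<bar>x i\<bar> powr p) = 0" using lpnorm_powr[OF assms] by simp
 then have "\<forall>i. \<bar>x i\<bar> powr p = 0" using suminf_eq_zero_iff[OF lp_sumI[OF assms(1)]] by simp
 then show "x = 0" by (simp add: fun_eq_iff)
qed (simp add: lpnorm_def)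

lemma normed_on_lp:
 assumes "p \<ge> 1"
 shows "normed_on (lp p) (lpnorm p)"
proof
 show "subspace (lp p)"
 proof -
  have "0 \<in> lp p" by (simp add: lp_def)
  then show ?thesis unfolding subspace_def using assms lp_add[of _ p] lp_scale[of _ p] by blast
 qed
 show "0 \<le> lpnorm p x" for x by (rule lpnorm_nonneg)
 show "lpnorm p (- x) = lpnorm p x" for x by (simp add: lpnorm_def)
qed (use assms in \<open>auto intro: lpnorm_triangle lpnorm_scale simp: lpnorm_eq_0\<close>)

lemma coord_le_lpnorm:
 assumes "x \<in> lp p" "p > 0"
 shows "\<bar>x i\<bar> \<le> lpnorm p x"
proof -
 have "(\<Sum>j\<in>{i}. \<bar>x j\<bar> powr p) \<le> (\<Sum>j. \<bar>x j\<bar> powr p)" using lp_sumI[OF assms(1)] by (intro sum_le_suminf) auto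
 then have "(\<bar>x i\<bar> powr p) powr (1 / p) \<le> lpnorm p x"
  unfolding lpnorm_def using assms by (intro powr_mono2) auto
 then show ?thesis using assms by (simp add: powr_powr)
qed

text \<open>The limit is formed coordinatewise. The bound on partial sums of p-th powers survives
  the passage to the limit, first in the second index of the sequence and then in the number of
  terms.\<close>

lemma mcomplete_lp:
 assumes p: "p \<ge> 1"
 shows "Metric_space.mcomplete (lp p) (\<lambda>x y. lpnorm p (x - y))"
proof -
 interpret normed_on "lp p" "lpnorm p" by (rule normed_on_lp[OF p])
 show ?thesis unfolding mcomplete_def
 proof (intro allI impI)
  fix \<sigma> assume C: "MCauchy \<sigma>"
  then have \<sigma>: "\<sigma> n \<in> lp p" for n by (auto simp: MCauchy_def)
  have diff: "\<sigma> n - \<sigma> m \<in> lp p" for n m using \<sigma> by simp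
  have "Cauchy (\<lambda>n. \<sigma> n i)" for i unfolding Cauchy_def dist_real_def
  proof (intro allI impI)
   fix e :: real assume "e > 0"
   then obtain M where "\<forall>n n'. M \<le> n \<longrightarrow> M \<le> n' \<longrightarrow> lpnorm p (\<sigma> n - \<sigma> n') < e"
    using C unfolding MCauchy_def by blast
   moreover have "\<bar>\<sigma> m i - \<sigma> n i\<bar> \<le> lpnorm p (\<sigma> m - \<sigma> n)" for m n
    using coord_le_lpnorm[OF diff, of m n i] p by simp
   ultimately show "\<exists>M. \<forall>m\<ge>M. \<forall>n\<ge>M. \<bar>\<sigma> m i - \<sigma> n i\<bar> < e" by (meson le_less_trans)
  qed
  then have "\<exists>z. (\<lambda>n. \<sigma> n i) \<longlonglongrightarrow> z" for i by (simp add: Cauchy_convergent_iff convergent_def)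
  then obtain z where z: "\<And>i. (\<lambda>n. \<sigma> n i) \<longlonglongrightarrow> z i" by metis
  have key: "\<exists>M. \<forall>n\<ge>M. \<sigma> n - z \<in> lp p \<and> lpnorm p (\<sigma> n - z) \<le> e" if "e > 0" for e
  proof -
   obtain M where M: "\<forall>n n'. M \<le> n \<longrightarrow> M \<le> n' \<longrightarrow> lpnorm p (\<sigma> n - \<sigma> n') < e"
    using C \<open>e > 0\<close> unfolding MCauchy_def by blast
   show ?thesis
   proof (intro exI[of _ M] allI impI)
    fix n assume n: "n \<ge> M"
    have b: "(\<Sum>k<K. \<bar>(\<sigma> n - z) k\<bar> powr p) \<le> e powr p" for K
    proof (rule LIMSEQ_le_const2)
     show "(\<lambda>m. \<Sum>k<K. \<bar>(\<sigma> n - \<sigma> m) k\<bar> powr p) \<longlonglongrightarrow> (\<Sum>k<K. \<bar>(\<sigma> n - z) k\<bar> powr p)"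
     proof (intro tendsto_sum tendsto_powr2 tendsto_const tendsto_rabs)
      show "(\<lambda>m. (\<sigma> n - \<sigma> m) k) \<longlonglongrightarrow> (\<sigma> n - z) k" for k
       using tendsto_diff[OF tendsto_const z[of k], of "\<sigma> n k"] by simp
     qed (use p in auto)
     show "\<exists>N. \<forall>m\<ge>N. (\<Sum>k<K. \<bar>(\<sigma> n - \<sigma> m) k\<bar> powr p) \<le> e powr p"
     proof (intro exI[of _ M] allI impI)
      fix m assume m: "m \<ge> M"
      have "(\<Sum>k<K. \<bar>(\<sigma> n - \<sigma> m) k\<bar> powr p) \<le> (\<Sum>k. \<bar>(\<sigma> n - \<sigma> m) k\<bar> powr p)"
       by (rule sum_le_suminf[OF lp_sumI[OF diff]]) auto
      also have "\<dots> = lpnorm p (\<sigma> n - \<sigma> m) powr p" using lpnorm_powr[OF diff] p by simp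
      also have "\<dots> \<le> e powr p" using M n m p by (intro powr_mono2) (auto simp: less_imp_le)
      finally show "(\<Sum>k<K. \<bar>(\<sigma> n - \<sigma> m) k\<bar> powr p) \<le> e powr p" .
     qed
    qed
    have sm: "summable (\<lambda>k. \<bar>(\<sigma> n - z) k\<bar> powr p)"
    proof (rule bounded_imp_summable)
     show "(\<Sum>k\<le>K. \<bar>(\<sigma> n - z) k\<bar> powr p) \<le> e powr p" for K
      using b[of "Suc K"] by (simp add: lessThan_Suc_atMost)
    qed simp
    then have in_lp: "\<sigma> n - z \<in> lp p" by (simp add: lp_def)
    moreover have "(\<Sum>k. \<bar>(\<sigma> n - z) k\<bar> powr p) \<le> e powr p" using suminf_le_const[OF sm b] .
    ultimately show "\<sigma> n - z \<in> lp p \<and> lpnorm p (\<sigma> n - z) \<le> e" using p \<open>e > 0\<close> by (auto intro!: lpnorm_leI)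
   qed
  qed
  obtain M where "\<sigma> M - z \<in> lp p" using key[of 1] by auto
  then have "\<sigma> M - (\<sigma> M - z) \<in> lp p" by (rule closed_diff[OF \<sigma>])
  moreover have "\<sigma> M - (\<sigma> M - z) = z" by (rule ext) simp
  ultimately have zlp: "z \<in> lp p" by (simp only:)
  have "limitin mtopology \<sigma> z sequentially" unfolding limit_metric_sequentially
  proof (intro conjI allI impI zlp)
   fix e :: real assume "e > 0"
   then obtain M where "\<forall>n\<ge>M. lpnorm p (\<sigma> n - z) \<le> e / 2" using key[of "e / 2"] by auto
   then show "\<exists>M. \<forall>n\<ge>M. \<sigma> n \<in> lp p \<and> lpnorm p (\<sigma> n - z) < e"
    using \<sigma> \<open>e > 0\<close> by (intro exI[of _ M]) (auto intro: le_less_trans)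
  qed
  then show "\<exists>x. limitin mtopology \<sigma> x sequentially" by blast
 qed
qed

section \<open>Uniform convexity and uniform smoothness of the sequence spaces\<close>

lemma half_to_norm:
 fixes p h z :: real
 assumes p: "p \<ge> 1" and h: "h \<ge> 0" "(h / 2) powr p \<le> 1 - z"
 shows "h \<le> 2 - 2 * z / p"
proof -
 have "1 + p * (h / 2 - 1) \<le> 1 - z" using powr_tangent[of p "h / 2"] assms by simp
 then have "p * (h / 2 - 1) \<le> - z" by simp
 then have "h / 2 - 1 \<le> - z / p" using p by (simp add: field_simps)
 then show ?thesis by simp
qed

lemma unif_convex_lp_ge2:
 assumes p: "p \<ge> 2"
 shows "unif_convex_on (lp p) (lpnorm p) p (2 / (p * 2 powr p))"
proof -
 interpret normed_on "lp p" "lpnorm p" by (rule normed_on_lp) (use p in simp)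
 show ?thesis
 proof
  show "p \<ge> 2" "2 / (p * 2 powr p) > 0" using p by auto
  fix x y assume x: "x \<in> lp p" and y: "y \<in> lp p" and one: "lpnorm p x = 1" "lpnorm p y = 1"
  note sx = lp_sumI[OF x] and sy = lp_sumI[OF y]
   and sp = lp_sumI[OF closed_add[OF x y]] and sm = lp_sumI[OF closed_diff[OF x y]]
  have "(\<Sum>i. \<bar>(x + y) i\<bar> powr p) + (\<Sum>i. \<bar>(x - y) i\<bar> powr p)
    \<le> 2 powr (p - 1) * ((\<Sum>i. \<bar>x i\<bar> powr p) + (\<Sum>i. \<bar>y i\<bar> powr p))"
   unfolding suminf_add[OF sp sm] suminf_add[OF sx sy] suminf_mult[OF summable_add[OF sx sy], symmetric]
   using clarkson_scalar[OF p] by (intro suminf_le summable_add summable_mult sp sm sx sy) simp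
  then have "lpnorm p (x + y) powr p + lpnorm p (x - y) powr p \<le> 2 powr (p - 1) * (1 + 1)"
   using lpnorm_powr[OF x] lpnorm_powr[OF y] lpnorm_powr[OF closed_add[OF x y]]
    lpnorm_powr[OF closed_diff[OF x y]] p one by simp
  also have "2 powr (p - 1) * (1 + 1) = 2 powr p" by (simp add: powr_diff)
  finally have "lpnorm p (x + y) powr p / 2 powr p \<le> (2 powr p - lpnorm p (x - y) powr p) / 2 powr p"
   by (intro divide_right_mono) auto
  then have "(lpnorm p (x + y) / 2) powr p \<le> 1 - lpnorm p (x - y) powr p / 2 powr p"
   by (simp add: powr_divide diff_divide_distrib)
  from half_to_norm[OF _ _ this] p
  show "lpnorm p (x + y) \<le> 2 - 2 / (p * 2 powr p) * lpnorm p (x - y) powr p" by (simp add: mult.commute)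
 qed
qed

text \<open>The scalar inequality carries the weight (|a| + |b|)^(p - 2), which varies with the
  coordinate, so type 2 does not follow by mere addition. A parameter t of the order of the squared
  distance balances the weighted term against the total mass of the two vectors.\<close>

lemma unif_convex_lp_le2:
 assumes p: "1 < p" "p \<le> 2"
 shows "\<exists>c. unif_convex_on (lp p) (lpnorm p) 2 c"
proof -
 interpret normed_on "lp p" "lpnorm p" by (rule normed_on_lp) (use p in simp)
 obtain c where c: "c > 0" and sc: "\<And>a b :: real. c * ((a - b)\<^sup>2 * (\<bar>a\<bar> + \<bar>b\<bar>) powr (p - 2)) \<le>
   (\<bar>a\<bar> powr p + \<bar>b\<bar> powr p) / 2 - \<bar>(a + b) / 2\<bar> powr p"
  using convex_scalar_le2[OF p] by metis
 define \<alpha> where "\<alpha> = p / 2"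
 have \<alpha>: "0 < \<alpha>" "\<alpha> \<le> 1" using p by (auto simp: \<alpha>_def)
 \<comment> \<open>With t = k d^2, the first term becomes k 2^(p + 1) d^2, twice the bound k 2^p d^2
   for the term that is subtracted from it.\<close>
 define k where "k = 2 powr (- (p + 1) / \<alpha>)"
 have k: "k > 0" "k powr (1 - \<alpha>) = k * 2 powr (p + 1)"
 proof -
  show "k > 0" by (simp add: k_def)
  have "k powr (- \<alpha>) = 2 powr (p + 1)" using \<alpha> by (simp add: k_def powr_powr add.commute)
  then show "k powr (1 - \<alpha>) = k * 2 powr (p + 1)"
   using \<open>k > 0\<close> powr_add[of k 1 "- \<alpha>"] by (simp add: add.commute)
 qed
 define C where "C = c / \<alpha> * (k * 2 powr p)"
 have C: "C > 0" using c \<alpha> k by (simp add: C_def)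
 \<comment> \<open>the tangent line of \<open>u \<mapsto> u\<^sup>\<alpha> v\<^sup>1\<^sup>-\<^sup>\<alpha>\<close> replaces Hoelder's inequality\<close>
 have pt: "c / \<alpha> * (\<bar>a - b\<bar> powr p * t powr (1 - \<alpha>) - (1 - \<alpha>) * (t * (2 powr (p - 1) * (\<bar>a\<bar> powr p + \<bar>b\<bar> powr p))))
   \<le> (\<bar>a\<bar> powr p + \<bar>b\<bar> powr p) / 2 - \<bar>(a + b) / 2\<bar> powr p" if "t > 0" for a b t :: real
 proof -
  define m where "m = \<bar>a\<bar> + \<bar>b\<bar>"
  define u where "u = (a - b)\<^sup>2 * m powr (p - 2)"
  have m0: "m \<ge> 0" by (simp add: m_def)
  have "\<bar>a - b\<bar> powr p * t powr (1 - \<alpha>) \<le> \<alpha> * u + (1 - \<alpha>) * (t * m powr p)"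
  proof (cases "a = b \<or> m = 0")
   case True
   then have "a = b" by (auto simp: m_def)
   then show ?thesis using \<alpha> that by (simp add: u_def)
  next
   case False
   then have pos: "m > 0" "\<bar>a - b\<bar> > 0" "u > 0" "t * m powr p > 0" using m0 that by (auto simp: u_def)
   have "u powr \<alpha> * (t * m powr p) powr (1 - \<alpha>) \<le> \<alpha> * u + (1 - \<alpha>) * (t * m powr p)"
    using \<alpha> pos by (intro Youngs_inequality_0) auto
   also have "u powr \<alpha> = \<bar>a - b\<bar> powr p * m powr ((p - 2) * \<alpha>)"
    using pos by (simp add: u_def powr_mult sq_powr powr_powr \<alpha>_def)
   also have "(t * m powr p) powr (1 - \<alpha>) = t powr (1 - \<alpha>) * m powr (p * (1 - \<alpha>))"
    using pos that by (simp add: powr_mult powr_powr)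
   also have "\<bar>a - b\<bar> powr p * m powr ((p - 2) * \<alpha>) * (t powr (1 - \<alpha>) * m powr (p * (1 - \<alpha>)))
     = \<bar>a - b\<bar> powr p * t powr (1 - \<alpha>) * (m powr ((p - 2) * \<alpha>) * m powr (p * (1 - \<alpha>)))"
    by simp
   also have "m powr ((p - 2) * \<alpha>) * m powr (p * (1 - \<alpha>)) = m powr ((p - 2) * \<alpha> + p * (1 - \<alpha>))"
    by (simp add: powr_add)
   also have "(p - 2) * \<alpha> + p * (1 - \<alpha>) = 0" by (simp add: \<alpha>_def algebra_simps diff_divide_distrib)
   finally show ?thesis using pos by simp
  qed
  also have "(1 - \<alpha>) * (t * m powr p) \<le> (1 - \<alpha>) * (t * (2 powr (p - 1) * (\<bar>a\<bar> powr p + \<bar>b\<bar> powr p)))"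
   unfolding m_def using \<alpha> that p by (intro mult_left_mono powr_add_le) auto
  finally have "\<bar>a - b\<bar> powr p * t powr (1 - \<alpha>) - (1 - \<alpha>) * (t * (2 powr (p - 1) * (\<bar>a\<bar> powr p + \<bar>b\<bar> powr p))) \<le> \<alpha> * u"
   by simp
  then have "c / \<alpha> * (\<bar>a - b\<bar> powr p * t powr (1 - \<alpha>) - (1 - \<alpha>) * (t * (2 powr (p - 1) * (\<bar>a\<bar> powr p + \<bar>b\<bar> powr p)))) \<le> c / \<alpha> * (\<alpha> * u)"
   using c \<alpha> by (intro mult_left_mono) auto
  also have "\<dots> = c * u" using \<alpha> by simp
  also have "\<dots> \<le> (\<bar>a\<bar> powr p + \<bar>b\<bar> powr p) / 2 - \<bar>(a + b) / 2\<bar> powr p"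
   using sc[of a b] by (simp add: u_def m_def)
  finally show ?thesis .
 qed
 have "unif_convex_on (lp p) (lpnorm p) 2 (2 * C / p)"
 proof
  show "(2::real) \<ge> 2" "2 * C / p > 0" using C p by auto
  fix x y assume x: "x \<in> lp p" and y: "y \<in> lp p" and one: "lpnorm p x = 1" "lpnorm p y = 1"
  define d where "d = lpnorm p (x - y)"
  define h where "h = lpnorm p (x + y)"
  have xyh: "(1/2) *\<^sub>R (x + y) \<in> lp p" using x y by (simp only: closed_add closed_scale)
  note sx = lp_sumI[OF x] and sy = lp_sumI[OF y]
   and sp = lp_sumI[OF xyh] and sm = lp_sumI[OF closed_diff[OF x y]]
  have hh: "(\<Sum>i. \<bar>((1/2) *\<^sub>R (x + y)) i\<bar> powr p) = (h / 2) powr p"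
   using lpnorm_powr[OF xyh] lpnorm_scale[OF closed_add[OF x y], of "1/2"] p by (simp add: h_def)
  have dd: "(\<Sum>i. \<bar>(x - y) i\<bar> powr p) = d powr p"
   using lpnorm_powr[OF closed_diff[OF x y]] p by (simp add: d_def)
  have xx: "(\<Sum>i. \<bar>x i\<bar> powr p) = 1" "(\<Sum>i. \<bar>y i\<bar> powr p) = 1"
   using lpnorm_powr[OF x] lpnorm_powr[OF y] p one by auto
  have "C * d\<^sup>2 \<le> 1 - (h / 2) powr p"
  proof (cases "d = 0")
   case True
   have "h \<le> 1 + 1" unfolding h_def using lpnorm_triangle[OF x y] p one by simp
   then have "(h / 2) powr p \<le> 1 powr p" using p by (intro powr_mono2) (auto simp: h_def lpnorm_nonneg)
   then show ?thesis using True by simp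
  next
   case False
   then have d: "d > 0" using lpnorm_nonneg[of p "x - y"] by (simp add: d_def less_le)
   define t where "t = k * d\<^sup>2"
   have t: "t > 0" using k d by (simp add: t_def)
   define A where "A i = c / \<alpha> * (\<bar>(x - y) i\<bar> powr p * t powr (1 - \<alpha>) - (1 - \<alpha>) * (t * (2 powr (p - 1) * (\<bar>x i\<bar> powr p + \<bar>y i\<bar> powr p))))" for i
   define B where "B i = (\<bar>x i\<bar> powr p + \<bar>y i\<bar> powr p) / 2 - \<bar>((1/2) *\<^sub>R (x + y)) i\<bar> powr p" for i
   have AB: "A i \<le> B i" for i using pt[OF t, of "x i" "y i"] by (simp add: A_def B_def)
   have As: "A sums (c / \<alpha> * (d powr p * t powr (1 - \<alpha>) - (1 - \<alpha>) * (t * (2 powr (p - 1) * (1 + 1)))))"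
    unfolding A_def using sx sy sm dd xx
    by (intro sums_mult sums_diff sums_mult2 sums_add) (auto simp: sums_iff)
   have Bs: "B sums ((1 + 1) / 2 - (h / 2) powr p)" unfolding B_def using sx sy sp hh xx
    by (intro sums_diff sums_divide sums_add) (auto simp: sums_iff)
   have "c / \<alpha> * (d powr p * t powr (1 - \<alpha>) - (1 - \<alpha>) * (t * (2 powr (p - 1) * (1 + 1)))) \<le> (1 + 1) / 2 - (h / 2) powr p"
    by (rule sums_le[OF AB As Bs])
   also have "2 powr (p - 1) * (1 + 1) = 2 powr p" by (simp add: powr_diff)
   also have "d powr p * t powr (1 - \<alpha>) = k * 2 powr (p + 1) * d\<^sup>2"
   proof -
    have "t powr (1 - \<alpha>) = k powr (1 - \<alpha>) * d powr (2 * (1 - \<alpha>))"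
     using d k by (simp add: t_def powr_mult sq_powr)
    moreover have "d powr p * d powr (2 * (1 - \<alpha>)) = d\<^sup>2"
     using d by (simp add: powr_add[symmetric] \<alpha>_def powr_numeral)
    ultimately show ?thesis using k by (simp add: mult.left_commute)
   qed
   finally have "c / \<alpha> * (k * 2 powr (p + 1) * d\<^sup>2 - (1 - \<alpha>) * (k * d\<^sup>2 * 2 powr p)) \<le> 1 - (h / 2) powr p"
    by (simp add: t_def)
   moreover have "C * d\<^sup>2 \<le> c / \<alpha> * (k * 2 powr (p + 1) * d\<^sup>2 - (1 - \<alpha>) * (k * d\<^sup>2 * 2 powr p))"
   proof -
    have "(1 - \<alpha>) * (k * d\<^sup>2 * 2 powr p) \<le> 1 * (k * d\<^sup>2 * 2 powr p)"
     using \<alpha> k by (intro mult_right_mono) auto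
    then have "k * 2 powr p * d\<^sup>2 \<le> k * 2 powr (p + 1) * d\<^sup>2 - (1 - \<alpha>) * (k * d\<^sup>2 * 2 powr p)"
     by (simp add: powr_add)
    then have "c / \<alpha> * (k * 2 powr p * d\<^sup>2) \<le> c / \<alpha> * (k * 2 powr (p + 1) * d\<^sup>2 - (1 - \<alpha>) * (k * d\<^sup>2 * 2 powr p))"
     using c \<alpha> by (intro mult_left_mono) auto
    then show ?thesis by (simp add: C_def)
   qed
   ultimately show ?thesis by linarith
  qed
  then have "(h / 2) powr p \<le> 1 - C * d\<^sup>2" by simp
  then have "h \<le> 2 - 2 * (C * d\<^sup>2) / p" using p by (intro half_to_norm) (auto simp: h_def lpnorm_nonneg)
  then show "lpnorm p (x + y) \<le> 2 - 2 * C / p * lpnorm p (x - y) powr 2"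
   using lpnorm_nonneg[of p "x - y"] by (simp add: h_def d_def powr_numeral)
 qed
 then show ?thesis by blast
qed

text \<open>The scalar inequality sums to ((A + B) / 2)^p \<le> W^p + E^p, and Bernoulli's
  inequality at (A + B) / (2 W) removes the power.\<close>

lemma unif_smooth_lp_le2:
 assumes p: "1 < p" "p \<le> 2"
 shows "unif_smooth_on (lp p) (lpnorm p) p 2"
proof -
 interpret normed_on "lp p" "lpnorm p" by (rule normed_on_lp) (use p in simp)
 show ?thesis
 proof
  show "1 < p" "(0::real) \<le> 2" using p by auto
  fix w e assume w: "w \<in> lp p" and e: "e \<in> lp p" and pos: "0 < lpnorm p w"
  define W E A B where "W = lpnorm p w" and "E = lpnorm p e"
   and "A = lpnorm p (w + e)" and "B = lpnorm p (w - e)"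
  note sw = lp_sumI[OF w] and se = lp_sumI[OF e]
   and sp = lp_sumI[OF closed_add[OF w e]] and sm = lp_sumI[OF closed_diff[OF w e]]
  have n: "0 < W" "0 \<le> E" "0 \<le> A" "0 \<le> B" using pos by (auto simp: W_def E_def A_def B_def)
  have "(\<Sum>i. \<bar>(w + e) i\<bar> powr p) + (\<Sum>i. \<bar>(w - e) i\<bar> powr p)
    \<le> 2 * (\<Sum>i. \<bar>w i\<bar> powr p) + 2 * (\<Sum>i. \<bar>e i\<bar> powr p)"
  proof (rule sums_le[OF _ sums_add[OF summable_sums[OF sp] summable_sums[OF sm]]
     sums_add[OF sums_mult[OF summable_sums[OF sw]] sums_mult[OF summable_sums[OF se]]]])
   show "\<bar>(w + e) i\<bar> powr p + \<bar>(w - e) i\<bar> powr p \<le> 2 * \<bar>w i\<bar> powr p + 2 * \<bar>e i\<bar> powr p" for i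
    using smooth_scalar_le2[of p "w i" "e i"] p by simp
  qed
  then have "A powr p + B powr p \<le> 2 * W powr p + 2 * E powr p"
   using lpnorm_powr[OF w] lpnorm_powr[OF e] lpnorm_powr[OF closed_add[OF w e]]
    lpnorm_powr[OF closed_diff[OF w e]] p by (simp add: W_def E_def A_def B_def)
  moreover have "((A + B) / 2) powr p \<le> (A powr p + B powr p) / 2" using p n by (intro powr_half_le) auto
  ultimately have "((A + B) / 2) powr p \<le> W powr p + E powr p" by simp
  then have "((A + B) / 2) powr p / W powr p \<le> (W powr p + E powr p) / W powr p"
   by (intro divide_right_mono) auto
  also have "(W powr p + E powr p) / W powr p = 1 + E powr p / W powr p"
   using n by (simp add: add_divide_distrib)
  also have "((A + B) / 2) powr p / W powr p = ((A + B) / 2 / W) powr p" by (rule powr_divide[symmetric])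
  finally have "((A + B) / 2 / W) powr p \<le> 1 + E powr p / W powr p" .
  moreover have "1 + p * ((A + B) / 2 / W - 1) \<le> ((A + B) / 2 / W) powr p"
   using n p by (intro powr_tangent) auto
  ultimately have pT: "p * ((A + B) / 2 / W - 1) \<le> E powr p / W powr p" by linarith
  have cancel: "T \<le> z" if "p * T \<le> z" "0 \<le> z" for T z
  proof (cases "T \<ge> 0")
   case True
   then have "1 * T \<le> p * T" using p by (intro mult_right_mono) auto
   then show ?thesis using that by simp
  qed (use that in simp)
  have "(A + B) / 2 / W - 1 \<le> E powr p / W powr p" by (rule cancel[OF pT]) simp
  then have "((A + B) / 2 / W - 1) * (2 * W) \<le> E powr p / W powr p * (2 * W)"
   using n by (intro mult_right_mono) auto
  moreover have "A + B = ((A + B) / 2 / W - 1) * (2 * W) + 2 * W" using n by (simp add: left_diff_distrib)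
  ultimately have "A + B \<le> E powr p / W powr p * (2 * W) + 2 * W" by linarith
  also have "\<dots> = 2 * W + 2 * (E powr p * (W / W powr p))" by simp
  also have "W / W powr p = W powr (1 - p)" using n by (simp add: powr_diff)
  finally show "lpnorm p (w + e) + lpnorm p (w - e) \<le> 2 * lpnorm p w + 2 * lpnorm p e powr p * lpnorm p w powr (1 - p)"
   by (simp add: W_def E_def A_def B_def)
 qed
qed

text \<open>Coordinatewise squares lie in \<open>lp (p / 2)\<close>, and since p / 2 \<ge> 1 its
  triangle inequality bounds the norm of w^2 + K e^2. This is what sums the two-point
  inequality.\<close>

lemma unif_smooth_lp_ge2:
 assumes p: "p \<ge> 2"
 shows "\<exists>K. unif_smooth_on (lp p) (lpnorm p) 2 K"
proof -
 interpret normed_on "lp p" "lpnorm p" by (rule normed_on_lp) (use p in simp)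
 obtain K where K: "K \<ge> 0" and sc: "\<And>a b :: real. (\<bar>a + b\<bar> powr p + \<bar>a - b\<bar> powr p) / 2 \<le> (a\<^sup>2 + K * b\<^sup>2) powr (p / 2)"
  using smooth_scalar_ge2[OF p] by metis
 have sq: "(\<lambda>i. (x i)\<^sup>2) \<in> lp (p / 2)" "lpnorm (p / 2) (\<lambda>i. (x i)\<^sup>2) = (lpnorm p x)\<^sup>2" if "x \<in> lp p" for x
 proof -
  have e: "\<bar>(x i)\<^sup>2\<bar> powr (p / 2) = \<bar>x i\<bar> powr p" for i by (simp add: sq_powr)
  show "(\<lambda>i. (x i)\<^sup>2) \<in> lp (p / 2)" using that unfolding lp_def mem_Collect_eq e .
  have "lpnorm (p / 2) (\<lambda>i. (x i)\<^sup>2) = (\<Sum>i. \<bar>x i\<bar> powr p) powr (2 / p)" unfolding lpnorm_def e by simp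
  also have "\<dots> = lpnorm p x powr 2" by (simp add: lpnorm_def powr_powr)
  also have "\<dots> = (lpnorm p x)\<^sup>2" using lpnorm_nonneg[of p x] by (simp add: powr_numeral)
  finally show "lpnorm (p / 2) (\<lambda>i. (x i)\<^sup>2) = (lpnorm p x)\<^sup>2" .
 qed
 have "unif_smooth_on (lp p) (lpnorm p) 2 K"
 proof
  show "(1::real) < 2" "0 \<le> K" using K by auto
  fix w e assume w: "w \<in> lp p" and e: "e \<in> lp p" and pos: "0 < lpnorm p w"
  define W E A B where "W = lpnorm p w" and "E = lpnorm p e"
   and "A = lpnorm p (w + e)" and "B = lpnorm p (w - e)"
  note sp = lp_sumI[OF closed_add[OF w e]] and sm = lp_sumI[OF closed_diff[OF w e]]
  have n: "0 < W" "0 \<le> E" "0 \<le> A" "0 \<le> B" using pos by (auto simp: W_def E_def A_def B_def)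
  define f where "f = (\<lambda>i. (w i)\<^sup>2) + K *\<^sub>R (\<lambda>i. (e i)\<^sup>2)"
  have fl: "f \<in> lp (p / 2)" unfolding f_def using p sq(1)[OF w] sq(1)[OF e] by (intro lp_add lp_scale) auto
  have "lpnorm (p / 2) f \<le> lpnorm (p / 2) (\<lambda>i. (w i)\<^sup>2) + lpnorm (p / 2) (K *\<^sub>R (\<lambda>i. (e i)\<^sup>2))"
   unfolding f_def using p sq(1)[OF w] sq(1)[OF e] by (intro lpnorm_triangle lp_scale) auto
  also have "\<dots> = W\<^sup>2 + K * E\<^sup>2" using p K sq[OF w] sq[OF e] by (simp add: lpnorm_scale W_def E_def)
  finally have fle: "lpnorm (p / 2) f \<le> W\<^sup>2 + K * E\<^sup>2" .
  have "(A powr p + B powr p) / 2 = (\<Sum>i. (\<bar>(w + e) i\<bar> powr p + \<bar>(w - e) i\<bar> powr p) / 2)"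
   using lpnorm_powr[OF closed_add[OF w e]] lpnorm_powr[OF closed_diff[OF w e]] p
    suminf_divide[OF summable_add[OF sp sm], of 2] suminf_add[OF sp sm] by (simp add: A_def B_def)
  also have "\<dots> \<le> (\<Sum>i. \<bar>f i\<bar> powr (p / 2))"
  proof (rule suminf_le)
   fix i
   have "\<bar>f i\<bar> = (w i)\<^sup>2 + K * (e i)\<^sup>2" using K by (simp add: f_def)
   then show "(\<bar>(w + e) i\<bar> powr p + \<bar>(w - e) i\<bar> powr p) / 2 \<le> \<bar>f i\<bar> powr (p / 2)"
    using sc[of "w i" "e i"] by simp
  qed (use fl sp sm in \<open>auto intro!: summable_divide summable_add lp_sumI\<close>)
  also have "\<dots> = lpnorm (p / 2) f powr (p / 2)" using fl p by (simp add: lpnorm_powr)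
  also have "\<dots> \<le> (W\<^sup>2 + K * E\<^sup>2) powr (p / 2)" using fle p lpnorm_nonneg by (intro powr_mono2) auto
  finally have 1: "(A powr p + B powr p) / 2 \<le> (W\<^sup>2 + K * E\<^sup>2) powr (p / 2)" .
  have "(((A + B) / 2)\<^sup>2) powr (p / 2) = ((A + B) / 2) powr p" using n by (simp add: sq_powr)
  also have "\<dots> \<le> (A powr p + B powr p) / 2" using p n by (intro powr_half_le) auto
  finally have "(((A + B) / 2)\<^sup>2) powr (p / 2) \<le> (W\<^sup>2 + K * E\<^sup>2) powr (p / 2)" using 1 by linarith
  then have "((A + B) / 2)\<^sup>2 \<le> W\<^sup>2 + K * E\<^sup>2"
   using p K by (smt (verit) powr_less_mono2 zero_le_power2 mult_nonneg_nonneg divide_pos_pos)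
  also have "\<dots> \<le> (W + K * E\<^sup>2 / (2 * W))\<^sup>2"
  proof -
   have "(W + K * E\<^sup>2 / (2 * W))\<^sup>2 = W\<^sup>2 + K * E\<^sup>2 + (K * E\<^sup>2 / (2 * W))\<^sup>2"
    using n by (simp add: power2_eq_square field_simps)
   then show ?thesis by simp
  qed
  finally have "(A + B) / 2 \<le> W + K * E\<^sup>2 / (2 * W)" by (rule power2_le_imp_le) (use n K in auto)
  then have "A + B \<le> 2 * W + K * E\<^sup>2 / W" by simp
  also have "K * E\<^sup>2 / W = K * E powr 2 * W powr (1 - 2)"
   using n by (simp add: powr_numeral powr_minus divide_inverse)
  finally show "lpnorm p (w + e) + lpnorm p (w - e) \<le> 2 * lpnorm p w + K * lpnorm p e powr 2 * lpnorm p w powr (1 - 2)"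
   by (simp add: W_def E_def A_def B_def)
 qed
 then show ?thesis by blast
qed

section \<open>Partitions of a Lipschitz curve\<close>

definition nxt :: "real set \<Rightarrow> real \<Rightarrow> real"
 where "nxt P a = Min {b \<in> P. a < b}"

definition prv :: "real set \<Rightarrow> real \<Rightarrow> real"
 where "prv P b = Max {a \<in> P. a < b}"

lemma nxt_props:
 assumes "finite P" "c \<in> P" "a < c"
 shows "nxt P a \<in> P" "a < nxt P a" "nxt P a \<le> c" "\<And>b. b \<in> P \<Longrightarrow> a < b \<Longrightarrow> nxt P a \<le> b"
proof -
 have "nxt P a \<in> {b \<in> P. a < b}" unfolding nxt_def by (rule Min_in) (use assms in auto)
 then show "nxt P a \<in> P" "a < nxt P a" by auto
 show *: "nxt P a \<le> b" if "b \<in> P" "a < b" for b unfolding nxt_def using assms that by (intro Min_le) auto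
 show "nxt P a \<le> c" using * assms by auto
qed

lemma prv_props:
 assumes "finite P" "c \<in> P" "c < a"
 shows "prv P a \<in> P" "prv P a < a" "c \<le> prv P a" "\<And>b. b \<in> P \<Longrightarrow> b < a \<Longrightarrow> b \<le> prv P a"
proof -
 have "prv P a \<in> {b \<in> P. b < a}" unfolding prv_def by (rule Max_in) (use assms in auto)
 then show "prv P a \<in> P" "prv P a < a" by auto
 show *: "b \<le> prv P a" if "b \<in> P" "b < a" for b unfolding prv_def using assms that by (intro Max_ge) auto
 show "c \<le> prv P a" using * assms by auto
qed

lemma nxt_prv:
 assumes "finite P" "c \<in> P" "c < v" "v \<in> P"
 shows "nxt P (prv P v) = v"
proof -
 note p = prv_props[OF assms(1-3)]
 note n = nxt_props[OF assms(1) assms(4) p(2)]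
 have "\<not> nxt P (prv P v) < v" using p(4)[OF n(1)] n(2) by auto
 then show ?thesis using n(3) by simp
qed

text \<open>Stated for general g because it is applied to chord lengths and, with both signs, to the
  widths of arcs, where it yields an equality.\<close>

lemma chain_subadditive:
 fixes g :: "real \<Rightarrow> real \<Rightarrow> real"
 assumes P: "finite P" "x \<in> P" "y \<in> P" "x \<le> y"
  and g: "\<And>x y z. x \<in> P \<Longrightarrow> y \<in> P \<Longrightarrow> z \<in> P \<Longrightarrow> x \<le> y \<Longrightarrow> y \<le> z \<Longrightarrow> g x z \<le> g x y + g y z"
   "\<And>x. g x x \<le> 0"
 shows "g x y \<le> (\<Sum>a\<in>P \<inter> {x..<y}. g a (nxt P a))"
 using P(2-4)
proof (induction "card (P \<inter> {x..<y})" arbitrary: x rule: less_induct)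
 case less
 show ?case
 proof (cases "x = y")
  case True
  then show ?thesis using g(2)[of x] by simp
 next
  case False
  then have xy: "x < y" using less by simp
  note n = nxt_props[OF P(1) less.prems(2) xy]
  have eq: "P \<inter> {x..<y} = insert x (P \<inter> {nxt P x..<y})" using n less.prems xy by force
  have ni: "x \<notin> P \<inter> {nxt P x..<y}" using n by auto
  have fin: "finite (P \<inter> {nxt P x..<y})" using P by auto
  have "card (P \<inter> {nxt P x..<y}) < card (P \<inter> {x..<y})" unfolding eq using ni fin by simp
  then have "g (nxt P x) y \<le> (\<Sum>a\<in>P \<inter> {nxt P x..<y}. g a (nxt P a))"
   using n less.prems by (intro less.hyps) auto
  moreover have "g x y \<le> g x (nxt P x) + g (nxt P x) y" using n less.prems by (intro g(1)) auto
  ultimately show ?thesis unfolding eq using ni fin by simp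
 qed
qed

lemma sum_parents:
 assumes P: "finite P" "finite P'" "P \<subseteq> P'" "P' \<subseteq> {z..L}" "z \<in> P" "L \<in> P"
 shows "(\<Sum>c\<in>P' - {L}. f c) = (\<Sum>a\<in>P - {L}. \<Sum>c\<in>P' \<inter> {a..<nxt P a}. f c)"
proof -
 have nx: "nxt P a \<in> P" "a < nxt P a" "nxt P a \<le> L" "\<And>b. b \<in> P \<Longrightarrow> a < b \<Longrightarrow> nxt P a \<le> b"
  if "a \<in> P - {L}" for a
 proof -
  have "a < L" using that P by force
  from nxt_props[OF P(1,6) this]
  show "nxt P a \<in> P" "a < nxt P a" "nxt P a \<le> L" "\<And>b. b \<in> P \<Longrightarrow> a < b \<Longrightarrow> nxt P a \<le> b" by auto
 qed
 have U: "P' - {L} = (\<Union>a\<in>P - {L}. P' \<inter> {a..<nxt P a})"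
 proof (intro set_eqI iffI)
  fix c assume c: "c \<in> P' - {L}"
  define a where "a = Max {q \<in> P. q \<le> c}"
  have "a \<in> {q \<in> P. q \<le> c}" unfolding a_def
  proof (rule Max_in)
   have "z \<in> {q \<in> P. q \<le> c}" using c P by auto
   then show "{q \<in> P. q \<le> c} \<noteq> {}" by blast
  qed (use P in auto)
  moreover have am: "q \<le> a" if "q \<in> P" "q \<le> c" for q unfolding a_def using P that by (intro Max_ge) auto
  moreover have "c < L" using c P by force
  ultimately have a: "a \<in> P - {L}" "a \<le> c" by auto
  have "c < nxt P a" using nx[OF a(1)] am[of "nxt P a"] by force
  then show "c \<in> (\<Union>a\<in>P - {L}. P' \<inter> {a..<nxt P a})" using a c by auto
 next
  fix c assume "c \<in> (\<Union>a\<in>P - {L}. P' \<inter> {a..<nxt P a})"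
  then show "c \<in> P' - {L}" using nx by force
 qed
 show ?thesis unfolding U
 proof (rule sum.UNION_disjoint)
  show "\<forall>i\<in>P - {L}. \<forall>j\<in>P - {L}. i \<noteq> j \<longrightarrow> P' \<inter> {i..<nxt P i} \<inter> (P' \<inter> {j..<nxt P j}) = {}"
  proof (intro ballI impI)
   fix i j assume ij: "i \<in> P - {L}" "j \<in> P - {L}" "i \<noteq> j"
   then consider "nxt P i \<le> j" | "nxt P j \<le> i" using nx(4)[OF ij(1), of j] nx(4)[OF ij(2), of i] by force
   then show "P' \<inter> {i..<nxt P i} \<inter> (P' \<inter> {j..<nxt P j}) = {}" by cases auto
  qed
 qed (use P in auto)
qed

text \<open>The factor 3/2 is below 2: together with the factor 1/2 gained from one scale to the
  next it gives the contraction 3/4 in the recursions for deviations and for angles.\<close>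

lemma powr_add_split:
 fixes s :: real
 assumes "s \<ge> 1"
 obtains K where "K > 0" "\<And>a b. a \<ge> 0 \<Longrightarrow> b \<ge> 0 \<Longrightarrow> (a + b) powr s \<le> 3/2 * a powr s + K * b powr s"
proof
 define k where "k = (3/2) powr (1/s) - 1"
 have "1 powr (1/s) < (3/2) powr (1/s)" using assms by (intro powr_less_mono2) auto
 then have k: "k > 0" by (simp add: k_def)
 have k1: "(1 + k) powr s = 3/2" using assms by (simp add: k_def powr_powr)
 have "1/k + 1 > 0" using k by (intro add_pos_pos) auto
 then show "(1/k + 1) powr s > 0" by simp
 fix a b :: real assume ab: "a \<ge> 0" "b \<ge> 0"
 show "(a + b) powr s \<le> 3/2 * a powr s + (1/k + 1) powr s * b powr s"
 proof (cases "b \<le> k * a")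
  case True
  have "(a + b) powr s \<le> ((1 + k) * a) powr s"
   using ab assms True by (intro powr_mono2) (auto simp: algebra_simps)
  also have "\<dots> = 3/2 * a powr s" using k1 by (simp add: powr_mult)
  finally show ?thesis by (simp add: add_increasing2)
 next
  case False
  then have "a \<le> 1/k * b" using k by (simp add: field_simps)
  then have "(a + b) powr s \<le> ((1/k + 1) * b) powr s"
   using ab assms by (intro powr_mono2) (auto simp: algebra_simps)
  also have "\<dots> = (1/k + 1) powr s * b powr s" by (simp add: powr_mult)
  finally show ?thesis by (simp add: add_increasing)
 qed
qed

lemma powr_add4:
 fixes a b c d s :: real
 assumes "a \<ge> 0" "b \<ge> 0" "c \<ge> 0" "d \<ge> 0" "s \<ge> 0"
 shows "(a + b + c + d) powr s \<le> 4 powr s * (a powr s + b powr s + c powr s + d powr s)"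
proof -
 define m where "m = max (max a b) (max c d)"
 have "(a + b + c + d) powr s \<le> (4 * m) powr s" using assms by (intro powr_mono2) (auto simp: m_def)
 also have "\<dots> = 4 powr s * m powr s" by (simp add: powr_mult)
 also have "m powr s \<le> a powr s + b powr s + c powr s + d powr s"
  by (auto simp: m_def max_def add_increasing add_increasing2)
 finally show ?thesis by simp
qed

text \<open>A bound by the next finer scale leaves the term at the last scale, for which an a priori
  estimate is needed; the forward version leaves the term at scale 0.\<close>

lemma geometric_backward:
 fixes Z \<Delta> :: "nat \<Rightarrow> real"
 assumes "\<And>j. Z j \<le> 3/4 * Z (Suc j) + \<Delta> j" "\<And>j. 0 \<le> Z j"
 shows "(\<Sum>j<n. Z j) \<le> 3 * Z n + 4 * (\<Sum>j<n. \<Delta> j)"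
proof -
 have "(\<Sum>j<n. Z j) \<le> (\<Sum>j<n. 3/4 * Z (Suc j) + \<Delta> j)" by (intro sum_mono assms)
 also have "\<dots> = 3/4 * (\<Sum>j<n. Z (Suc j)) + (\<Sum>j<n. \<Delta> j)" by (simp add: sum.distrib sum_distrib_left)
 also have "(\<Sum>j<n. Z (Suc j)) = (\<Sum>j<n. Z j) + Z n - Z 0" using sum.lessThan_Suc_shift[of Z n] by simp
 finally show ?thesis using assms(2)[of 0] by argo
qed

lemma geometric_forward:
 fixes Z \<Delta> :: "nat \<Rightarrow> real"
 assumes "\<And>j. Z (Suc j) \<le> 3/4 * Z j + \<Delta> j" "\<And>j. 0 \<le> Z j"
 shows "(\<Sum>j<n. Z j) \<le> 4 * Z 0 + 4 * (\<Sum>j<n. \<Delta> j)"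
proof -
 have "(\<Sum>j<n. Z (Suc j)) \<le> (\<Sum>j<n. 3/4 * Z j + \<Delta> j)" by (intro sum_mono assms)
 also have "\<dots> = 3/4 * (\<Sum>j<n. Z j) + (\<Sum>j<n. \<Delta> j)" by (simp add: sum.distrib sum_distrib_left)
 finally show ?thesis using sum.lessThan_Suc_shift[of Z n] assms(2)[of n] by simp
qed

lemma separated_reals_card:
 fixes \<rho> L :: real
 assumes "finite P" "P \<subseteq> {0..L}" "\<rho> > 0" "\<And>a b. a \<in> P \<Longrightarrow> b \<in> P \<Longrightarrow> a < b \<Longrightarrow> \<rho> \<le> b - a"
 shows "card P \<le> Suc (nat \<lfloor>L / \<rho>\<rfloor>)"
proof -
 let ?g = "\<lambda>x. nat \<lfloor>x / \<rho>\<rfloor>"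
 have *: "?g a < ?g b" if "a \<in> P" "b \<in> P" "a < b" for a b
 proof -
  have "(a + \<rho>) / \<rho> \<le> b / \<rho>" using assms(4)[OF that] assms(3) by (intro divide_right_mono) auto
  then have "a / \<rho> + 1 \<le> b / \<rho>" using assms(3) by (simp add: add_divide_distrib)
  then have "\<lfloor>a / \<rho>\<rfloor> + 1 \<le> \<lfloor>b / \<rho>\<rfloor>" by linarith
  moreover have "0 \<le> \<lfloor>a / \<rho>\<rfloor>" using that assms by auto
  ultimately show ?thesis by linarith
 qed
 have "inj_on ?g P" by (rule inj_onI) (metis * less_irrefl linorder_neqE_linordered_idom)
 moreover have "?g ` P \<subseteq> {..nat \<lfloor>L / \<rho>\<rfloor>}" using assms by (auto intro!: nat_mono floor_mono divide_right_mono)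
 ultimately have "card P \<le> card {..nat \<lfloor>L / \<rho>\<rfloor>}" by (metis card_inj_on_le finite_atMost)
 then show ?thesis by simp
qed

section \<open>Arcs of a Lipschitz curve\<close>

locale curve_on = unif_convex_on +
 fixes g :: "real \<Rightarrow> 'a" and L :: real
 assumes lip_g: "lip g" and L_pos: "L > 0"
begin

lemma g_in [simp]: "g t \<in> V"
 using lip_g by (auto simp: lip_def)

lemma g_lip: "N (g t - g u) \<le> \<bar>t - u\<bar>"
 using lip_g by (auto simp: lip_def)

definition dg :: "real \<Rightarrow> real \<Rightarrow> real"
 where "dg a b = (SUP q\<in>{a..b} \<times> {a..b}. N (g (fst q) - g (snd q)))"

lemma dg_bdd: "bdd_above ((\<lambda>q. N (g (fst q) - g (snd q))) ` ({a..b} \<times> {a..b}))"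
proof (rule bdd_aboveI2)
 fix q assume "q \<in> {a..b} \<times> {a..b}"
 then show "N (g (fst q) - g (snd q)) \<le> \<bar>b - a\<bar>" using g_lip[of "fst q" "snd q"] by auto
qed

lemma dg_ge: "a \<le> t \<Longrightarrow> t \<le> b \<Longrightarrow> a \<le> u \<Longrightarrow> u \<le> b \<Longrightarrow> N (g t - g u) \<le> dg a b"
 unfolding dg_def using cSUP_upper[OF _ dg_bdd[of a b], of "(t, u)"] by auto

lemma dg_le:
 assumes "a \<le> b" "\<And>t u. a \<le> t \<Longrightarrow> t \<le> b \<Longrightarrow> a \<le> u \<Longrightarrow> u \<le> b \<Longrightarrow> N (g t - g u) \<le> c"
 shows "dg a b \<le> c"
 unfolding dg_def by (rule cSUP_least) (use assms in auto)

lemma dg_nonneg: "a \<le> b \<Longrightarrow> 0 \<le> dg a b"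
 using dg_ge[of a a b a] by simp

lemma dg_mono: "a \<le> b \<Longrightarrow> a' \<le> a \<Longrightarrow> b \<le> b' \<Longrightarrow> dg a b \<le> dg a' b'"
 by (rule dg_le) (auto intro!: dg_ge)

lemma dg_le_len: "a \<le> b \<Longrightarrow> dg a b \<le> b - a"
proof (rule dg_le)
 show "N (g t - g u) \<le> b - a" if "a \<le> t" "t \<le> b" "a \<le> u" "u \<le> b" for t u using g_lip[of t u] that by linarith
qed

lemma dg_split:
 assumes "a \<le> c" "c \<le> b"
 shows "dg a b \<le> dg a c + dg c b"
proof (rule dg_le)
 show "a \<le> b" using assms by simp
 have mix: "N (g t - g u) \<le> dg a c + dg c b" if "a \<le> t" "t \<le> c" "c \<le> u" "u \<le> b" for t u
  using N_diff_triangle[of "g t" "g c" "g u"] dg_ge[of a t c c] dg_ge[of c c b u] that by simp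
 fix t u assume tu: "a \<le> t" "t \<le> b" "a \<le> u" "u \<le> b"
 consider "t \<le> c" "u \<le> c" | "c \<le> t" "c \<le> u" | "t \<le> c" "c \<le> u" | "u \<le> c" "c \<le> t" by linarith
 then show "N (g t - g u) \<le> dg a c + dg c b"
 proof cases
  case 1
  then show ?thesis using dg_ge[of a t c u] dg_nonneg[of c b] tu assms by simp
 next
  case 2
  then show ?thesis using dg_ge[of c t b u] dg_nonneg[of a c] tu assms by simp
 next
  case 3
  then show ?thesis using mix tu by simp
 next
  case 4
  then show ?thesis using mix[of u t] tu by (simp add: N_commute)
 qed
qed

definition dsep :: "real \<Rightarrow> real set \<Rightarrow> bool"
 where "dsep \<rho> P \<longleftrightarrow> (\<forall>a\<in>P. \<forall>b\<in>P. a < b \<longrightarrow> \<rho> \<le> dg a b)"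

text \<open>Maximal sets of parameters whose arcs all have diameter at least \<rho>. Using diameter
  instead of length makes an arc comparable to a ball of radius \<rho>, however much the curve
  oscillates, and maximality bounds the diameters from above.\<close>

definition part :: "real \<Rightarrow> real set \<Rightarrow> bool"
 where "part \<rho> P \<longleftrightarrow> finite P \<and> P \<subseteq> {0..L} \<and> 0 \<in> P \<and> L \<in> P \<and> dsep \<rho> P \<and>
  (\<forall>t. 0 \<le> t \<longrightarrow> t \<le> L \<longrightarrow> dsep \<rho> (insert t P) \<longrightarrow> t \<in> P)"

text \<open>Diameters are at most parameter lengths, so admissible sets have at most L / \<rho> + 1
  elements and a largest one exists. Extending a given set is what makes the partitions
  nested.\<close>

lemma part_extend:
 assumes "finite P" "P \<subseteq> {0..L}" "0 \<in> P" "L \<in> P" "dsep \<rho> P" "\<rho> > 0"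
 obtains P' where "P \<subseteq> P'" "part \<rho> P'"
proof -
 let ?Q = "\<lambda>P'. finite P' \<and> P \<subseteq> P' \<and> P' \<subseteq> {0..L} \<and> dsep \<rho> P'"
 have bound: "card P' \<le> Suc (nat \<lfloor>L / \<rho>\<rfloor>)" if "?Q P'" for P'
 proof (rule separated_reals_card)
  fix a b assume ab: "a \<in> P'" "b \<in> P'" "a < b"
  then have "\<rho> \<le> dg a b" using that by (auto simp: dsep_def)
  then show "\<rho> \<le> b - a" using dg_le_len[of a b] ab by simp
 qed (use that assms in auto)
 have "?Q P" using assms by auto
 moreover have "\<forall>P'. ?Q P' \<longrightarrow> card P' < Suc (Suc (nat \<lfloor>L / \<rho>\<rfloor>))" using bound by (meson less_Suc_eq_le)
 ultimately have "\<exists>P'. ?Q P' \<and> (\<forall>P''. ?Q P'' \<longrightarrow> card P'' \<le> card P')" by (rule ex_has_greatest_nat)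
 then obtain P' where P': "?Q P'" "\<And>P''. ?Q P'' \<Longrightarrow> card P'' \<le> card P'" by blast
 have "t \<in> P'" if "0 \<le> t" "t \<le> L" "dsep \<rho> (insert t P')" for t
 proof (rule ccontr)
  assume "t \<notin> P'"
  then have "card (insert t P') = Suc (card P')" using P' by simp
  moreover have "?Q (insert t P')" using that P' by auto
  ultimately show False using P'(2)[of "insert t P'"] by simp
 qed
 then have "part \<rho> P'" unfolding part_def using P'(1) assms by blast
 then show ?thesis using that P'(1) by blast
qed

text \<open>An arc of diameter above 2 \<rho> could be cut where the diameter of its first part, a
  continuous function of the cutting point, reaches \<rho>. The second part would keep more than
  \<rho>, against maximality.\<close>

lemma part_arc:
 assumes P: "part \<rho> P" and a: "a \<in> P" "a < L" and \<rho>: "\<rho> > 0"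
 shows "\<rho> \<le> dg a (nxt P a)" "dg a (nxt P a) \<le> 2 * \<rho>"
proof -
 have fin: "finite P" "L \<in> P" and sep: "dsep \<rho> P" and P0: "P \<subseteq> {0..L}"
  and mx: "\<And>t. 0 \<le> t \<Longrightarrow> t \<le> L \<Longrightarrow> dsep \<rho> (insert t P) \<Longrightarrow> t \<in> P" using P by (auto simp: part_def)
 define b where "b = nxt P a"
 note n = nxt_props[OF fin a(2), folded b_def]
 show "\<rho> \<le> dg a (nxt P a)" using sep a n by (auto simp: dsep_def b_def)
 show "dg a (nxt P a) \<le> 2 * \<rho>"
 proof (rule ccontr)
  assume "\<not> ?thesis"
  then have big: "dg a b > 2 * \<rho>" by (simp add: b_def)
  have cont: "continuous_on {a..b} (\<lambda>t. dg a t)"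
  proof (rule lipschitz_on_continuous_on[where L=1], rule lipschitz_onI)
   fix t u assume tu: "t \<in> {a..b}" "u \<in> {a..b}"
   have *: "\<bar>dg a t - dg a u\<bar> \<le> u - t" if "a \<le> t" "t \<le> u" for t u
    using dg_split[of a t u] dg_mono[of a t a u] dg_le_len[of t u] that by simp
   show "dist (dg a t) (dg a u) \<le> 1 * dist t u"
    using *[of t u] *[of u t] tu by (cases "t \<le> u") (auto simp: dist_real_def abs_minus_commute)
  qed simp
  have "dg a a \<le> 0" using dg_le_len[of a a] by simp
  then obtain t where t: "a \<le> t" "t \<le> b" "dg a t = \<rho>" using IVT'[of "\<lambda>t. dg a t" a \<rho> b] cont big \<rho> n by auto
  have tb: "dg t b > \<rho>" using dg_split[of a t b] t big by simp
  have "a \<noteq> t" "t \<noteq> b" using t \<rho> \<open>dg a a \<le> 0\<close> big by auto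
  then have at: "a < t" "t < b" using t by auto
  then have tP: "t \<notin> P" using n(4)[of t] by auto
  have "dsep \<rho> (insert t P)" unfolding dsep_def
  proof (intro ballI impI)
   fix c d assume cd: "c \<in> insert t P" "d \<in> insert t P" "c < d"
   consider "c \<in> P" "d \<in> P" | "c = t" "d \<in> P" | "c \<in> P" "d = t" using cd by auto
   then show "\<rho> \<le> dg c d"
   proof cases
    case 1
    then show ?thesis using sep cd by (auto simp: dsep_def)
   next
    case 2
    then have "b \<le> d" using n(4)[of d] at cd by simp
    then show ?thesis using dg_mono[of t b t d] tb at 2 by simp
   next
    case 3
    then have "c \<le> a" using n(4)[of c] at cd by force
    then show ?thesis using dg_mono[of a t c t] t at 3 by simp
   qed
  qed
  then have "t \<in> P" using mx[of t] at a P0 n by force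
  then show False using tP by simp
 qed
qed

end

section \<open>Deviation of arcs from their chords\<close>

context unif_convex_on
begin

text \<open>This constant and those derived from it are fixed before any curve is given, so they
  depend on s and cU alone.\<close>

definition Ksplit :: real
 where "Ksplit = (SOME K. K > 0 \<and> (\<forall>a b. a \<ge> 0 \<longrightarrow> b \<ge> 0 \<longrightarrow> (a + b) powr s \<le> 3/2 * a powr s + K * b powr s))"

lemma Ksplit: "Ksplit > 0" "a \<ge> 0 \<Longrightarrow> b \<ge> 0 \<Longrightarrow> (a + b) powr s \<le> 3/2 * a powr s + Ksplit * b powr s"
proof -
 have "\<exists>K. K > 0 \<and> (\<forall>a b. a \<ge> 0 \<longrightarrow> b \<ge> 0 \<longrightarrow> (a + b) powr s \<le> 3/2 * a powr s + K * b powr s)"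
  using powr_add_split[of s] s_ge by (metis one_le_numeral order_trans)
 then have "Ksplit > 0 \<and> (\<forall>a b. a \<ge> 0 \<longrightarrow> b \<ge> 0 \<longrightarrow> (a + b) powr s \<le> 3/2 * a powr s + Ksplit * b powr s)"
  unfolding Ksplit_def by (rule someI_ex)
 then show "Ksplit > 0" "a \<ge> 0 \<Longrightarrow> b \<ge> 0 \<Longrightarrow> (a + b) powr s \<le> 3/2 * a powr s + Ksplit * b powr s" by auto
qed

definition KZ :: real where "KZ = Ksplit * (2 powr (s - 1) / cU)"
definition CZ :: real where "CZ = 3 * 2 powr s + 4 * KZ"
definition Knew :: real where "Knew = 10 * (2 / cU + 2 powr s)"
definition KT :: real where "KT = Ksplit * 128 powr s"
definition CT :: real where "CT = 4 * 2 powr s + 4 * (2 * KT * (2 * CZ + 2 powr s) + 2 * 8 powr s * (CZ + 2 powr s) + Knew)"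

lemma dir_change:
 assumes "x \<in> V" "y \<in> V" "k \<ge> 0" "N (x - k *\<^sub>R y) \<le> e" "e < N x"
 shows "N x * N (dir x - dir y) \<le> 2 * e"
proof -
 have "k *\<^sub>R y \<noteq> 0" using assms by auto
 then have k: "k > 0" "k *\<^sub>R y \<noteq> 0" using assms by auto
 have "N x * N (dir x - dir (k *\<^sub>R y)) \<le> 2 * N (x - k *\<^sub>R y)" using assms k by (intro dir_perturb) auto
 then show ?thesis using assms k by (simp add: dir_scale)
qed

end

locale filtration = curve_on +
 fixes \<rho> :: "nat \<Rightarrow> real" and P :: "nat \<Rightarrow> real set"
 assumes \<rho>_pos: "\<rho> j > 0" and \<rho>_half: "\<rho> j = 2 * \<rho> (Suc j)"
  and P_part: "part (\<rho> j) (P j)" and P_mono: "P j \<subseteq> P (Suc j)"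
begin

definition Q :: "nat \<Rightarrow> real set" where "Q j = P j - {L}"
definition I :: "nat \<Rightarrow> real set" where "I j = P j - {0, L}"
abbreviation nx :: "nat \<Rightarrow> real \<Rightarrow> real" where "nx j \<equiv> nxt (P j)"
abbreviation pv :: "nat \<Rightarrow> real \<Rightarrow> real" where "pv j \<equiv> prv (P j)"

lemma P_fin: "finite (P j)" and P_sub: "P j \<subseteq> {0..L}" and P_ends: "0 \<in> P j" "L \<in> P j"
 using P_part[of j] by (auto simp: part_def)

lemma Q_fin: "finite (Q j)" and I_fin: "finite (I j)"
 using P_fin by (auto simp: Q_def I_def)

lemma Q_lt: "a \<in> Q j \<Longrightarrow> a < L" "a \<in> Q j \<Longrightarrow> 0 \<le> a" "a \<in> Q j \<Longrightarrow> a \<in> P j"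
 using P_sub[of j] by (force simp: Q_def)+

lemma nx: 
 assumes "a \<in> Q j"
 shows "nx j a \<in> P j" "a < nx j a" "nx j a \<le> L" "\<And>b. b \<in> P j \<Longrightarrow> a < b \<Longrightarrow> nx j a \<le> b"
 using nxt_props[OF P_fin[of j] P_ends(2)[of j] Q_lt(1)[OF assms]] by auto

lemma pv:
 assumes "v \<in> I j"
 shows "pv j v \<in> Q j" "pv j v < v" "nx j (pv j v) = v" "v \<in> Q j" "0 < v" "v < L"
proof -
 have v: "0 < v" "v < L" "v \<in> P j" using assms P_sub[of j] by (force simp: I_def)+
 note p = prv_props[OF P_fin[of j] P_ends(1)[of j] v(1)]
 show "pv j v < v" by (rule p(2))
 show "pv j v \<in> Q j" using p v by (auto simp: Q_def)
 show "nx j (pv j v) = v" by (rule nxt_prv[OF P_fin P_ends(1) v(1,3)])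
 show "v \<in> Q j" "0 < v" "v < L" using v by (auto simp: Q_def)
qed

lemma arc: "a \<in> Q j \<Longrightarrow> \<rho> j \<le> dg a (nx j a)" "a \<in> Q j \<Longrightarrow> dg a (nx j a) \<le> 2 * \<rho> j"
 using part_arc[OF P_part _ _ \<rho>_pos] Q_lt by auto

definition chord :: "nat \<Rightarrow> real \<Rightarrow> real"
 where "chord j a = N (g (nx j a) - g a)"

definition kids :: "nat \<Rightarrow> real \<Rightarrow> real set"
 where "kids j a = P (Suc j) \<inter> {a..<nx j a}"

text \<open>The growth of the inscribed polygon over one arc under refinement. Deviations and angles
  are charged to it, and its sum over all arcs and scales telescopes to at most L.\<close>

definition exc :: "nat \<Rightarrow> real \<Rightarrow> real"
 where "exc j a = (\<Sum>c\<in>kids j a. chord (Suc j) c) - chord j a"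

definition len :: "nat \<Rightarrow> real"
 where "len j = (\<Sum>a\<in>Q j. chord j a)"

lemma chain_le: "x \<in> P j \<Longrightarrow> y \<in> P j \<Longrightarrow> x \<le> y \<Longrightarrow> N (g y - g x) \<le> (\<Sum>a\<in>P j \<inter> {x..<y}. chord j a)"
 unfolding chord_def
proof (rule chain_subadditive[OF P_fin, where g="\<lambda>x y. N (g y - g x)"])
 show "N (g z - g x) \<le> N (g y - g x) + N (g z - g y)" for x y z
  using N_diff_triangle[of "g z" "g y" "g x"] by simp
qed auto

lemma widths: "(\<Sum>a\<in>Q j. nx j a - a) = L"
proof -
 have eq: "P j \<inter> {0..<L} = Q j" using P_sub[of j] by (auto simp: Q_def)
 have "- (L - 0) \<le> (\<Sum>a\<in>P j \<inter> {0..<L}. - (nx j a - a))"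
  by (rule chain_subadditive[OF P_fin P_ends, where g="\<lambda>x y. - (y - x)"]) (use L_pos in auto)
 moreover have "L - 0 \<le> (\<Sum>a\<in>P j \<inter> {0..<L}. nx j a - a)"
  by (rule chain_subadditive[OF P_fin P_ends, where g="\<lambda>x y. y - x"]) (use L_pos in auto)
 ultimately show ?thesis unfolding eq sum_negf by simp
qed

lemma len_le: "len j \<le> L"
proof -
 have "len j \<le> (\<Sum>a\<in>Q j. nx j a - a)" unfolding len_def chord_def
 proof (rule sum_mono)
  fix a assume "a \<in> Q j"
  then show "N (g (nx j a) - g a) \<le> nx j a - a" using g_lip[of "nx j a" a] nx(2)[of a j] by simp
 qed
 then show ?thesis by (simp add: widths)
qed

lemma card_Q: "real (card (Q j)) * \<rho> j \<le> L"
proof -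
 have "(\<Sum>a\<in>Q j. \<rho> j) \<le> (\<Sum>a\<in>Q j. nx j a - a)"
 proof (rule sum_mono)
  fix a assume "a \<in> Q j"
  then show "\<rho> j \<le> nx j a - a" using arc(1)[of a j] dg_le_len[of a "nx j a"] nx(2)[of a j] by simp
 qed
 then show ?thesis by (simp add: widths)
qed

lemma sum_kids: "(\<Sum>c\<in>Q (Suc j). f c) = (\<Sum>a\<in>Q j. \<Sum>c\<in>kids j a. f c)"
 unfolding Q_def kids_def by (rule sum_parents[where z=0]) (use P_fin P_mono P_sub P_ends in auto)

lemma sum_exc: "(\<Sum>a\<in>Q j. exc j a) = len (Suc j) - len j"
 by (simp add: exc_def sum_subtractf len_def sum_kids)

lemma kids_props: "a \<in> Q j \<Longrightarrow> c \<in> kids j a \<Longrightarrow> c \<in> Q (Suc j) \<and> a \<le> c \<and> c < nx j a \<and> nx (Suc j) c \<le> nx j a"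
proof -
 assume a: "a \<in> Q j" and c: "c \<in> kids j a"
 then have c': "c \<in> P (Suc j)" "a \<le> c" "c < nx j a" by (auto simp: kids_def)
 then have cQ: "c \<in> Q (Suc j)" using nx(3)[OF a] by (auto simp: Q_def)
 have "nx j a \<in> P (Suc j)" using nx(1)[OF a] P_mono by auto
 then show ?thesis using c' cQ nx(4)[OF cQ, of "nx j a"] by auto
qed

lemma kids_fin: "finite (kids j a)"
 using P_fin by (auto simp: kids_def)

text \<open>The path from a over u, v, w to the end of the arc is no longer than the refined
  polygon. By the triangle inequality it exceeds the chord of the arc by at least the excess at
  v.\<close>

lemma exc_three:
 assumes a: "a \<in> Q j" and u: "u \<in> P (Suc j)" "v \<in> P (Suc j)" "w \<in> P (Suc j)" "a \<le> u" "u \<le> v" "v \<le> w" "w \<le> nx j a"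
 shows "N (g v - g u) + N (g w - g v) - N (g w - g u) \<le> exc j a"
proof -
 let ?b = "nx j a"
 have ab: "a \<in> P (Suc j)" "?b \<in> P (Suc j)" using a nx(1)[OF a] P_mono[of j] Q_lt(3)[OF a] by auto
 have split: "(\<Sum>c\<in>P (Suc j) \<inter> {x..<z}. chord (Suc j) c) =
   (\<Sum>c\<in>P (Suc j) \<inter> {x..<y}. chord (Suc j) c) + (\<Sum>c\<in>P (Suc j) \<inter> {y..<z}. chord (Suc j) c)"
  if "x \<le> y" "y \<le> z" for x y z
 proof -
  have "P (Suc j) \<inter> {x..<z} = P (Suc j) \<inter> {x..<y} \<union> P (Suc j) \<inter> {y..<z}" using that by auto
  then show ?thesis using P_fin[of "Suc j"] by (simp only:) (rule sum.union_disjoint, auto)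
 qed
 have "(\<Sum>c\<in>kids j a. chord (Suc j) c) = (\<Sum>c\<in>P (Suc j) \<inter> {a..<u}. chord (Suc j) c)
  + ((\<Sum>c\<in>P (Suc j) \<inter> {u..<v}. chord (Suc j) c) + ((\<Sum>c\<in>P (Suc j) \<inter> {v..<w}. chord (Suc j) c)
  + (\<Sum>c\<in>P (Suc j) \<inter> {w..<?b}. chord (Suc j) c)))"
  unfolding kids_def using u split[of a u ?b] split[of u v ?b] split[of v w ?b] by simp
 also have "\<dots> \<ge> N (g u - g a) + (N (g v - g u) + (N (g w - g v) + N (g ?b - g w)))"
  using u ab by (intro add_mono chain_le) auto
 finally have "N (g u - g a) + (N (g v - g u) + (N (g w - g v) + N (g ?b - g w))) \<le> exc j a + chord j a"
  by (simp add: exc_def)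
 moreover have "chord j a \<le> N (g ?b - g w) + N (g w - g a)" "N (g w - g a) \<le> N (g w - g u) + N (g u - g a)"
  unfolding chord_def by (auto intro!: N_diff_triangle)
 ultimately show ?thesis by linarith
qed

lemma exc_nonneg: "a \<in> Q j \<Longrightarrow> 0 \<le> exc j a"
 using exc_three[of a j a a a] Q_lt(3)[of a j] P_mono[of j] nx(2)[of a j] by auto

section \<open>Largest deviation of an arc from its chord\<close>

definition esup :: "real \<Rightarrow> real \<Rightarrow> real"
 where "esup a b = (SUP t\<in>{a..b}. sdist (g t) (g a) (g b))"

definition e :: "nat \<Rightarrow> real \<Rightarrow> real"
 where "e j a = esup a (nx j a)"

lemma esup_ge: "a \<le> t \<Longrightarrow> t \<le> b \<Longrightarrow> sdist (g t) (g a) (g b) \<le> esup a b"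
 unfolding esup_def
proof (rule cSUP_upper)
 show "bdd_above ((\<lambda>t. sdist (g t) (g a) (g b)) ` {a..b})"
 proof (rule bdd_aboveI2)
  fix t assume "t \<in> {a..b}"
  then show "sdist (g t) (g a) (g b) \<le> dg a b"
   using sdist_le_left[of "g t" "g a" "g b"] dg_ge[of a t b a] by auto
 qed
qed auto

lemma esup_le: "a \<le> b \<Longrightarrow> (\<And>t. a \<le> t \<Longrightarrow> t \<le> b \<Longrightarrow> sdist (g t) (g a) (g b) \<le> c) \<Longrightarrow> esup a b \<le> c"
 unfolding esup_def by (rule cSUP_least) auto

lemma esup_nonneg: "a \<le> b \<Longrightarrow> 0 \<le> esup a b"
 using esup_ge[of a a b] by simp

lemma e_nonneg: "a \<in> Q j \<Longrightarrow> 0 \<le> e j a"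
 unfolding e_def using nx(2)[of a j] by (intro esup_nonneg) auto

lemma e_le: "a \<in> Q j \<Longrightarrow> e j a \<le> 2 * \<rho> j"
 unfolding e_def
proof (rule esup_le)
 assume a: "a \<in> Q j"
 show "a \<le> nx j a" using nx(2)[OF a] by simp
 show "sdist (g t) (g a) (g (nx j a)) \<le> 2 * \<rho> j" if "a \<le> t" "t \<le> nx j a" for t
  using sdist_le_left[of "g t" "g a" "g (nx j a)"] dg_ge[of a t "nx j a" a] arc(2)[OF a] that by auto
qed

text \<open>Since arcs have diameter at least \<rho>, small deviation forces a long chord; an arc
  with a short chord can thus always be charged to its deviation.\<close>

lemma dg_le_chord_esup:
 assumes "a \<le> b"
 shows "dg a b \<le> N (g b - g a) + 2 * esup a b"
proof (rule dg_le[OF assms])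
 fix t u assume tu: "a \<le> t" "t \<le> b" "a \<le> u" "u \<le> b"
 obtain l where l: "0 \<le> l" "l \<le> 1" "sdist (g t) (g a) (g b) = N (g t - (g a + l *\<^sub>R (g b - g a)))"
  using sdist_attained[of "g t" "g a" "g b"] by auto
 obtain m where m: "0 \<le> m" "m \<le> 1" "sdist (g u) (g a) (g b) = N (g u - (g a + m *\<^sub>R (g b - g a)))"
  using sdist_attained[of "g u" "g a" "g b"] by auto
 have "(g a + l *\<^sub>R (g b - g a)) - (g a + m *\<^sub>R (g b - g a)) = (l - m) *\<^sub>R (g b - g a)"
  by (simp add: algebra_simps)
 then have "N ((g a + l *\<^sub>R (g b - g a)) - (g a + m *\<^sub>R (g b - g a))) = \<bar>l - m\<bar> * N (g b - g a)"
  by (simp add: N_scale)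
 also have "\<dots> \<le> 1 * N (g b - g a)" using l m by (intro mult_right_mono) auto
 finally have 1: "N ((g a + l *\<^sub>R (g b - g a)) - (g a + m *\<^sub>R (g b - g a))) \<le> N (g b - g a)" by simp
 have "N (g t - g u) \<le> N (g t - (g a + l *\<^sub>R (g b - g a))) + N ((g a + l *\<^sub>R (g b - g a)) - g u)"
  by (rule N_diff_triangle) auto
 moreover have "N ((g a + l *\<^sub>R (g b - g a)) - g u) \<le>
   N ((g a + l *\<^sub>R (g b - g a)) - (g a + m *\<^sub>R (g b - g a))) + N ((g a + m *\<^sub>R (g b - g a)) - g u)"
  by (rule N_diff_triangle) auto
 moreover have "N ((g a + m *\<^sub>R (g b - g a)) - g u) = sdist (g u) (g a) (g b)"
  using m(3) by (simp add: N_commute)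
 ultimately show "N (g t - g u) \<le> N (g b - g a) + 2 * esup a b"
  using 1 l(3) esup_ge[OF tu(1,2)] esup_ge[OF tu(3,4)] by linarith
qed

lemma chord_ge: "a \<in> Q j \<Longrightarrow> \<rho> j \<le> chord j a + 2 * e j a"
 using dg_le_chord_esup[of a "nx j a"] arc(1)[of a j] nx(2)[of a j] by (simp add: chord_def e_def)

lemma chord_le: "a \<in> Q j \<Longrightarrow> chord j a \<le> 2 * \<rho> j"
 using dg_ge[of a "nx j a" "nx j a" a] arc(2)[of a j] nx(2)[of a j] by (simp add: chord_def)

lemma kid_dev:
 assumes a: "a \<in> Q j" and z: "z \<in> P (Suc j)" "a \<le> z" "z \<le> nx j a"
 shows "sdist (g z) (g a) (g (nx j a)) powr s \<le> 2 powr (s - 1) / cU * (\<rho> j powr (s - 1) * exc j a)"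
proof -
 have ab: "a \<in> P (Suc j)" "nx j a \<in> P (Suc j)" using a nx(1)[OF a] P_mono[of j] Q_lt(3)[OF a] by auto
 have d: "N (g z - g a) \<le> 2 * \<rho> j" "N (g (nx j a) - g z) \<le> 2 * \<rho> j"
  using dg_ge[of a z "nx j a" a] dg_ge[of a "nx j a" "nx j a" z] arc(2)[OF a] z nx(2)[OF a] by auto
 have "cU * sdist (g z) (g a) (g (nx j a)) powr s \<le>
   (2 * \<rho> j) powr (s - 1) * (N (g z - g a) + N (g (nx j a) - g z) - N (g (nx j a) - g a))"
  by (rule excess_sdist) (use d in auto)
 also have "\<dots> \<le> (2 * \<rho> j) powr (s - 1) * exc j a"
  by (intro mult_left_mono exc_three[OF a]) (use ab z in auto)
 also have "\<dots> = 2 powr (s - 1) * (\<rho> j powr (s - 1) * exc j a)" by (simp add: powr_mult)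
 finally show ?thesis using cU_pos by (simp add: field_simps)
qed

text \<open>A point of the arc is close to the chord of the child arc containing it, and the ends of
  that chord are close to the chord of the parent by \<open>kid_dev\<close>. Only one child matters
  for each point, so the sum over all children is a generous bound for the maximum.\<close>

lemma e_step:
 assumes a: "a \<in> Q j"
 shows "e j a powr s \<le> 3/2 * (\<Sum>c\<in>kids j a. e (Suc j) c powr s) + KZ * (\<rho> j powr (s - 1) * exc j a)"
  (is "_ \<le> ?R")
proof -
 let ?b = "nx j a" and ?X = "2 powr (s - 1) / cU * (\<rho> j powr (s - 1) * exc j a)"
 have X0: "?X \<ge> 0" using exc_nonneg[OF a] cU_pos by simp
 have S0: "(\<Sum>c\<in>kids j a. e (Suc j) c powr s) \<ge> 0" by (rule sum_nonneg) simp
 have KX: "Ksplit * ?X = KZ * (\<rho> j powr (s - 1) * exc j a)" by (simp add: KZ_def)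
 have "0 \<le> Ksplit * ?X" by (rule mult_nonneg_nonneg[OF less_imp_le[OF Ksplit(1)] X0])
 then have R0: "?R \<ge> 0" using S0 unfolding KX by simp
 have s0: "s > 0" using s_ge by simp
 have "sdist (g t) (g a) (g ?b) powr s \<le> ?R" if t: "a \<le> t" "t \<le> ?b" for t
 proof (cases "t = ?b")
  case True
  then show ?thesis using R0 s0 by simp
 next
  case False
  define K where "K = {q \<in> P (Suc j). q \<le> t}"
  define c where "c = Max K"
  have aP: "a \<in> P (Suc j)" using P_mono[of j] Q_lt(3)[OF a] by auto
  have K: "finite K" "a \<in> K" using P_fin[of "Suc j"] aP t by (auto simp: K_def)
  have "c \<in> K" unfolding c_def using K by (intro Max_in) auto
  moreover have cm: "q \<le> c" if "q \<in> K" for q unfolding c_def using K that by (intro Max_ge) auto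
  ultimately have c: "c \<in> kids j a" "c \<le> t" using False t K by (auto simp: K_def kids_def)
  note kp = kids_props[OF a c(1)]
  have cQ: "c \<in> Q (Suc j)" using kp by simp
  have tn: "t < nx (Suc j) c" using cm[of "nx (Suc j) c"] nx(1,2)[OF cQ] by (force simp: K_def)
  let ?\<delta> = "?X powr (1/s)"
  have "(y powr (1/s)) powr s = y" if "y \<ge> 0" for y using s0 that by (simp add: powr_powr)
  from this[OF X0] have \<delta>s: "?\<delta> powr s = ?X" .
  have dv: "sdist (g z) (g a) (g ?b) \<le> ?\<delta>" if "z \<in> P (Suc j)" "a \<le> z" "z \<le> ?b" for z
  proof -
   have "(sdist (g z) (g a) (g ?b) powr s) powr (1/s) \<le> ?\<delta>"
    using kid_dev[OF a that] s0 by (intro powr_mono2) auto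
   then show ?thesis using s0 by (simp add: powr_powr)
  qed
  have "sdist (g t) (g a) (g ?b) \<le> sdist (g t) (g c) (g (nx (Suc j) c)) + ?\<delta>"
   by (rule sdist_transfer) (use dv[of c] dv[of "nx (Suc j) c"] kp nx(1,2)[OF cQ] Q_lt(3)[OF cQ] in auto)
  also have "sdist (g t) (g c) (g (nx (Suc j) c)) \<le> e (Suc j) c"
   unfolding e_def using c tn by (intro esup_ge) auto
  finally have "sdist (g t) (g a) (g ?b) powr s \<le> (e (Suc j) c + ?\<delta>) powr s"
   using s0 by (intro powr_mono2) auto
  also have "\<dots> \<le> 3/2 * e (Suc j) c powr s + Ksplit * ?\<delta> powr s" using e_nonneg[OF cQ] by (intro Ksplit) auto
  also have "e (Suc j) c powr s \<le> (\<Sum>c\<in>kids j a. e (Suc j) c powr s)"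
   using c kids_fin by (intro member_le_sum) auto
  finally show ?thesis unfolding \<delta>s KX by simp
 qed
 then have *: "sdist (g t) (g a) (g ?b) \<le> ?R powr (1/s)" if "a \<le> t" "t \<le> ?b" for t
 proof -
  have "(sdist (g t) (g a) (g ?b) powr s) powr (1/s) \<le> ?R powr (1/s)"
   using \<open>\<And>t. a \<le> t \<Longrightarrow> t \<le> ?b \<Longrightarrow> sdist (g t) (g a) (g ?b) powr s \<le> ?R\<close> that s0 by (intro powr_mono2) auto
  then show ?thesis using s0 by (simp add: powr_powr)
 qed
 have "e j a \<le> ?R powr (1/s)" unfolding e_def[of j a] using nx(2)[OF a] * by (intro esup_le) auto
 then have "e j a powr s \<le> (?R powr (1/s)) powr s" using e_nonneg[OF a] s0 by (intro powr_mono2) auto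
 then show ?thesis using s0 R0 by (simp add: powr_powr)
qed

text \<open>The factor \<rho>^(1 - s) gives every term the dimension of a length. Because s \<ge> 2
  it at least doubles from one scale to the next, which turns the factor 3/2 of
  \<open>e_step\<close> into 3/4.\<close>

definition Z :: "nat \<Rightarrow> real"
 where "Z j = (\<Sum>a\<in>Q j. e j a powr s) * \<rho> j powr (1 - s)"

lemma Z_nonneg: "0 \<le> Z j"
 unfolding Z_def by (intro mult_nonneg_nonneg sum_nonneg) auto

lemma \<rho>_powr: "\<rho> j powr (1 - s) \<le> 1/2 * \<rho> (Suc j) powr (1 - s)"
proof -
 have 1: "\<rho> j powr (1 - s) = 2 powr (1 - s) * \<rho> (Suc j) powr (1 - s)" by (subst \<rho>_half) (simp add: powr_mult)
 have "(2::real) powr (1 - s) \<le> 2 powr (-1)" using s_ge by (intro powr_mono) auto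
 then have "2 powr (1 - s) \<le> 1/2" by (simp add: powr_minus)
 then have "2 powr (1 - s) * \<rho> (Suc j) powr (1 - s) \<le> 1/2 * \<rho> (Suc j) powr (1 - s)"
  by (rule mult_right_mono) simp
 with 1 show ?thesis by simp
qed

lemma Z_step: "Z j \<le> 3/4 * Z (Suc j) + KZ * (len (Suc j) - len j)"
proof -
 have "(\<Sum>a\<in>Q j. e j a powr s) \<le> (\<Sum>a\<in>Q j. 3/2 * (\<Sum>c\<in>kids j a. e (Suc j) c powr s) + KZ * (\<rho> j powr (s - 1) * exc j a))"
  by (intro sum_mono e_step)
 also have "\<dots> = 3/2 * (\<Sum>c\<in>Q (Suc j). e (Suc j) c powr s) + KZ * \<rho> j powr (s - 1) * (len (Suc j) - len j)"
  by (simp only: sum.distrib sum_distrib_left[symmetric] sum_kids sum_exc mult.assoc)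
 finally have "Z j \<le> (3/2 * (\<Sum>c\<in>Q (Suc j). e (Suc j) c powr s) + KZ * \<rho> j powr (s - 1) * (len (Suc j) - len j)) * \<rho> j powr (1 - s)"
  unfolding Z_def by (intro mult_right_mono) auto
 also have "\<dots> = 3/2 * (\<Sum>c\<in>Q (Suc j). e (Suc j) c powr s) * \<rho> j powr (1 - s)
   + KZ * (len (Suc j) - len j) * (\<rho> j powr (s - 1) * \<rho> j powr (1 - s))"
  by (simp add: algebra_simps)
 also have "\<rho> j powr (s - 1) * \<rho> j powr (1 - s) = 1" using \<rho>_pos[of j] by (simp add: powr_add[symmetric])
 also have "3/2 * (\<Sum>c\<in>Q (Suc j). e (Suc j) c powr s) * \<rho> j powr (1 - s)
   \<le> 3/2 * (\<Sum>c\<in>Q (Suc j). e (Suc j) c powr s) * (1/2 * \<rho> (Suc j) powr (1 - s))"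
  by (intro mult_left_mono \<rho>_powr mult_nonneg_nonneg sum_nonneg) auto
 finally show ?thesis by (simp add: Z_def)
qed

lemma Z_le: "Z j \<le> 2 powr s * L"
proof -
 have "(\<Sum>a\<in>Q j. e j a powr s) \<le> (\<Sum>a\<in>Q j. (2 * \<rho> j) powr s)"
  using e_le e_nonneg s_ge by (intro sum_mono powr_mono2) auto
 then have "Z j \<le> (\<Sum>a\<in>Q j. (2 * \<rho> j) powr s) * \<rho> j powr (1 - s)"
  unfolding Z_def by (intro mult_right_mono) auto
 also have "\<dots> = 2 powr s * (real (card (Q j)) * (\<rho> j powr s * \<rho> j powr (1 - s)))" by (simp add: powr_mult)
 also have "\<rho> j powr s * \<rho> j powr (1 - s) = \<rho> j" using \<rho>_pos[of j] by (simp add: powr_add[symmetric])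
 also have "2 powr s * (real (card (Q j)) * \<rho> j) \<le> 2 powr s * L" by (intro mult_left_mono card_Q) auto
 finally show ?thesis .
qed

lemma len_telescope: "(\<Sum>j<n. len (Suc j) - len j) \<le> L"
proof -
 have "(\<Sum>j<n. len (Suc j) - len j) = len n - len 0" by (rule sum_lessThan_telescope)
 moreover have "0 \<le> len 0" unfolding len_def chord_def by (intro sum_nonneg) auto
 ultimately show ?thesis using len_le[of n] by simp
qed

lemma KZ_nonneg: "0 \<le> KZ"
 using Ksplit(1) cU_pos by (simp add: KZ_def)

lemma Z_sum: "(\<Sum>j<n. Z j) \<le> CZ * L"
proof -
 have "(\<Sum>j<n. Z j) \<le> 3 * Z n + 4 * (\<Sum>j<n. KZ * (len (Suc j) - len j))"
  by (rule geometric_backward[where Z=Z and \<Delta>="\<lambda>j. KZ * (len (Suc j) - len j)", OF Z_step Z_nonneg])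
 also have "(\<Sum>j<n. KZ * (len (Suc j) - len j)) = KZ * (\<Sum>j<n. len (Suc j) - len j)"
  by (simp add: sum_distrib_left)
 also have "\<dots> \<le> KZ * L" by (intro mult_left_mono len_telescope KZ_nonneg)
 finally show ?thesis using Z_le[of n] by (simp add: CZ_def algebra_simps)
qed

end

section \<open>Turning between consecutive arcs\<close>

context filtration
begin

definition dL :: "nat \<Rightarrow> real \<Rightarrow> 'a" where "dL j v = dir (g v - g (pv j v))"
definition dR :: "nat \<Rightarrow> real \<Rightarrow> 'a" where "dR j v = dir (g (nx j v) - g v)"
text \<open>A general norm provides no angles, so the turn at v is measured by the distance between
  the unit directions of the two chords meeting there.\<close>

definition \<theta> :: "nat \<Rightarrow> real \<Rightarrow> real" where "\<theta> j v = N (dL j v - dR j v)"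

lemma dLR_in [simp]: "dL j v \<in> V" "dR j v \<in> V"
 by (simp_all add: dL_def dR_def)

lemma \<theta>_nonneg [simp]: "0 \<le> \<theta> j v"
 by (simp add: \<theta>_def)

lemma \<theta>_le2: "\<theta> j v \<le> 2"
 unfolding \<theta>_def dL_def dR_def by (rule N_dir_diff_le) auto

text \<open>If d and d' are below \<rho> / 16, the finer chord is long and its direction is stable.
  Otherwise the right side is at least 2, the largest possible difference of directions.\<close>

lemma dir_step:
 assumes "x \<in> V" "y \<in> V" "k \<ge> 0" "N (x - k *\<^sub>R y) \<le> d" "\<rho> (Suc j) \<le> N x + 2 * d'" "0 \<le> d" "0 \<le> d'"
 shows "N (dir x - dir y) \<le> 32 * (d + d') / \<rho> j"
proof (cases "d < \<rho> j / 16 \<and> d' < \<rho> j / 16")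
 case True
 have rp: "\<rho> j > 0" by (rule \<rho>_pos)
 have Nx: "N x \<ge> \<rho> j / 4" using assms(5) True \<rho>_half[of j] rp by linarith
 then have "d < N x" using True rp by linarith
 then have "N x * N (dir x - dir y) \<le> 2 * d" using assms by (intro dir_change) auto
 moreover have "\<rho> j / 4 * N (dir x - dir y) \<le> N x * N (dir x - dir y)"
  using Nx by (intro mult_right_mono) auto
 ultimately have "\<rho> j / 4 * N (dir x - dir y) \<le> 2 * d" by linarith
 then have "N (dir x - dir y) * \<rho> j \<le> 8 * d" by (simp add: mult.commute)
 also have "8 * d \<le> 32 * (d + d')" using assms by simp
 finally show ?thesis using rp by (simp add: pos_le_divide_eq)
next
 case False
 have rp: "\<rho> j > 0" by (rule \<rho>_pos)
 have "2 * \<rho> j \<le> 32 * (d + d')" using False assms by auto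
 moreover have "N (dir x - dir y) * \<rho> j \<le> 2 * \<rho> j"
  using N_dir_diff_le[OF assms(1,2)] rp by (intro mult_right_mono) auto
 ultimately have "N (dir x - dir y) * \<rho> j \<le> 32 * (d + d')" by linarith
 then show ?thesis using rp by (simp add: pos_le_divide_eq)
qed

lemma e_near:
 assumes "a \<in> Q j" "a \<le> t" "t \<le> nx j a"
 obtains l where "0 \<le> l" "l \<le> 1" "N (g t - (g a + l *\<^sub>R (g (nx j a) - g a))) \<le> e j a"
proof -
 obtain l where l: "0 \<le> l" "l \<le> 1" "sdist (g t) (g a) (g (nx j a)) = N (g t - (g a + l *\<^sub>R (g (nx j a) - g a)))"
  using sdist_attained[of "g t" "g a" "g (nx j a)"] by auto
 moreover have "sdist (g t) (g a) (g (nx j a)) \<le> e j a" unfolding e_def using assms by (intro esup_ge) auto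
 ultimately show ?thesis using that[of l] by simp
qed

lemma I_Suc: "v \<in> I j \<Longrightarrow> v \<in> I (Suc j)"
 using P_mono[of j] by (auto simp: I_def)

definition err :: "nat \<Rightarrow> real \<Rightarrow> real"
 where "err j v = e j (pv j v) + e (Suc j) (pv (Suc j) v) + e j v + e (Suc j) v"

text \<open>The finer neighbours of v lie on the two old arcs at v, so both directions change only
  by the deviations of these arcs and of the new ones, relative to \<rho>.\<close>

lemma \<theta>_step:
 assumes v: "v \<in> I j"
 shows "\<theta> (Suc j) v \<le> \<theta> j v + 32 * err j v / \<rho> j"
proof -
 note p = pv[OF v] and p' = pv[OF I_Suc[OF v]]
 have u: "pv j v \<le> pv (Suc j) v"
 proof -
  have "pv j v \<in> P (Suc j)" using p(1) P_mono[of j] by (auto simp: Q_def)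
  then show ?thesis using prv_props(4)[OF P_fin[of "Suc j"] P_ends(1)[of "Suc j"] p(5) _ p(2)] by simp
 qed
 have w: "nx (Suc j) v \<le> nx j v" using nx(4)[OF p'(4), of "nx j v"] nx(1,2)[OF p(4)] P_mono[of j] by auto
 have R: "N (dR (Suc j) v - dR j v) \<le> 32 * (e j v + e (Suc j) v) / \<rho> j"
 proof -
  obtain l where l: "0 \<le> l" "l \<le> 1" "N (g (nx (Suc j) v) - (g v + l *\<^sub>R (g (nx j v) - g v))) \<le> e j v"
   using e_near[OF p(4), of "nx (Suc j) v"] nx(2)[OF p'(4)] w by auto
  have "N ((g (nx (Suc j) v) - g v) - l *\<^sub>R (g (nx j v) - g v)) \<le> e j v"
   using l(3) by (simp add: diff_diff_eq)
  then show ?thesis unfolding dR_def using l(1) chord_ge[OF p'(4)] e_nonneg[OF p(4)] e_nonneg[OF p'(4)]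
   by (intro dir_step[where k=l]) (auto simp: chord_def)
 qed
 have Lf: "N (dL (Suc j) v - dL j v) \<le> 32 * (e j (pv j v) + e (Suc j) (pv (Suc j) v)) / \<rho> j"
 proof -
  have "pv (Suc j) v \<le> nx j (pv j v)" using p(3) p'(2) by simp
  from e_near[OF p(1) u this] obtain l where l: "0 \<le> l" "l \<le> 1"
   "N (g (pv (Suc j) v) - (g (pv j v) + l *\<^sub>R (g v - g (pv j v)))) \<le> e j (pv j v)" unfolding p(3) by blast
  have eq: "(g v - g (pv (Suc j) v)) - (1 - l) *\<^sub>R (g v - g (pv j v))
    = - (g (pv (Suc j) v) - (g (pv j v) + l *\<^sub>R (g v - g (pv j v))))"
   by (simp add: algebra_simps)
  have "N ((g v - g (pv (Suc j) v)) - (1 - l) *\<^sub>R (g v - g (pv j v))) \<le> e j (pv j v)"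
   using l(3) by (simp only: eq N_minus)
  then show ?thesis
   unfolding dL_def using l(2) chord_ge[OF p'(1)] e_nonneg[OF p(1)] e_nonneg[OF p'(1)] p'(3)
   by (intro dir_step[where k="1 - l"]) (auto simp: chord_def)
 qed
 have "\<theta> (Suc j) v \<le> N (dL (Suc j) v - dL j v) + N (dL j v - dR (Suc j) v)"
  unfolding \<theta>_def by (rule N_diff_triangle) auto
 also have "N (dL j v - dR (Suc j) v) \<le> \<theta> j v + N (dR j v - dR (Suc j) v)"
  unfolding \<theta>_def by (rule N_diff_triangle) auto
 finally show ?thesis
  using R Lf by (simp add: err_def N_commute[of "dR j v"] add_divide_distrib distrib_left)
qed

lemma sum_pv: "(\<Sum>v\<in>I j. f (pv j v)) \<le> (\<Sum>a\<in>Q j. f a)" if "\<And>a. f a \<ge> 0" for f :: "real \<Rightarrow> real"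
proof -
 have inj: "inj_on (pv j) (I j)" by (rule inj_on_inverseI[where g="nx j"]) (rule pv(3))
 have "(\<Sum>v\<in>I j. f (pv j v)) = (\<Sum>a\<in>pv j ` I j. f a)" using inj by (simp add: sum.reindex)
 also have "\<dots> \<le> (\<Sum>a\<in>Q j. f a)" using that pv(1) Q_fin by (intro sum_mono2) auto
 finally show ?thesis .
qed

lemma sum_I: "(\<Sum>v\<in>I j. f v) \<le> (\<Sum>a\<in>Q j. f a)" if "\<And>a. f a \<ge> 0" for f :: "real \<Rightarrow> real"
 using that pv(4) Q_fin by (intro sum_mono2) auto

section \<open>Summation of the turns over the scales\<close>

definition \<Theta> :: "nat \<Rightarrow> real"
 where "\<Theta> j = (\<Sum>v\<in>I j. \<theta> j v powr s) * \<rho> j"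

lemma \<Theta>_nonneg: "0 \<le> \<Theta> j"
 unfolding \<Theta>_def using \<rho>_pos[of j] by (intro mult_nonneg_nonneg sum_nonneg) auto

lemma KT_nonneg: "0 \<le> KT"
 using Ksplit(1) by (simp add: KT_def)

lemma err_sum: "(\<Sum>v\<in>I j. (err j v / \<rho> j) powr s) * \<rho> j \<le> 4 powr s * (2 * Z j + 2 * Z (Suc j))"
proof -
 have s0: "s \<ge> 0" using s_ge by simp
 have IS: "I j \<subseteq> I (Suc j)" using I_Suc by auto
 have "(\<Sum>v\<in>I j. (err j v) powr s) \<le> (\<Sum>v\<in>I j. 4 powr s * (e j (pv j v) powr s + e (Suc j) (pv (Suc j) v) powr s + e j v powr s + e (Suc j) v powr s))"
  unfolding err_def using s0 e_nonneg pv(1,4) I_Suc by (intro sum_mono powr_add4) auto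
 also have "\<dots> = 4 powr s * ((\<Sum>v\<in>I j. e j (pv j v) powr s) + (\<Sum>v\<in>I j. e (Suc j) (pv (Suc j) v) powr s)
   + (\<Sum>v\<in>I j. e j v powr s) + (\<Sum>v\<in>I j. e (Suc j) v powr s))"
  by (simp add: sum_distrib_left sum.distrib distrib_left)
 also have "\<dots> \<le> 4 powr s * ((\<Sum>a\<in>Q j. e j a powr s) + (\<Sum>a\<in>Q (Suc j). e (Suc j) a powr s)
   + (\<Sum>a\<in>Q j. e j a powr s) + (\<Sum>a\<in>Q (Suc j). e (Suc j) a powr s))"
 proof (intro mult_left_mono add_mono)
  have "(\<Sum>v\<in>I j. e (Suc j) (pv (Suc j) v) powr s) \<le> (\<Sum>v\<in>I (Suc j). e (Suc j) (pv (Suc j) v) powr s)"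
   using IS I_fin by (intro sum_mono2) auto
  also have "\<dots> \<le> (\<Sum>a\<in>Q (Suc j). e (Suc j) a powr s)" by (rule sum_pv) simp
  finally show "(\<Sum>v\<in>I j. e (Suc j) (pv (Suc j) v) powr s) \<le> (\<Sum>a\<in>Q (Suc j). e (Suc j) a powr s)" .
  have "(\<Sum>v\<in>I j. e (Suc j) v powr s) \<le> (\<Sum>v\<in>I (Suc j). e (Suc j) v powr s)"
   using IS I_fin by (intro sum_mono2) auto
  also have "\<dots> \<le> (\<Sum>a\<in>Q (Suc j). e (Suc j) a powr s)" by (rule sum_I) simp
  finally show "(\<Sum>v\<in>I j. e (Suc j) v powr s) \<le> (\<Sum>a\<in>Q (Suc j). e (Suc j) a powr s)" .
 qed (auto intro: sum_pv sum_I)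
 finally have "(\<Sum>v\<in>I j. (err j v) powr s) * \<rho> j powr (1 - s) \<le> 4 powr s * ((\<Sum>a\<in>Q j. e j a powr s) + (\<Sum>a\<in>Q (Suc j). e (Suc j) a powr s)
   + (\<Sum>a\<in>Q j. e j a powr s) + (\<Sum>a\<in>Q (Suc j). e (Suc j) a powr s)) * \<rho> j powr (1 - s)"
  by (rule mult_right_mono) simp
 also have "\<dots> = 4 powr s * (2 * Z j + 2 * ((\<Sum>a\<in>Q (Suc j). e (Suc j) a powr s) * \<rho> j powr (1 - s)))"
  by (simp add: Z_def algebra_simps)
 also have "(\<Sum>a\<in>Q (Suc j). e (Suc j) a powr s) * \<rho> j powr (1 - s) \<le> Z (Suc j)" unfolding Z_def
 proof (intro mult_left_mono sum_nonneg)
  show "\<rho> j powr (1 - s) \<le> \<rho> (Suc j) powr (1 - s)"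
   using \<rho>_powr[of j] powr_ge_zero[of "\<rho> (Suc j)" "1 - s"] by linarith
 qed auto
 finally have 1: "(\<Sum>v\<in>I j. (err j v) powr s) * \<rho> j powr (1 - s) \<le> 4 powr s * (2 * Z j + 2 * Z (Suc j))" by simp
 have "(err j v / \<rho> j) powr s = err j v powr s * \<rho> j powr (- s)" for v
  by (simp add: powr_divide powr_minus_divide)
 then have "(\<Sum>v\<in>I j. (err j v / \<rho> j) powr s) * \<rho> j = (\<Sum>v\<in>I j. err j v powr s) * (\<rho> j powr (- s) * \<rho> j)"
  by (simp add: sum_distrib_right[symmetric])
 also have "\<rho> j powr (- s) * \<rho> j = \<rho> j powr (1 - s)"
  using \<rho>_pos[of j] powr_mult_base[of "\<rho> j" "- s"] by (simp add: mult.commute)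
 finally show ?thesis using 1 by simp
qed

text \<open>At an old vertex refinement changes the turn by deviations, whose powers are already
  summed in Z, while the weight \<rho> is halved. The recursion therefore runs from coarse to fine,
  opposite to that for Z.\<close>

lemma \<Theta>_old: "(\<Sum>v\<in>I j. \<theta> (Suc j) v powr s) * \<rho> (Suc j) \<le> 3/4 * \<Theta> j + KT * (2 * Z j + 2 * Z (Suc j))"
proof -
 have "\<theta> (Suc j) v powr s \<le> 3/2 * \<theta> j v powr s + Ksplit * (32 powr s * (err j v / \<rho> j) powr s)" if v: "v \<in> I j" for v
 proof -
  have er: "0 \<le> err j v" unfolding err_def using e_nonneg[OF pv(1)[OF v]] e_nonneg[OF pv(4)[OF v]]
    e_nonneg[OF pv(1)[OF I_Suc[OF v]]] e_nonneg[OF pv(4)[OF I_Suc[OF v]]] by simp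
  have "\<theta> (Suc j) v powr s \<le> (\<theta> j v + 32 * (err j v / \<rho> j)) powr s"
   using \<theta>_step[OF v] s_ge by (intro powr_mono2) auto
  also have "\<dots> \<le> 3/2 * \<theta> j v powr s + Ksplit * (32 * (err j v / \<rho> j)) powr s"
   using er \<rho>_pos[of j] by (intro Ksplit) auto
  finally show ?thesis by (simp only: powr_mult[of 32])
 qed
 then have "(\<Sum>v\<in>I j. \<theta> (Suc j) v powr s) \<le> (\<Sum>v\<in>I j. 3/2 * \<theta> j v powr s + Ksplit * (32 powr s * (err j v / \<rho> j) powr s))"
  by (rule sum_mono)
 also have "\<dots> = 3/2 * (\<Sum>v\<in>I j. \<theta> j v powr s) + Ksplit * (32 powr s * (\<Sum>v\<in>I j. (err j v / \<rho> j) powr s))"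
  by (simp only: sum.distrib sum_distrib_left[symmetric])
 finally have "(\<Sum>v\<in>I j. \<theta> (Suc j) v powr s) * (\<rho> j / 2) \<le>
   (3/2 * (\<Sum>v\<in>I j. \<theta> j v powr s) + Ksplit * (32 powr s * (\<Sum>v\<in>I j. (err j v / \<rho> j) powr s))) * (\<rho> j / 2)"
  using \<rho>_pos[of j] by (intro mult_right_mono) auto
 also have "\<dots> = 3/4 * \<Theta> j + Ksplit * 32 powr s / 2 * ((\<Sum>v\<in>I j. (err j v / \<rho> j) powr s) * \<rho> j)"
  by (simp add: \<Theta>_def algebra_simps)
 also have "\<dots> \<le> 3/4 * \<Theta> j + Ksplit * 32 powr s / 2 * (4 powr s * (2 * Z j + 2 * Z (Suc j)))"
  using Ksplit(1) by (intro add_left_mono mult_left_mono err_sum) auto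
 also have "Ksplit * 32 powr s / 2 * (4 powr s * (2 * Z j + 2 * Z (Suc j))) = KT * (2 * Z j + 2 * Z (Suc j)) / 2"
 proof -
  have "32 powr s * 4 powr s = (128::real) powr s" by (simp add: powr_mult[symmetric])
  then show ?thesis by (simp add: KT_def mult.assoc mult.left_commute[of "4 powr s"])
 qed
 also have "KT * (2 * Z j + 2 * Z (Suc j)) / 2 \<le> KT * (2 * Z j + 2 * Z (Suc j))"
  using KT_nonneg Z_nonneg[of j] Z_nonneg[of "Suc j"] by simp
 finally show ?thesis using \<rho>_half[of j] by simp
qed

text \<open>Small deviations on both sides guarantee chords of length at least \<rho> / 2, so that
  \<open>excess_dir\<close> gives a useful bound.\<close>

definition good :: "nat \<Rightarrow> real \<Rightarrow> bool"
 where "good j v \<longleftrightarrow> e j (pv j v) < \<rho> j / 4 \<and> e j v < \<rho> j / 4"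

lemma \<theta>_bad:
 assumes "v \<in> I j" "\<not> good j v"
 shows "\<theta> j v powr s * \<rho> j \<le> 8 powr s * ((e j (pv j v) powr s + e j v powr s) * \<rho> j powr (1 - s))"
proof -
 have en: "0 \<le> e j (pv j v)" "0 \<le> e j v" using e_nonneg pv(1,4)[OF assms(1)] by auto
 have rp: "\<rho> j > 0" by (rule \<rho>_pos)
 define m where "m = max (e j (pv j v)) (e j v)"
 have m: "\<rho> j \<le> 4 * m" "0 \<le> m" using assms(2) en by (auto simp: good_def m_def)
 have "\<theta> j v * \<rho> j \<le> 2 * (4 * m)" using \<theta>_le2[of j v] m rp by (intro mult_mono) auto
 then have "(\<theta> j v * \<rho> j) powr s \<le> (8 * m) powr s" using s_ge rp by (intro powr_mono2) auto
 then have "\<theta> j v powr s * \<rho> j powr s \<le> 8 powr s * m powr s" by (simp add: powr_mult)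
 also have "m powr s \<le> e j (pv j v) powr s + e j v powr s" by (auto simp: m_def max_def)
 finally have "\<theta> j v powr s * \<rho> j powr s * \<rho> j powr (1 - s) \<le> 8 powr s * (e j (pv j v) powr s + e j v powr s) * \<rho> j powr (1 - s)"
  by (intro mult_right_mono) auto
 moreover have "\<rho> j powr s * \<rho> j powr (1 - s) = \<rho> j" using rp by (simp add: powr_add[symmetric])
 ultimately show ?thesis by (simp add: mult.assoc)
qed

lemma \<theta>_good:
 assumes a: "a \<in> Q j" and v: "v \<in> kids j a" "v \<noteq> a" and gd: "good (Suc j) v"
 shows "\<theta> (Suc j) v powr s * \<rho> (Suc j) \<le> 2 / cU * exc j a"
proof -
 note kp = kids_props[OF a v(1)]
 have vI: "v \<in> I (Suc j)" using kp v Q_lt(2)[OF a] Q_lt(1)[of v "Suc j"] by (auto simp: I_def Q_def)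
 note p = pv[OF vI]
 have au: "a \<le> pv (Suc j) v"
 proof -
  have "a \<in> P (Suc j)" using Q_lt(3)[OF a] P_mono[of j] by auto
  then show ?thesis using prv_props(4)[OF P_fin[of "Suc j"] P_ends(1)[of "Suc j"] p(5), of a] kp v by simp
 qed
 let ?x = "g v - g (pv (Suc j) v)" and ?y = "g (nx (Suc j) v) - g v"
 have c: "\<rho> (Suc j) / 2 \<le> N ?x" "\<rho> (Suc j) / 2 \<le> N ?y"
  using chord_ge[OF p(1)] chord_ge[OF p(4)] gd p(3) by (auto simp: chord_def good_def)
 have nz: "?x \<noteq> 0" "?y \<noteq> 0" using c \<rho>_pos[of "Suc j"] by auto
 have "cU * min (N ?x) (N ?y) * N (dir ?x - dir ?y) powr s \<le> N ?x + N ?y - N (?x + ?y)"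
  by (rule excess_dir) (use nz in auto)
 also have "?x + ?y = g (nx (Suc j) v) - g (pv (Suc j) v)" by simp
 also have "N ?x + N ?y - N (g (nx (Suc j) v) - g (pv (Suc j) v)) \<le> exc j a"
  using p kp au nx(1,2)[OF p(4)] Q_lt(3) by (intro exc_three[OF a]) auto
 finally have 1: "cU * (min (N ?x) (N ?y) * \<theta> (Suc j) v powr s) \<le> exc j a"
  by (simp add: \<theta>_def dL_def dR_def mult.assoc)
 have "\<rho> (Suc j) / 2 * \<theta> (Suc j) v powr s \<le> min (N ?x) (N ?y) * \<theta> (Suc j) v powr s"
  using c by (intro mult_right_mono) auto
 then have "cU * (\<rho> (Suc j) / 2 * \<theta> (Suc j) v powr s) \<le> cU * (min (N ?x) (N ?y) * \<theta> (Suc j) v powr s)"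
  using cU_pos by (intro mult_left_mono) auto
 then have "cU * (\<rho> (Suc j) / 2 * \<theta> (Suc j) v powr s) \<le> exc j a" using 1 by linarith
 then show ?thesis using cU_pos by (simp add: field_simps)
qed

text \<open>\<open>\<theta>_good\<close> charges each new vertex to the whole excess of the parent
  arc, so the number of such vertices matters. If the excess is at most r there are at most 10 of
  them; otherwise their number times r is at most 10 times the excess, and the trivial bound
  \<theta> \<le> 2 is enough.\<close>

lemma good_sum:
 assumes a: "a \<in> Q j"
 defines "G \<equiv> {v \<in> kids j a. v \<noteq> a \<and> good (Suc j) v}"
 shows "(\<Sum>v\<in>G. \<theta> (Suc j) v powr s * \<rho> (Suc j)) \<le> Knew * exc j a"
proof -
 let ?r = "\<rho> (Suc j)"
 have rp: "?r > 0" by (rule \<rho>_pos)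
 have x0: "0 \<le> exc j a" by (rule exc_nonneg[OF a])
 have finG: "finite G" using kids_fin by (auto simp: G_def)
 have ch: "?r / 2 \<le> chord (Suc j) v" if "v \<in> G" for v
  using chord_ge[of v "Suc j"] kids_props[OF a, of v] that by (auto simp: G_def good_def)
 have "real (card G) * (?r / 2) = (\<Sum>v\<in>G. ?r / 2)" by simp
 also have "\<dots> \<le> (\<Sum>v\<in>G. chord (Suc j) v)" by (intro sum_mono ch)
 also have "\<dots> \<le> (\<Sum>v\<in>kids j a. chord (Suc j) v)"
  using kids_fin by (intro sum_mono2) (auto simp: G_def chord_def)
 also have "\<dots> = chord j a + exc j a" by (simp add: exc_def)
 also have "\<dots> \<le> 4 * ?r + exc j a" using chord_le[OF a] \<rho>_half[of j] by simp
 finally have cardG: "real (card G) * ?r \<le> 8 * ?r + 2 * exc j a" by simp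
 show ?thesis
 proof (cases "exc j a \<le> ?r")
  case True
  then have "real (card G) * ?r \<le> 10 * ?r" using cardG by simp
  then have c10: "real (card G) \<le> 10" using rp by simp
  have "(\<Sum>v\<in>G. \<theta> (Suc j) v powr s * ?r) \<le> (\<Sum>v\<in>G. 2 / cU * exc j a)"
   by (intro sum_mono \<theta>_good[OF a]) (auto simp: G_def)
  also have "\<dots> = real (card G) * (2 / cU * exc j a)" by simp
  also have "\<dots> \<le> 10 * (2 / cU * exc j a)" using c10 x0 cU_pos by (intro mult_right_mono) auto
  also have "\<dots> \<le> Knew * exc j a" using x0 by (simp add: Knew_def algebra_simps)
  finally show ?thesis .
 next
  case False
  have "(\<Sum>v\<in>G. \<theta> (Suc j) v powr s * ?r) \<le> (\<Sum>v\<in>G. 2 powr s * ?r)"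
   using \<theta>_le2 s_ge rp by (intro sum_mono mult_right_mono powr_mono2) auto
  also have "\<dots> = 2 powr s * (real (card G) * ?r)" by simp
  also have "\<dots> \<le> 2 powr s * (10 * exc j a)" using cardG False by (intro mult_left_mono) auto
  also have "\<dots> \<le> Knew * exc j a" using x0 cU_pos by (simp add: Knew_def algebra_simps)
  finally show ?thesis .
 qed
qed

lemma \<Theta>_new: "(\<Sum>v\<in>I (Suc j) - I j. \<theta> (Suc j) v powr s) * \<rho> (Suc j)
  \<le> Knew * (len (Suc j) - len j) + 8 powr s * (2 * Z (Suc j))"
proof -
 let ?f = "\<lambda>v. \<theta> (Suc j) v powr s * \<rho> (Suc j)"
 define B where "B = {v \<in> I (Suc j). \<not> good (Suc j) v}"
 define W where "W = {v \<in> I (Suc j) - I j. good (Suc j) v}"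
 have rp: "\<rho> (Suc j) > 0" by (rule \<rho>_pos)
 have fin: "finite B" "finite W" using I_fin by (auto simp: B_def W_def)
 have "(\<Sum>v\<in>I (Suc j) - I j. \<theta> (Suc j) v powr s) * \<rho> (Suc j) = (\<Sum>v\<in>I (Suc j) - I j. ?f v)"
  by (simp add: sum_distrib_right)
 also have "\<dots> \<le> (\<Sum>v\<in>B \<union> W. ?f v)" using fin rp by (intro sum_mono2) (auto simp: B_def W_def)
 also have "\<dots> = (\<Sum>v\<in>B. ?f v) + (\<Sum>v\<in>W. ?f v)" using fin by (intro sum.union_disjoint) (auto simp: B_def W_def)
 also have "(\<Sum>v\<in>B. ?f v) \<le> 8 powr s * (2 * Z (Suc j))"
 proof -
  have "(\<Sum>v\<in>B. ?f v) \<le> (\<Sum>v\<in>B. 8 powr s * ((e (Suc j) (pv (Suc j) v) powr s + e (Suc j) v powr s) * \<rho> (Suc j) powr (1 - s)))"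
   by (intro sum_mono \<theta>_bad) (auto simp: B_def)
  also have "\<dots> \<le> (\<Sum>v\<in>I (Suc j). 8 powr s * ((e (Suc j) (pv (Suc j) v) powr s + e (Suc j) v powr s) * \<rho> (Suc j) powr (1 - s)))"
   using I_fin by (intro sum_mono2) (auto simp: B_def)
  also have "\<dots> = 8 powr s * (((\<Sum>v\<in>I (Suc j). e (Suc j) (pv (Suc j) v) powr s) + (\<Sum>v\<in>I (Suc j). e (Suc j) v powr s)) * \<rho> (Suc j) powr (1 - s))"
   by (simp only: sum_distrib_left[symmetric] sum_distrib_right[symmetric] sum.distrib)
  also have "\<dots> \<le> 8 powr s * (((\<Sum>a\<in>Q (Suc j). e (Suc j) a powr s) + (\<Sum>a\<in>Q (Suc j). e (Suc j) a powr s)) * \<rho> (Suc j) powr (1 - s))"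
   by (intro mult_left_mono mult_right_mono add_mono sum_pv sum_I) auto
  also have "\<dots> = 8 powr s * (2 * Z (Suc j))" by (simp add: Z_def)
  finally show ?thesis .
 qed
 also have "(\<Sum>v\<in>W. ?f v) \<le> Knew * (len (Suc j) - len j)"
 proof -
  define h where "h v = (if v \<in> W then ?f v else 0)" for v
  have WQ: "W \<subseteq> Q (Suc j)" using pv(4) by (auto simp: W_def)
  have "(\<Sum>v\<in>W. ?f v) = (\<Sum>v\<in>Q (Suc j). h v)"
   unfolding h_def using Q_fin WQ by (subst sum.inter_restrict[symmetric]) (auto simp: Int_absorb1)
  also have "\<dots> = (\<Sum>a\<in>Q j. \<Sum>v\<in>kids j a. h v)" by (rule sum_kids)
  also have "\<dots> \<le> (\<Sum>a\<in>Q j. Knew * exc j a)"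
  proof (rule sum_mono)
   fix a assume a: "a \<in> Q j"
   have "(\<Sum>v\<in>kids j a. h v) = (\<Sum>v\<in>{v \<in> kids j a. v \<in> W}. ?f v)"
    unfolding h_def using kids_fin by (simp add: sum.inter_filter)
   also have "\<dots> \<le> (\<Sum>v\<in>{v \<in> kids j a. v \<noteq> a \<and> good (Suc j) v}. ?f v)"
   proof (rule sum_mono2)
    have "a \<notin> W" using Q_lt(3)[OF a] Q_lt(1)[OF a] pv(5)[of a "Suc j"] by (auto simp: W_def I_def)
    then show "{v \<in> kids j a. v \<in> W} \<subseteq> {v \<in> kids j a. v \<noteq> a \<and> good (Suc j) v}" by (auto simp: W_def)
   qed (use kids_fin rp in auto)
   also have "\<dots> \<le> Knew * exc j a" by (rule good_sum[OF a])
   finally show "(\<Sum>v\<in>kids j a. h v) \<le> Knew * exc j a" .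
  qed
  also have "\<dots> = Knew * (len (Suc j) - len j)" by (simp add: sum_distrib_left[symmetric] sum_exc)
  finally show ?thesis .
 qed
 finally show ?thesis by simp
qed

lemma \<Theta>_step: "\<Theta> (Suc j) \<le> 3/4 * \<Theta> j + (2 * KT * Z j + (2 * KT + 2 * 8 powr s) * Z (Suc j) + Knew * (len (Suc j) - len j))"
proof -
 have IS: "I j \<subseteq> I (Suc j)" using I_Suc by auto
 have "(\<Sum>v\<in>I (Suc j). \<theta> (Suc j) v powr s) = (\<Sum>v\<in>I (Suc j) - I j. \<theta> (Suc j) v powr s) + (\<Sum>v\<in>I j. \<theta> (Suc j) v powr s)"
  using IS I_fin by (intro sum.subset_diff) auto
 then have "\<Theta> (Suc j) = (\<Sum>v\<in>I (Suc j) - I j. \<theta> (Suc j) v powr s) * \<rho> (Suc j) + (\<Sum>v\<in>I j. \<theta> (Suc j) v powr s) * \<rho> (Suc j)"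
  by (simp add: \<Theta>_def distrib_right)
 then show ?thesis using \<Theta>_new[of j] \<Theta>_old[of j] by (simp add: algebra_simps)
qed

lemma \<Theta>_sum: "(\<Sum>j<n. \<Theta> j) \<le> CT * L"
proof -
 let ?A = "2 * KT" and ?B = "2 * KT + 2 * 8 powr s"
 let ?D = "\<lambda>j. ?A * Z j + ?B * Z (Suc j) + Knew * (len (Suc j) - len j)"
 have A0: "0 \<le> ?A" "0 \<le> ?B" using KT_nonneg by auto
 have K0: "0 \<le> Knew" using cU_pos by (simp add: Knew_def)
 have ZS: "(\<Sum>j<n. Z (Suc j)) \<le> (CZ + 2 powr s) * L"
 proof -
  have "(\<Sum>j<n. Z (Suc j)) = (\<Sum>j<n. Z j) + Z n - Z 0" using sum.lessThan_Suc_shift[of Z n] by simp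
  then show ?thesis using Z_sum[of n] Z_le[of n] Z_nonneg[of 0] by (simp add: distrib_right)
 qed
 have "(\<Sum>j<n. \<Theta> j) \<le> 4 * \<Theta> 0 + 4 * (\<Sum>j<n. ?D j)"
  by (rule geometric_forward[where Z=\<Theta> and \<Delta>="?D", OF \<Theta>_step \<Theta>_nonneg])
 also have "(\<Sum>j<n. ?D j) = ?A * (\<Sum>j<n. Z j) + ?B * (\<Sum>j<n. Z (Suc j)) + Knew * (\<Sum>j<n. len (Suc j) - len j)"
  by (simp only: sum.distrib sum_distrib_left[symmetric])
 also have "\<dots> \<le> ?A * (CZ * L) + ?B * ((CZ + 2 powr s) * L) + Knew * L"
  by (intro add_mono mult_left_mono A0 K0 Z_sum ZS len_telescope)
 also have "\<Theta> 0 \<le> 2 powr s * L"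
 proof -
  have "(\<Sum>v\<in>I 0. \<theta> 0 v powr s) \<le> (\<Sum>a\<in>Q 0. \<theta> 0 a powr s)" by (rule sum_I) simp
  also have "\<dots> \<le> (\<Sum>a\<in>Q 0. 2 powr s)" using \<theta>_le2 s_ge by (intro sum_mono powr_mono2) auto
  finally have "\<Theta> 0 \<le> (\<Sum>a\<in>Q 0. 2 powr s) * \<rho> 0"
   unfolding \<Theta>_def using \<rho>_pos[of 0] by (intro mult_right_mono) auto
  also have "\<dots> = 2 powr s * (real (card (Q 0)) * \<rho> 0)" by simp
  also have "\<dots> \<le> 2 powr s * L" by (intro mult_left_mono card_Q) auto
  finally show ?thesis .
 qed
 finally have "(\<Sum>j<n. \<Theta> j) \<le> 4 * (2 powr s * L) + 4 * (?A * (CZ * L) + ?B * ((CZ + 2 powr s) * L) + Knew * L)"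
  by simp
 also have "\<dots> = CT * L" by (simp add: CT_def algebra_simps)
 finally show ?thesis .
qed

end

section \<open>Covers and Hausdorff content\<close>

context normed_on
begin

definition ediam :: "'a set \<Rightarrow> ennreal"
 where "ediam S = (SUP x\<in>S. SUP y\<in>S. ennreal (N (x - y)))"

lemma ediam_ge: "x \<in> S \<Longrightarrow> y \<in> S \<Longrightarrow> ennreal (N (x - y)) \<le> ediam S"
 unfolding ediam_def by (meson SUP_upper SUP_upper2)

lemma ediam_le: "(\<And>x y. x \<in> S \<Longrightarrow> y \<in> S \<Longrightarrow> N (x - y) \<le> c) \<Longrightarrow> ediam S \<le> ennreal c"
 unfolding ediam_def by (intro SUP_least ennreal_leI)

lemma ediam_empty [simp]: "ediam {} = 0"
 by (simp add: ediam_def bot_ennreal)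

lemma N_le_ediam: "x \<in> S \<Longrightarrow> y \<in> S \<Longrightarrow> ediam S \<le> ennreal c \<Longrightarrow> 0 \<le> c \<Longrightarrow> N (x - y) \<le> c"
 using order_trans[OF ediam_ge[of x S y], of "ennreal c"] by (simp add: ennreal_le_iff)

definition fine_covers :: "real \<Rightarrow> 'a set \<Rightarrow> (nat \<Rightarrow> 'a set) set"
 where "fine_covers \<delta> S = {U. S \<subseteq> (\<Union>i. U i) \<and> (\<forall>i. U i \<subseteq> V \<and> ediam (U i) \<le> ennreal \<delta>)}"

text \<open>The premeasure of one-dimensional Hausdorff measure at scale \<delta>. Its growth as
  \<delta> decreases is the second quantity that telescopes, besides the polygon length.\<close>

definition hcont :: "real \<Rightarrow> 'a set \<Rightarrow> ennreal"
 where "hcont \<delta> S = (INF U\<in>fine_covers \<delta> S. (\<Sum>i. ediam (U i)))"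

text \<open>The 1-Lipschitz function f maps the part of a member in T into an interval no longer
  than the diameter of the member. These intervals cover [0, c), and Lebesgue measure is countably
  subadditive.\<close>

lemma hit_sum:
 fixes f :: "'a \<Rightarrow> real"
 assumes U: "T \<subseteq> (\<Union>i. U i)" "\<And>i. U i \<subseteq> V"
  and f: "\<And>x y. x \<in> V \<Longrightarrow> y \<in> V \<Longrightarrow> \<bar>f x - f y\<bar> \<le> N (x - y)" and c: "{0..<c} \<subseteq> f ` T"
 shows "ennreal c \<le> (\<Sum>i. if U i \<inter> T \<noteq> {} then ediam (U i) else 0)"
proof (cases "c \<le> 0")
 case False
 let ?D = "\<lambda>i. if U i \<inter> T \<noteq> {} then ediam (U i) else 0"
 have "\<exists>C. C \<in> sets lborel \<and> f ` (U i \<inter> T) \<subseteq> C \<and> emeasure lborel C \<le> ?D i" for i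
 proof -
  consider "U i \<inter> T = {}" | "U i \<inter> T \<noteq> {}" "ediam (U i) = \<infinity>" | "U i \<inter> T \<noteq> {}" "ediam (U i) < \<infinity>"
   by (cases "ediam (U i) = \<infinity>") (auto simp: less_top)
  then show ?thesis
  proof cases
   case 1
   then show ?thesis by (intro exI[of _ "{}"]) auto
  next
   case 2
   then show ?thesis by (intro exI[of _ UNIV]) auto
  next
   case 3
   let ?W = "f ` (U i \<inter> T)"
   obtain d where d: "ediam (U i) = ennreal d" "d \<ge> 0" using 3(2) by (cases "ediam (U i)") auto
   have close: "\<bar>v - w\<bar> \<le> d" if "v \<in> ?W" "w \<in> ?W" for v w
   proof -
    from that(1) obtain x where x: "x \<in> U i" "v = f x" by blast
    from that(2) obtain y where y: "y \<in> U i" "w = f y" by blast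
    have "N (x - y) \<le> d" using N_le_ediam[OF x(1) y(1)] d by simp
    moreover have "x \<in> V" "y \<in> V" using x y U(2)[of i] by blast+
    ultimately show ?thesis using f[of x y] x y by simp
   qed
   obtain w where w: "w \<in> ?W" using 3 by auto
   have bd: "bdd_above ?W" "bdd_below ?W"
    using close[OF _ w] by (auto intro!: bdd_aboveI[of _ "w + d"] bdd_belowI[of _ "w - d"] simp: abs_le_iff algebra_simps) force+
   have "Sup ?W \<le> Inf ?W + d"
   proof (rule cSup_least)
    fix v assume v: "v \<in> ?W"
    have "v - d \<le> Inf ?W" using close[OF v] w by (intro cInf_greatest) (force simp: abs_le_iff)+
    then show "v \<le> Inf ?W + d" by simp
   qed (use w in auto)
   moreover have "Inf ?W \<le> Sup ?W" using w bd by (meson cInf_lower cSup_upper order_trans)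
   ultimately have "emeasure lborel {Inf ?W..Sup ?W} \<le> ediam (U i)" using d by (simp add: ennreal_leI)
   moreover have "?W \<subseteq> {Inf ?W..Sup ?W}"
    using cInf_lower[OF _ bd(2)] cSup_upper[OF _ bd(1)] by (meson atLeastAtMost_iff subsetI)
   ultimately show ?thesis using 3 by (intro exI[of _ "{Inf ?W..Sup ?W}"]) auto
  qed
 qed
 then obtain C where C: "\<And>i. C i \<in> sets lborel" "\<And>i. f ` (U i \<inter> T) \<subseteq> C i" "\<And>i. emeasure lborel (C i) \<le> ?D i"
  by metis
 have rC: "range C \<subseteq> sets lborel" using C(1) by blast
 have "f ` T \<subseteq> (\<Union>i. C i)" using U(1) C(2) by blast
 with c have cC: "{0..<c} \<subseteq> (\<Union>i. C i)" by (rule order_trans)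
 have mC: "(\<Union>i. C i) \<in> sets lborel" by (rule sets.countable_nat_UN[OF rC])
 have "emeasure lborel {0..<c} \<le> emeasure lborel (\<Union>i. C i)" by (rule emeasure_mono[OF cC mC])
 also have "\<dots> \<le> (\<Sum>i. emeasure lborel (C i))" using rC by (rule emeasure_subadditive_countably)
 also have "\<dots> \<le> (\<Sum>i. ?D i)" by (intro suminf_le C summableI)
 finally show ?thesis using False by simp
qed (simp add: ennreal_neg)

text \<open>Covers are indexed by the naturals. The set W z is placed at the least index of its
  group, and the other indices of the group receive the empty set, which has diameter 0.\<close>

lemma merge_cover:
 assumes U: "U \<in> fine_covers \<delta> S" and \<delta>: "\<delta> \<le> \<Delta>"
  and Zs: "finite Zs" and disj: "\<And>z z'. z \<in> Zs \<Longrightarrow> z' \<in> Zs \<Longrightarrow> z \<noteq> z' \<Longrightarrow> J z \<inter> J z' = {}"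
  and W: "\<And>z i. z \<in> Zs \<Longrightarrow> i \<in> J z \<Longrightarrow> U i \<subseteq> W z" "\<And>z. z \<in> Zs \<Longrightarrow> W z \<subseteq> V"
   "\<And>z. z \<in> Zs \<Longrightarrow> ediam (W z) \<le> ennreal \<Delta>"
 shows "hcont \<Delta> S + (\<Sum>z\<in>Zs. \<Sum>i. if i \<in> J z then ediam (U i) else 0)
  \<le> (\<Sum>i. ediam (U i)) + (\<Sum>z\<in>Zs. ediam (W z))"
proof -
 define JJ where "JJ = (\<Union>z\<in>Zs. J z)"
 define a where "a i = (if i \<in> JJ then 0 else ediam (U i))" for i
 define b where "b z i = (if i \<in> J z \<and> i = (LEAST k. k \<in> J z) then ediam (W z) else 0)" for z i
 define U' where "U' i = (if i \<in> JJ then (\<Union>z\<in>{z \<in> Zs. i \<in> J z \<and> i = (LEAST k. k \<in> J z)}. W z) else U i)" for i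
 have Up: "S \<subseteq> (\<Union>i. U i)" "\<And>i. U i \<subseteq> V" "\<And>i. ediam (U i) \<le> ennreal \<delta>" using U by (auto simp: fine_covers_def)
 have uniq: "z = z'" if "z \<in> Zs" "z' \<in> Zs" "i \<in> J z" "i \<in> J z'" for z z' i
  using disj[OF that(1,2)] that by auto
 have U'_eq: "U' i = (if i = (LEAST k. k \<in> J z) then W z else {})" if "z \<in> Zs" "i \<in> J z" for z i
 proof -
  have "z' \<in> Zs \<and> i \<in> J z' \<longleftrightarrow> z' = z" for z' using that uniq[OF that(1) _ that(2), of z'] by metis
  then have "{z' \<in> Zs. i \<in> J z' \<and> i = (LEAST k. k \<in> J z')} = (if i = (LEAST k. k \<in> J z) then {z} else {})"
   unfolding conj_assoc[symmetric] by (simp only: split: if_split) blast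
  moreover have "i \<in> JJ" using that by (auto simp: JJ_def)
  ultimately show ?thesis by (simp add: U'_def)
 qed
 have sumU: "ediam (U i) = a i + (\<Sum>z\<in>Zs. if i \<in> J z then ediam (U i) else 0)" for i
 proof (cases "i \<in> JJ")
  case True
  then obtain z where z: "z \<in> Zs" "i \<in> J z" by (auto simp: JJ_def)
  have "i \<in> J z' \<longleftrightarrow> z' = z" if "z' \<in> Zs" for z' using z uniq[OF z(1) that z(2)] by metis
  then have "(\<Sum>z'\<in>Zs. if i \<in> J z' then ediam (U i) else 0) = (\<Sum>z'\<in>Zs. if z' = z then ediam (U i) else 0)"
   by (intro sum.cong) simp_all
  then show ?thesis using True z Zs by (simp add: a_def)
 next
  case False
  then have "(\<Sum>z\<in>Zs. if i \<in> J z then ediam (U i) else 0) = 0" by (intro sum.neutral) (auto simp: JJ_def)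
  then show ?thesis using False by (simp add: a_def)
 qed
 have dU': "ediam (U' i) \<le> a i + (\<Sum>z\<in>Zs. b z i)" for i
 proof (cases "i \<in> JJ")
  case True
  then obtain z where z: "z \<in> Zs" "i \<in> J z" by (auto simp: JJ_def)
  have "ediam (U' i) = b z i" using U'_eq[OF z] z by (simp add: b_def)
  also have "\<dots> \<le> (\<Sum>z\<in>Zs. b z i)" using z Zs by (intro member_le_sum) auto
  finally show ?thesis using True by (simp add: a_def)
 qed (simp add: a_def U'_def)
 have "U' \<in> fine_covers \<Delta> S" unfolding fine_covers_def
 proof (intro CollectI conjI allI)
  show "U' i \<subseteq> V" for i using Up(2) W(2) by (auto simp: U'_def)
  show "ediam (U' i) \<le> ennreal \<Delta>" for i
  proof (cases "i \<in> JJ")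
   case True
   then obtain z where z: "z \<in> Zs" "i \<in> J z" by (auto simp: JJ_def)
   then show ?thesis using U'_eq[OF z] W(3)[OF z(1)] by simp
  next
   case False
   then show ?thesis using Up(3)[of i] \<delta> by (simp add: U'_def order_trans ennreal_leI)
  qed
  show "S \<subseteq> (\<Union>i. U' i)"
  proof
   fix x assume "x \<in> S"
   then obtain i where i: "x \<in> U i" using Up(1) by auto
   show "x \<in> (\<Union>i. U' i)"
   proof (cases "i \<in> JJ")
    case True
    then obtain z where z: "z \<in> Zs" "i \<in> J z" by (auto simp: JJ_def)
    let ?m = "LEAST k. k \<in> J z"
    have m: "?m \<in> J z" using z(2) by (rule LeastI)
    have "x \<in> U' ?m" using U'_eq[OF z(1) m] W(1)[OF z] i by auto
    then show ?thesis by blast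
   next
    case False
    then show ?thesis using i by (auto simp: U'_def)
   qed
  qed
 qed
 then have "hcont \<Delta> S \<le> (\<Sum>i. ediam (U' i))" unfolding hcont_def by (rule INF_lower)
 also have "\<dots> \<le> (\<Sum>i. a i + (\<Sum>z\<in>Zs. b z i))" by (intro suminf_le dU') auto
 also have "\<dots> = (\<Sum>i. a i) + (\<Sum>z\<in>Zs. \<Sum>i. b z i)"
  by (simp only: suminf_add[OF summableI summableI, symmetric] suminf_sum[OF summableI])
 also have "\<dots> \<le> (\<Sum>i. a i) + (\<Sum>z\<in>Zs. ediam (W z))"
 proof (rule add_left_mono, rule sum_mono)
  fix z
  let ?m = "LEAST k. k \<in> J z"
  have "(\<Sum>i. b z i) = (\<Sum>i\<in>{?m}. b z i)" by (rule suminf_finite) (auto simp: b_def)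
  then show "(\<Sum>i. b z i) \<le> ediam (W z)" by (simp add: b_def)
 qed
 finally have 1: "hcont \<Delta> S \<le> (\<Sum>i. a i) + (\<Sum>z\<in>Zs. ediam (W z))" .
 have 2: "(\<Sum>i. ediam (U i)) = (\<Sum>i. a i) + (\<Sum>z\<in>Zs. \<Sum>i. if i \<in> J z then ediam (U i) else 0)"
 proof -
  have "(\<Sum>i. ediam (U i)) = (\<Sum>i. a i + (\<Sum>z\<in>Zs. if i \<in> J z then ediam (U i) else 0))"
   by (rule suminf_cong) (rule sumU)
  also have "\<dots> = (\<Sum>i. a i) + (\<Sum>i. \<Sum>z\<in>Zs. if i \<in> J z then ediam (U i) else 0)"
   by (rule suminf_add[symmetric]) (rule summableI)+
  also have "(\<Sum>i. \<Sum>z\<in>Zs. if i \<in> J z then ediam (U i) else 0) = (\<Sum>z\<in>Zs. \<Sum>i. if i \<in> J z then ediam (U i) else 0)"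
   by (rule suminf_sum) (rule summableI)
  finally show ?thesis .
 qed
 show ?thesis unfolding 2 using add_right_mono[OF 1, of "\<Sum>z\<in>Zs. \<Sum>i. if i \<in> J z then ediam (U i) else 0"]
  by (simp only: add.assoc add.commute add.left_commute)
qed

text \<open>A largest spread subset of the finite set exists. The bound is max D 0 because a member
  of the subset has distance 0 to itself even if D is negative.\<close>

lemma maximal_spread:
 assumes "finite Y"
 obtains Zs where "Zs \<subseteq> Y" "\<And>z z'. z \<in> Zs \<Longrightarrow> z' \<in> Zs \<Longrightarrow> z \<noteq> z' \<Longrightarrow> D < N (z - z')"
  "\<And>y. y \<in> Y \<Longrightarrow> \<exists>z\<in>Zs. N (y - z) \<le> max D 0"
proof -
 define P where "P Zs \<longleftrightarrow> Zs \<subseteq> Y \<and> (\<forall>z\<in>Zs. \<forall>z'\<in>Zs. z \<noteq> z' \<longrightarrow> D < N (z - z'))" for Zs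
 have "P {}" by (simp add: P_def)
 moreover have "\<forall>Zs. P Zs \<longrightarrow> card Zs < Suc (card Y)"
  using card_mono[OF assms] by (simp add: P_def less_Suc_eq_le)
 ultimately have "\<exists>Zs. P Zs \<and> (\<forall>Zs'. P Zs' \<longrightarrow> card Zs' \<le> card Zs)" by (rule ex_has_greatest_nat)
 then obtain Zs where Zs: "P Zs" and max: "\<forall>Zs'. P Zs' \<longrightarrow> card Zs' \<le> card Zs" by (elim exE conjE)
 have sub: "Zs \<subseteq> Y" using Zs unfolding P_def by (rule conjunct1)
 have spread: "D < N (z - z')" if "z \<in> Zs" "z' \<in> Zs" "z \<noteq> z'" for z z' using Zs that unfolding P_def by metis
 from sub assms have finZ: "finite Zs" by (rule finite_subset)
 have "\<exists>z\<in>Zs. N (y - z) \<le> max D 0" if y: "y \<in> Y" for y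
 proof (rule ccontr)
  assume a: "\<not> (\<exists>z\<in>Zs. N (y - z) \<le> max D 0)"
  have far: "D < N (y - z)" "0 < N (y - z)" if "z \<in> Zs" for z
  proof -
   have "\<not> N (y - z) \<le> max D 0" using a that by (rule_tac notI) (erule notE, rule bexI)
   then show "D < N (y - z)" "0 < N (y - z)" by (simp_all add: not_le)
  qed
  have yZ: "y \<notin> Zs" using far(2)[of y] by auto
  have "P (insert y Zs)" unfolding P_def
  proof (intro conjI ballI impI)
   show "insert y Zs \<subseteq> Y" using sub y by (rule_tac insert_subsetI)
   fix z z' assume "z \<in> insert y Zs" "z' \<in> insert y Zs" "z \<noteq> z'"
   then consider "z = y" "z' \<in> Zs" | "z' = y" "z \<in> Zs" | "z \<in> Zs" "z' \<in> Zs" by (elim insertE) simp_all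
   then show "D < N (z - z')"
   proof cases
    case 1
    then show ?thesis using far(1)[of z'] by simp
   next
    case 2
    then show ?thesis using far(1)[of z] N_commute[of z y] by simp
   next
    case 3
    then show ?thesis using spread \<open>z \<noteq> z'\<close> by simp
   qed
  qed
  with max have "card (insert y Zs) \<le> card Zs" by simp
  then show False using finZ yZ by simp
 qed
 then show ?thesis using that[of Zs] sub spread by simp
qed

end

section \<open>Content of a Lipschitz curve\<close>

context curve_on
begin

definition G :: "'a set" where "G = g ` {0..L}"

lemma G_V: "G \<subseteq> V" by (auto simp: G_def)

lemma dist_values:
 assumes "0 \<le> t" "t \<le> L" "0 \<le> u" "u \<le> L" "h \<le> N (g u - g t)"
 shows "{0..<h} \<subseteq> (\<lambda>z. N (z - g t)) ` (G \<inter> {z. N (z - g t) < h})"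
proof
 fix v assume v: "v \<in> {0..<h}"
 let ?f = "\<lambda>w. N (g w - g t)"
 have cont: "continuous_on S ?f" for S
 proof (rule lipschitz_on_continuous_on[where L=1], rule lipschitz_onI)
  fix x y
  have "\<bar>?f x - ?f y\<bar> \<le> N ((g x - g t) - (g y - g t))" by (rule N_diff_abs) auto
  also have "\<dots> = N (g x - g y)" by simp
  finally show "dist (?f x) (?f y) \<le> 1 * dist x y" using g_lip[of x y] by (simp add: dist_real_def)
 qed simp
 obtain w where w: "0 \<le> w" "w \<le> L" "?f w = v"
 proof (cases "t \<le> u")
  case True
  have "\<exists>w. t \<le> w \<and> w \<le> u \<and> ?f w = v" by (rule IVT'[OF _ _ True cont]) (use v assms in auto)
  then obtain w where "t \<le> w" "w \<le> u" "?f w = v" by blast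
  then show ?thesis using assms that[of w] by simp
 next
  case False
  then have "u \<le> t" by simp
  have "\<exists>w. u \<le> w \<and> w \<le> t \<and> ?f w = v" by (rule IVT2'[OF _ _ \<open>u \<le> t\<close> cont]) (use v assms in auto)
  then obtain w where "u \<le> w" "w \<le> t" "?f w = v" by blast
  then show ?thesis using assms that[of w] by simp
 qed
 then show "v \<in> (\<lambda>z. N (z - g t)) ` (G \<inter> {z. N (z - g t) < h})"
  using v by (intro image_eqI[of _ _ "g w"]) (auto simp: G_def)
qed

text \<open>The curve joins the center y to a point at distance at least h, so the distance to y
  takes all values in [0, h) on the part of the curve inside the ball.\<close>

lemma ball_hits:
 assumes U: "U \<in> fine_covers \<delta> G" and "y \<in> G" "p \<in> G" "h \<le> N (p - y)"
 shows "ennreal h \<le> (\<Sum>i. if U i \<inter> (G \<inter> {z. N (z - y) < h}) \<noteq> {} then ediam (U i) else 0)"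
proof -
 obtain t u where tu: "0 \<le> t" "t \<le> L" "0 \<le> u" "u \<le> L" "y = g t" "p = g u" using assms by (auto simp: G_def)
 show ?thesis
 proof (rule hit_sum)
  show "{0..<h} \<subseteq> (\<lambda>z. N (z - y)) ` (G \<inter> {z. N (z - y) < h})" using dist_values[of t u h] tu assms by simp
  show "\<bar>N (a - y) - N (b - y)\<bar> \<le> N (a - b)" if "a \<in> V" "b \<in> V" for a b
   using N_diff_abs[of "a - y" "b - y"] that tu by simp
 qed (use U in \<open>auto simp: fine_covers_def\<close>)
qed

lemma strand_hits:
 assumes U: "U \<in> fine_covers \<delta> G" and ab: "0 \<le> a" "a \<le> b" "b \<le> L"
 shows "ennreal (N (g b - g a)) \<le> (\<Sum>i. if U i \<inter> g ` {a..b} \<noteq> {} then ediam (U i) else 0)"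
proof (rule hit_sum)
 have "continuous_on {a..b} (\<lambda>w. N (g w - g a))"
 proof (rule lipschitz_on_continuous_on[where L=1], rule lipschitz_onI)
  fix x y
  have "\<bar>N (g x - g a) - N (g y - g a)\<bar> \<le> N ((g x - g a) - (g y - g a))" by (rule N_diff_abs) auto
  then show "dist (N (g x - g a)) (N (g y - g a)) \<le> 1 * dist x y"
   using g_lip[of x y] by (simp add: dist_real_def)
 qed simp
 then have "\<exists>w. a \<le> w \<and> w \<le> b \<and> N (g w - g a) = v" if "v \<in> {0..<N (g b - g a)}" for v
  using that ab by (intro IVT') auto
 then show "{0..<N (g b - g a)} \<subseteq> (\<lambda>z. N (z - g a)) ` g ` {a..b}" by fastforce
 show "\<bar>N (x - g a) - N (y - g a)\<bar> \<le> N (x - y)" if "x \<in> V" "y \<in> V" for x y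
  using N_diff_abs[of "x - g a" "y - g a"] that by simp
 have "g ` {a..b} \<subseteq> G" using ab by (auto simp: G_def)
 moreover have "G \<subseteq> (\<Union>i. U i)" using U by (simp add: fine_covers_def)
 ultimately show "g ` {a..b} \<subseteq> (\<Union>i. U i)" by (rule order_trans)
 show "U i \<subseteq> V" for i using U by (simp add: fine_covers_def)
qed

text \<open>The parameter interval is cut into equal pieces of length at most \<delta>. This bound
  makes the content finite, so that differences of contents make sense.\<close>

lemma hcont_G_le:
 assumes "\<delta> > 0"
 shows "hcont \<delta> G \<le> ennreal L"
proof -
 define n where "n = nat \<lceil>L / \<delta>\<rceil>"
 have n: "real n \<ge> L / \<delta>" "n > 0" using assms L_pos by (auto simp: n_def)
 define U where "U i = (if i < n then g ` {real i * (L / n)..real (Suc i) * (L / n)} else {})" for i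
 have step: "L / n \<le> \<delta>" using n assms L_pos by (simp add: field_simps)
 have d: "ediam (U i) \<le> ennreal (L / n)" if "i < n" for i
 proof (rule ediam_le)
  fix x y assume "x \<in> U i" "y \<in> U i"
  then have "x \<in> g ` {real i * (L / n)..real (Suc i) * (L / n)}" "y \<in> g ` {real i * (L / n)..real (Suc i) * (L / n)}"
   using that by (simp_all only: U_def if_True)
  then obtain t u where tu: "x = g t" "y = g u" "t \<in> {real i * (L / n)..real (Suc i) * (L / n)}"
   "u \<in> {real i * (L / n)..real (Suc i) * (L / n)}" by (elim imageE)
  have "real (Suc i) * (L / n) - real i * (L / n) = L / n" by (simp add: algebra_simps add_divide_distrib)
  then have "\<bar>t - u\<bar> \<le> L / n" using tu unfolding atLeastAtMost_iff by linarith
  then show "N (x - y) \<le> L / n" using g_lip[of t u] tu by simp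
 qed
 have "U \<in> fine_covers \<delta> G" unfolding fine_covers_def
 proof (intro CollectI conjI allI)
  show "U i \<subseteq> V" for i by (auto simp: U_def)
  show "ediam (U i) \<le> ennreal \<delta>" for i
  proof (cases "i < n")
   case True
   then show ?thesis using d[OF True] step by (meson ennreal_leI order_trans)
  qed (simp add: U_def)
  show "G \<subseteq> (\<Union>i. U i)"
  proof
   fix x assume "x \<in> G"
   then obtain t where t: "0 \<le> t" "t \<le> L" "x = g t" by (auto simp: G_def)
   define i where "i = min (nat \<lfloor>t / (L / n)\<rfloor>) (n - 1)"
   have q: "L / n > 0" using n L_pos by simp
   have i: "i < n" using n by (auto simp: i_def)
   have tq: "0 \<le> t / (L / n)" using t q by simp
   have "real i \<le> t / (L / n)"
   proof -
    have "real (nat \<lfloor>t / (L / n)\<rfloor>) \<le> t / (L / n)" using tq by simp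
    then show ?thesis by (auto simp: i_def min_def)
   qed
   moreover have "t / (L / n) \<le> real (Suc i)"
   proof (cases "nat \<lfloor>t / (L / n)\<rfloor> \<le> n - 1")
    case True
    then show ?thesis using tq by (simp add: i_def) linarith
   next
    case False
    then have "Suc i = n" using n by (auto simp: i_def)
    moreover have "t / (L / n) \<le> n" using t L_pos n q by (simp add: field_simps)
    ultimately show ?thesis by simp
   qed
   ultimately have "real i * (L / n) \<le> t" "t \<le> real (Suc i) * (L / n)"
    by (simp_all only: pos_le_divide_eq[OF q] pos_divide_le_eq[OF q])
   then have "x \<in> U i" using t i by (auto simp: U_def)
   then show "x \<in> (\<Union>i. U i)" by blast
  qed
 qed
 then have "hcont \<delta> G \<le> (\<Sum>i. ediam (U i))" unfolding hcont_def by (rule INF_lower)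
 also have "\<dots> = (\<Sum>i<n. ediam (U i))" by (rule suminf_finite) (auto simp: U_def)
 also have "\<dots> \<le> (\<Sum>i<n. ennreal (L / n))" by (intro sum_mono d) auto
 also have "\<dots> = ennreal (\<Sum>i<n. L / n)" using L_pos by (intro sum_ennreal) simp
 also have "(\<Sum>i<n. L / n) = L" using n by simp
 finally show ?thesis .
qed

end

section \<open>Merging covers\<close>

context normed_on
begin

lemma N_three: "x \<in> V \<Longrightarrow> p \<in> V \<Longrightarrow> q \<in> V \<Longrightarrow> y \<in> V \<Longrightarrow> N (x - y) \<le> N (x - p) + N (p - q) + N (q - y)"
 using N_diff_triangle[of x p y] N_diff_triangle[of p q y] by simp

text \<open>A member has diameter at most \<delta>, so it meets at most one of the sets B x and
  nothing is counted twice.\<close>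

lemma disjoint_hits:
 assumes fin: "finite H" and U: "\<And>i. ediam (U i) \<le> ennreal \<delta>" "0 \<le> \<delta>"
  and sep: "\<And>x x' p q. x \<in> H \<Longrightarrow> x' \<in> H \<Longrightarrow> x \<noteq> x' \<Longrightarrow> p \<in> B x \<Longrightarrow> q \<in> B x' \<Longrightarrow> \<delta> < N (p - q)"
 shows "(\<Sum>x\<in>H. \<Sum>i. if U i \<inter> B x \<noteq> {} then ediam (U i) else 0)
  \<le> (\<Sum>i. if U i \<inter> (\<Union>x\<in>H. B x) \<noteq> {} then ediam (U i) else 0)"
proof -
 let ?S = "\<lambda>T i. if U i \<inter> T \<noteq> {} then ediam (U i) else 0"
 have "(\<Sum>x\<in>H. \<Sum>i. ?S (B x) i) = (\<Sum>i. \<Sum>x\<in>H. ?S (B x) i)" by (rule suminf_sum[symmetric]) (rule summableI)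
 also have "\<dots> \<le> (\<Sum>i. ?S (\<Union>x\<in>H. B x) i)"
 proof (rule suminf_le)
  fix i
  show "(\<Sum>x\<in>H. ?S (B x) i) \<le> ?S (\<Union>x\<in>H. B x) i"
  proof (cases "\<exists>x\<in>H. U i \<inter> B x \<noteq> {}")
   case True
   then obtain x where x: "x \<in> H" "U i \<inter> B x \<noteq> {}" by (elim bexE)
   then obtain p where p: "p \<in> U i" "p \<in> B x" by auto
   have "U i \<inter> B x' \<noteq> {} \<longleftrightarrow> x' = x" if x': "x' \<in> H" for x'
   proof
    assume "U i \<inter> B x' \<noteq> {}"
    then obtain q where q: "q \<in> U i" "q \<in> B x'" by auto
    have "N (p - q) \<le> \<delta>" by (rule N_le_ediam[OF p(1) q(1) U])
    then show "x' = x" using sep[OF x(1) x' _ p(2) q(2)] by fastforce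
   qed (use x in simp)
   then have "(\<Sum>x'\<in>H. ?S (B x') i) = (\<Sum>x'\<in>H. if x' = x then ediam (U i) else 0)"
    by (intro sum.cong) simp_all
   also have "\<dots> = ediam (U i)" using x fin by simp
   finally show ?thesis using x by auto
  next
   case False
   then have "(\<Sum>x\<in>H. ?S (B x) i) = 0" by (intro sum.neutral) auto
   then show ?thesis by simp
  qed
 qed (rule summableI)+
 finally show ?thesis .
qed

text \<open>All members of a cover that meet the same core are replaced by their union; the total diameter
 drops by the gain, so the content at the coarser scale is smaller.\<close>

lemma merge_gain:
 assumes fin: "finite Zs" and core: "\<And>z. z \<in> Zs \<Longrightarrow> core z \<subseteq> V"
  and sep: "\<And>z z' p q. z \<in> Zs \<Longrightarrow> z' \<in> Zs \<Longrightarrow> z \<noteq> z' \<Longrightarrow> p \<in> core z \<Longrightarrow> q \<in> core z' \<Longrightarrow> \<delta> < N (p - q)"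
  and c: "\<And>z p q. z \<in> Zs \<Longrightarrow> p \<in> core z \<Longrightarrow> q \<in> core z \<Longrightarrow> N (p - q) \<le> c z"
  and c0: "\<And>z. z \<in> Zs \<Longrightarrow> 0 \<le> c z" "\<And>z. z \<in> Zs \<Longrightarrow> c z + 2 * \<delta> \<le> \<Delta>"
  and \<delta>: "0 \<le> \<delta>" "\<delta> \<le> \<Delta>" and \<gamma>: "\<And>z. z \<in> Zs \<Longrightarrow> 0 \<le> \<gamma> z"
  and gain: "\<And>U z. U \<in> fine_covers \<delta> S \<Longrightarrow> z \<in> Zs \<Longrightarrow>
   ennreal (c z + 2 * \<delta> + \<gamma> z) \<le> (\<Sum>i. if U i \<inter> core z \<noteq> {} then ediam (U i) else 0)"
 shows "hcont \<Delta> S + ennreal (\<Sum>z\<in>Zs. \<gamma> z) \<le> hcont \<delta> S"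
proof -
 have "hcont \<Delta> S + ennreal (\<Sum>z\<in>Zs. \<gamma> z) \<le> (\<Sum>i. ediam (U i))" if U: "U \<in> fine_covers \<delta> S" for U
 proof -
  define J where "J z = {i. U i \<inter> core z \<noteq> {}}" for z
  define W where "W z = (\<Union>i\<in>J z. U i)" for z
  have UV: "U i \<subseteq> V" "ediam (U i) \<le> ennreal \<delta>" for i using U by (simp_all add: fine_covers_def)
  have near: "N (x - y) \<le> \<delta>" if "x \<in> U i" "y \<in> U i" for x y i by (rule N_le_ediam[OF that UV(2) \<delta>(1)])
  have disj: "J z \<inter> J z' = {}" if z: "z \<in> Zs" "z' \<in> Zs" "z \<noteq> z'" for z z'
  proof (rule ccontr)
   assume "J z \<inter> J z' \<noteq> {}"
   then obtain i where "i \<in> J z" "i \<in> J z'" by (elim ex_in_conv[THEN iffD2, THEN exE] IntE)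
   then obtain p q where p: "p \<in> U i" "p \<in> core z" and q: "q \<in> U i" "q \<in> core z'" unfolding J_def by blast
   show False using near[OF p(1) q(1)] sep[OF z p(2) q(2)] by simp
  qed
  have diamW: "ediam (W z) \<le> ennreal (c z + 2 * \<delta>)" if z: "z \<in> Zs" for z
  proof (rule ediam_le)
   fix x y assume "x \<in> W z" "y \<in> W z"
   then obtain i k where ik: "i \<in> J z" "k \<in> J z" "x \<in> U i" "y \<in> U k" unfolding W_def by (elim UN_E)
   then obtain p q where p: "p \<in> U i" "p \<in> core z" and q: "q \<in> U k" "q \<in> core z" unfolding J_def by blast
   have V: "x \<in> V" "y \<in> V" "p \<in> V" "q \<in> V"
    using UV(1)[THEN subsetD, OF ik(3)] UV(1)[THEN subsetD, OF ik(4)] UV(1)[THEN subsetD, OF p(1)] UV(1)[THEN subsetD, OF q(1)] .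
   have "N (x - y) \<le> N (x - p) + N (p - q) + N (q - y)" using V by (intro N_three)
   then show "N (x - y) \<le> c z + 2 * \<delta>"
    using near[OF ik(3) p(1)] near[OF q(1) ik(4)] c[OF z p(2) q(2)] by linarith
  qed
  have merged: "hcont \<Delta> S + (\<Sum>z\<in>Zs. \<Sum>i. if i \<in> J z then ediam (U i) else 0)
    \<le> (\<Sum>i. ediam (U i)) + (\<Sum>z\<in>Zs. ediam (W z))"
  proof (rule merge_cover[OF U \<delta>(2) fin disj])
   show "U i \<subseteq> W z" if "i \<in> J z" for z i unfolding W_def using that by (rule UN_upper)
   show "W z \<subseteq> V" for z unfolding W_def using UV(1) by (rule UN_least)
   show "ediam (W z) \<le> ennreal \<Delta>" if "z \<in> Zs" for z
    using diamW[OF that] ennreal_leI[OF c0(2)[OF that]] by (rule order_trans)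
  qed
  let ?c = "\<Sum>z\<in>Zs. c z + 2 * \<delta>" and ?g = "\<Sum>z\<in>Zs. \<gamma> z"
  have pos: "0 \<le> c z + 2 * \<delta>" if "z \<in> Zs" for z using c0(1)[OF that] \<delta>(1) by simp
  have nn: "0 \<le> ?c" "0 \<le> ?g" using pos \<gamma> by (simp_all add: sum_nonneg)
  have "ennreal (?c + ?g) = (\<Sum>z\<in>Zs. ennreal (c z + 2 * \<delta> + \<gamma> z))"
   using pos \<gamma> by (subst sum_ennreal) (auto simp: sum.distrib)
  also have "\<dots> \<le> (\<Sum>z\<in>Zs. \<Sum>i. if i \<in> J z then ediam (U i) else 0)"
   by (rule sum_mono) (use gain[OF U] in \<open>simp add: J_def\<close>)
  finally have "hcont \<Delta> S + ennreal (?c + ?g) \<le> hcont \<Delta> S + (\<Sum>z\<in>Zs. \<Sum>i. if i \<in> J z then ediam (U i) else 0)"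
   by (rule add_left_mono)
  also note merged
  also have "(\<Sum>i. ediam (U i)) + (\<Sum>z\<in>Zs. ediam (W z)) \<le> (\<Sum>i. ediam (U i)) + ennreal ?c"
  proof (rule add_left_mono)
   have "(\<Sum>z\<in>Zs. ediam (W z)) \<le> (\<Sum>z\<in>Zs. ennreal (c z + 2 * \<delta>))" by (rule sum_mono) (rule diamW)
   also have "\<dots> = ennreal ?c" using pos by (rule sum_ennreal)
   finally show "(\<Sum>z\<in>Zs. ediam (W z)) \<le> ennreal ?c" .
  qed
  finally have "ennreal ?c + (hcont \<Delta> S + ennreal ?g) \<le> ennreal ?c + (\<Sum>i. ediam (U i))"
   using nn by (simp only: ennreal_plus add.assoc add.left_commute add.commute)
  \<comment> \<open>The sum of the merged diameters is finite, so it cancels in the extended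
    reals.\<close>
  then show ?thesis by (simp only: ennreal_add_left_cancel_le) simp
 qed
 then show ?thesis unfolding hcont_def[of \<delta>] by (rule INF_greatest)
qed

lemma near_segment:
 assumes "z \<in> V" "a \<in> V" "b \<in> V" "sdist z a b \<le> \<eta>"
 obtains l where "0 \<le> l" "l \<le> 1" "N (z - (a + l *\<^sub>R (b - a))) \<le> \<eta>"
 using sdist_attained[OF assms(1-3)] assms(4) by metis

lemma near_segment_diff:
 assumes V: "p \<in> V" "q \<in> V" "a \<in> V" "b \<in> V"
  and p: "N (p - (a + l *\<^sub>R (b - a))) \<le> \<eta>" and q: "N (q - (a + m *\<^sub>R (b - a))) \<le> \<eta>"
 shows "N (p - q) \<le> \<bar>l - m\<bar> * N (b - a) + 2 * \<eta>"
proof -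
 let ?p = "a + l *\<^sub>R (b - a)" and ?q = "a + m *\<^sub>R (b - a)"
 have "N (?p - ?q) = N ((l - m) *\<^sub>R (b - a))" by (simp add: algebra_simps)
 also have "\<dots> = \<bar>l - m\<bar> * N (b - a)" using V by (simp add: N_scale)
 finally have e: "N (?p - ?q) = \<bar>l - m\<bar> * N (b - a)" .
 have "N (p - q) \<le> N (p - ?p) + N (?p - ?q) + N (?q - q)" using V by (intro N_three) simp_all
 moreover have "N (?q - q) = N (q - ?q)" by (rule N_commute)
 ultimately show ?thesis using e p q by linarith
qed

end

context curve_on
begin

text \<open>A core consists of a nearly straight strand through z and a small ball around a point y
  z off the strand. Every cover spends at least the chord length C on the strand and w / 2 on the
  ball, on different members, because the two are more than \<delta> apart. As z is 6 R away from
  both ends, the ball does not enlarge the diameter of the strand, so the merged set has diameter at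
  most C + 2 \<eta> + 2 \<delta> \<le> C + w / 4. The difference is the gain w / 4.\<close>

lemma strand_merge:
 fixes a b :: "'a \<Rightarrow> real" and y :: "'a \<Rightarrow> 'a"
 assumes fin: "finite Zs"
  and ab: "\<And>z. z \<in> Zs \<Longrightarrow> 0 \<le> a z" "\<And>z. z \<in> Zs \<Longrightarrow> a z \<le> b z" "\<And>z. z \<in> Zs \<Longrightarrow> b z \<le> L"
  and zs: "\<And>z. z \<in> Zs \<Longrightarrow> \<exists>t. a z \<le> t \<and> t \<le> b z \<and> z = g t"
  and line: "\<And>z t. z \<in> Zs \<Longrightarrow> a z \<le> t \<Longrightarrow> t \<le> b z \<Longrightarrow> sdist (g t) (g (a z)) (g (b z)) \<le> \<eta>"
  and ends: "\<And>z. z \<in> Zs \<Longrightarrow> 6 * R \<le> N (z - g (a z))" "\<And>z. z \<in> Zs \<Longrightarrow> 6 * R \<le> N (z - g (b z))"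
  and Dm: "\<And>z. z \<in> Zs \<Longrightarrow> dg (a z) (b z) \<le> Dm"
  and y: "\<And>z. z \<in> Zs \<Longrightarrow> y z \<in> G" "\<And>z. z \<in> Zs \<Longrightarrow> N (y z - z) \<le> R"
   "\<And>z t. z \<in> Zs \<Longrightarrow> a z \<le> t \<Longrightarrow> t \<le> b z \<Longrightarrow> w \<le> N (y z - g t)"
  and far: "\<And>z z'. z \<in> Zs \<Longrightarrow> z' \<in> Zs \<Longrightarrow> z \<noteq> z' \<Longrightarrow> 2 * Dm + \<delta> < N (z - z')"
  and num: "0 < w" "w \<le> R" "0 \<le> \<eta>" "\<eta> \<le> w / 16" "0 < \<delta>" "\<delta> \<le> w / 16" "0 \<le> Dm" "Dm + w \<le> \<Delta>"
 shows "hcont \<Delta> G + ennreal (real (card Zs) * (w / 4)) \<le> hcont \<delta> G"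
proof -
 define strand where "strand z = g ` {a z..b z}" for z
 define ball where "ball z = G \<inter> {p. N (p - y z) < w / 2}" for z
 define C where "C z = N (g (b z) - g (a z))" for z
 have zG: "z \<in> G" if z: "z \<in> Zs" for z
 proof -
  obtain t where "a z \<le> t" "t \<le> b z" "z = g t" using zs[OF z] by (elim exE conjE)
  then show ?thesis using ab[OF z] unfolding G_def by (intro image_eqI[of _ _ t]) simp_all
 qed
 have inV: "p \<in> V" if "p \<in> G" for p using G_V that by (rule subsetD)
 have zV: "z \<in> V" "y z \<in> V" if "z \<in> Zs" for z using inV[OF zG[OF that]] inV[OF y(1)[OF that]] .
 have strandV: "strand z \<subseteq> V" for z unfolding strand_def by auto
 have ballV: "ball z \<subseteq> V" for z unfolding ball_def using G_V by (rule le_infI1)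
 have yz: "w \<le> N (y z - z)" if z: "z \<in> Zs" for z using zs[OF z] y(3)[OF z] by metis
 have ballz: "N (p - z) \<le> 3/2 * R" if z: "z \<in> Zs" and p: "p \<in> ball z" for z p
 proof -
  have "p \<in> V" using subsetD[OF ballV p] .
  then have "N (p - z) \<le> N (p - y z) + N (y z - z)" using zV[OF z] by (intro N_diff_triangle) simp_all
  then show ?thesis using p y(2)[OF z] num unfolding ball_def by simp
 qed
 \<comment> \<open>The position l0 of z along the chord; the distances from z to the ends say that
   the chord extends about 6 R to both sides.\<close>
 have key: "\<exists>l0. 0 \<le> l0 \<and> l0 \<le> 1 \<and> N (z - (g (a z) + l0 *\<^sub>R (g (b z) - g (a z)))) \<le> \<eta> \<and>
   6 * R \<le> l0 * C z + 2 * \<eta> \<and> 6 * R \<le> (1 - l0) * C z + 2 * \<eta>" if z: "z \<in> Zs" for z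
 proof -
  obtain t where t: "a z \<le> t" "t \<le> b z" "z = g t" using zs[OF z] by (elim exE conjE)
  have sd: "sdist z (g (a z)) (g (b z)) \<le> \<eta>" unfolding t(3) by (rule line[unfolded t(3)[symmetric]]) (use z t in \<open>simp_all\<close>)
  obtain l where l: "0 \<le> l" "l \<le> 1" "N (z - (g (a z) + l *\<^sub>R (g (b z) - g (a z)))) \<le> \<eta>"
   using near_segment[OF zV(1)[OF z] g_in g_in sd] .
  have 1: "N (z - g (a z)) \<le> \<bar>l - 0\<bar> * C z + 2 * \<eta>" unfolding C_def
   using zV[OF z] l num by (intro near_segment_diff) simp_all
  have 2: "N (z - g (b z)) \<le> \<bar>l - 1\<bar> * C z + 2 * \<eta>" unfolding C_def
   using zV[OF z] l num by (intro near_segment_diff) simp_all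
  have "\<bar>l - 0\<bar> = l" "\<bar>l - 1\<bar> = 1 - l" using l by simp_all
  then show ?thesis using 1 2 l ends[OF z] by (intro exI[of _ l]) simp
 qed
 have Cz: "R \<le> C z" if z: "z \<in> Zs" for z
 proof -
  obtain l where l: "0 \<le> l" "l \<le> 1" "6 * R \<le> l * C z + 2 * \<eta>" "6 * R \<le> (1 - l) * C z + 2 * \<eta>" using key[OF z] by (elim exE conjE)
  have "l * C z + (1 - l) * C z = C z" by (simp add: algebra_simps)
  then show ?thesis using l num by linarith
 qed
 have pos: "\<exists>l. 0 \<le> l \<and> l \<le> 1 \<and> N (p - (g (a z) + l *\<^sub>R (g (b z) - g (a z)))) \<le> \<eta>"
  if z: "z \<in> Zs" and p: "p \<in> strand z" for z p
 proof -
  obtain t where t: "a z \<le> t" "t \<le> b z" "p = g t" using p unfolding strand_def by auto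
  obtain l where "0 \<le> l" "l \<le> 1" "N (g t - (g (a z) + l *\<^sub>R (g (b z) - g (a z)))) \<le> \<eta>"
   using near_segment[OF g_in g_in g_in line[OF z t(1,2)]] .
  then show ?thesis using t(3) by auto
 qed
 have near_mult: "\<bar>l - m\<bar> * C z \<le> C z" if "0 \<le> l" "l \<le> 1" "0 \<le> m" "m \<le> 1" for l m z
 proof -
  have "\<bar>l - m\<bar> \<le> 1" using that by simp
  moreover have "0 \<le> C z" by (simp add: C_def)
  ultimately have "\<bar>l - m\<bar> * C z \<le> 1 * C z" by (rule mult_right_mono)
  then show ?thesis by simp
 qed
 have ss: "N (p - q) \<le> C z + 2 * \<eta>" if z: "z \<in> Zs" and p: "p \<in> strand z" and q: "q \<in> strand z" for z p q
 proof -
  obtain l m where l: "0 \<le> l" "l \<le> 1" "N (p - (g (a z) + l *\<^sub>R (g (b z) - g (a z)))) \<le> \<eta>"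
   and m: "0 \<le> m" "m \<le> 1" "N (q - (g (a z) + m *\<^sub>R (g (b z) - g (a z)))) \<le> \<eta>"
   using pos[OF z p] pos[OF z q] by (elim exE conjE)
  have "N (p - q) \<le> \<bar>l - m\<bar> * C z + 2 * \<eta>" unfolding C_def
   by (rule near_segment_diff) (use l m subsetD[OF strandV p] subsetD[OF strandV q] in simp_all)
  then show ?thesis using near_mult[OF l(1,2) m(1,2), of z] by linarith
 qed
 have sb: "N (p - q) \<le> C z" if z: "z \<in> Zs" and p: "p \<in> strand z" and q: "q \<in> ball z" for z p q
 proof -
  obtain l where l: "0 \<le> l" "l \<le> 1" "N (p - (g (a z) + l *\<^sub>R (g (b z) - g (a z)))) \<le> \<eta>"
   using pos[OF z p] by (elim exE conjE)
  obtain m where m: "0 \<le> m" "m \<le> 1" "N (z - (g (a z) + m *\<^sub>R (g (b z) - g (a z)))) \<le> \<eta>"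
   "6 * R \<le> m * C z + 2 * \<eta>" "6 * R \<le> (1 - m) * C z + 2 * \<eta>" using key[OF z] by (elim exE conjE)
  have V: "p \<in> V" "q \<in> V" using subsetD[OF strandV p] subsetD[OF ballV q] .
  have 1: "N (p - z) \<le> \<bar>l - m\<bar> * C z + 2 * \<eta>" unfolding C_def
   using V zV[OF z] l m by (intro near_segment_diff) simp_all
  have C0: "0 \<le> C z" by (simp add: C_def)
  have sum1: "m * C z + (1 - m) * C z = C z" by (simp add: algebra_simps)
  have 2: "\<bar>l - m\<bar> * C z \<le> C z - 6 * R + 2 * \<eta>"
  proof (cases "l \<le> m")
   case True
   have "\<bar>l - m\<bar> * C z \<le> m * C z" by (rule mult_right_mono) (use True l C0 in simp_all)
   then show ?thesis using m sum1 by linarith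
  next
   case False
   have "\<bar>l - m\<bar> * C z \<le> (1 - m) * C z" by (rule mult_right_mono) (use False l C0 in simp_all)
   then show ?thesis using m sum1 by linarith
  qed
  have "N (p - q) \<le> N (p - z) + N (z - q)" using V zV[OF z] by (intro N_diff_triangle) simp_all
  moreover have "N (z - q) = N (q - z)" by (rule N_commute)
  ultimately show ?thesis using 1 2 ballz[OF z q] num by linarith
 qed
 have bb: "N (p - q) \<le> C z" if z: "z \<in> Zs" and p: "p \<in> ball z" and q: "q \<in> ball z" for z p q
 proof -
  have V: "p \<in> V" "q \<in> V" using subsetD[OF ballV p] subsetD[OF ballV q] .
  have "N (p - q) \<le> N (p - y z) + N (y z - q)" using V zV[OF z] by (intro N_diff_triangle) simp_all
  moreover have "N (y z - q) = N (q - y z)" by (rule N_commute)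
  ultimately show ?thesis using p q Cz[OF z] num unfolding ball_def by simp
 qed
 have chordDm: "C z \<le> Dm" if z: "z \<in> Zs" for z
  using dg_ge[of "a z" "b z" "b z" "a z"] ab[OF z] Dm[OF z] unfolding C_def by simp
 have R6: "6 * R \<le> Dm" if z: "z \<in> Zs" for z
 proof -
  obtain t where t: "a z \<le> t" "t \<le> b z" "z = g t" using zs[OF z] by (elim exE conjE)
  show ?thesis using dg_ge[of "a z" t "b z" "a z"] t ab[OF z] Dm[OF z] ends(1)[OF z] by simp
 qed
 have within: "N (p - z) \<le> Dm" if z: "z \<in> Zs" and p: "p \<in> strand z \<union> ball z" for z p using p
 proof
  assume "p \<in> strand z"
  then obtain u where u: "a z \<le> u" "u \<le> b z" "p = g u" unfolding strand_def by auto
  obtain t where t: "a z \<le> t" "t \<le> b z" "z = g t" using zs[OF z] by (elim exE conjE)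
  show ?thesis using dg_ge[of "a z" u "b z" t] t u Dm[OF z] by simp
 next
  assume "p \<in> ball z"
  then show ?thesis using ballz[OF z] R6[OF z] num by fastforce
 qed
 have "hcont \<Delta> G + ennreal (\<Sum>z\<in>Zs. w / 4) \<le> hcont \<delta> G"
 proof (rule merge_gain[where core="\<lambda>z. strand z \<union> ball z" and c="\<lambda>z. C z + 2 * \<eta>"])
  show "strand z \<union> ball z \<subseteq> V" for z using strandV ballV by (rule Un_least)
  fix z assume z: "z \<in> Zs"
  show "0 \<le> C z + 2 * \<eta>" using num by (simp add: C_def)
  show "C z + 2 * \<eta> + 2 * \<delta> \<le> \<Delta>" using chordDm[OF z] num by linarith
  show "0 \<le> w / 4" using num by simp
  show "N (p - q) \<le> C z + 2 * \<eta>" if p: "p \<in> strand z \<union> ball z" and q: "q \<in> strand z \<union> ball z" for p q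
  proof -
   have V: "p \<in> V" "q \<in> V" using p q strandV[of z] ballV[of z] by auto
   consider "p \<in> strand z" "q \<in> strand z" | "p \<in> strand z" "q \<in> ball z" | "p \<in> ball z" "q \<in> strand z" | "p \<in> ball z" "q \<in> ball z"
    using p q by (elim UnE)
   then show ?thesis
   proof cases
    case 1 then show ?thesis using ss[OF z] by simp
   next
    case 2 then show ?thesis using sb[OF z, of p q] num by simp
   next
    case 3 then show ?thesis using sb[OF z, of q p] num N_commute[of p q] by simp
   next
    case 4 then show ?thesis using bb[OF z, of p q] num by simp
   qed
  qed
  show "\<delta> < N (p - q)" if z': "z' \<in> Zs" "z \<noteq> z'" and p: "p \<in> strand z \<union> ball z" and q: "q \<in> strand z' \<union> ball z'" for z' p q
  proof -
   have V: "p \<in> V" "q \<in> V" using p q strandV[of z] ballV[of z] strandV[of z'] ballV[of z'] by auto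
   have "N (z - z') \<le> N (z - p) + N (p - q) + N (q - z')" using V zV[OF z] zV[OF z'(1)] by (intro N_three)
   moreover have "N (z - p) = N (p - z)" by (rule N_commute)
   ultimately show ?thesis using within[OF z p] within[OF z'(1) q] far[OF z z'] by linarith
  qed
  fix U assume U: "U \<in> fine_covers \<delta> G"
  let ?S = "\<lambda>T. \<lambda>i. if U i \<inter> T \<noteq> {} then ediam (U i) else 0"
  have UV: "U i \<subseteq> V" "ediam (U i) \<le> ennreal \<delta>" for i using U by (simp_all add: fine_covers_def)
  have "ennreal (C z) \<le> (\<Sum>i. ?S (strand z) i)"
   unfolding C_def strand_def by (rule strand_hits[OF U ab[OF z]])
  moreover have "ennreal (w / 2) \<le> (\<Sum>i. ?S (ball z) i)" unfolding ball_def
  proof (rule ball_hits[OF U y(1)[OF z] zG[OF z]])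
   show "w / 2 \<le> N (z - y z)" using yz[OF z] num N_commute[of z "y z"] zV[OF z] by simp
  qed
  ultimately have "ennreal (C z) + ennreal (w / 2) \<le> (\<Sum>i. ?S (strand z) i) + (\<Sum>i. ?S (ball z) i)"
   by (rule add_mono)
  also have "\<dots> = (\<Sum>i. ?S (strand z) i + ?S (ball z) i)" by (rule suminf_add) (rule summableI)+
  also have "\<dots> \<le> (\<Sum>i. ?S (strand z \<union> ball z) i)"
  proof (rule suminf_le)
   fix i
   have "U i \<inter> strand z = {} \<or> U i \<inter> ball z = {}"
   proof (rule ccontr)
    assume "\<not> (U i \<inter> strand z = {} \<or> U i \<inter> ball z = {})"
    then obtain p q where p: "p \<in> U i" "p \<in> strand z" and q: "q \<in> U i" "q \<in> ball z" by blast
    obtain t where t: "a z \<le> t" "t \<le> b z" "p = g t" using p(2) unfolding strand_def by auto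
    have V: "p \<in> V" "q \<in> V" using subsetD[OF strandV p(2)] subsetD[OF ballV q(2)] .
    have "N (q - p) \<le> \<delta>" using N_le_ediam[OF q(1) p(1) UV(2)] num by simp
    moreover have "w \<le> N (y z - p)" using y(3)[OF z t(1,2)] t(3) by simp
    moreover have "N (y z - p) \<le> N (y z - q) + N (q - p)" using V zV[OF z] by (intro N_diff_triangle) simp_all
    moreover have "N (y z - q) = N (q - y z)" by (rule N_commute)
    moreover have "N (q - y z) < w / 2" using q(2) unfolding ball_def by simp
    ultimately show False using num by linarith
   qed
   then show "?S (strand z) i + ?S (ball z) i \<le> ?S (strand z \<union> ball z) i"
    by (elim disjE) (simp_all add: Int_Un_distrib)
  qed (rule summableI)+
  finally have 1: "ennreal (C z) + ennreal (w / 2) \<le> (\<Sum>i. ?S (strand z \<union> ball z) i)" .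
  have "ennreal (C z + 2 * \<eta> + 2 * \<delta> + w / 4) \<le> ennreal (C z + w / 2)" using num by (intro ennreal_leI) simp
  also have "\<dots> = ennreal (C z) + ennreal (w / 2)" using num by (simp add: ennreal_plus[symmetric] C_def del: ennreal_plus)
  also note 1
  finally show "ennreal (C z + 2 * \<eta> + 2 * \<delta> + w / 4) \<le> (\<Sum>i. ?S (strand z \<union> ball z) i)" .
 qed (use fin num in simp_all)
 then show ?thesis by simp
qed

text \<open>Disjoint balls of radius r / 4 around m net points force every cover to spend m r / 4,
  while the union of the members meeting them has diameter at most 5 T. As m r \<ge> 40 T, this is
  at most half of the amount spent, and m r / 8 is gained.\<close>

lemma dense_merge:
 assumes X: "finite X" "X \<subseteq> G" and r: "0 < r" "r \<le> T"
  and sep: "\<And>x y. x \<in> X \<Longrightarrow> y \<in> X \<Longrightarrow> x \<noteq> y \<Longrightarrow> r \<le> N (x - y)"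
  and N0: "40 * T \<le> real N0 * r" and \<Delta>: "5 * T \<le> \<Delta>"
 shows "hcont \<Delta> G + ennreal (real (card {x \<in> X. N0 \<le> card {y \<in> X. N (x - y) \<le> T}}) * (r / 8)) \<le> hcont (r / 8) G"
proof -
 define Y where "Y = {x \<in> X. N0 \<le> card {y \<in> X. N (x - y) \<le> T}}"
 have YX: "Y \<subseteq> X" and finY: "finite Y" unfolding Y_def using X(1) by simp_all
 have T: "0 < T" using r by simp
 obtain Zs where Zs: "Zs \<subseteq> Y" and spread: "\<And>z z'. z \<in> Zs \<Longrightarrow> z' \<in> Zs \<Longrightarrow> z \<noteq> z' \<Longrightarrow> 2 * T < N (z - z')"
  and cover: "\<And>y. y \<in> Y \<Longrightarrow> \<exists>z\<in>Zs. N (y - z) \<le> max (2 * T) 0"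
  using maximal_spread[OF finY, of "2 * T"] by metis
 have finZ: "finite Zs" using Zs finY by (rule finite_subset)
 have ZX: "z \<in> X" if "z \<in> Zs" for z using subsetD[OF YX subsetD[OF Zs that]] .
 have XV: "x \<in> V" if "x \<in> X" for x using subsetD[OF G_V subsetD[OF X(2) that]] .
 define near where "near x z \<longleftrightarrow> z \<in> Zs \<and> N (z - x) \<le> T" for x z
 \<comment> \<open>All points within T of a center must stay in its group, since this keeps the
   group crowded; a crowded point near no center goes to one within 2 T.\<close>
 define f where "f x = (if \<exists>z. near x z then SOME z. near x z else SOME z. z \<in> Zs \<and> N (x - z) \<le> 2 * T)" for x
 define H where "H z = {x \<in> X. (x \<in> Y \<or> (\<exists>z. near x z)) \<and> f x = z}" for z
 have finH: "finite (H z)" for z unfolding H_def using X(1) by simp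
 have HX: "x \<in> X" "f x = z" if "x \<in> H z" for x z using that unfolding H_def by simp_all
 have near_uniq: "z = z'" if n: "near x z" "near x z'" and x: "x \<in> X" for x z z'
 proof (rule ccontr)
  assume ne: "z \<noteq> z'"
  have z: "z \<in> Zs" "z' \<in> Zs" using n unfolding near_def by simp_all
  have "N (z - z') \<le> N (z - x) + N (x - z')" using XV[OF x] XV[OF ZX[OF z(1)]] XV[OF ZX[OF z(2)]] by (intro N_diff_triangle)
  moreover have "N (x - z') = N (z' - x)" by (rule N_commute)
  ultimately show False using spread[OF z ne] n unfolding near_def by simp
 qed
 have f_near: "f x = z" if "near x z" "x \<in> X" for x z
 proof -
  have "near x (SOME z. near x z)" using that(1) by (rule someI)
  then have "(SOME z. near x z) = z" using that near_uniq by blast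
  then show ?thesis unfolding f_def using that(1) by auto
 qed
 have f_dist: "f x \<in> Zs \<and> N (x - f x) \<le> 2 * T" if x: "x \<in> X" "x \<in> Y \<or> (\<exists>z. near x z)" for x
 proof (cases "\<exists>z. near x z")
  case True
  then obtain z where z: "near x z" by (elim exE)
  have zz: "z \<in> Zs" "N (z - x) \<le> T" using z unfolding near_def by simp_all
  have "N (x - z) = N (z - x)" by (rule N_commute)
  then show ?thesis using f_near[OF z x(1)] zz T by simp
 next
  case False
  then have "\<exists>z. z \<in> Zs \<and> N (x - z) \<le> 2 * T" using cover[of x] x T by fastforce
  from someI_ex[OF this] show ?thesis unfolding f_def if_not_P[OF False] .
 qed
 have H_dist: "N (x - z) \<le> 2 * T" if "x \<in> H z" for x z using f_dist[of x] that unfolding H_def by auto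
 have H_card: "N0 \<le> card (H z)" if z: "z \<in> Zs" for z
 proof -
  have "{y \<in> X. N (z - y) \<le> T} \<subseteq> H z"
  proof
   fix y assume "y \<in> {y \<in> X. N (z - y) \<le> T}"
   then have "y \<in> X" "near y z" using z unfolding near_def by simp_all
   then show "y \<in> H z" using f_near[of y z] unfolding H_def by auto
  qed
  then have "card {y \<in> X. N (z - y) \<le> T} \<le> card (H z)" by (rule card_mono[OF finH])
  moreover have "N0 \<le> card {y \<in> X. N (z - y) \<le> T}" using subsetD[OF Zs z] unfolding Y_def by simp
  ultimately show ?thesis by simp
 qed
 have big: "5 * T \<le> real (card (H z)) * (r / 8)" if z: "z \<in> Zs" for z
 proof -
  have "real N0 * r \<le> real (card (H z)) * r" using H_card[OF z] r by (intro mult_right_mono) simp_all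
  then show ?thesis using N0 by simp
 qed
 define B where "B x = G \<inter> {p. N (p - x) < r / 4}" for x
 have BV: "p \<in> V" if "p \<in> B x" for p x using that G_V unfolding B_def by auto
 have Bd: "N (p - x) < r / 4" if "p \<in> B x" for p x using that unfolding B_def by simp
 have Bsep: "r / 8 < N (p - q)" if x: "x \<in> X" "x' \<in> X" "x \<noteq> x'" and p: "p \<in> B x" and q: "q \<in> B x'" for x x' p q
 proof -
  have "N (x - x') \<le> N (x - p) + N (p - q) + N (q - x')" using XV x BV[OF p] BV[OF q] by (intro N_three) simp_all
  moreover have "N (x - p) = N (p - x)" by (rule N_commute)
  ultimately show ?thesis using sep[OF x] Bd[OF p] Bd[OF q] r by linarith
 qed
 have "hcont \<Delta> G + ennreal (\<Sum>z\<in>Zs. real (card (H z)) * (r / 8)) \<le> hcont (r / 8) G"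
 proof (rule merge_gain[where core="\<lambda>z. \<Union>x\<in>H z. B x" and c="\<lambda>z. 4 * T + r / 2"])
  show "(\<Union>x\<in>H z. B x) \<subseteq> V" for z using BV by (intro UN_least subsetI)
  fix z assume z: "z \<in> Zs"
  show "0 \<le> 4 * T + r / 2" "4 * T + r / 2 + 2 * (r / 8) \<le> \<Delta>" "0 \<le> real (card (H z)) * (r / 8)" using r \<Delta> by simp_all
  show "r / 8 < N (p - q)" if "z' \<in> Zs" "z \<noteq> z'" and p: "p \<in> (\<Union>x\<in>H z. B x)" and q: "q \<in> (\<Union>x\<in>H z'. B x)" for z' p q
  proof -
   obtain x x' where x: "x \<in> H z" "p \<in> B x" "x' \<in> H z'" "q \<in> B x'" using p q by (elim UN_E)
   have "x \<noteq> x'" using HX(2)[OF x(1)] HX(2)[OF x(3)] that(2) by auto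
   then show ?thesis using Bsep[OF HX(1)[OF x(1)] HX(1)[OF x(3)]] x by simp
  qed
  show "N (p - q) \<le> 4 * T + r / 2" if p: "p \<in> (\<Union>x\<in>H z. B x)" and q: "q \<in> (\<Union>x\<in>H z. B x)" for p q
  proof -
   obtain x x' where x: "x \<in> H z" "p \<in> B x" "x' \<in> H z" "q \<in> B x'" using p q by (elim UN_E)
   have V: "p \<in> V" "q \<in> V" "x \<in> V" "x' \<in> V" "z \<in> V" using BV[OF x(2)] BV[OF x(4)] XV[OF HX(1)[OF x(1)]] XV[OF HX(1)[OF x(3)]] XV[OF ZX[OF z]] .
   have "N (p - q) \<le> N (p - x) + N (x - x') + N (x' - q)" using V by (intro N_three)
   moreover have "N (x - x') \<le> N (x - z) + N (z - x')" using V by (intro N_diff_triangle)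
   moreover have "N (x' - q) = N (q - x')" "N (z - x') = N (x' - z)" by (rule N_commute)+
   ultimately show ?thesis using H_dist[OF x(1)] H_dist[OF x(3)] Bd[OF x(2)] Bd[OF x(4)] by linarith
  qed
  fix U assume U: "U \<in> fine_covers (r / 8) G"
  let ?S = "\<lambda>T. \<lambda>i. if U i \<inter> T \<noteq> {} then ediam (U i) else 0"
  have UV: "ediam (U i) \<le> ennreal (r / 8)" for i using U by (simp add: fine_covers_def)
  have hit: "ennreal (r / 4) \<le> (\<Sum>i. ?S (B x) i)" if x: "x \<in> H z" for x
  proof -
   have "0 < real (card (H z) - 1)"
   proof -
    have "5 * r \<le> real (card (H z)) * (r / 8)" using big[OF z] r by linarith
    then have "40 * r \<le> real (card (H z)) * r" by simp
    then have "40 \<le> real (card (H z))" using r by (simp only: mult_le_cancel_right_pos)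
    then show ?thesis by simp
   qed
   then have "card (H z - {x}) \<noteq> 0" using x finH by simp
   then obtain x' where x': "x' \<in> H z" "x' \<noteq> x" by (metis Diff_iff card.empty ex_in_conv singletonI)
   show ?thesis unfolding B_def
   proof (rule ball_hits[OF U])
    show "x \<in> G" "x' \<in> G" using subsetD[OF X(2) HX(1)] x x' by simp_all
    show "r / 4 \<le> N (x' - x)" using sep[OF HX(1)[OF x'(1)] HX(1)[OF x] x'(2)] r by simp
   qed
  qed
  have "ennreal (real (card (H z)) * (r / 4)) = (\<Sum>x\<in>H z. ennreal (r / 4))"
   using r by (subst sum_ennreal) simp_all
  also have "\<dots> \<le> (\<Sum>x\<in>H z. \<Sum>i. ?S (B x) i)" by (rule sum_mono) (rule hit)
  also have "\<dots> \<le> (\<Sum>i. ?S (\<Union>x\<in>H z. B x) i)"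
   using r by (intro disjoint_hits[OF finH UV _ Bsep]) (auto dest: HX(1))
  finally have 1: "ennreal (real (card (H z)) * (r / 4)) \<le> (\<Sum>i. ?S (\<Union>x\<in>H z. B x) i)" .
  have "4 * T + r / 2 + 2 * (r / 8) + real (card (H z)) * (r / 8) \<le> real (card (H z)) * (r / 4)"
   using big[OF z] r by linarith
  from order_trans[OF ennreal_leI[OF this] 1]
  show "ennreal (4 * T + r / 2 + 2 * (r / 8) + real (card (H z)) * (r / 8)) \<le> (\<Sum>i. ?S (\<Union>x\<in>H z. B x) i)" .
 qed (use finZ r \<Delta> in simp_all)
 moreover have "real (card Y) * (r / 8) \<le> (\<Sum>z\<in>Zs. real (card (H z)) * (r / 8))"
 proof -
  have "Y \<subseteq> (\<Union>z\<in>Zs. H z)"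
  proof
   fix y assume y: "y \<in> Y"
   then have "y \<in> X" using YX by auto
   then show "y \<in> (\<Union>z\<in>Zs. H z)" using f_dist[of y] y unfolding H_def by auto
  qed
  then have "card Y \<le> card (\<Union>z\<in>Zs. H z)" by (rule card_mono[rotated]) (use finZ finH in simp)
  also have "\<dots> \<le> (\<Sum>z\<in>Zs. card (H z))" by (rule card_UN_le[OF finZ])
  finally have "real (card Y) \<le> (\<Sum>z\<in>Zs. real (card (H z)))" by (simp only: of_nat_sum[symmetric] of_nat_le_iff)
  then have "real (card Y) * (r / 8) \<le> (\<Sum>z\<in>Zs. real (card (H z))) * (r / 8)" using r by (intro mult_right_mono) simp_all
  then show ?thesis by (simp only: sum_distrib_right)
 qed
 ultimately show ?thesis unfolding Y_def[symmetric] by (meson add_left_mono ennreal_leI order_trans)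
qed

end

section \<open>The sum over one curve\<close>

lemma sum_cover:
 fixes \<phi> :: "'x \<Rightarrow> real"
 assumes "finite X" "finite W" "\<And>x. x \<in> X \<Longrightarrow> 0 \<le> \<phi> x" "\<And>x. x \<in> X \<Longrightarrow> \<exists>w\<in>W. Pr x w"
 shows "(\<Sum>x\<in>X. \<phi> x) \<le> (\<Sum>w\<in>W. \<Sum>x\<in>{x \<in> X. Pr x w}. \<phi> x)"
proof -
 have "\<phi> x \<le> (\<Sum>w\<in>W. if Pr x w then \<phi> x else 0)" if x: "x \<in> X" for x
 proof -
  obtain w where w: "w \<in> W" "Pr x w" using assms(4)[OF x] by (elim bexE)
  have "(if Pr x w then \<phi> x else 0) \<le> (\<Sum>w\<in>W. if Pr x w then \<phi> x else 0)"
   by (rule member_le_sum) (use w assms(2) assms(3)[OF x] in auto)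
  then show ?thesis using w by simp
 qed
 then have "(\<Sum>x\<in>X. \<phi> x) \<le> (\<Sum>x\<in>X. \<Sum>w\<in>W. if Pr x w then \<phi> x else 0)" by (rule sum_mono)
 also have "\<dots> = (\<Sum>w\<in>W. \<Sum>x\<in>X. if Pr x w then \<phi> x else 0)" by (rule sum.swap)
 also have "\<dots> = (\<Sum>w\<in>W. \<Sum>x\<in>{x \<in> X. Pr x w}. \<phi> x)" using assms(1) by (simp add: sum.inter_filter)
 finally show ?thesis .
qed

lemma sum_charge:
 fixes \<phi> h :: "_ \<Rightarrow> real"
 assumes fin: "finite X" "finite W" and \<phi>: "\<And>x. x \<in> X \<Longrightarrow> 0 \<le> \<phi> x" and h: "\<And>w. w \<in> W \<Longrightarrow> 0 \<le> h w"
  and ch: "\<And>x. x \<in> X \<Longrightarrow> \<exists>w\<in>W. Pr x w \<and> \<phi> x \<le> h w"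
  and card: "\<And>w. w \<in> W \<Longrightarrow> card {x \<in> X. Pr x w} \<le> n"
 shows "(\<Sum>x\<in>X. \<phi> x) \<le> real n * (\<Sum>w\<in>W. h w)"
proof -
 have "(\<Sum>x\<in>X. \<phi> x) \<le> (\<Sum>w\<in>W. \<Sum>x\<in>{x \<in> X. Pr x w \<and> \<phi> x \<le> h w}. \<phi> x)" by (rule sum_cover[OF fin \<phi> ch])
 also have "\<dots> \<le> (\<Sum>w\<in>W. real n * h w)"
 proof (rule sum_mono)
  fix w assume w: "w \<in> W"
  have "(\<Sum>x\<in>{x \<in> X. Pr x w \<and> \<phi> x \<le> h w}. \<phi> x) \<le> real (card {x \<in> X. Pr x w \<and> \<phi> x \<le> h w}) * h w"
   by (rule sum_bounded_above) simp
  also have "\<dots> \<le> real n * h w"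
  proof (rule mult_right_mono[OF _ h[OF w]])
   have "card {x \<in> X. Pr x w \<and> \<phi> x \<le> h w} \<le> card {x \<in> X. Pr x w}" by (rule card_mono) (use fin in auto)
   then show "real (card {x \<in> X. Pr x w \<and> \<phi> x \<le> h w}) \<le> real n" using card[OF w] by simp
  qed
  finally show "(\<Sum>x\<in>{x \<in> X. Pr x w \<and> \<phi> x \<le> h w}. \<phi> x) \<le> real n * h w" .
 qed
 finally show ?thesis by (simp add: sum_distrib_left)
qed

text \<open>A shift by m is a sum of m shifts by one, each telescoping to a difference of two values
  of f. A gain between scales j and j + m therefore costs a factor m.\<close>

lemma telescope_shift:
 fixes f :: "nat \<Rightarrow> real"
 assumes "\<And>i. 0 \<le> f i" "\<And>i. f i \<le> L"
 shows "(\<Sum>j<n. f (j + m) - f j) \<le> real m * L"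
proof (induction m)
 case (Suc m)
 have "(\<Sum>j<n. f (j + Suc m) - f (j + m)) = f (n + m) - f m"
  using sum_lessThan_telescope[of "\<lambda>j. f (j + m)" n] by simp
 also have "\<dots> \<le> L" using assms(1)[of m] assms(2)[of "n + m"] by linarith
 finally have "(\<Sum>j<n. f (j + Suc m) - f (j + m)) + (\<Sum>j<n. f (j + m) - f j) \<le> L + real m * L"
  using Suc by (rule add_mono)
 then show ?case by (simp add: sum.distrib[symmetric] algebra_simps del: sum.distrib)
qed simp

lemma sum_dyadic: "(\<Sum>M=1..<m. (real M + c) / 2 ^ M) \<le> c + 2" if "0 \<le> c"
proof -
 have F: "(\<Sum>M=1..<Suc m. (real M + c) / 2 ^ M) = c + 2 - (real m + 2 + c) / 2 ^ m" for m
  by (induction m) (simp_all add: field_simps)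
 show ?thesis
 proof (cases m)
  case (Suc k)
  have "0 \<le> (real k + 2 + c) / 2 ^ k" using that by simp
  then show ?thesis unfolding Suc F by linarith
 qed (use that in simp)
qed

text \<open>The number 40 T / r demanded by \<open>dense_merge\<close> for T = 10 \<rho> and r =
  \<rho> / 2^\<kappa>.\<close>

definition crowd :: "nat \<Rightarrow> nat" where "crowd \<kappa> = 400 * 2 ^ \<kappa>"

text \<open>One summand for each of the classes \<open>dense\<close>, \<open>ends\<close>,
  \<open>bent\<close>, \<open>angled\<close> and \<open>flats\<close>, in this order.\<close>

definition (in unif_convex_on) Kstar :: "real \<Rightarrow> nat \<Rightarrow> real"
 where "Kstar A \<kappa> = 2 ^ (\<kappa> + 3) * (real \<kappa> + 10) + 4 * real (crowd \<kappa>)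
  + real (crowd \<kappa>) * (192 * 2 ^ \<kappa> / A) powr s * CZ + real (crowd \<kappa>) * (384 * 2 ^ \<kappa> / A) powr s * CT
  + 64 * 2 ^ \<kappa> * real (crowd \<kappa>) * (real \<kappa> + 13)"

text \<open>The partition at scale \<rho> j is paired with balls of radius A \<rho> j / 2^\<kappa>,
  at most \<rho> j / 20, so arcs are long compared with the balls. The beta numbers enter only
  through \<open>wit\<close>: whatever line is proposed, the ball contains a point of the curve far
  from it.\<close>

locale star = filtration +
 fixes A :: real and \<kappa> :: nat and Y :: "nat \<Rightarrow> 'a set" and \<beta> :: "nat \<Rightarrow> 'a \<Rightarrow> real"
 assumes A: "1 \<le> A" and \<kappa>: "20 * A \<le> 2 ^ \<kappa>" and Y_fin: "finite (Y j)" and Y_G: "Y j \<subseteq> G"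
  and Y_sep: "x \<in> Y j \<Longrightarrow> y \<in> Y j \<Longrightarrow> x \<noteq> y \<Longrightarrow> \<rho> j / 2 ^ \<kappa> \<le> N (x - y)"
  and \<beta>_pos: "x \<in> Y j \<Longrightarrow> 0 < \<beta> j x" and \<beta>_le: "x \<in> Y j \<Longrightarrow> \<beta> j x \<le> 1"
  and wit: "x \<in> Y j \<Longrightarrow> a \<in> V \<Longrightarrow> w \<in> V \<Longrightarrow> w \<noteq> 0 \<Longrightarrow>
   \<exists>y\<in>G. N (y - x) \<le> A * \<rho> j / 2 ^ \<kappa> \<and> (\<forall>t. \<beta> j x * (A * \<rho> j / 2 ^ \<kappa>) \<le> N (y - (a + t *\<^sub>R w)))"
  and \<rho>0: "\<rho> 0 \<le> L"
begin

definition R :: "nat \<Rightarrow> real" where "R j = A * \<rho> j / 2 ^ \<kappa>"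
text \<open>The base scale 2^7 \<rho> j exceeds all merged diameters, which are at most 50 \<rho> j
  for crowded points and below 5 \<rho> j for strands. As every scale is \<open>\<rho> 0\<close>
  times a power of 2, the gains become differences of one sequence.\<close>

definition \<Phi> :: "nat \<Rightarrow> real" where "\<Phi> i = enn2real (hcont (2 ^ 7 * \<rho> 0 / 2 ^ i) G)"
definition dense :: "nat \<Rightarrow> 'a set" where "dense j = {x \<in> Y j. crowd \<kappa> \<le> card {y \<in> Y j. N (x - y) \<le> 10 * \<rho> j}}"
definition sparse :: "nat \<Rightarrow> 'a set" where "sparse j = Y j - dense j"
definition ends :: "nat \<Rightarrow> 'a set" where "ends j = {x \<in> sparse j. N (x - g 0) \<le> 5 * \<rho> j \<or> N (x - g L) \<le> 5 * \<rho> j}"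
text \<open>The numbers here and in \<open>angled\<close> are chosen so that an arc of deviation
  below \<beta> R / 192, or two such arcs meeting with a turn below \<beta> R / (384 \<rho>), stay
  within \<beta> R / 64 of the chord of the whole.\<close>

definition bent :: "nat \<Rightarrow> 'a set"
 where "bent j = {x \<in> sparse j. \<exists>a\<in>Q j. N (x - g a) \<le> 5 * \<rho> j \<and> \<beta> j x * R j \<le> 192 * e j a}"
definition angled :: "nat \<Rightarrow> 'a set"
 where "angled j = {x \<in> sparse j. \<exists>v\<in>I j. N (x - g v) \<le> 5 * \<rho> j \<and> \<beta> j x * R j \<le> 384 * (\<rho> j * \<theta> j v)}"
definition flats :: "nat \<Rightarrow> 'a set" where "flats j = sparse j - ends j - bent j - angled j"

lemma Y_V: "x \<in> Y j \<Longrightarrow> x \<in> V" using Y_G G_V by blast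
lemma sparse_Y: "x \<in> sparse j \<Longrightarrow> x \<in> Y j" by (simp add: sparse_def)
lemma sparse_fin: "finite (sparse j)" using Y_fin by (simp add: sparse_def)
lemma \<rho>_eq: "\<rho> j = \<rho> 0 / 2 ^ j"
proof (induction j)
 case (Suc j)
 then show ?case using \<rho>_half[of j] by simp
qed simp
lemma R_pos: "0 < R j" using A \<rho>_pos[of j] by (simp add: R_def)
lemma R_le: "20 * R j \<le> \<rho> j"
proof -
 have "20 * A * \<rho> j \<le> 2 ^ \<kappa> * \<rho> j" using \<kappa> \<rho>_pos[of j] by (intro mult_right_mono) simp_all
 then show ?thesis by (simp add: R_def field_simps)
qed

lemma hcont_fin: "0 < d \<Longrightarrow> hcont d G = ennreal (enn2real (hcont d G))"
 using hcont_G_le[of d] by (metis ennreal_enn2real ennreal_less_top order_le_less_trans)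

lemma gain_real:
 assumes "0 < d" "0 < d'" "0 \<le> c" "hcont d' G + ennreal c \<le> hcont d G"
 shows "c \<le> enn2real (hcont d G) - enn2real (hcont d' G)"
proof -
 have "ennreal (enn2real (hcont d' G) + c) = ennreal (enn2real (hcont d' G)) + ennreal c"
  using assms(3) by (intro ennreal_plus) simp_all
 also have "\<dots> = hcont d' G + ennreal c" unfolding hcont_fin[OF assms(2), symmetric] ..
 also note assms(4)
 also note hcont_fin[OF assms(1)]
 finally have "ennreal (enn2real (hcont d' G) + c) \<le> ennreal (enn2real (hcont d G))" .
 then have "enn2real (hcont d' G) + c \<le> enn2real (hcont d G)" by (rule ennreal_le_iff[THEN iffD1, rotated]) simp
 then show ?thesis by linarith
qed

lemma \<Phi>_nonneg: "0 \<le> \<Phi> i" by (simp add: \<Phi>_def)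
lemma \<Phi>_le: "\<Phi> i \<le> L"
proof -
 have "hcont (2 ^ 7 * \<rho> 0 / 2 ^ i) G \<le> ennreal L" using \<rho>_pos[of 0] by (intro hcont_G_le) simp
 then show ?thesis unfolding \<Phi>_def using L_pos by (simp add: enn2real_leI)
qed
lemma \<Phi>_gain:
 assumes "0 \<le> c" "hcont (2 ^ 7 * \<rho> j) G + ennreal c \<le> hcont (2 ^ 7 * \<rho> j / 2 ^ m) G"
 shows "c \<le> \<Phi> (j + m) - \<Phi> j"
proof -
 have "c \<le> enn2real (hcont (2 ^ 7 * \<rho> j / 2 ^ m) G) - enn2real (hcont (2 ^ 7 * \<rho> j) G)"
  using \<rho>_pos[of j] assms by (intro gain_real) simp_all
 moreover have "2 ^ 7 * \<rho> j / 2 ^ m = 2 ^ 7 * \<rho> 0 / 2 ^ (j + m)" "2 ^ 7 * \<rho> j = 2 ^ 7 * \<rho> 0 / 2 ^ j"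
  by (simp_all add: \<rho>_eq[of j] power_add)
 ultimately show ?thesis unfolding \<Phi>_def by (simp only:)
qed

section \<open>Crowded points, ends of the curve, bent arcs and turns\<close>

lemma dense_sum: "(\<Sum>j<n. real (card (dense j)) * \<rho> j) \<le> 2 ^ (\<kappa> + 3) * (real \<kappa> + 10) * L"
proof -
 have 1: "real (card (dense j)) * \<rho> j \<le> 2 ^ (\<kappa> + 3) * (\<Phi> (j + (\<kappa> + 10)) - \<Phi> j)" for j
 proof -
  let ?r = "\<rho> j / 2 ^ \<kappa>"
  have p: "0 < \<rho> j" by (rule \<rho>_pos)
  have "\<rho> j \<le> 10 * \<rho> j * 2 ^ \<kappa>"
  proof -
   have "1 \<le> (2::real) ^ \<kappa>" by simp
   then have "1 \<le> 10 * (2::real) ^ \<kappa>" by linarith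
   then have "1 * \<rho> j \<le> (10 * 2 ^ \<kappa>) * \<rho> j" by (rule mult_right_mono) (use p in simp)
   then show ?thesis by (simp add: mult_ac)
  qed
  then have r: "0 < ?r" "?r \<le> 10 * \<rho> j" using p by (simp_all add: field_simps)
  have "hcont (2 ^ 7 * \<rho> j) G + ennreal (real (card (dense j)) * (?r / 8)) \<le> hcont (?r / 8) G"
   unfolding dense_def
  proof (rule dense_merge[OF Y_fin Y_G r Y_sep])
   show "40 * (10 * \<rho> j) \<le> real (crowd \<kappa>) * ?r" by (simp add: crowd_def)
   show "5 * (10 * \<rho> j) \<le> 2 ^ 7 * \<rho> j" using p by simp
  qed
  \<comment> \<open>The fine scale of \<open>dense_merge\<close> is the base scale shifted by
    \<kappa> + 10 steps.\<close>
  moreover have "?r / 8 = 2 ^ 7 * \<rho> j / 2 ^ (\<kappa> + 10)" by (simp add: power_add)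
  ultimately have h: "hcont (2 ^ 7 * \<rho> j) G + ennreal (real (card (dense j)) * (?r / 8)) \<le> hcont (2 ^ 7 * \<rho> j / 2 ^ (\<kappa> + 10)) G"
   by (simp only:)
  have "real (card (dense j)) * (?r / 8) \<le> \<Phi> (j + (\<kappa> + 10)) - \<Phi> j" using r by (intro \<Phi>_gain[OF _ h]) simp
  then have "2 ^ (\<kappa> + 3) * (real (card (dense j)) * (?r / 8)) \<le> 2 ^ (\<kappa> + 3) * (\<Phi> (j + (\<kappa> + 10)) - \<Phi> j)"
   by (rule mult_left_mono) simp
  moreover have "2 ^ (\<kappa> + 3) * (real (card (dense j)) * (?r / 8)) = real (card (dense j)) * \<rho> j" by (simp add: power_add)
  ultimately show ?thesis by simp
 qed
 have "(\<Sum>j<n. real (card (dense j)) * \<rho> j) \<le> 2 ^ (\<kappa> + 3) * (\<Sum>j<n. \<Phi> (j + (\<kappa> + 10)) - \<Phi> j)"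
  unfolding sum_distrib_left by (rule sum_mono) (rule 1)
 also have "\<dots> \<le> 2 ^ (\<kappa> + 3) * (real (\<kappa> + 10) * L)"
  by (rule mult_left_mono[OF telescope_shift[OF \<Phi>_nonneg \<Phi>_le]]) simp
 finally show ?thesis by (simp add: mult_ac)
qed

lemma sparse_near: "x \<in> sparse j \<Longrightarrow> card {y \<in> Y j. N (x - y) \<le> 10 * \<rho> j} \<le> crowd \<kappa>"
 by (auto simp: sparse_def dense_def not_le)

text \<open>Points within 5 \<rho> of p are within 10 \<rho> of each other, so a single sparse point
  among them bounds their number. Each arc, vertex or end is thus charged boundedly often.\<close>

lemma sparse_card:
 assumes S: "S \<subseteq> sparse j" and p: "p \<in> V"
 shows "card {x \<in> S. N (x - p) \<le> 5 * \<rho> j} \<le> crowd \<kappa>"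
proof (cases "{x \<in> S. N (x - p) \<le> 5 * \<rho> j} = {}")
 case False
 then obtain x where x: "x \<in> S" "N (x - p) \<le> 5 * \<rho> j" by auto
 have xs: "x \<in> sparse j" using S x by auto
 have "{x \<in> S. N (x - p) \<le> 5 * \<rho> j} \<subseteq> {y \<in> Y j. N (x - y) \<le> 10 * \<rho> j}"
 proof
  fix y assume y: "y \<in> {x \<in> S. N (x - p) \<le> 5 * \<rho> j}"
  then have ys: "y \<in> Y j" using S sparse_Y by auto
  have "N (x - y) \<le> N (x - p) + N (p - y)" using Y_V[OF sparse_Y[OF xs]] Y_V[OF ys] p by (intro N_diff_triangle)
  moreover have "N (p - y) = N (y - p)" by (rule N_commute)
  ultimately show "y \<in> {y \<in> Y j. N (x - y) \<le> 10 * \<rho> j}" using x y ys by simp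
 qed
 then have "card {x \<in> S. N (x - p) \<le> 5 * \<rho> j} \<le> card {y \<in> Y j. N (x - y) \<le> 10 * \<rho> j}"
  by (intro card_mono) (use Y_fin in simp_all)
 then show ?thesis using sparse_near[OF xs] by simp
next
 case True
 show ?thesis unfolding True by simp
qed

lemma \<rho>_sum: "(\<Sum>j<n. \<rho> j) \<le> 2 * L"
proof -
 have "(\<Sum>j<n. \<rho> j) = 2 * \<rho> 0 - 2 * \<rho> n"
 proof (induction n)
  case (Suc n)
  then show ?case using \<rho>_half[of n] by simp
 qed simp
 then show ?thesis using \<rho>_pos[of n] \<rho>0 by linarith
qed

text \<open>Boundedly many points per scale are near the two ends of the curve, and the scales form
  a geometric series starting at most at L.\<close>

lemma ends_sum: "(\<Sum>j<n. real (card (ends j)) * \<rho> j) \<le> 4 * real (crowd \<kappa>) * L"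
proof -
 have c: "real (card (ends j)) * \<rho> j \<le> (2 * real (crowd \<kappa>)) * \<rho> j" for j
 proof (rule mult_right_mono)
  have "ends j = {x \<in> sparse j. N (x - g 0) \<le> 5 * \<rho> j} \<union> {x \<in> sparse j. N (x - g L) \<le> 5 * \<rho> j}"
   unfolding ends_def by auto
  then have "card (ends j) \<le> card {x \<in> sparse j. N (x - g 0) \<le> 5 * \<rho> j} + card {x \<in> sparse j. N (x - g L) \<le> 5 * \<rho> j}"
   by (simp only: card_Un_le)
  also have "\<dots> \<le> crowd \<kappa> + crowd \<kappa>" by (intro add_mono sparse_card order_refl g_in)
  finally show "real (card (ends j)) \<le> 2 * real (crowd \<kappa>)" by simp
 qed (use \<rho>_pos[of j] in simp)
 have "(\<Sum>j<n. real (card (ends j)) * \<rho> j) \<le> (2 * real (crowd \<kappa>)) * (\<Sum>j<n. \<rho> j)"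
  unfolding sum_distrib_left by (rule sum_mono) (rule c)
 also have "\<dots> \<le> (2 * real (crowd \<kappa>)) * (2 * L)" by (rule mult_left_mono[OF \<rho>_sum]) simp
 finally show ?thesis by simp
qed

lemma \<beta>_powr:
 assumes x: "x \<in> Y j" and le: "\<beta> j x * R j \<le> c * h" and h: "0 \<le> h" "0 < c"
 shows "\<beta> j x powr s * \<rho> j \<le> (c * 2 ^ \<kappa> / A) powr s * (h powr s * \<rho> j powr (1 - s))"
proof -
 have p: "0 < \<rho> j" by (rule \<rho>_pos)
 have "\<beta> j x \<le> (c * h) / R j" using le R_pos[of j] by (simp add: field_simps)
 also have "\<dots> = (c * 2 ^ \<kappa> / A) * (h / \<rho> j)" using A p by (simp add: R_def field_simps)
 finally have "\<beta> j x powr s \<le> ((c * 2 ^ \<kappa> / A) * (h / \<rho> j)) powr s"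
  using \<beta>_pos[OF x] s_ge by (intro powr_mono2) simp_all
 also have "\<dots> = (c * 2 ^ \<kappa> / A) powr s * (h powr s / \<rho> j powr s)"
  using A p h by (simp only: powr_mult powr_divide)
 finally have "\<beta> j x powr s * \<rho> j \<le> (c * 2 ^ \<kappa> / A) powr s * (h powr s / \<rho> j powr s) * \<rho> j"
  using p by (intro mult_right_mono) simp_all
 also have "\<dots> = (c * 2 ^ \<kappa> / A) powr s * (h powr s * \<rho> j powr (1 - s))" using p by (simp add: powr_diff)
 finally show ?thesis .
qed

lemma bent_sum: "(\<Sum>j<n. \<Sum>x\<in>bent j. \<beta> j x powr s * \<rho> j) \<le> real (crowd \<kappa>) * (192 * 2 ^ \<kappa> / A) powr s * CZ * L"
proof -
 let ?c = "(192 * 2 ^ \<kappa> / A) powr s"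
 have 1: "(\<Sum>x\<in>bent j. \<beta> j x powr s * \<rho> j) \<le> real (crowd \<kappa>) * ?c * Z j" for j
 proof -
  have "(\<Sum>x\<in>bent j. \<beta> j x powr s * \<rho> j) \<le> real (crowd \<kappa>) * (\<Sum>a\<in>Q j. ?c * (e j a powr s * \<rho> j powr (1 - s)))"
  proof (rule sum_charge[where Pr="\<lambda>x a. N (x - g a) \<le> 5 * \<rho> j"])
   show "finite (bent j)" using sparse_fin[of j] by (simp add: bent_def)
   show "finite (Q j)" by (rule Q_fin)
   show "0 \<le> \<beta> j x powr s * \<rho> j" for x using \<rho>_pos[of j] by simp
   show "0 \<le> ?c * (e j a powr s * \<rho> j powr (1 - s))" for a by simp
   show "\<exists>a\<in>Q j. N (x - g a) \<le> 5 * \<rho> j \<and> \<beta> j x powr s * \<rho> j \<le> ?c * (e j a powr s * \<rho> j powr (1 - s))" if hx: "x \<in> bent j" for x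
   proof -
    obtain a where a: "a \<in> Q j" "N (x - g a) \<le> 5 * \<rho> j" "\<beta> j x * R j \<le> 192 * e j a" and x: "x \<in> Y j"
     using hx sparse_Y unfolding bent_def by auto
    show ?thesis using a \<beta>_powr[OF x a(3) e_nonneg[OF a(1)]] by auto
   qed
   show "card {x \<in> bent j. N (x - g a) \<le> 5 * \<rho> j} \<le> crowd \<kappa>" for a
    by (rule sparse_card) (auto simp: bent_def)
  qed
  then show ?thesis unfolding Z_def by (simp add: sum_distrib_left sum_distrib_right mult_ac)
 qed
 have "(\<Sum>j<n. \<Sum>x\<in>bent j. \<beta> j x powr s * \<rho> j) \<le> real (crowd \<kappa>) * ?c * (\<Sum>j<n. Z j)"
  unfolding sum_distrib_left by (rule sum_mono) (rule 1)
 also have "\<dots> \<le> real (crowd \<kappa>) * ?c * (CZ * L)" by (rule mult_left_mono[OF Z_sum]) simp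
 finally show ?thesis by (simp add: mult_ac)
qed

lemma angled_sum: "(\<Sum>j<n. \<Sum>x\<in>angled j. \<beta> j x powr s * \<rho> j) \<le> real (crowd \<kappa>) * (384 * 2 ^ \<kappa> / A) powr s * CT * L"
proof -
 let ?c = "(384 * 2 ^ \<kappa> / A) powr s"
 have 1: "(\<Sum>x\<in>angled j. \<beta> j x powr s * \<rho> j) \<le> real (crowd \<kappa>) * ?c * \<Theta> j" for j
 proof -
  have p: "0 < \<rho> j" by (rule \<rho>_pos)
  have "(\<Sum>x\<in>angled j. \<beta> j x powr s * \<rho> j) \<le> real (crowd \<kappa>) * (\<Sum>v\<in>I j. ?c * (\<theta> j v powr s * \<rho> j))"
  proof (rule sum_charge[where Pr="\<lambda>x v. N (x - g v) \<le> 5 * \<rho> j"])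
   show "finite (angled j)" using sparse_fin[of j] by (simp add: angled_def)
   show "finite (I j)" by (rule I_fin)
   show "0 \<le> \<beta> j x powr s * \<rho> j" for x using p by simp
   show "0 \<le> ?c * (\<theta> j v powr s * \<rho> j)" for v using p by simp
   show "\<exists>v\<in>I j. N (x - g v) \<le> 5 * \<rho> j \<and> \<beta> j x powr s * \<rho> j \<le> ?c * (\<theta> j v powr s * \<rho> j)" if hx: "x \<in> angled j" for x
   proof -
    obtain v where v: "v \<in> I j" "N (x - g v) \<le> 5 * \<rho> j" "\<beta> j x * R j \<le> 384 * (\<rho> j * \<theta> j v)" and x: "x \<in> Y j"
     using hx sparse_Y unfolding angled_def by auto
    have "\<beta> j x powr s * \<rho> j \<le> ?c * ((\<rho> j * \<theta> j v) powr s * \<rho> j powr (1 - s))"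
     using p by (intro \<beta>_powr[OF x v(3)]) simp_all
    also have "(\<rho> j * \<theta> j v) powr s * \<rho> j powr (1 - s) = \<theta> j v powr s * (\<rho> j powr s * \<rho> j powr (1 - s))"
     using p by (simp add: powr_mult mult_ac)
    also have "\<rho> j powr s * \<rho> j powr (1 - s) = \<rho> j" using p by (simp add: powr_add[symmetric])
    finally show ?thesis using v by auto
   qed
   show "card {x \<in> angled j. N (x - g v) \<le> 5 * \<rho> j} \<le> crowd \<kappa>" for v
    by (rule sparse_card) (auto simp: angled_def)
  qed
  then show ?thesis unfolding \<Theta>_def by (simp add: sum_distrib_left sum_distrib_right mult_ac)
 qed
 have "(\<Sum>j<n. \<Sum>x\<in>angled j. \<beta> j x powr s * \<rho> j) \<le> real (crowd \<kappa>) * ?c * (\<Sum>j<n. \<Theta> j)"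
  unfolding sum_distrib_left by (rule sum_mono) (rule 1)
 also have "\<dots> \<le> real (crowd \<kappa>) * ?c * (CT * L)" by (rule mult_left_mono[OF \<Theta>_sum]) simp
 finally show ?thesis by (simp add: mult_ac)
qed

section \<open>Balls near whose centers the curve is straight\<close>

lemma arc_cover:
 assumes "0 \<le> t" "t \<le> L"
 obtains a where "a \<in> Q j" "a \<le> t" "t \<le> nx j a"
proof -
 let ?S = "{a \<in> Q j. a \<le> t}"
 have Q0: "0 \<in> Q j" using P_ends[of j] L_pos by (simp add: Q_def)
 have fin: "finite ?S" using Q_fin[of j] by simp
 have ne: "?S \<noteq> {}" using Q0 assms by auto
 define a where "a = Max ?S"
 have a: "a \<in> Q j" "a \<le> t" using Max_in[OF fin ne] unfolding a_def by simp_all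
 have "t \<le> nx j a"
 proof (rule ccontr)
  assume n: "\<not> t \<le> nx j a"
  then have "nx j a \<in> ?S" using nx(1)[OF a(1)] assms by (auto simp: Q_def)
  then have "nx j a \<le> a" unfolding a_def by (rule Max_ge[OF fin])
  then show False using nx(2)[OF a(1)] by simp
 qed
 then show ?thesis using that a by simp
qed

text \<open>Near a ball that is not charged to anything else the curve is a straight strand running through its center.\<close>

lemma flat_strand:
 assumes x: "x \<in> flats j"
 shows "\<exists>a b. 0 \<le> a \<and> a \<le> b \<and> b \<le> L \<and> (\<exists>t. a \<le> t \<and> t \<le> b \<and> x = g t) \<and>
  (\<forall>t. a \<le> t \<longrightarrow> t \<le> b \<longrightarrow> sdist (g t) (g a) (g b) \<le> \<beta> j x * R j / 64) \<and>
  6 * R j \<le> N (x - g a) \<and> 6 * R j \<le> N (x - g b) \<and> dg a b \<le> 4 * \<rho> j \<and> g a \<noteq> g b"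
proof -
 let ?b = "\<beta> j x * R j"
 have xs: "x \<in> sparse j" "x \<notin> ends j" "x \<notin> bent j" "x \<notin> angled j" using x by (simp_all add: flats_def)
 have xY: "x \<in> Y j" using sparse_Y[OF xs(1)] .
 have xV: "x \<in> V" using Y_V[OF xY] .
 have p: "0 < \<rho> j" by (rule \<rho>_pos)
 have b: "0 < ?b" "?b \<le> R j"
  using \<beta>_pos[OF xY] R_pos[of j] mult_right_mono[OF \<beta>_le[OF xY], of "R j"] by simp_all
 have eb: "192 * e j a < ?b" if "a \<in> Q j" "N (x - g a) \<le> 5 * \<rho> j" for a
  using xs(1,3) that by (auto simp: bent_def not_le)
 have tb: "384 * (\<rho> j * \<theta> j v) < ?b" if "v \<in> I j" "N (x - g v) \<le> 5 * \<rho> j" for v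
  using xs(1,4) that by (auto simp: angled_def not_le)
 obtain t where t: "0 \<le> t" "t \<le> L" "x = g t" using subsetD[OF Y_G xY] unfolding G_def by auto
 obtain a where a: "a \<in> Q j" "a \<le> t" "t \<le> nx j a" using arc_cover[OF t(1,2), of j] .
 have xa: "N (x - g a) \<le> 2 * \<rho> j" using dg_ge[of a t "nx j a" a] a t arc(2)[OF a(1)] nx(2)[OF a(1)] by simp
 have ea: "192 * e j a < ?b" using eb[OF a(1)] xa p by simp
 \<comment> \<open>If x is far from both ends of its arc, the arc itself serves. Otherwise x is
   close to a vertex v, and the two arcs meeting at v are joined.\<close>
 show ?thesis
 proof (cases "6 * R j \<le> N (x - g a) \<and> 6 * R j \<le> N (x - g (nx j a))")
  case True
  have "sdist (g u) (g a) (g (nx j a)) \<le> ?b / 64" if "a \<le> u" "u \<le> nx j a" for u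
   using esup_ge[OF that] ea b unfolding e_def by linarith
  moreover have "g a \<noteq> g (nx j a)"
  proof
   assume "g a = g (nx j a)"
   then have "chord j a = 0" by (simp add: chord_def N_zero)
   then show False using chord_ge[OF a(1)] ea b R_le[of j] R_pos[of j] by linarith
  qed
  ultimately show ?thesis using True a t nx(2,3)[OF a(1)] Q_lt(2)[OF a(1)] arc(2)[OF a(1)] p
   by (intro exI[of _ a] exI[of _ "nx j a"]) auto
 next
  case False
  then obtain v where v: "v = a \<or> v = nx j a" "N (x - g v) < 6 * R j" by (auto simp: not_le)
  have vP: "v \<in> P j" using v(1) Q_lt(3)[OF a(1)] nx(1)[OF a(1)] by (elim disjE) simp_all
  have close: "N (x - g v) \<le> 5 * \<rho> j" using v(2) R_le[of j] p by linarith
  have "v \<noteq> 0" "v \<noteq> L" using xs(1,2) close unfolding ends_def by auto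
  then have vI: "v \<in> I j" using vP by (simp add: I_def)
  note pvv = pv[OF vI]
  define u where "u = pv j v"
  define w where "w = nx j v"
  have u: "u \<in> Q j" "u < v" "nx j u = v" and vQ: "v \<in> Q j" unfolding u_def by (rule pvv)+
  have w: "v < w" "w \<le> L" unfolding w_def using nx(2,3)[OF vQ] .
  have u0: "0 \<le> u" by (rule Q_lt(2)[OF u(1)])
  have tuw: "u \<le> t" "t \<le> w"
  proof -
   have "u \<le> t \<and> t \<le> w"
   proof (cases "v = a")
    case True
    then show ?thesis using u(2) a w_def by simp
   next
    case False
    then have va: "v = nx j a" using v(1) by simp
    have "u \<le> a"
    proof (rule ccontr)
     assume "\<not> u \<le> a"
     then have "nx j a \<le> u" using nx(4)[OF a(1) Q_lt(3)[OF u(1)]] by simp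
     then show False using u(2) va by simp
    qed
    then show ?thesis using a va w(1) by simp
   qed
   then show "u \<le> t" "t \<le> w" by simp_all
  qed
  have du: "dg u v \<le> 2 * \<rho> j" "\<rho> j \<le> dg u v" using arc[OF u(1)] u(3) by simp_all
  have dw: "dg v w \<le> 2 * \<rho> j" using arc(2)[OF vQ] w_def by simp
  have vu: "N (g v - g u) \<le> 2 * \<rho> j" using dg_ge[of u v v u] u(2) du(1) by simp
  have xu: "N (x - g u) \<le> 5 * \<rho> j"
  proof -
   have "N (x - g u) \<le> N (x - g v) + N (g v - g u)" using xV by (intro N_diff_triangle) simp_all
   then show ?thesis using v(2) vu R_le[of j] p by linarith
  qed
  have eu: "192 * e j u < ?b" by (rule eb[OF u(1) xu])
  have ev: "192 * e j v < ?b" by (rule eb[OF vQ close])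
  have th: "384 * (\<rho> j * \<theta> j v) < ?b" by (rule tb[OF vI close])
  \<comment> \<open>By \<open>sdist_dir\<close> the vertex v is within 2 \<rho> \<theta> of the
    chord of the joined arcs, and convexity carries this over to both arcs.\<close>
  have sv: "sdist (g v) (g u) (g w) \<le> ?b / 192"
  proof -
   have "sdist (g v) (g u) (g w) \<le> min (N (g v - g u)) (N (g w - g v)) * N (dir (g v - g u) - dir (g w - g v))"
    by (rule sdist_dir) simp_all
   also have "\<dots> = min (N (g v - g u)) (N (g w - g v)) * \<theta> j v" unfolding \<theta>_def dL_def dR_def u_def w_def ..
   also have "\<dots> \<le> (2 * \<rho> j) * \<theta> j v" using vu by (intro mult_right_mono) simp_all
   finally show ?thesis using th by simp
  qed
  have sd: "sdist (g r) (g u) (g w) \<le> ?b / 64" if r: "u \<le> r" "r \<le> w" for r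
  proof (cases "r \<le> v")
   case True
   have "sdist (g r) (g u) (g w) \<le> sdist (g r) (g u) (g v) + ?b / 192"
    by (rule sdist_transfer) (use sv b in simp_all)
   moreover have "sdist (g r) (g u) (g v) \<le> e j u" unfolding e_def using esup_ge[of u r "nx j u"] r True u(3) by simp
   ultimately show ?thesis using eu b by linarith
  next
   case False
   have "sdist (g r) (g u) (g w) \<le> sdist (g r) (g v) (g w) + ?b / 192"
    by (rule sdist_transfer) (use sv b in simp_all)
   moreover have "sdist (g r) (g v) (g w) \<le> e j v" unfolding e_def using esup_ge[of v r "nx j v"] r False w_def by simp
   ultimately show ?thesis using ev b by linarith
  qed
  have ends': "6 * R j \<le> N (x - g u)" "6 * R j \<le> N (x - g w)"
  proof -
   have "\<rho> j \<le> N (g v - g u) + 2 * e j u" using chord_ge[OF u(1)] u(3) by (simp add: chord_def)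
   moreover have "N (g v - g u) \<le> N (g v - x) + N (x - g u)" using xV by (intro N_diff_triangle) simp_all
   moreover have vx: "N (g v - x) = N (x - g v)" by (rule N_commute)
   ultimately show "6 * R j \<le> N (x - g u)" using v(2) eu b R_le[of j] by linarith
   have "\<rho> j \<le> N (g w - g v) + 2 * e j v" using chord_ge[OF vQ] by (simp add: chord_def w_def)
   moreover have "N (g w - g v) \<le> N (g w - x) + N (x - g v)" using xV by (intro N_diff_triangle) simp_all
   moreover have "N (g w - x) = N (x - g w)" by (rule N_commute)
   ultimately show "6 * R j \<le> N (x - g w)" using v(2) ev b R_le[of j] by linarith
  qed
  have uw: "u \<le> w" using u(2) w(1) by simp
  have duw: "dg u w \<le> 4 * \<rho> j" using dg_split[of u v w] u(2) w(1) du dw by simp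
  have "g u \<noteq> g w"
  proof
   assume eq: "g u = g w"
   have "esup u w \<le> ?b / 64" using uw sd by (rule esup_le)
   moreover have "dg u w \<le> N (g w - g u) + 2 * esup u w" using uw by (rule dg_le_chord_esup)
   moreover have "dg u v \<le> dg u w" using u(2) w(1) by (intro dg_mono) simp_all
   moreover have "N (g w - g u) = 0" using eq by (simp add: N_zero)
   ultimately show False using du b R_le[of j] R_pos[of j] by linarith
  qed
  then show ?thesis using u0 uw w(2) tuw t(3) sd ends' duw by (intro exI[of _ u] exI[of _ w]) auto
 qed
qed

text \<open>On one layer the witnesses are off their strands by a distance comparable to w = R /
  2^M, so one content scale serves the whole layer. The factor 2 in the lower bound leaves room for
  the width of the strand.\<close>

definition layer :: "nat \<Rightarrow> nat \<Rightarrow> 'a set"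
 where "layer j M = {x \<in> flats j. 2 / 2 ^ M \<le> \<beta> j x \<and> \<beta> j x < 4 / 2 ^ M}"

lemma flats_sparse: "x \<in> flats j \<Longrightarrow> x \<in> sparse j" by (simp add: flats_def)

text \<open>\<open>strand_merge\<close> requires strands that are far apart, so it is applied to a 9
  \<rho>-separated subset. The points of the layer near each member of this subset are at most
  \<open>crowd \<kappa>\<close> in number, since the members are sparse.\<close>

lemma layer_card: "real (card (layer j M)) * \<rho> j \<le> 4 * 2 ^ \<kappa> * 2 ^ M * real (crowd \<kappa>) * (\<Phi> (j + (M + \<kappa> + 11)) - \<Phi> j)"
proof -
 define w where "w = R j / 2 ^ M"
 \<comment> \<open>The base scale divided by a power of 2, so that \<Phi> records it; the hypothesis
   A \<ge> 1 makes it at most w / 16.\<close>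
 define d where "d = 2 ^ 7 * \<rho> j / 2 ^ (M + \<kappa> + 11)"
 have p: "0 < \<rho> j" by (rule \<rho>_pos)
 have w0: "0 < w" "w \<le> R j" using R_pos[of j] by (simp_all add: w_def divide_le_eq one_le_power)
 have d0: "0 < d" "d \<le> w / 16" "d < \<rho> j"
 proof -
  show "0 < d" using p by (simp add: d_def)
  have d': "d = \<rho> j / (16 * 2 ^ \<kappa> * 2 ^ M)" by (simp add: d_def power_add)
  have "\<rho> j \<le> A * \<rho> j" using mult_right_mono[OF A, of "\<rho> j"] p by simp
  then have "\<rho> j / (16 * 2 ^ \<kappa> * 2 ^ M) \<le> A * \<rho> j / (16 * 2 ^ \<kappa> * 2 ^ M)" by (intro divide_right_mono) simp_all
  also have "\<dots> = w / 16" by (simp add: w_def R_def)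
  finally show dw: "d \<le> w / 16" by (simp add: d')
  show "d < \<rho> j" using dw w0 R_le[of j] p by linarith
 qed
 have lf: "x \<in> flats j" "x \<in> sparse j" "x \<in> Y j" "2 / 2 ^ M \<le> \<beta> j x" "\<beta> j x < 4 / 2 ^ M" if "x \<in> layer j M" for x
  using that flats_sparse[of x j] sparse_Y[of x j] by (simp_all add: layer_def)
 have fin: "finite (layer j M)" using sparse_fin[of j] by (simp add: layer_def flats_def)
 obtain Zs where Zs: "Zs \<subseteq> layer j M" and spread: "\<And>z z'. z \<in> Zs \<Longrightarrow> z' \<in> Zs \<Longrightarrow> z \<noteq> z' \<Longrightarrow> 9 * \<rho> j < N (z - z')"
  and cover: "\<And>y. y \<in> layer j M \<Longrightarrow> \<exists>z\<in>Zs. N (y - z) \<le> max (9 * \<rho> j) 0"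
  using maximal_spread[OF fin, of "9 * \<rho> j"] by metis
 have finZ: "finite Zs" using Zs fin by (rule finite_subset)
 have ZL: "z \<in> layer j M" if "z \<in> Zs" for z using subsetD[OF Zs that] .
 have st: "\<forall>z\<in>Zs. \<exists>q. 0 \<le> fst q \<and> fst q \<le> snd q \<and> snd q \<le> L \<and> (\<exists>t. fst q \<le> t \<and> t \<le> snd q \<and> z = g t) \<and>
  (\<forall>t. fst q \<le> t \<longrightarrow> t \<le> snd q \<longrightarrow> sdist (g t) (g (fst q)) (g (snd q)) \<le> \<beta> j z * R j / 64) \<and>
  6 * R j \<le> N (z - g (fst q)) \<and> 6 * R j \<le> N (z - g (snd q)) \<and> dg (fst q) (snd q) \<le> 4 * \<rho> j \<and> g (fst q) \<noteq> g (snd q)"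
 proof
  fix z assume "z \<in> Zs"
  from flat_strand[OF lf(1)[OF ZL[OF this]]] show "\<exists>q. 0 \<le> fst q \<and> fst q \<le> snd q \<and> snd q \<le> L \<and> (\<exists>t. fst q \<le> t \<and> t \<le> snd q \<and> z = g t) \<and>
  (\<forall>t. fst q \<le> t \<longrightarrow> t \<le> snd q \<longrightarrow> sdist (g t) (g (fst q)) (g (snd q)) \<le> \<beta> j z * R j / 64) \<and>
  6 * R j \<le> N (z - g (fst q)) \<and> 6 * R j \<le> N (z - g (snd q)) \<and> dg (fst q) (snd q) \<le> 4 * \<rho> j \<and> g (fst q) \<noteq> g (snd q)"
   unfolding split_paired_Ex fst_conv snd_conv .
 qed
 then obtain q where q: "\<forall>z\<in>Zs. 0 \<le> fst (q z) \<and> fst (q z) \<le> snd (q z) \<and> snd (q z) \<le> L \<and> (\<exists>t. fst (q z) \<le> t \<and> t \<le> snd (q z) \<and> z = g t) \<and>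
  (\<forall>t. fst (q z) \<le> t \<longrightarrow> t \<le> snd (q z) \<longrightarrow> sdist (g t) (g (fst (q z))) (g (snd (q z))) \<le> \<beta> j z * R j / 64) \<and>
  6 * R j \<le> N (z - g (fst (q z))) \<and> 6 * R j \<le> N (z - g (snd (q z))) \<and> dg (fst (q z)) (snd (q z)) \<le> 4 * \<rho> j \<and> g (fst (q z)) \<noteq> g (snd (q z))"
  by (rule bchoice[THEN exE])
 define a where "a z = fst (q z)" for z
 define b where "b z = snd (q z)" for z
 have ab: "0 \<le> a z" "a z \<le> b z" "b z \<le> L" "\<exists>t. a z \<le> t \<and> t \<le> b z \<and> z = g t"
  "\<And>t. a z \<le> t \<Longrightarrow> t \<le> b z \<Longrightarrow> sdist (g t) (g (a z)) (g (b z)) \<le> \<beta> j z * R j / 64"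
  "6 * R j \<le> N (z - g (a z))" "6 * R j \<le> N (z - g (b z))" "dg (a z) (b z) \<le> 4 * \<rho> j" "g (a z) \<noteq> g (b z)" if "z \<in> Zs" for z
  using bspec[OF q that] unfolding a_def b_def by simp_all
 have size: "2 * w \<le> \<beta> j z * R j" "\<beta> j z * R j \<le> 4 * w" if z: "z \<in> Zs" for z
  using mult_right_mono[OF lf(4)[OF ZL[OF z]], of "R j"] mult_right_mono[OF less_imp_le[OF lf(5)[OF ZL[OF z]]], of "R j"] R_pos[of j]
  by (simp_all add: w_def)
 \<comment> \<open>The witness is taken against the line through the two ends of the strand, which
   is why \<open>flat_strand\<close> provides distinct ends.\<close>
 have "\<forall>z\<in>Zs. \<exists>y. y \<in> G \<and> N (y - z) \<le> R j \<and> (\<forall>t. \<beta> j z * R j \<le> N (y - (g (a z) + t *\<^sub>R (g (b z) - g (a z)))))"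
 proof
  fix z assume z: "z \<in> Zs"
  have "g (b z) - g (a z) \<noteq> 0" using ab(9)[OF z] by simp
  from wit[OF lf(3)[OF ZL[OF z]] g_in _ this] show "\<exists>y. y \<in> G \<and> N (y - z) \<le> R j \<and> (\<forall>t. \<beta> j z * R j \<le> N (y - (g (a z) + t *\<^sub>R (g (b z) - g (a z)))))"
   unfolding R_def by auto
 qed
 then obtain y where y: "\<forall>z\<in>Zs. y z \<in> G \<and> N (y z - z) \<le> R j \<and> (\<forall>t. \<beta> j z * R j \<le> N (y z - (g (a z) + t *\<^sub>R (g (b z) - g (a z)))))"
  by (rule bchoice[THEN exE])
 have yG: "y z \<in> G" "N (y z - z) \<le> R j" "\<beta> j z * R j \<le> N (y z - (g (a z) + t *\<^sub>R (g (b z) - g (a z))))" if "z \<in> Zs" for z t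
  using bspec[OF y that] by simp_all
 have "hcont (2 ^ 7 * \<rho> j) G + ennreal (real (card Zs) * (w / 4)) \<le> hcont d G"
 proof (rule strand_merge[where a=a and b=b and y=y and \<eta>="w / 16" and R="R j" and Dm="4 * \<rho> j"])
  fix z assume z: "z \<in> Zs"
  show "0 \<le> a z" "a z \<le> b z" "b z \<le> L" "\<exists>t. a z \<le> t \<and> t \<le> b z \<and> z = g t" by (rule ab[OF z])+
  show "6 * R j \<le> N (z - g (a z))" "6 * R j \<le> N (z - g (b z))" "dg (a z) (b z) \<le> 4 * \<rho> j" by (rule ab[OF z])+
  show sd: "sdist (g t) (g (a z)) (g (b z)) \<le> w / 16" if "a z \<le> t" "t \<le> b z" for t
   using ab(5)[OF z that] size(2)[OF z] by linarith
  show "y z \<in> G" "N (y z - z) \<le> R j" by (rule yG[OF z])+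
  show "w \<le> N (y z - g t)" if t: "a z \<le> t" "t \<le> b z" for t
  proof -
   have yV: "y z \<in> V" using subsetD[OF G_V yG(1)[OF z]] .
   obtain l where l: "N (g t - (g (a z) + l *\<^sub>R (g (b z) - g (a z)))) \<le> w / 16"
    using near_segment[OF g_in g_in g_in sd[OF t]] by metis
   let ?m = "g (a z) + l *\<^sub>R (g (b z) - g (a z))"
   have "N (y z - ?m) \<le> N (y z - g t) + N (g t - ?m)" using yV by (intro N_diff_triangle) simp_all
   then show ?thesis using yG(3)[OF z, of l] l size(1)[OF z] w0 by linarith
  qed
  show "2 * (4 * \<rho> j) + d < N (z - z')" if "z' \<in> Zs" "z \<noteq> z'" for z' using spread[OF z that] d0 by linarith
 qed (use finZ w0 d0 p R_le[of j] in simp_all)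
 then have gain: "real (card Zs) * (w / 4) \<le> \<Phi> (j + (M + \<kappa> + 11)) - \<Phi> j"
  unfolding d_def using w0 by (intro \<Phi>_gain) simp_all
 have "card (layer j M) \<le> card (\<Union>z\<in>Zs. {x \<in> Y j. N (z - x) \<le> 10 * \<rho> j})"
 proof (rule card_mono)
  show "finite (\<Union>z\<in>Zs. {x \<in> Y j. N (z - x) \<le> 10 * \<rho> j})" using finZ Y_fin by simp
  show "layer j M \<subseteq> (\<Union>z\<in>Zs. {x \<in> Y j. N (z - x) \<le> 10 * \<rho> j})"
  proof
   fix x assume x: "x \<in> layer j M"
   obtain z where z: "z \<in> Zs" "N (x - z) \<le> max (9 * \<rho> j) 0" using cover[OF x] by (elim bexE)
   have "N (z - x) = N (x - z)" by (rule N_commute)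
   then have "N (z - x) \<le> 10 * \<rho> j" using z(2) p by simp
   then show "x \<in> (\<Union>z\<in>Zs. {x \<in> Y j. N (z - x) \<le> 10 * \<rho> j})" using lf(3)[OF x] by (intro UN_I[OF z(1)]) simp
  qed
 qed
 also have "\<dots> \<le> (\<Sum>z\<in>Zs. card {x \<in> Y j. N (z - x) \<le> 10 * \<rho> j})" by (rule card_UN_le[OF finZ])
 also have "\<dots> \<le> (\<Sum>z\<in>Zs. crowd \<kappa>)" by (rule sum_mono) (rule sparse_near[OF lf(2)[OF ZL]])
 finally have "card (layer j M) \<le> card Zs * crowd \<kappa>" by simp
 then have cl: "real (card (layer j M)) \<le> real (card Zs) * real (crowd \<kappa>)" by (simp only: of_nat_mult[symmetric] of_nat_le_iff)
 have \<rho>w: "\<rho> j \<le> 2 ^ \<kappa> * 2 ^ M * w"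
 proof -
  have "2 ^ \<kappa> * 2 ^ M * w = A * \<rho> j" by (simp add: w_def R_def)
  then show ?thesis using mult_right_mono[OF A, of "\<rho> j"] p by simp
 qed
 have "real (card (layer j M)) * \<rho> j \<le> (real (card Zs) * real (crowd \<kappa>)) * (2 ^ \<kappa> * 2 ^ M * w)"
  using cl \<rho>w p by (intro mult_mono) simp_all
 also have "\<dots> = 4 * 2 ^ \<kappa> * 2 ^ M * real (crowd \<kappa>) * (real (card Zs) * (w / 4))" by simp
 also have "\<dots> \<le> 4 * 2 ^ \<kappa> * 2 ^ M * real (crowd \<kappa>) * (\<Phi> (j + (M + \<kappa> + 11)) - \<Phi> j)"
  by (rule mult_left_mono[OF gain]) simp
 finally show ?thesis .
qed

text \<open>On layer M the power \<beta>^s is at most 16 / 4^M, the weighted count of points is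
  bounded by a multiple of 2^M times a content difference, and the shift of the content brings a
  factor linear in M. Altogether this is summable like M / 2^M.\<close>

lemma layer_sum: "(\<Sum>j<n. \<Sum>x\<in>layer j M. \<beta> j x powr s * \<rho> j) \<le> 64 * 2 ^ \<kappa> * real (crowd \<kappa>) * L * ((real M + (real \<kappa> + 11)) / 2 ^ M)"
proof -
 let ?c = "64 * 2 ^ \<kappa> * real (crowd \<kappa>) / 2 ^ M"
 have 1: "(\<Sum>x\<in>layer j M. \<beta> j x powr s * \<rho> j) \<le> ?c * (\<Phi> (j + (M + \<kappa> + 11)) - \<Phi> j)" for j
 proof -
  have p: "0 < \<rho> j" by (rule \<rho>_pos)
  have "(\<Sum>x\<in>layer j M. \<beta> j x powr s * \<rho> j) \<le> real (card (layer j M)) * ((16 / 4 ^ M) * \<rho> j)"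
  proof (rule sum_bounded_above)
   fix x assume x: "x \<in> layer j M"
   then have b: "0 < \<beta> j x" "\<beta> j x \<le> 1" "\<beta> j x < 4 / 2 ^ M"
    using \<beta>_pos[of x j] \<beta>_le[of x j] sparse_Y[OF flats_sparse, of x j] by (simp_all add: layer_def)
   have "\<beta> j x powr s \<le> \<beta> j x powr 2" using b s_ge by (intro powr_mono') simp_all
   also have "\<dots> = (\<beta> j x)\<^sup>2" using b by (simp add: powr_numeral)
   also have "\<dots> \<le> (4 / 2 ^ M)\<^sup>2" using b by (intro power_mono) simp_all
   also have "\<dots> = 16 / 4 ^ M" by (simp add: power_divide power2_eq_square power_mult_distrib[symmetric])
   finally show "\<beta> j x powr s * \<rho> j \<le> (16 / 4 ^ M) * \<rho> j" using p by (intro mult_right_mono) simp_all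
  qed
  also have "\<dots> = (16 / 4 ^ M) * (real (card (layer j M)) * \<rho> j)" by simp
  also have "\<dots> \<le> (16 / 4 ^ M) * (4 * 2 ^ \<kappa> * 2 ^ M * real (crowd \<kappa>) * (\<Phi> (j + (M + \<kappa> + 11)) - \<Phi> j))"
   by (rule mult_left_mono[OF layer_card]) simp
  also have "\<dots> = ((2 ^ M / 4 ^ M) * 2 ^ M) * ?c * (\<Phi> (j + (M + \<kappa> + 11)) - \<Phi> j)" by simp
  also have "(2 ^ M / 4 ^ M) * 2 ^ M = (1::real)" by (simp add: power_mult_distrib[symmetric])
  finally show ?thesis by simp
 qed
 have "(\<Sum>j<n. \<Sum>x\<in>layer j M. \<beta> j x powr s * \<rho> j) \<le> ?c * (\<Sum>j<n. \<Phi> (j + (M + \<kappa> + 11)) - \<Phi> j)"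
  unfolding sum_distrib_left by (rule sum_mono) (rule 1)
 also have "\<dots> \<le> ?c * (real (M + \<kappa> + 11) * L)"
  by (rule mult_left_mono[OF telescope_shift[OF \<Phi>_nonneg \<Phi>_le]]) simp
 finally show ?thesis by (simp add: add.assoc mult_ac)
qed

lemma flats_sum: "(\<Sum>j<n. \<Sum>x\<in>flats j. \<beta> j x powr s * \<rho> j) \<le> 64 * 2 ^ \<kappa> * real (crowd \<kappa>) * (real \<kappa> + 13) * L"
proof -
 \<comment> \<open>The index of the layer containing x. It is at least 1 because \<beta> \<le> 1,
   and only finitely many values occur for the finitely many points in question.\<close>
 define \<mu> where "\<mu> j x = (LEAST M. 2 / 2 ^ M \<le> \<beta> j x)" for j x
 have \<mu>: "1 \<le> \<mu> j x \<and> 2 / 2 ^ \<mu> j x \<le> \<beta> j x \<and> \<beta> j x < 4 / 2 ^ \<mu> j x" if x: "x \<in> flats j" for j x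
 proof -
  have b: "0 < \<beta> j x" "\<beta> j x \<le> 1" using \<beta>_pos \<beta>_le sparse_Y[OF flats_sparse[OF x]] by simp_all
  obtain M where "(1/2) ^ M < \<beta> j x / 2" using b real_arch_pow_inv[of "\<beta> j x / 2" "1/2"] by auto
  then have "2 / 2 ^ M \<le> \<beta> j x" by (simp add: power_one_over field_simps)
  then have 1: "2 / 2 ^ \<mu> j x \<le> \<beta> j x" unfolding \<mu>_def by (rule LeastI)
  have 2: "\<mu> j x \<noteq> 0"
  proof
   assume "\<mu> j x = 0"
   then show False using 1 b by simp
  qed
  then obtain k where k: "\<mu> j x = Suc k" by (cases "\<mu> j x") simp_all
  then have "\<not> 2 / 2 ^ k \<le> \<beta> j x" using not_less_Least[of k "\<lambda>M. 2 / 2 ^ M \<le> \<beta> j x"] unfolding \<mu>_def by simp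
  then show ?thesis using 1 2 k by simp
 qed
 have "finite ((\<lambda>(j, x). \<mu> j x) ` (SIGMA j:{..<n}. Y j))" using Y_fin by (intro finite_imageI finite_SigmaI) simp_all
 then obtain m where m: "\<forall>k\<in>(\<lambda>(j, x). \<mu> j x) ` (SIGMA j:{..<n}. Y j). k < m" unfolding finite_nat_set_iff_bounded by (elim exE)
 have "(\<Sum>x\<in>flats j. \<beta> j x powr s * \<rho> j) \<le> (\<Sum>M=1..<m. \<Sum>x\<in>layer j M. \<beta> j x powr s * \<rho> j)" if j: "j < n" for j
  unfolding layer_def
 proof (rule sum_cover)
  show "finite (flats j)" using sparse_fin[of j] by (simp add: flats_def)
  show "0 \<le> \<beta> j x powr s * \<rho> j" for x using \<rho>_pos[of j] by simp
  show "\<exists>M\<in>{1..<m}. 2 / 2 ^ M \<le> \<beta> j x \<and> \<beta> j x < 4 / 2 ^ M" if x: "x \<in> flats j" for x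
  proof -
   have "\<mu> j x \<in> (\<lambda>(j, x). \<mu> j x) ` (SIGMA j:{..<n}. Y j)"
    using j sparse_Y[OF flats_sparse[OF x]] by (intro image_eqI[of _ _ "(j, x)"]) simp_all
   from bspec[OF m this] show ?thesis using \<mu>[OF x] by (intro bexI[of _ "\<mu> j x"]) simp_all
  qed
 qed simp
 then have "(\<Sum>j<n. \<Sum>x\<in>flats j. \<beta> j x powr s * \<rho> j) \<le> (\<Sum>j<n. \<Sum>M=1..<m. \<Sum>x\<in>layer j M. \<beta> j x powr s * \<rho> j)"
  by (intro sum_mono) simp
 also have "\<dots> = (\<Sum>M=1..<m. \<Sum>j<n. \<Sum>x\<in>layer j M. \<beta> j x powr s * \<rho> j)" by (rule sum.swap)
 also have "\<dots> \<le> (\<Sum>M=1..<m. 64 * 2 ^ \<kappa> * real (crowd \<kappa>) * L * ((real M + (real \<kappa> + 11)) / 2 ^ M))"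
  by (rule sum_mono) (rule layer_sum)
 also have "\<dots> = 64 * 2 ^ \<kappa> * real (crowd \<kappa>) * L * (\<Sum>M=1..<m. (real M + (real \<kappa> + 11)) / 2 ^ M)"
  by (rule sum_distrib_left[symmetric])
 also have "\<dots> \<le> 64 * 2 ^ \<kappa> * real (crowd \<kappa>) * L * (real \<kappa> + 11 + 2)"
  using L_pos by (intro mult_left_mono sum_dyadic) simp_all
 also have "\<dots> = 64 * 2 ^ \<kappa> * real (crowd \<kappa>) * (real \<kappa> + 13) * L" by (simp add: algebra_simps)
 finally show ?thesis .
qed

lemma star_sum: "(\<Sum>j<n. \<Sum>x\<in>Y j. \<beta> j x powr s * \<rho> j) \<le> Kstar A \<kappa> * L"
proof -
 let ?f = "\<lambda>j x. \<beta> j x powr s * \<rho> j"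
 have 1: "(\<Sum>x\<in>Y j. ?f j x) \<le> real (card (dense j)) * \<rho> j + real (card (ends j)) * \<rho> j + (\<Sum>x\<in>bent j. ?f j x)
   + (\<Sum>x\<in>angled j. ?f j x) + (\<Sum>x\<in>flats j. ?f j x)" for j
 proof -
  have p: "0 < \<rho> j" by (rule \<rho>_pos)
  have fin: "finite (dense j)" "finite (ends j)" "finite (bent j)" "finite (angled j)" "finite (flats j)"
   using Y_fin[of j] sparse_fin[of j] by (simp_all add: dense_def ends_def bent_def angled_def flats_def)
  have f0: "0 \<le> ?f j x" for x using p by simp
  have un: "(\<Sum>x\<in>S \<union> T. ?f j x) \<le> (\<Sum>x\<in>S. ?f j x) + (\<Sum>x\<in>T. ?f j x)" if "finite S" "finite T" for S T
   using sum.union_inter[OF that, of "?f j"] sum_nonneg[of "S \<inter> T" "?f j"] f0 by simp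
  have small: "(\<Sum>x\<in>S. ?f j x) \<le> real (card S) * \<rho> j" if S: "S \<subseteq> Y j" for S
  proof (rule sum_bounded_above)
   fix x assume "x \<in> S"
   then have x: "x \<in> Y j" using S by auto
   have "\<beta> j x powr s \<le> 1 powr s" using \<beta>_pos[OF x] \<beta>_le[OF x] s_ge by (intro powr_mono2) simp_all
   then show "?f j x \<le> \<rho> j" using p by (simp add: mult_left_le_one_le)
  qed
  have "Y j \<subseteq> dense j \<union> (ends j \<union> (bent j \<union> (angled j \<union> flats j)))" unfolding flats_def sparse_def by auto
  then have "(\<Sum>x\<in>Y j. ?f j x) \<le> (\<Sum>x\<in>dense j \<union> (ends j \<union> (bent j \<union> (angled j \<union> flats j))). ?f j x)"
   using fin f0 by (intro sum_mono2) simp_all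
  also have "\<dots> \<le> (\<Sum>x\<in>dense j. ?f j x) + ((\<Sum>x\<in>ends j. ?f j x) + ((\<Sum>x\<in>bent j. ?f j x) + ((\<Sum>x\<in>angled j. ?f j x) + (\<Sum>x\<in>flats j. ?f j x))))"
   using fin by (intro order_trans[OF un] add_left_mono) simp_all
  also have "(\<Sum>x\<in>dense j. ?f j x) \<le> real (card (dense j)) * \<rho> j" by (rule small) (simp add: dense_def)
  finally have a: "(\<Sum>x\<in>Y j. ?f j x) \<le> real (card (dense j)) * \<rho> j + ((\<Sum>x\<in>ends j. ?f j x) + ((\<Sum>x\<in>bent j. ?f j x) + ((\<Sum>x\<in>angled j. ?f j x) + (\<Sum>x\<in>flats j. ?f j x))))" by simp
  have "(\<Sum>x\<in>ends j. ?f j x) \<le> real (card (ends j)) * \<rho> j" by (rule small) (auto simp: ends_def sparse_def)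
  then show ?thesis using a by linarith
 qed
 have "(\<Sum>j<n. \<Sum>x\<in>Y j. ?f j x) \<le> (\<Sum>j<n. real (card (dense j)) * \<rho> j) + (\<Sum>j<n. real (card (ends j)) * \<rho> j)
   + (\<Sum>j<n. \<Sum>x\<in>bent j. ?f j x) + (\<Sum>j<n. \<Sum>x\<in>angled j. ?f j x) + (\<Sum>j<n. \<Sum>x\<in>flats j. ?f j x)"
  unfolding sum.distrib[symmetric] by (rule sum_mono) (rule 1)
 also have "\<dots> \<le> Kstar A \<kappa> * L"
  unfolding Kstar_def distrib_right by (intro add_mono dense_sum ends_sum bent_sum angled_sum flats_sum)
 finally show ?thesis .
qed

end

section \<open>Curves through connected sets\<close>

text \<open>Passes from finite sets of integer scales to initial segments of the naturals, for which
  the estimates are stated.\<close>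

lemma sum_reindex_bound:
 fixes \<phi> :: "'x \<Rightarrow> real"
 assumes fin: "finite K" and inj: "inj_on h K" and le: "\<And>k. k \<in> K \<Longrightarrow> \<phi> k \<le> \<psi> (h k)"
  and nn: "\<And>j. 0 \<le> \<psi> j" and B: "\<And>n. (\<Sum>j<n::nat. \<psi> j) \<le> B"
 shows "(\<Sum>k\<in>K. \<phi> k) \<le> B"
proof -
 obtain n where n: "h ` K \<subseteq> {..<n}" using finite_imageI[OF fin, of h] unfolding finite_nat_iff_bounded by (elim exE)
 have "(\<Sum>k\<in>K. \<phi> k) \<le> (\<Sum>k\<in>K. \<psi> (h k))" by (rule sum_mono) (rule le)
 also have "\<dots> = (\<Sum>j\<in>h ` K. \<psi> j)" by (simp add: sum.reindex[OF inj])
 also have "\<dots> \<le> (\<Sum>j<n. \<psi> j)" using n nn by (intro sum_mono2) simp_all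
 finally show ?thesis using B[of n] by simp
qed

context curve_on
begin

lemma filtration_exists:
 assumes r0: "0 < r0" "r0 \<le> dg 0 L"
 obtains P where "\<And>j. part (r0 / 2 ^ j) (P j)" "\<And>j. P j \<subseteq> P (Suc j)"
proof -
 have "dsep r0 {0, L}" using r0 L_pos unfolding dsep_def by auto
 then obtain P0 where P0: "part r0 P0" using part_extend[of "{0, L}" r0] r0 L_pos by auto
 have step: "\<exists>P'. part (r0 / 2 ^ Suc n) P' \<and> P \<subseteq> P'" if P: "part (r0 / 2 ^ n) P" for n P
 proof -
  have le: "r0 / 2 ^ Suc n \<le> r0 / 2 ^ n" using r0 by (simp add: field_simps)
  have "dsep (r0 / 2 ^ n) P" using P by (simp add: part_def)
  then have ds: "dsep (r0 / 2 ^ Suc n) P" unfolding dsep_def using le by (meson order_trans)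
  have Pp: "finite P" "P \<subseteq> {0..L}" "0 \<in> P" "L \<in> P" using P by (simp_all add: part_def)
  have "0 < r0 / 2 ^ Suc n" using r0 by simp
  then obtain P' where "P \<subseteq> P'" "part (r0 / 2 ^ Suc n) P'" by (rule part_extend[OF Pp ds])
  then show ?thesis by auto
 qed
 have "\<exists>P. \<forall>n. part (r0 / 2 ^ n) (P n) \<and> P n \<subseteq> P (Suc n)"
 proof (rule dependent_nat_choice)
  show "\<exists>x. part (r0 / 2 ^ 0) x" using P0 by auto
 qed (use step in auto)
 then obtain P where "\<forall>n. part (r0 / 2 ^ n) (P n) \<and> P n \<subseteq> P (Suc n)" by (elim exE)
 then show ?thesis by (intro that[of P]) simp_all
qed

lemma G_diam:
 assumes "x \<in> G" "y \<in> G"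
 shows "N (x - y) \<le> dg 0 L"
proof -
 obtain t u where "x = g t" "y = g u" "0 \<le> t" "t \<le> L" "0 \<le> u" "u \<le> L" using assms unfolding G_def by auto
 then show ?thesis using dg_ge[of 0 t L u] by simp
qed

text \<open>The curve is 1-Lipschitz, so parameters chosen for the net points are at least r apart
  in [0, L].\<close>

lemma net_card:
 assumes X: "finite X" "X \<subseteq> G" and r: "0 < r" and sep: "\<And>x y. x \<in> X \<Longrightarrow> y \<in> X \<Longrightarrow> x \<noteq> y \<Longrightarrow> r \<le> N (x - y)"
 shows "real (card X) * r \<le> L + r"
proof -
 have "\<forall>x\<in>X. \<exists>t. 0 \<le> t \<and> t \<le> L \<and> x = g t"
 proof
  fix x assume "x \<in> X"
  then have "x \<in> g ` {0..L}" using X(2) unfolding G_def by (rule_tac subsetD)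
  then show "\<exists>t. 0 \<le> t \<and> t \<le> L \<and> x = g t" by auto
 qed
 then obtain \<tau> where \<tau>: "\<forall>x\<in>X. 0 \<le> \<tau> x \<and> \<tau> x \<le> L \<and> x = g (\<tau> x)" by (rule bchoice[THEN exE])
 have \<tau>': "0 \<le> \<tau> x" "\<tau> x \<le> L" "x = g (\<tau> x)" if "x \<in> X" for x using bspec[OF \<tau> that] by simp_all
 have inj: "inj_on \<tau> X"
 proof (rule inj_onI)
  fix x y assume xy: "x \<in> X" "y \<in> X" "\<tau> x = \<tau> y"
  have "x = g (\<tau> x)" by (rule \<tau>'[OF xy(1)])
  also have "\<dots> = y" unfolding xy(3) by (rule \<tau>'(3)[OF xy(2), symmetric])
  finally show "x = y" .
 qed
 have "card (\<tau> ` X) \<le> Suc (nat \<lfloor>L / r\<rfloor>)"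
 proof (rule separated_reals_card)
  show "\<tau> ` X \<subseteq> {0..L}" using \<tau>' by auto
  fix a b assume "a \<in> \<tau> ` X" "b \<in> \<tau> ` X" "a < b"
  then obtain x y where xy: "x \<in> X" "y \<in> X" "a = \<tau> x" "b = \<tau> y" by (elim imageE)
  have "x \<noteq> y" using xy \<open>a < b\<close> by auto
  then have "r \<le> N (x - y)" by (rule sep[OF xy(1,2)])
  also have "N (x - y) = N (g a - g b)" using \<tau>'(3)[OF xy(1)] \<tau>'(3)[OF xy(2)] xy by simp
  also have "\<dots> \<le> \<bar>a - b\<bar>" by (rule g_lip)
  finally show "r \<le> b - a" using \<open>a < b\<close> by simp
 qed (use X r in simp_all)
 then have "card X \<le> Suc (nat \<lfloor>L / r\<rfloor>)" using card_image[OF inj] by simp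
 moreover have "real (nat \<lfloor>L / r\<rfloor>) \<le> L / r" using L_pos r by (intro of_nat_floor) simp
 ultimately have "real (card X) \<le> L / r + 1" by linarith
 then have "real (card X) * r \<le> (L / r + 1) * r" using r by (intro mult_right_mono) simp_all
 moreover have "(L / r + 1) * r = L + r" using r by (simp add: distrib_right)
 ultimately show ?thesis by (simp only:)
qed

text \<open>There are three ranges of scales. Where the mesh exceeds the diameter D of the curve, a
  net has a single point and its beta number is at most D over the mesh. On the next \<kappa> scales
  counting net points is enough. At all finer scales 2^\<kappa> times the mesh is at most D, so
  partitions at that scale exist and \<open>star_sum\<close> applies.\<close>

lemma curve_star:
 fixes F :: "(int \<times> 'a) set" and b :: "int \<Rightarrow> 'a \<Rightarrow> real"
 defines "r \<equiv> \<lambda>k::int. 2 powr (- real_of_int k)"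
 assumes A: "1 \<le> A" and \<kappa>: "20 * A \<le> 2 ^ \<kappa>" and fin: "finite F" and FG: "\<And>k x. (k, x) \<in> F \<Longrightarrow> x \<in> G"
  and sep: "\<And>k x y. (k, x) \<in> F \<Longrightarrow> (k, y) \<in> F \<Longrightarrow> x \<noteq> y \<Longrightarrow> r k \<le> N (x - y)"
  and b0: "\<And>k x. (k, x) \<in> F \<Longrightarrow> 0 \<le> b k x" and nontriv: "\<exists>w\<in>V. w \<noteq> 0"
  and wit: "\<And>k x a w. (k, x) \<in> F \<Longrightarrow> a \<in> V \<Longrightarrow> w \<in> V \<Longrightarrow> w \<noteq> 0 \<Longrightarrow> 0 < b k x \<Longrightarrow>
   \<exists>y\<in>G. N (y - x) \<le> A * r k \<and> (\<forall>t. b k x * (A * r k) \<le> N (y - (a + t *\<^sub>R w)))"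
 shows "(\<Sum>(k, x)\<in>F. b k x powr s * r k) \<le> (Kstar A \<kappa> + 2 * real \<kappa> + 2) * L"
proof -
 define D where "D = dg 0 L"
 define \<phi> where "\<phi> k x = b k x powr s * r k" for k x
 define Fk where "Fk k = {x. (k, x) \<in> F}" for k
 define \<psi> where "\<psi> k = (\<Sum>x\<in>Fk k. \<phi> k x)" for k
 have r0: "0 < r k" for k by (simp add: r_def)
 have \<phi>0: "0 \<le> \<phi> k x" for k x using r0[of k] by (simp add: \<phi>_def)
 have DL: "D \<le> L" using dg_le_len[of 0 L] L_pos by (simp add: D_def)
 have FV: "x \<in> V" if "(k, x) \<in> F" for k x using subsetD[OF G_V FG[OF that]] .
 \<comment> \<open>The witness is taken against a line through x itself, so its distance to x is at
   least the beta number times the radius.\<close>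
 have size: "b k x * r k \<le> D \<and> b k x \<le> 1" if kx: "(k, x) \<in> F" and b: "0 < b k x" for k x
 proof -
  obtain w where w: "w \<in> V" "w \<noteq> 0" using nontriv by (elim bexE)
  obtain y where y: "y \<in> G" "N (y - x) \<le> A * r k" "\<forall>t. b k x * (A * r k) \<le> N (y - (x + t *\<^sub>R w))"
   using wit[OF kx FV[OF kx] w b] by (elim bexE conjE)
  have 1: "b k x * (A * r k) \<le> N (y - x)" using spec[OF y(3), of 0] by simp
  have 2: "N (y - x) \<le> D" unfolding D_def by (rule G_diam[OF y(1) FG[OF kx]])
  have Ar: "0 < A * r k" "r k \<le> A * r k" using A r0[of k] mult_right_mono[OF A, of "r k"] by simp_all
  have "b k x * r k \<le> b k x * (A * r k)" using Ar b by (intro mult_left_mono) simp_all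
  moreover have "b k x * (A * r k) \<le> 1 * (A * r k)" using 1 y(2) by simp
  then have "b k x \<le> 1" using Ar(1) by (rule mult_right_le_imp_le)
  ultimately show ?thesis using 1 2 by simp
 qed
 have Fk_fin: "finite (Fk k)" for k
 proof -
  have "Fk k \<subseteq> snd ` F" unfolding Fk_def by force
  then show ?thesis using fin by (meson finite_imageI finite_subset)
 qed
 have split: "(\<Sum>(k, x)\<in>F. b k x powr s * r k) = (\<Sum>k\<in>fst ` F. \<psi> k)"
 proof -
  have "F = Sigma (fst ` F) Fk" unfolding Fk_def by force
  then have "(\<Sum>(k, x)\<in>F. \<phi> k x) = (\<Sum>(k, x)\<in>Sigma (fst ` F) Fk. \<phi> k x)" by simp
  also have "\<dots> = (\<Sum>k\<in>fst ` F. \<psi> k)" unfolding \<psi>_def using fin Fk_fin by (intro sum.Sigma[symmetric]) auto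
  finally show ?thesis unfolding \<phi>_def .
 qed
 have K0: "0 \<le> Kstar A \<kappa>"
 proof -
  have "0 \<le> CZ" using Ksplit(1) cU_pos by (simp add: CZ_def KZ_def)
  moreover have "0 \<le> CT" using Ksplit(1) cU_pos \<open>0 \<le> CZ\<close> by (simp add: CT_def KT_def Knew_def)
  ultimately show ?thesis by (simp add: Kstar_def)
 qed
 show ?thesis
 proof (cases "0 < D")
  case False
  have "\<psi> k = 0" for k unfolding \<psi>_def
  proof (rule sum.neutral, rule ballI)
   fix x assume "x \<in> Fk k"
   then have kx: "(k, x) \<in> F" by (simp add: Fk_def)
   have "b k x = 0"
   proof (rule ccontr)
    assume "b k x \<noteq> 0"
    then have b: "0 < b k x" using b0[OF kx] by simp
    then have "0 < b k x * r k" using r0[of k] by simp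
    then show False using size[OF kx b] False by simp
   qed
   then show "\<phi> k x = 0" by (simp add: \<phi>_def)
  qed
  then have "(\<Sum>(k, x)\<in>F. b k x powr s * r k) = 0" using split by simp
  then show ?thesis using K0 L_pos by simp
 next
  case True
  \<comment> \<open>2^(-m) is the largest power of 2 not exceeding D.\<close>
  define m where "m = - \<lfloor>log 2 D\<rfloor>"
  have m: "2 powr (- real_of_int m) \<le> D" "D < 2 powr (1 - real_of_int m)"
  proof -
   have "D = 2 powr (log 2 D)" using True by simp
   moreover have "- real_of_int m \<le> log 2 D" "log 2 D < 1 - real_of_int m" unfolding m_def by linarith+
   then have "2 powr (- real_of_int m) \<le> 2 powr (log 2 D)" "2 powr (log 2 D) < 2 powr (1 - real_of_int m)"
    by simp_all
   ultimately show "2 powr (- real_of_int m) \<le> D" "D < 2 powr (1 - real_of_int m)" by simp_all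
  qed
  define K1 where "K1 = {k \<in> fst ` F. k < m}"
  define K2 where "K2 = {k \<in> fst ` F. m \<le> k \<and> k < m + int \<kappa>}"
  define K3 where "K3 = {k \<in> fst ` F. m + int \<kappa> \<le> k}"
  have Kfin: "finite K1" "finite K2" "finite K3" using fin by (simp_all add: K1_def K2_def K3_def)
  have Kun: "fst ` F = K1 \<union> (K2 \<union> K3)" unfolding K1_def K2_def K3_def by auto
  have "(\<Sum>k\<in>fst ` F. \<psi> k) = (\<Sum>k\<in>K1. \<psi> k) + (\<Sum>k\<in>K2 \<union> K3. \<psi> k)"
   unfolding Kun by (rule sum.union_disjoint) (use Kfin in \<open>auto simp: K1_def K2_def K3_def\<close>)
  also have "(\<Sum>k\<in>K2 \<union> K3. \<psi> k) = (\<Sum>k\<in>K2. \<psi> k) + (\<Sum>k\<in>K3. \<psi> k)"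
   by (rule sum.union_disjoint) (use Kfin in \<open>auto simp: K2_def K3_def\<close>)
  finally have three: "(\<Sum>k\<in>fst ` F. \<psi> k) = (\<Sum>k\<in>K1. \<psi> k) + ((\<Sum>k\<in>K2. \<psi> k) + (\<Sum>k\<in>K3. \<psi> k))" .
  \<comment> \<open>With i steps above the diameter, b \<le> 1 / 2^i and b r \<le> D; since s \<ge>
    2, b^s r \<le> b (b r) \<le> D / 2^i.\<close>
  have S1: "(\<Sum>k\<in>K1. \<psi> k) \<le> 2 * L"
  proof (rule sum_reindex_bound[where h="\<lambda>k. nat (m - 1 - k)" and \<psi>="\<lambda>i. D / 2 ^ i"])
   show "inj_on (\<lambda>k. nat (m - 1 - k)) K1" by (rule inj_onI) (auto simp: K1_def)
   show "0 \<le> D / 2 ^ i" for i using True by simp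
   show "(\<Sum>i<n. D / 2 ^ i) \<le> 2 * L" for n
   proof -
    have "(\<Sum>i<n. D / 2 ^ i) = 2 * D - 2 * D / 2 ^ n" by (induction n) (simp_all add: field_simps)
    moreover have "0 \<le> 2 * D / 2 ^ n" using True by simp
    ultimately show ?thesis using DL by linarith
   qed
   fix k assume "k \<in> K1"
   then have k: "k < m" by (simp add: K1_def)
   let ?i = "nat (m - 1 - k)"
   have rk: "r k = 2 powr (1 - real_of_int m) * 2 ^ ?i"
   proof -
    have "2 powr (1 - real_of_int m) * 2 ^ ?i = 2 powr (1 - real_of_int m) * 2 powr (real ?i)"
     by (simp add: powr_realpow)
    also have "\<dots> = 2 powr (1 - real_of_int m + real ?i)" by (simp add: powr_add)
    also have "1 - real_of_int m + real ?i = - real_of_int k" using k by (simp add: of_nat_nat)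
    finally show ?thesis by (simp add: r_def)
   qed
   have rD: "D * 2 ^ ?i \<le> r k" unfolding rk using m(2) by (intro mult_right_mono) simp_all
   have "D < r k"
   proof -
    have "2 powr (1 - real_of_int m) * 1 \<le> r k" unfolding rk by (rule mult_left_mono) simp_all
    then show ?thesis using m(2) by simp
   qed
   show "\<psi> k \<le> D / 2 ^ ?i"
   proof (cases "Fk k = {}")
    case False
    then obtain x where x: "x \<in> Fk k" by auto
    have uniq: "y = x" if "y \<in> Fk k" for y
    proof (rule ccontr)
     assume "y \<noteq> x"
     then have "r k \<le> N (y - x)" using sep[of k y x] that x by (simp add: Fk_def)
     moreover have "N (y - x) \<le> D" unfolding D_def using FG[of k] that x by (intro G_diam) (simp_all add: Fk_def)
     ultimately show False using \<open>D < r k\<close> by simp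
    qed
    have "Fk k = {x}"
    proof (rule equalityI; rule subsetI)
     fix y assume "y \<in> Fk k"
     then show "y \<in> {x}" unfolding singleton_iff by (rule uniq)
    next
     fix y assume "y \<in> {x}"
     then show "y \<in> Fk k" using x by simp
    qed
    then have eq: "\<psi> k = \<phi> k x" by (simp add: \<psi>_def)
    have kx: "(k, x) \<in> F" using x by (simp add: Fk_def)
    show ?thesis
    proof (cases "0 < b k x")
     case b: True
     have bb: "b k x * r k \<le> D" "b k x \<le> 1" using size[OF kx b] by simp_all
     have "b k x * (D * 2 ^ ?i) \<le> b k x * r k" using rD b by (intro mult_left_mono) simp_all
     then have "(b k x * 2 ^ ?i) * D \<le> 1 * D" using bb(1) by (simp add: mult_ac)
     then have "b k x * 2 ^ ?i \<le> 1" using True by (rule mult_right_le_imp_le)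
     then have bi: "b k x \<le> 1 / 2 ^ ?i" by (simp add: field_simps)
     have "b k x powr s \<le> b k x powr 2" using b bb s_ge by (intro powr_mono') simp_all
     also have "\<dots> = b k x * b k x" using b by (simp add: powr_numeral power2_eq_square)
     finally have "\<phi> k x \<le> (b k x * b k x) * r k" unfolding \<phi>_def using r0[of k] by (intro mult_right_mono) simp_all
     also have "\<dots> = b k x * (b k x * r k)" by simp
     also have "\<dots> \<le> (1 / 2 ^ ?i) * D" using bi bb b r0[of k] by (intro mult_mono) simp_all
     finally show ?thesis using eq by simp
    next
     case False
     then have "b k x = 0" using b0[OF kx] by simp
     then show ?thesis using eq True by (simp add: \<phi>_def)
    qed
   qed (use True in \<open>simp add: \<psi>_def\<close>)
  qed (rule Kfin)
  have S2: "(\<Sum>k\<in>K2. \<psi> k) \<le> real \<kappa> * (2 * L)"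
  proof -
   have "\<psi> k \<le> 2 * L" if k: "k \<in> K2" for k
   proof -
    have "\<psi> k \<le> real (card (Fk k)) * r k" unfolding \<psi>_def
    proof (rule sum_bounded_above)
     fix x assume "x \<in> Fk k"
     then have kx: "(k, x) \<in> F" by (simp add: Fk_def)
     have "b k x \<le> 1" using size[OF kx] b0[OF kx] by (cases "0 < b k x") simp_all
     then have "b k x powr s \<le> 1 powr s" using b0[OF kx] s_ge by (intro powr_mono2) simp_all
     then show "\<phi> k x \<le> r k" unfolding \<phi>_def using r0[of k] by (simp add: mult_left_le_one_le)
    qed
    also have "\<dots> \<le> L + r k" by (rule net_card[OF Fk_fin _ r0]) (use FG sep in \<open>auto simp: Fk_def\<close>)
    also have "r k \<le> 2 powr (- real_of_int m)" unfolding r_def using k by (intro powr_mono) (simp_all add: K2_def)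
    finally show ?thesis using m(1) DL by linarith
   qed
   then have "(\<Sum>k\<in>K2. \<psi> k) \<le> real (card K2) * (2 * L)" by (rule sum_bounded_above)
   also have "\<dots> \<le> real \<kappa> * (2 * L)"
   proof (rule mult_right_mono)
    have "K2 \<subseteq> {m..<m + int \<kappa>}" by (auto simp: K2_def)
    then have "card K2 \<le> card {m..<m + int \<kappa>}" by (intro card_mono) simp_all
    then show "real (card K2) \<le> real \<kappa>" by simp
   qed (use L_pos in simp)
   finally show ?thesis .
  qed
  have S3: "(\<Sum>k\<in>K3. \<psi> k) \<le> Kstar A \<kappa> * L"
  proof -
   define r1 where "r1 = 2 powr (- real_of_int m)"
   have r1: "0 < r1" "r1 \<le> dg 0 L" using m(1) by (simp_all add: r1_def D_def)
   obtain P where P: "\<And>j. part (r1 / 2 ^ j) (P j)" "\<And>j. P j \<subseteq> P (Suc j)" using filtration_exists[OF r1] by metis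
   define kk where "kk j = m + int \<kappa> + int j" for j
   define Y where "Y j = {x \<in> Fk (kk j). 0 < b (kk j) x}" for j
   have rkk: "r (kk j) = r1 / 2 ^ j / 2 ^ \<kappa>" for j
   proof -
    have "r1 / 2 ^ j / 2 ^ \<kappa> = 2 powr (- real_of_int m) / 2 powr (real j) / 2 powr (real \<kappa>)" by (simp add: r1_def powr_realpow)
    also have "\<dots> = 2 powr (- real_of_int m - real j - real \<kappa>)" by (simp add: powr_diff)
    also have "- real_of_int m - real j - real \<kappa> = - real_of_int (kk j)" by (simp add: kk_def)
    finally show ?thesis by (simp add: r_def)
   qed
   have YF: "(kk j, x) \<in> F" "0 < b (kk j) x" if "x \<in> Y j" for x j using that by (simp_all add: Y_def Fk_def)
   interpret S: star V N s cU g L "\<lambda>j. r1 / 2 ^ j" P A \<kappa> Y "\<lambda>j. b (kk j)"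
   proof unfold_locales
    show "0 < r1 / 2 ^ j" for j using r1 by simp
    show "r1 / 2 ^ j = 2 * (r1 / 2 ^ Suc j)" for j by simp
    show "part (r1 / 2 ^ j) (P j)" "P j \<subseteq> P (Suc j)" for j by (rule P)+
    show "1 \<le> A" "20 * A \<le> 2 ^ \<kappa>" by (rule A \<kappa>)+
    show "finite (Y j)" for j using Fk_fin by (simp add: Y_def)
    show "Y j \<subseteq> G" for j by (rule subsetI, rule FG, rule YF(1))
    show "r1 / 2 ^ j / 2 ^ \<kappa> \<le> N (x - y)" if "x \<in> Y j" "y \<in> Y j" "x \<noteq> y" for x y j
     using sep[OF YF(1)[OF that(1)] YF(1)[OF that(2)] that(3)] unfolding rkk .
    show "0 < b (kk j) x" "b (kk j) x \<le> 1" if "x \<in> Y j" for x j using YF[OF that] size by simp_all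
    show "r1 / 2 ^ 0 \<le> L" using r1 DL by (simp add: D_def)
    show "\<exists>y\<in>G. N (y - x) \<le> A * (r1 / 2 ^ j) / 2 ^ \<kappa> \<and> (\<forall>t. b (kk j) x * (A * (r1 / 2 ^ j) / 2 ^ \<kappa>) \<le> N (y - (a + t *\<^sub>R w)))"
     if "x \<in> Y j" "a \<in> V" "w \<in> V" "w \<noteq> 0" for x a w j
     using wit[OF YF(1)[OF that(1)] that(2-4) YF(2)[OF that(1)]] unfolding rkk by simp
   qed
   show ?thesis
   proof (rule sum_reindex_bound[where h="\<lambda>k. nat (k - (m + int \<kappa>))" and \<psi>="\<lambda>j. \<Sum>x\<in>Y j. b (kk j) x powr s * (r1 / 2 ^ j)"])
    show "inj_on (\<lambda>k. nat (k - (m + int \<kappa>))) K3" by (rule inj_onI) (auto simp: K3_def)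
    show "0 \<le> (\<Sum>x\<in>Y j. b (kk j) x powr s * (r1 / 2 ^ j))" for j using r1 by (intro sum_nonneg) simp
    show "(\<Sum>j<n. \<Sum>x\<in>Y j. b (kk j) x powr s * (r1 / 2 ^ j)) \<le> Kstar A \<kappa> * L" for n by (rule S.star_sum)
    fix k assume "k \<in> K3"
    then have k: "kk (nat (k - (m + int \<kappa>))) = k" by (simp add: K3_def kk_def)
    let ?j = "nat (k - (m + int \<kappa>))"
    have "\<psi> k = (\<Sum>x\<in>Y ?j. \<phi> k x)" unfolding \<psi>_def
    proof (rule sum.mono_neutral_right[OF Fk_fin])
     show "Y ?j \<subseteq> Fk k" by (auto simp: Y_def k)
     show "\<forall>x\<in>Fk k - Y ?j. \<phi> k x = 0"
     proof
      fix x assume x: "x \<in> Fk k - Y ?j"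
      then have "(k, x) \<in> F" "\<not> 0 < b k x" by (auto simp: Y_def k Fk_def)
      then have "b k x = 0" using b0[of k x] by simp
      then show "\<phi> k x = 0" by (simp add: \<phi>_def)
     qed
    qed
    also have "\<dots> \<le> (\<Sum>x\<in>Y ?j. b (kk ?j) x powr s * (r1 / 2 ^ ?j))"
    proof (rule sum_mono)
     fix x
     have "r k = r1 / 2 ^ ?j / 2 ^ \<kappa>" using rkk[of ?j] unfolding k .
     also have "\<dots> \<le> r1 / 2 ^ ?j / 1" using r1 by (intro divide_left_mono) simp_all
     finally show "\<phi> k x \<le> b (kk ?j) x powr s * (r1 / 2 ^ ?j)" unfolding \<phi>_def k by (intro mult_left_mono) simp_all
    qed
    finally show "\<psi> k \<le> (\<Sum>x\<in>Y ?j. b (kk ?j) x powr s * (r1 / 2 ^ ?j))" .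
   qed (rule Kfin)
  qed
  have "(\<Sum>k\<in>fst ` F. \<psi> k) \<le> 2 * L + (real \<kappa> * (2 * L) + Kstar A \<kappa> * L)"
   unfolding three using S1 S2 S3 by linarith
  also have "\<dots> = (Kstar A \<kappa> + 2 * real \<kappa> + 2) * L" by (simp add: algebra_simps)
  finally show ?thesis unfolding split .
 qed
qed

end

context Metric_space
begin

text \<open>The vertex set grows by one short edge at a time, as in Prim's algorithm; each of the
  edges counts twice in \<open>wt\<close>.\<close>

lemma spanning_tree:
 assumes X: "finite X" "x0 \<in> X" and c0: "0 \<le> c"
  and step: "\<And>C. C \<subseteq> X \<Longrightarrow> x0 \<in> C \<Longrightarrow> C \<noteq> X \<Longrightarrow> \<exists>x\<in>C. \<exists>y\<in>X - C. d x y < c"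
 obtains R where "finite R" "sym R" "R \<subseteq> X \<times> X" "conn X R" "wt R \<le> 2 * real (card X) * c"
proof -
 have c: "\<exists>C R. C \<subseteq> X \<and> x0 \<in> C \<and> card C = n \<and> finite R \<and> sym R \<and> R \<subseteq> C \<times> C \<and> conn C R \<and> wt R \<le> 2 * real n * c"
  if "1 \<le> n" "n \<le> card X" "0 \<le> c" for n using that(1,2)
 proof (induction n rule: dec_induct)
  case base
  have "conn {x0} {}" by (simp add: conn_def)
  then show ?case using X that(3) by (intro exI[of _ "{x0}"] exI[of _ "{}"]) (simp add: wt_def)
 next
  case (step n)
  then obtain C R where CR: "C \<subseteq> X" "x0 \<in> C" "card C = n" "finite R" "sym R" "R \<subseteq> C \<times> C" "conn C R" "wt R \<le> 2 * real n * c"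
   by auto
  have "C \<noteq> X" using CR(3) step.prems by auto
  from assms(4)[OF CR(1,2) this] obtain x y where xy: "x \<in> C" "y \<in> X" "y \<notin> C" "d x y < c" by auto
  let ?R = "R \<union> {(x, y), (y, x)}"
  have "conn C ?R" using CR(7) by (rule conn_mono) auto
  then have 1: "conn (insert y C) ?R" by (rule conn_insert[OF _ xy(1)]) auto
  have 2: "card (insert y C) = Suc n" using CR(1,3) xy(3) finite_subset[OF CR(1) X(1)] by simp
  have 3: "sym ?R" using CR(5) by (intro sym_Un) (auto intro: symI)
  have 4: "wt ?R \<le> 2 * real (Suc n) * c"
  proof -
   have "(\<Sum>(a, b)\<in>?R. d a b) = (\<Sum>(a, b)\<in>R. d a b) + (\<Sum>(a, b)\<in>{(x, y), (y, x)}. d a b)"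
    using CR(4,6) xy(3) by (intro sum.union_disjoint) auto
   also have "(\<Sum>(a, b)\<in>{(x, y), (y, x)}. d a b) = d x y + d y x"
   proof -
    have "x \<noteq> y" using xy(1,3) by auto
    then show ?thesis by simp
   qed
   finally show ?thesis using CR(8) xy(4) commute[of x y] unfolding wt_def by (simp add: algebra_simps)
  qed
  show ?case using CR xy 1 2 3 4 by (intro exI[of _ "insert y C"] exI[of _ ?R]) auto
 qed
 have card: "1 \<le> card X" using X by (simp add: Suc_le_eq card_gt_0_iff) auto
 from c[OF card order_refl c0] obtain C R where CR: "C \<subseteq> X" "card C = card X" "finite R" "sym R" "R \<subseteq> C \<times> C" "conn C R" "wt R \<le> 2 * real (card X) * c"
   by auto
  have "C = X" using card_subset_eq[OF X(1) CR(1,2)] .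
  then show ?thesis using CR by (intro that[of R]) simp_all
qed

end

section \<open>Connected sets of finite measure\<close>

context normed_on
begin

definition nopen :: "'a set \<Rightarrow> bool"
 where "nopen U \<longleftrightarrow> U \<subseteq> V \<and> (\<forall>x\<in>U. \<exists>e>0. {y \<in> V. N (y - x) < e} \<subseteq> U)"

definition nconnected :: "'a set \<Rightarrow> bool"
 where "nconnected S \<longleftrightarrow> \<not> (\<exists>U W. nopen U \<and> nopen W \<and> S \<subseteq> U \<union> W \<and> U \<inter> W \<inter> S = {} \<and> U \<inter> S \<noteq> {} \<and> W \<inter> S \<noteq> {})"

lemma nconnectedD: "nconnected S \<Longrightarrow> nopen U \<Longrightarrow> nopen W \<Longrightarrow> S \<subseteq> U \<union> W \<Longrightarrow> U \<inter> W \<inter> S = {} \<Longrightarrow> U \<inter> S \<noteq> {} \<Longrightarrow> W \<inter> S = {}"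
 unfolding nconnected_def by metis

lemma nopen_ball: "x \<in> V \<Longrightarrow> nopen {y \<in> V. N (y - x) < e}"
 unfolding nopen_def
proof (intro conjI ballI)
 fix y assume x: "x \<in> V" and y: "y \<in> {y \<in> V. N (y - x) < e}"
 have "{z \<in> V. N (z - y) < e - N (y - x)} \<subseteq> {y \<in> V. N (y - x) < e}"
 proof
  fix z assume "z \<in> {z \<in> V. N (z - y) < e - N (y - x)}"
  then show "z \<in> {y \<in> V. N (y - x) < e}" using N_diff_triangle[of z y x] x y by simp
 qed
 then show "\<exists>e'>0. {z \<in> V. N (z - y) < e'} \<subseteq> {y \<in> V. N (y - x) < e}" using y by (intro exI[of _ "e - N (y - x)"]) simp
qed auto

lemma nopen_outside: "x \<in> V \<Longrightarrow> nopen {y \<in> V. e < N (y - x)}"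
 unfolding nopen_def
proof (intro conjI ballI)
 fix y assume x: "x \<in> V" and y: "y \<in> {y \<in> V. e < N (y - x)}"
 have "{z \<in> V. N (z - y) < N (y - x) - e} \<subseteq> {y \<in> V. e < N (y - x)}"
 proof
  fix z assume "z \<in> {z \<in> V. N (z - y) < N (y - x) - e}"
  then show "z \<in> {y \<in> V. e < N (y - x)}" using N_diff_triangle[of y z x] N_commute[of y z] x y by simp
 qed
 then show "\<exists>e'>0. {z \<in> V. N (z - y) < e'} \<subseteq> {y \<in> V. e < N (y - x)}" using y by (intro exI[of _ "N (y - x) - e"]) simp
qed auto

lemma nopen_UN: "(\<And>i. i \<in> I \<Longrightarrow> nopen (B i)) \<Longrightarrow> nopen (\<Union>i\<in>I. B i)"
 unfolding nopen_def
proof (intro conjI ballI)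
 assume B: "\<And>i. i \<in> I \<Longrightarrow> B i \<subseteq> V \<and> (\<forall>x\<in>B i. \<exists>e>0. {y \<in> V. N (y - x) < e} \<subseteq> B i)"
 show "(\<Union>i\<in>I. B i) \<subseteq> V" using B by (intro UN_least) simp
 fix x assume "x \<in> (\<Union>i\<in>I. B i)"
 then obtain i where i: "i \<in> I" "x \<in> B i" by (elim UN_E)
 then obtain e where "e > 0" "{y \<in> V. N (y - x) < e} \<subseteq> B i" using B[OF i(1)] by auto
 then show "\<exists>e>0. {y \<in> V. N (y - x) < e} \<subseteq> (\<Union>i\<in>I. B i)" using UN_upper[of i I B] i(1) by (meson order_trans)
qed

text \<open>If the distance to x omitted the value v, an open ball and its open exterior would
  separate S. This replaces the intermediate value theorem as long as no curve is available.\<close>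

lemma nconnected_values:
 assumes S: "nconnected S" "S \<subseteq> V" and x: "x \<in> S" "p \<in> S" "h \<le> N (p - x)"
 shows "{0..<h} \<subseteq> (\<lambda>z. N (z - x)) ` (S \<inter> {z. N (z - x) < h})"
proof
 fix v assume v: "v \<in> {0..<h}"
 have xV: "x \<in> V" using S(2) x(1) by (rule subsetD)
 show "v \<in> (\<lambda>z. N (z - x)) ` (S \<inter> {z. N (z - x) < h})"
 proof (rule ccontr)
  assume n: "v \<notin> (\<lambda>z. N (z - x)) ` (S \<inter> {z. N (z - x) < h})"
  have ne: "N (z - x) \<noteq> v" if "z \<in> S" for z
  proof
   assume "N (z - x) = v"
   then have "v \<in> (\<lambda>z. N (z - x)) ` (S \<inter> {z. N (z - x) < h})" using that v by (intro image_eqI[of _ _ z]) simp_all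
   then show False using n by contradiction
  qed
  have v0: "0 < v" using ne[OF x(1)] v by (simp add: N_zero)
  have "{y \<in> V. v < N (y - x)} \<inter> S = {}"
  proof (rule nconnectedD[OF S(1) nopen_ball[OF xV, of v] nopen_outside[OF xV]])
   show "S \<subseteq> {y \<in> V. N (y - x) < v} \<union> {y \<in> V. v < N (y - x)}"
   proof
    fix z assume z: "z \<in> S"
    then have "z \<in> V" using S(2) by (rule_tac subsetD)
    then show "z \<in> {y \<in> V. N (y - x) < v} \<union> {y \<in> V. v < N (y - x)}" using ne[OF z] by auto
   qed
   show "{y \<in> V. N (y - x) < v} \<inter> {y \<in> V. v < N (y - x)} \<inter> S = {}" by auto
   have "x \<in> {y \<in> V. N (y - x) < v} \<inter> S" using x(1) xV v0 by (simp add: N_zero)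
   then show "{y \<in> V. N (y - x) < v} \<inter> S \<noteq> {}" by auto
  qed
  moreover have "p \<in> {y \<in> V. v < N (y - x)} \<inter> S" using x v subsetD[OF S(2) x(2)] by simp
  ultimately show False by simp
 qed
qed

text \<open>Around each point a ball of radius r / 4 forces members of total diameter r / 4, and no
  member meets two of these balls. At least two points are required so that S leaves each
  ball.\<close>

lemma nconnected_sep_card:
 assumes S: "nconnected S" "S \<subseteq> V" and X: "finite X" "X \<subseteq> S" "2 \<le> card X" and r: "0 < r"
  and sep: "\<And>x y. x \<in> X \<Longrightarrow> y \<in> X \<Longrightarrow> x \<noteq> y \<Longrightarrow> r \<le> N (x - y)"
 shows "ennreal (real (card X) * (r / 4)) \<le> hcont (r / 4) S"
 unfolding hcont_def
proof (rule INF_greatest)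
 fix U assume U: "U \<in> fine_covers (r / 4) S"
 define B where "B x = S \<inter> {z. N (z - x) < r / 4}" for x
 let ?S = "\<lambda>x i. if U i \<inter> B x \<noteq> {} then ediam (U i) else 0"
 have UV: "U i \<subseteq> V" "ediam (U i) \<le> ennreal (r / 4)" and cov: "S \<subseteq> (\<Union>i. U i)" for i using U by (simp_all add: fine_covers_def)
 have XV: "x \<in> V" if "x \<in> X" for x using subsetD[OF S(2) subsetD[OF X(2) that]] .
 have BS: "B x \<subseteq> S" for x by (simp add: B_def)
 have hit: "ennreal (r / 4) \<le> (\<Sum>i. ?S x i)" if x: "x \<in> X" for x
 proof -
  have "card (X - {x}) \<noteq> 0" using x X by simp
  then obtain p where p: "p \<in> X" "p \<noteq> x" by (metis Diff_iff card.empty ex_in_conv singletonI)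
  show ?thesis
  proof (rule hit_sum[where f="\<lambda>z. N (z - x)"])
   show "B x \<subseteq> (\<Union>i. U i)" using BS cov by (rule order_trans)
   show "U i \<subseteq> V" for i by (rule UV)
   show "\<bar>N (a - x) - N (b - x)\<bar> \<le> N (a - b)" if "a \<in> V" "b \<in> V" for a b
    using N_diff_abs[of "a - x" "b - x"] that XV[OF x] by simp
   have "r / 4 \<le> N (p - x)" using sep[OF p(1) x p(2)] r by simp
   then show "{0..<r / 4} \<subseteq> (\<lambda>z. N (z - x)) ` B x"
    unfolding B_def by (rule nconnected_values[OF S subsetD[OF X(2) x] subsetD[OF X(2) p(1)]])
  qed
 qed
 have "ennreal (real (card X) * (r / 4)) = (\<Sum>x\<in>X. ennreal (r / 4))" using r by (subst sum_ennreal) simp_all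
 also have "\<dots> \<le> (\<Sum>x\<in>X. \<Sum>i. ?S x i)" by (rule sum_mono) (rule hit)
 also have "\<dots> \<le> (\<Sum>i. if U i \<inter> (\<Union>x\<in>X. B x) \<noteq> {} then ediam (U i) else 0)"
 proof (rule disjoint_hits[OF X(1) UV(2)])
  show "0 \<le> r / 4" using r by simp
  fix x x' p q assume x: "x \<in> X" "x' \<in> X" "x \<noteq> x'" and pq: "p \<in> B x" "q \<in> B x'"
  have V: "p \<in> V" "q \<in> V" using subsetD[OF S(2) subsetD[OF BS pq(1)]] subsetD[OF S(2) subsetD[OF BS pq(2)]] .
  have "N (x - x') \<le> N (x - p) + N (p - q) + N (q - x')" using V XV[OF x(1)] XV[OF x(2)] by (intro N_three)
  moreover have "N (x - p) = N (p - x)" by (rule N_commute)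
  ultimately show "r / 4 < N (p - q)" using sep[OF x] pq r unfolding B_def by simp
 qed
 also have "\<dots> \<le> (\<Sum>i. ediam (U i))" by (rule suminf_le) (simp_all add: summableI)
 finally show "ennreal (real (card X) * (r / 4)) \<le> (\<Sum>i. ediam (U i))" .
qed

text \<open>If one part of the net had distance at least 2 r from the rest, the r-balls around the
  two parts would separate S. Hence a spanning tree with edges shorter than 2 r exists, and its
  doubled length is at most 4 r card = 16 (card r / 4) \<le> 16 H by the content bound.\<close>

lemma connected_curve:
 fixes X :: "nat \<Rightarrow> 'a set" and r :: "nat \<Rightarrow> real"
 assumes mc: "mcomplete" and S: "nconnected S" "S \<subseteq> V" "S \<noteq> {}"
  and H: "0 \<le> H" "\<And>\<delta>. 0 < \<delta> \<Longrightarrow> hcont \<delta> S \<le> ennreal H"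
  and r: "\<And>n. 0 < r n" "r \<longlonglongrightarrow> 0" and XS: "\<And>n. X n \<subseteq> S"
  and sep: "\<And>n x y. x \<in> X n \<Longrightarrow> y \<in> X n \<Longrightarrow> x \<noteq> y \<Longrightarrow> r n \<le> N (x - y)"
  and near: "\<And>n x. x \<in> S \<Longrightarrow> \<exists>y\<in>X n. N (y - x) < r n"
 obtains h where "lip h" "S \<subseteq> h ` {0..16 * H}"
proof -
 have bound: "real (card Y) * (r n / 4) \<le> H" if Y: "finite Y" "Y \<subseteq> X n" "2 \<le> card Y" for Y n
 proof -
  have rn: "0 < r n / 4" using r(1)[of n] by simp
  have "ennreal (real (card Y) * (r n / 4)) \<le> hcont (r n / 4) S"
   by (rule nconnected_sep_card[OF S(1,2) Y(1) order_trans[OF Y(2) XS] Y(3) r(1) sep[OF subsetD[OF Y(2)] subsetD[OF Y(2)]]])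
  also note H(2)[OF rn]
  finally show ?thesis using H(1) by (simp add: ennreal_le_iff)
 qed
 \<comment> \<open>Finite measure replaces compactness: more than 4 H / r separated points would
   exceed the content.\<close>
 have fin: "finite (X n)" for n
 proof (rule ccontr)
  assume "infinite (X n)"
  define k where "k = nat \<lceil>4 * H / r n\<rceil> + 2"
  obtain Y where Y: "finite Y" "card Y = k" "Y \<subseteq> X n" using infinite_arbitrarily_large[OF \<open>infinite (X n)\<close>] by metis
  have "4 * H / r n < real k" unfolding k_def by linarith
  then have "H < real k * (r n / 4)" using r(1)[of n] by (simp add: field_simps)
  then show False using bound[OF Y(1,3)] Y(2) by (simp add: k_def)
 qed
 have ne: "X n \<noteq> {}" for n using near S(3) by auto
 have XV: "x \<in> V" if "x \<in> X n" for x n using subsetD[OF S(2) subsetD[OF XS that]] .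
 have graph: "\<exists>R. finite R \<and> sym R \<and> R \<subseteq> X n \<times> X n \<and> conn (X n) R \<and> wt R \<le> 16 * H" for n
 proof (cases "2 \<le> card (X n)")
  case True
  obtain x0 where x0: "x0 \<in> X n" using ne[of n] by auto
  have step: "\<exists>x\<in>C. \<exists>y\<in>X n - C. N (x - y) < 2 * r n" if C: "C \<subseteq> X n" "x0 \<in> C" "C \<noteq> X n" for C
  proof (rule ccontr)
   assume "\<not> ?thesis"
   then have far: "2 * r n \<le> N (x - y)" if "x \<in> C" "y \<in> X n - C" for x y using that by (auto simp: not_less)
   define Bl where "Bl x = {z \<in> V. N (z - x) < r n}" for x
   have op: "nopen (\<Union>x\<in>T. Bl x)" if "T \<subseteq> X n" for T
    unfolding Bl_def using that XV by (intro nopen_UN nopen_ball) auto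
   have inS: "x \<in> (\<Union>x\<in>T. Bl x) \<inter> S" if "x \<in> T" "T \<subseteq> X n" for x T
   proof -
    have x: "x \<in> X n" using that by auto
    have "x \<in> Bl x" unfolding Bl_def using XV[OF x] r(1)[of n] by (simp add: N_zero)
    then show ?thesis using subsetD[OF XS x] that(1) by auto
   qed
   have "(\<Union>x\<in>X n - C. Bl x) \<inter> S = {}"
   proof (rule nconnectedD[OF S(1) op[OF C(1)] op])
    show "S \<subseteq> (\<Union>x\<in>C. Bl x) \<union> (\<Union>x\<in>X n - C. Bl x)"
    proof
     fix z assume z: "z \<in> S"
     obtain y where y: "y \<in> X n" "N (y - z) < r n" using near[OF z, of n] by (elim bexE)
     have "z \<in> Bl y" unfolding Bl_def using y subsetD[OF S(2) z] N_commute[of z y] by simp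
     then show "z \<in> (\<Union>x\<in>C. Bl x) \<union> (\<Union>x\<in>X n - C. Bl x)" using y(1) by auto
    qed
    show "(\<Union>x\<in>C. Bl x) \<inter> (\<Union>x\<in>X n - C. Bl x) \<inter> S = {}"
    proof (rule ccontr)
     assume "(\<Union>x\<in>C. Bl x) \<inter> (\<Union>x\<in>X n - C. Bl x) \<inter> S \<noteq> {}"
     then obtain z x y where z: "x \<in> C" "z \<in> Bl x" "y \<in> X n - C" "z \<in> Bl y" by auto
     have V: "x \<in> V" "y \<in> V" using XV C(1) z by auto
     have "N (x - y) \<le> N (x - z) + N (z - y)" using V z unfolding Bl_def by (intro N_diff_triangle) simp_all
     then show False using far[OF z(1,3)] z N_commute[of x z] unfolding Bl_def by simp
    qed
    show "(\<Union>x\<in>C. Bl x) \<inter> S \<noteq> {}" using inS[OF C(2,1)] by auto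
   qed simp
   moreover obtain y where "y \<in> X n - C" using C by auto
   ultimately show False using inS[of y "X n - C"] by auto
  qed
  obtain R where R: "finite R" "sym R" "R \<subseteq> X n \<times> X n" "conn (X n) R" "wt R \<le> 2 * real (card (X n)) * (2 * r n)"
   using spanning_tree[OF fin x0 _ step] r(1)[of n] by auto
  have "wt R \<le> 16 * (real (card (X n)) * (r n / 4))" using R(5) by (simp add: mult_ac)
  then have "wt R \<le> 16 * H" using bound[OF fin order_refl True] by linarith
  then show ?thesis using R by auto
 next
  case False
  have "conn (X n) {}"
  proof -
   have "card (X n) = 1" using False ne[of n] fin[of n] by (simp add: not_le card_gt_0_iff less_2_cases_iff)
   then obtain x where "X n = {x}" by (rule card_1_singletonE)
   then show ?thesis by (simp add: conn_def)
  qed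
  then show ?thesis using H(1) by (intro exI[of _ "{}"]) (simp add: sym_def wt_def)
 qed
 have tb: "mtotally_bounded S" unfolding mtotally_bounded_def
 proof (intro allI impI)
  fix \<epsilon> :: real assume "0 < \<epsilon>"
  then have "eventually (\<lambda>n. r n < \<epsilon>) sequentially" using r(2) by (auto dest: order_tendstoD)
  then obtain n where n: "r n < \<epsilon>" using eventually_happens trivial_limit_sequentially by blast
  have "S \<subseteq> (\<Union>x\<in>X n. mball x \<epsilon>)"
  proof
   fix z assume z: "z \<in> S"
   obtain y where y: "y \<in> X n" "N (y - z) < r n" using near[OF z, of n] by (elim bexE)
   then have "z \<in> mball y \<epsilon>" using n XV[OF y(1)] subsetD[OF S(2) z] by (simp add: in_mball)
   then show "z \<in> (\<Union>x\<in>X n. mball x \<epsilon>)" using y(1) by auto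
  qed
  with fin[of n] XS[of n] show "\<exists>K. finite K \<and> K \<subseteq> S \<and> S \<subseteq> (\<Union>x\<in>K. mball x \<epsilon>)"
   by (intro exI[of _ "X n"] conjI)
 qed
 show ?thesis by (rule curve_through_nets[OF mc S(2) tb fin XS ne near r(2) graph]) (assumption, rule that)
qed

end

section \<open>Jones numbers and necessity\<close>

locale lp_space =
 fixes p :: real
 assumes p_ge: "1 \<le> p"
begin

sublocale normed_on "lp p" "lpnorm p" by (rule normed_on_lp[OF p_ge])

lemma lpdiam_eq: "lpdiam p S = ediam S"
 by (simp add: lpdiam_def ediam_def fun_diff_def)

lemma H1_delta_eq: "H1_delta p \<delta> S = hcont \<delta> S"
 by (simp add: H1_delta_def hcont_def fine_covers_def lpdiam_eq)

lemma hcont_le_H1: "0 < \<delta> \<Longrightarrow> hcont \<delta> S \<le> H1 p S"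
 unfolding H1_def H1_delta_eq by (rule SUP_upper) simp

lemma lp_connected_eq: "lp_connected p S = nconnected S"
 by (simp add: lp_connected_def nconnected_def nopen_def lp_open_def fun_diff_def)

lemma cball_eq: "lpcball p x R = {y \<in> lp p. lpnorm p (y - x) \<le> R}"
 by (simp add: lpcball_def fun_diff_def)

lemma setdist_eq: "lpsetdist p x S = Inf ((\<lambda>y. lpnorm p (x - y)) ` S)"
 by (simp add: lpsetdist_def fun_diff_def)

lemma lines_eq: "lplines p = {range (\<lambda>t. a + t *\<^sub>R v) | a v. a \<in> lp p \<and> v \<in> lp p \<and> v \<noteq> 0}"
proof -
 have 1: "{(\<lambda>i. a i + t * v i) | t. True} = range (\<lambda>t. a + t *\<^sub>R v)" for a v :: seq
  by (auto simp: plus_fun_def scaleR_fun_def)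
 have 2: "(\<lambda>i. 0) = (0 :: seq)" by (simp add: zero_fun_def)
 show ?thesis unfolding lplines_def 1 2 ..
qed

lemma nontriv: "\<exists>w\<in>lp p. w \<noteq> 0"
proof
 let ?w = "\<lambda>i::nat. if i = 0 then 1 else 0 :: real"
 show "?w \<noteq> 0"
 proof
  assume "?w = 0"
  from fun_cong[OF this, of 0] show False by (simp add: zero_fun_def)
 qed
 have "summable (\<lambda>i. \<bar>?w i\<bar> powr p)" by (rule summable_finite[of "{0}"]) simp_all
 then show "?w \<in> lp p" by (simp add: lp_def)
qed

text \<open>The space contains a vector v of norm R, and x + v and x - v realise the diameter. The
  exact value is used both in the denominator of beta and for the weights in
  \<open>Sfun\<close>.\<close>

lemma cball_diam:
 assumes x: "x \<in> lp p" and R: "0 \<le> R"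
 shows "lpdiam p (lpcball p x R) = ennreal (2 * R)"
 unfolding lpdiam_eq
proof (rule antisym)
 show "ediam (lpcball p x R) \<le> ennreal (2 * R)"
 proof (rule ediam_le)
  fix y z assume "y \<in> lpcball p x R" "z \<in> lpcball p x R"
  then have yz: "y \<in> lp p" "z \<in> lp p" "lpnorm p (y - x) \<le> R" "lpnorm p (z - x) \<le> R" by (simp_all add: cball_eq)
  have "lpnorm p (y - z) \<le> lpnorm p (y - x) + lpnorm p (x - z)" using yz x by (intro N_diff_triangle)
  then show "lpnorm p (y - z) \<le> 2 * R" using yz N_commute[of x z] by linarith
 qed
 obtain w where w: "w \<in> lp p" "w \<noteq> 0" using nontriv by (elim bexE)
 have Nw: "0 < lpnorm p w" using w N_eq_0[OF w(1)] N_nonneg[of w] by linarith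
 define v where "v = (R / lpnorm p w) *\<^sub>R w"
 have v: "v \<in> lp p" "lpnorm p v = R" unfolding v_def using w Nw R by (simp_all add: N_scale)
 have "x + v \<in> lpcball p x R" "x - v \<in> lpcball p x R" using x v by (simp_all add: cball_eq)
 then have "ennreal (lpnorm p ((x + v) - (x - v))) \<le> ediam (lpcball p x R)" by (rule ediam_ge)
 moreover have "(x + v) - (x - v) = 2 *\<^sub>R v" by (simp add: scaleR_2)
 ultimately show "ennreal (2 * R) \<le> ediam (lpcball p x R)" using v by (simp add: N_scale)
qed

lemma setdist_le: "y \<in> S \<Longrightarrow> lpsetdist p x S \<le> lpnorm p (x - y)"
 unfolding setdist_eq by (rule cInf_lower) (auto intro: bdd_belowI[of _ 0])

lemma setdist_nonneg: "S \<noteq> {} \<Longrightarrow> 0 \<le> lpsetdist p x S"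
 unfolding setdist_eq by (rule cInf_greatest) auto

lemma line_sup:
 assumes E: "E \<subseteq> lp p" and x: "x \<in> E" "0 < R" and l: "l \<in> lplines p"
 shows "bdd_above ((\<lambda>y. lpsetdist p y l) ` (E \<inter> lpcball p x R))"
  "0 \<le> (SUP y\<in>E \<inter> lpcball p x R. lpsetdist p y l)"
proof -
 obtain a w where aw: "a \<in> lp p" "w \<in> lp p" "l = range (\<lambda>t. a + t *\<^sub>R w)" using l unfolding lines_eq by auto
 have al: "a \<in> l" unfolding aw(3) by (rule range_eqI[of _ _ 0]) simp
 have xV: "x \<in> lp p" using E x(1) by (rule subsetD)
 have "lpsetdist p y l \<le> R + lpnorm p (x - a)" if "y \<in> E \<inter> lpcball p x R" for y
 proof -
  have y: "y \<in> lp p" "lpnorm p (y - x) \<le> R" using that by (simp_all add: cball_eq)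
  have "lpsetdist p y l \<le> lpnorm p (y - a)" by (rule setdist_le[OF al])
  also have "\<dots> \<le> lpnorm p (y - x) + lpnorm p (x - a)" using y xV aw by (intro N_diff_triangle)
  finally show ?thesis using y by simp
 qed
 then have b: "bdd_above ((\<lambda>y. lpsetdist p y l) ` (E \<inter> lpcball p x R))" by (intro bdd_aboveI2)
 then show "bdd_above ((\<lambda>y. lpsetdist p y l) ` (E \<inter> lpcball p x R))" by simp
 have "x \<in> E \<inter> lpcball p x R" using x xV by (simp add: cball_eq N_zero)
 then have "lpsetdist p x l \<le> (SUP y\<in>E \<inter> lpcball p x R. lpsetdist p y l)" using b by (rule cSUP_upper)
 moreover have "0 \<le> lpsetdist p x l" using al by (intro setdist_nonneg) auto
 ultimately show "0 \<le> (SUP y\<in>E \<inter> lpcball p x R. lpsetdist p y l)" by simp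
qed

lemma beta_eq:
 assumes E: "E \<subseteq> lp p" and x: "x \<in> E" "0 < R"
 shows "beta p E (lpcball p x R) * (2 * R) = (INF l\<in>lplines p. SUP y\<in>E \<inter> lpcball p x R. lpsetdist p y l)"
proof -
 have xV: "x \<in> lp p" using E x(1) by (rule subsetD)
 have "x \<in> E \<inter> lpcball p x R" using x xV by (simp add: cball_eq N_zero)
 then have ne: "E \<inter> lpcball p x R \<noteq> {}" by auto
 show ?thesis unfolding beta_def using ne x(2) by (simp add: cball_diam[OF xV])
qed

lemma lines_ne: "lplines p \<noteq> {}"
proof -
 obtain w where w: "w \<in> lp p" "w \<noteq> 0" using nontriv by (elim bexE)
 then have "range (\<lambda>t. w + t *\<^sub>R w) \<in> lplines p" unfolding lines_eq by auto
 then show ?thesis by auto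
qed

lemma beta_nonneg:
 assumes E: "E \<subseteq> lp p" and x: "x \<in> E" "0 < R"
 shows "0 \<le> beta p E (lpcball p x R)"
proof -
 have "0 \<le> (INF l\<in>lplines p. SUP y\<in>E \<inter> lpcball p x R. lpsetdist p y l)"
  by (rule cINF_greatest[OF lines_ne]) (rule line_sup(2)[OF E x])
 then have "0 \<le> beta p E (lpcball p x R) * (2 * R)" unfolding beta_eq[OF E x] .
 then show ?thesis using x(2) by (simp add: zero_le_mult_iff)
qed

text \<open>The diameter in the definition is 2 R, so for every line the supremum of the distances
  is at least twice the claimed bound. This leaves room for a point that need not attain the
  supremum.\<close>

lemma beta_witness:
 assumes E: "E \<subseteq> lp p" and x: "x \<in> E" "0 < R" and b: "0 < beta p E (lpcball p x R)"
  and a: "a \<in> lp p" and w: "w \<in> lp p" "w \<noteq> 0"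
 shows "\<exists>y\<in>E. lpnorm p (y - x) \<le> R \<and> (\<forall>t. beta p E (lpcball p x R) * R \<le> lpnorm p (y - (a + t *\<^sub>R w)))"
proof -
 let ?b = "beta p E (lpcball p x R)" and ?S = "E \<inter> lpcball p x R"
 define l where "l = range (\<lambda>t. a + t *\<^sub>R w)"
 have l: "l \<in> lplines p" unfolding lines_eq l_def using a w by auto
 have xV: "x \<in> lp p" using E x(1) by (rule subsetD)
 have "x \<in> ?S" using x xV by (simp add: cball_eq N_zero)
 then have ne: "?S \<noteq> {}" by auto
 have bd: "bdd_above ((\<lambda>y. lpsetdist p y l) ` ?S)" using line_sup(1)[OF E x l] by simp
 have "?b * R < ?b * (2 * R)" using b x by simp
 also have "\<dots> \<le> (SUP y\<in>?S. lpsetdist p y l)"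
  unfolding beta_eq[OF E x] using line_sup(2)[OF E x] by (intro cINF_lower[OF _ l]) (auto intro!: bdd_belowI[of _ 0])
 finally obtain y where y: "y \<in> ?S" "?b * R < lpsetdist p y l" using less_cSUP_iff[OF ne bd] by auto
 have "?b * R \<le> lpnorm p (y - (a + t *\<^sub>R w))" for t
  using y(2) setdist_le[of "a + t *\<^sub>R w" l y] unfolding l_def by fastforce
 then show ?thesis using y(1) by (auto simp: cball_eq)
qed

text \<open>The infimum over lines need not be attained, hence a number c strictly above it. The
  direction is normalised so that the parameter on the line is a coordinate measuring
  length.\<close>

lemma beta_line:
 assumes E: "E \<subseteq> lp p" and x: "x \<in> E" "0 < R" and c: "beta p E (lpcball p x R) * (2 * R) < c"
 obtains a w where "a \<in> lp p" "w \<in> lp p" "lpnorm p w = 1"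
  "\<And>y. y \<in> E \<Longrightarrow> lpnorm p (y - x) \<le> R \<Longrightarrow> \<exists>t. lpnorm p (y - (a + t *\<^sub>R w)) < c"
proof -
 let ?S = "E \<inter> lpcball p x R"
 have "Inf ((\<lambda>l. SUP y\<in>?S. lpsetdist p y l) ` lplines p) < c" using c unfolding beta_eq[OF E x] .
 then obtain v where v: "v \<in> (\<lambda>l. SUP y\<in>?S. lpsetdist p y l) ` lplines p" "v < c"
  using cInf_lessD[of "(\<lambda>l. SUP y\<in>?S. lpsetdist p y l) ` lplines p" c] lines_ne by auto
 then obtain l where l: "l \<in> lplines p" "(SUP y\<in>?S. lpsetdist p y l) < c" by auto
 obtain a w where aw: "a \<in> lp p" "w \<in> lp p" "w \<noteq> 0" "l = range (\<lambda>t. a + t *\<^sub>R w)" using l(1) unfolding lines_eq by auto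
 have Nw: "0 < lpnorm p w" using aw N_eq_0[OF aw(2)] N_nonneg[of w] by linarith
 have bd: "bdd_above ((\<lambda>y. lpsetdist p y l) ` ?S)" using line_sup(1)[OF E x l(1)] by simp
 show ?thesis
 proof (rule that[of a "(1 / lpnorm p w) *\<^sub>R w"])
  show "lpnorm p ((1 / lpnorm p w) *\<^sub>R w) = 1" using Nw aw(2) by (simp add: N_scale)
  fix y assume y: "y \<in> E" "lpnorm p (y - x) \<le> R"
  then have "y \<in> ?S" using E by (auto simp: cball_eq)
  then have "lpsetdist p y l \<le> (SUP y\<in>?S. lpsetdist p y l)" using bd by (rule cSUP_upper)
  then have "Inf ((\<lambda>z. lpnorm p (y - z)) ` l) < c" using l(2) unfolding setdist_eq by simp
  moreover have "(\<lambda>z. lpnorm p (y - z)) ` l \<noteq> {}" by (simp add: aw(4))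
  ultimately obtain u where u: "u \<in> (\<lambda>z. lpnorm p (y - z)) ` l" "u < c" using cInf_lessD by metis
  then obtain z where z: "z \<in> l" "lpnorm p (y - z) < c" by auto
  then obtain t where "z = a + t *\<^sub>R w" unfolding aw(4) by auto
  then have "z = a + (t * lpnorm p w) *\<^sub>R ((1 / lpnorm p w) *\<^sub>R w)" using Nw by simp
  then show "\<exists>t. lpnorm p (y - (a + t *\<^sub>R ((1 / lpnorm p w) *\<^sub>R w))) < c" using z(2) by metis
 qed (use aw in simp_all)
qed

section \<open>Multiresolution families and their sums\<close>

abbreviation mesh :: "int \<Rightarrow> real" where "mesh k \<equiv> 2 powr (- real_of_int k)"

abbreviation bnum :: "real \<Rightarrow> seq set \<Rightarrow> int \<Rightarrow> seq \<Rightarrow> real"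
 where "bnum A E k x \<equiv> beta p E (lpcball p x (A * mesh k))"

lemma nets:
 assumes X: "multires_nets p E X"
 shows "X k \<subseteq> E" "X k \<subseteq> X (k + 1)"
  "x \<in> X k \<Longrightarrow> y \<in> X k \<Longrightarrow> x \<noteq> y \<Longrightarrow> mesh k \<le> lpnorm p (x - y)"
  "x \<in> E \<Longrightarrow> \<exists>y\<in>X k. lpnorm p (y - x) < mesh k"
proof -
 have n: "is_net p (mesh k) E (X k)" using X by (simp add: multires_nets_def)
 show "X k \<subseteq> E" using n by (simp add: is_net_def)
 show "X k \<subseteq> X (k + 1)" using X by (simp add: multires_nets_def)
 show "mesh k \<le> lpnorm p (x - y)" if "x \<in> X k" "y \<in> X k" "x \<noteq> y"
  using n that by (simp add: is_net_def fun_diff_def)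
 show "\<exists>y\<in>X k. lpnorm p (y - x) < mesh k" if x: "x \<in> E"
 proof -
  have "\<forall>x\<in>E. \<exists>y\<in>X k. lpnorm p (x - y) < mesh k" using n by (simp add: is_net_def fun_diff_def)
  from bspec[OF this x] show ?thesis using N_commute[of x] by simp
 qed
qed

lemma Sfun_term:
 assumes E: "E \<subseteq> lp p" and X: "multires_nets p E X" and A: "0 < A" and kx: "x \<in> X k"
 shows "ennreal (bnum A E k x powr r) * lpdiam p (lpcball p x (A * mesh k))
  = ennreal (2 * A * (bnum A E k x powr r * mesh k))"
proof -
 have x: "x \<in> lp p" using E nets(1)[OF X, of k] kx by auto
 have "0 \<le> A * mesh k" using A by simp
 then show ?thesis unfolding cball_diam[OF x \<open>0 \<le> A * mesh k\<close>]
  by (subst ennreal_mult''[symmetric]) (simp_all add: mult_ac)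
qed

lemma Sfun_ge:
 assumes E: "E \<subseteq> lp p" and X: "multires_nets p E X" and A: "0 < A" and F: "finite F" "F \<subseteq> {(k, x). x \<in> X k}"
 shows "ennreal (2 * A * (\<Sum>(k, x)\<in>F. bnum A E k x powr r * mesh k))
  \<le> Sfun p r E X A"
proof -
 let ?f = "\<lambda>(k, x). ennreal (bnum A E k x powr r) * lpdiam p (lpcball p x (A * mesh k))"
 let ?g = "\<lambda>(k, x). 2 * A * (bnum A E k x powr r * mesh k)"
 have "ennreal (\<Sum>q\<in>F. ?g q) = (\<Sum>q\<in>F. ennreal (?g q))" using A by (intro sum_ennreal[symmetric]) auto
 also have "\<dots> = (\<Sum>q\<in>F. ?f q)"
 proof (rule sum.cong[OF refl])
  fix q assume "q \<in> F"
  then obtain k x where q: "q = (k, x)" "x \<in> X k" using F(2) by (cases q) auto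
  show "ennreal (?g q) = ?f q" unfolding q(1) prod.case by (rule Sfun_term[OF E X A q(2), symmetric])
 qed
 also have "\<dots> \<le> infsum ?f {(k, x). x \<in> X k}"
  using F by (subst nonneg_infsum_complete) (auto intro!: SUP_upper)
 also have "\<dots> \<le> Sfun p r E X A" by (simp add: Sfun_def)
 finally show ?thesis by (simp add: sum_distrib_left case_prod_unfold)
qed

lemma Sfun_le:
 assumes E: "E \<subseteq> lp p" and X: "multires_nets p E X" and A: "0 < A" and d: "lpdiam p E \<le> ennreal D" "0 \<le> D" "0 \<le> K"
  and F: "\<And>F. finite F \<Longrightarrow> F \<subseteq> {(k, x). x \<in> X k} \<Longrightarrow>
   (\<Sum>(k, x)\<in>F. bnum A E k x powr r * mesh k) \<le> K"
 shows "Sfun p r E X A \<le> ennreal (D + 2 * A * K)"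
proof -
 let ?f = "\<lambda>(k, x). ennreal (bnum A E k x powr r) * lpdiam p (lpcball p x (A * mesh k))"
 let ?h = "\<lambda>(k, x). bnum A E k x powr r * mesh k"
 have "infsum ?f {(k, x). x \<in> X k} \<le> ennreal (2 * A * K)"
 proof (subst nonneg_infsum_complete)
  show "(SUP F\<in>{F. finite F \<and> F \<subseteq> {(k, x). x \<in> X k}}. sum ?f F) \<le> ennreal (2 * A * K)"
  proof (rule SUP_least)
   fix F assume "F \<in> {F. finite F \<and> F \<subseteq> {(k, x). x \<in> X k}}"
   then have F': "finite F" "F \<subseteq> {(k, x). x \<in> X k}" by simp_all
   have "sum ?f F = (\<Sum>q\<in>F. ennreal (2 * A * ?h q))"
   proof (rule sum.cong[OF refl])
    fix q assume "q \<in> F"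
    then obtain k x where q: "q = (k, x)" "x \<in> X k" using F'(2) by (cases q) auto
    show "?f q = ennreal (2 * A * ?h q)" unfolding q(1) prod.case by (rule Sfun_term[OF E X A q(2)])
   qed
   also have "\<dots> = ennreal (\<Sum>q\<in>F. 2 * A * ?h q)" using A by (intro sum_ennreal) auto
   also have "(\<Sum>q\<in>F. 2 * A * ?h q) = 2 * A * (\<Sum>q\<in>F. ?h q)" by (simp add: sum_distrib_left)
   also have "ennreal (2 * A * (\<Sum>q\<in>F. ?h q)) \<le> ennreal (2 * A * K)"
    using F[OF F'] A by (intro ennreal_leI mult_left_mono) simp_all
   finally show "sum ?f F \<le> ennreal (2 * A * K)" .
  qed
 qed auto
 then have "Sfun p r E X A \<le> ennreal D + ennreal (2 * A * K)" unfolding Sfun_def using d(1) by (intro add_mono)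
 then show ?thesis using d A by (simp add: ennreal_plus[symmetric] del: ennreal_plus)
qed

text \<open>The sum over all balls is the supremum over finite families, and all of them are treated
  on one curve of parameter length 16 H'. \<open>curve_on\<close> requires a positive length, so the
  estimate is made for every positive H' \<ge> H, and the surplus tends to 0 at the end; this
  includes H = 0.\<close>

lemma necessity:
 assumes uc: "unif_convex_on (lp p) (lpnorm p) s c" and A: "1 < A"
 shows "\<exists>C::real. \<forall>\<Sigma> X. \<Sigma> \<noteq> {} \<and> \<Sigma> \<subseteq> lp p \<and> lp_connected p \<Sigma> \<and> multires_nets p \<Sigma> X \<longrightarrow>
  Sfun p s \<Sigma> X A \<le> ennreal C * H1 p \<Sigma>"
proof -
 interpret uc: unif_convex_on "lp p" "lpnorm p" s c by (rule uc)
 obtain \<kappa> :: nat where \<kappa>: "20 * A < 2 ^ \<kappa>" using real_arch_pow[of 2 "20 * A"] by auto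
 define K where "K = max 0 (uc.Kstar A \<kappa> + 2 * real \<kappa> + 2)"
 define C where "C = 16 * (1 + 2 * A * K)"
 have K: "0 \<le> K" by (simp add: K_def)
 have C: "0 < C" using A K by (simp add: C_def add_pos_nonneg)
 have "Sfun p s \<Sigma> X A \<le> ennreal C * H1 p \<Sigma>"
  if \<Sigma>: "\<Sigma> \<noteq> {}" "\<Sigma> \<subseteq> lp p" "lp_connected p \<Sigma>" and X: "multires_nets p \<Sigma> X" for \<Sigma> X
 proof (cases "H1 p \<Sigma> = \<infinity>")
  case True
  then show ?thesis using C by (simp add: ennreal_mult_top)
 next
  case False
  then obtain H where H: "H1 p \<Sigma> = ennreal H" "0 \<le> H" by (cases "H1 p \<Sigma>") auto
  have step: "Sfun p s \<Sigma> X A \<le> ennreal (C * H') " if H': "H \<le> H'" "0 < H'" for H'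
  proof -
   let ?r = "\<lambda>n::nat. 2 powr (- real_of_int (int n))"
   have rlim: "?r \<longlonglongrightarrow> 0"
   proof -
    have "?r = (\<lambda>n. (1/2) ^ n)" by (simp add: powr_minus powr_realpow power_one_over inverse_eq_divide)
    then show ?thesis by (simp add: LIMSEQ_power_zero)
   qed
   obtain h where h: "lip h" "\<Sigma> \<subseteq> h ` {0..16 * H'}"
   proof (rule connected_curve[OF mcomplete_lp[OF p_ge] \<Sigma>(3)[unfolded lp_connected_eq] \<Sigma>(2,1), where H=H' and X="\<lambda>n. X (int n)" and r="?r"])
    show "0 \<le> H'" using H' by simp
    show "hcont \<delta> \<Sigma> \<le> ennreal H'" if "0 < \<delta>" for \<delta>
     using hcont_le_H1[OF that, of \<Sigma>] ennreal_leI[OF H'(1)] unfolding H(1) by (rule order_trans)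
    show "0 < ?r n" for n by simp
    show "?r \<longlonglongrightarrow> 0" by (rule rlim)
    show "X (int n) \<subseteq> \<Sigma>" for n by (rule nets(1)[OF X])
    show "?r n \<le> lpnorm p (x - y)" if "x \<in> X (int n)" "y \<in> X (int n)" "x \<noteq> y" for n x y by (rule nets(3)[OF X that])
    show "\<exists>y\<in>X (int n). lpnorm p (y - x) < ?r n" if "x \<in> \<Sigma>" for n x by (rule nets(4)[OF X that])
   qed
   define L where "L = 16 * H'"
   interpret cv: curve_on "lp p" "lpnorm p" s c h L by unfold_locales (use h H' in \<open>simp_all add: L_def\<close>)
   have \<Sigma>G: "\<Sigma> \<subseteq> cv.G" using h(2) unfolding cv.G_def by (simp only: L_def)
   have "Sfun p s \<Sigma> X A \<le> ennreal (L + 2 * A * (K * L))"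
   proof (rule Sfun_le[OF \<Sigma>(2) X])
    show "lpdiam p \<Sigma> \<le> ennreal L" unfolding lpdiam_eq
    proof (rule ediam_le)
     fix x y assume "x \<in> \<Sigma>" "y \<in> \<Sigma>"
     then have "lpnorm p (x - y) \<le> cv.dg 0 L" using \<Sigma>G by (intro cv.G_diam) auto
     also have "\<dots> \<le> L" using cv.dg_le_len[of 0 L] cv.L_pos by simp
     finally show "lpnorm p (x - y) \<le> L" .
    qed
    show "0 < A" "0 \<le> L" "0 \<le> K * L" using A cv.L_pos K by simp_all
    fix F :: "(int \<times> seq) set" assume F: "finite F" "F \<subseteq> {(k, x). x \<in> X k}"
    have FX: "x \<in> X k" if "(k, x) \<in> F" for k x using F(2) that by auto
    have FS: "x \<in> \<Sigma>" if "(k, x) \<in> F" for k x using nets(1)[OF X] FX[OF that] by auto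
    have R: "0 < A * mesh k" for k using A by simp
    have "(\<Sum>(k, x)\<in>F. bnum A \<Sigma> k x powr s * mesh k)
     \<le> (uc.Kstar A \<kappa> + 2 * real \<kappa> + 2) * L"
    proof (rule cv.curve_star[where b="\<lambda>k x. bnum A \<Sigma> k x"])
     show "1 \<le> A" "20 * A \<le> 2 ^ \<kappa>" using A \<kappa> by simp_all
     show "x \<in> cv.G" if "(k, x) \<in> F" for k x using \<Sigma>G FS[OF that] by (rule subsetD)
     show "mesh k \<le> lpnorm p (x - y)" if "(k, x) \<in> F" "(k, y) \<in> F" "x \<noteq> y" for k x y
      by (rule nets(3)[OF X FX[OF that(1)] FX[OF that(2)] that(3)])
     show "0 \<le> bnum A \<Sigma> k x" if "(k, x) \<in> F" for k x by (rule beta_nonneg[OF \<Sigma>(2) FS[OF that] R])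
     show "\<exists>w\<in>lp p. w \<noteq> 0" by (rule nontriv)
     show "\<exists>y\<in>cv.G. lpnorm p (y - x) \<le> A * mesh k \<and>
       (\<forall>t. bnum A \<Sigma> k x * (A * mesh k) \<le> lpnorm p (y - (a + t *\<^sub>R w)))"
      if kx: "(k, x) \<in> F" and aw: "a \<in> lp p" "w \<in> lp p" "w \<noteq> 0" and b: "0 < bnum A \<Sigma> k x" for k x a w
      using beta_witness[OF \<Sigma>(2) FS[OF kx] R b aw] \<Sigma>G by (elim bexE) (intro bexI, auto)
    qed (rule F)
    also have "\<dots> \<le> K * L" using cv.L_pos by (intro mult_right_mono) (simp_all add: K_def)
    finally show "(\<Sum>(k, x)\<in>F. bnum A \<Sigma> k x powr s * mesh k) \<le> K * L" .
   qed
   also have "L + 2 * A * (K * L) = C * H'" by (simp add: L_def C_def algebra_simps)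
   finally show ?thesis .
  qed
  have "Sfun p s \<Sigma> X A \<le> ennreal (C * H)"
  proof (rule ennreal_le_epsilon)
   fix \<epsilon> :: real assume \<epsilon>: "0 < \<epsilon>"
   have "Sfun p s \<Sigma> X A \<le> ennreal (C * (H + \<epsilon> / C))" using \<epsilon> C H(2) by (intro step) (simp_all add: add_nonneg_pos)
   also have "C * (H + \<epsilon> / C) = C * H + \<epsilon>" using C by (simp add: distrib_left)
   also have "ennreal (C * H + \<epsilon>) = ennreal (C * H) + ennreal \<epsilon>" using C H(2) \<epsilon> by (intro ennreal_plus) simp_all
   finally show "Sfun p s \<Sigma> X A \<le> ennreal (C * H) + ennreal \<epsilon>" .
  qed
  then show ?thesis using C H by (simp add: ennreal_mult)
 qed
 then show ?thesis by (intro exI[of _ C]) auto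
qed

end

section \<open>Sufficiency\<close>

lemma between_reals:
 fixes x y z a b c h r :: real
 assumes "\<bar>a - \<bar>x - z\<bar>\<bar> \<le> 2 * h" "\<bar>b - \<bar>z - y\<bar>\<bar> \<le> 2 * h" "\<bar>c - \<bar>x - y\<bar>\<bar> \<le> 2 * h"
  "h \<le> r / 20" "0 < r" "r \<le> a" "r \<le> b" "a < c" "b < c"
 shows "x < z \<and> z < y \<or> y < z \<and> z < x"
proof (cases "x \<le> y")
 case True
 have "x < z" using assms True by (intro linorder_not_le[THEN iffD1] notI) linarith
 moreover have "z < y" using assms True by (intro linorder_not_le[THEN iffD1] notI) linarith
 ultimately show ?thesis by simp
next
 case False
 have "y < z" using assms False by (intro linorder_not_le[THEN iffD1] notI) linarith
 moreover have "z < x" using assms False by (intro linorder_not_le[THEN iffD1] notI) linarith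
 ultimately show ?thesis by simp
qed

context normed_on
begin

lemma line_coords:
 assumes V: "u \<in> V" "v \<in> V" "a \<in> V" "w \<in> V" and w: "N w = 1"
  and u: "N (u - (a + t *\<^sub>R w)) \<le> h" and v: "N (v - (a + t' *\<^sub>R w)) \<le> h"
 shows "\<bar>N (u - v) - \<bar>t - t'\<bar>\<bar> \<le> 2 * h"
proof -
 let ?u = "a + t *\<^sub>R w" and ?v = "a + t' *\<^sub>R w"
 have "?u - ?v = (t - t') *\<^sub>R w" by (simp add: algebra_simps)
 then have e: "N (?u - ?v) = \<bar>t - t'\<bar>" using V w by (simp add: N_scale)
 have 1: "N (u - v) \<le> N (u - ?u) + N (?u - ?v) + N (?v - v)" using V by (intro N_three) simp_all
 have 2: "N (?u - ?v) \<le> N (?u - u) + N (u - v) + N (v - ?v)" using V by (intro N_three) simp_all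
 have c: "N (?v - v) = N (v - ?v)" "N (?u - u) = N (u - ?u)" by (rule N_commute)+
 show ?thesis using 1 2 u v unfolding c e by linarith
qed

end

context unif_smooth_on
begin

text \<open>The summand 1 makes the constant positive, as needed for a positive threshold of
  flatness.\<close>

definition Kbend :: real where "Kbend = cS * (2 powr q * 2 powr (q - 1)) + 1"

lemma Kbend_pos: "0 < Kbend" using cS_nonneg by (simp add: Kbend_def add_nonneg_pos)

text \<open>Coordinates along the line put z at a fraction t between a and b. Its offset e from that
  point of the chord is an affine expression in the three offsets from the line, so N e \<le> 2
  \<eta> r. Since z is at distance at least r from a and from b, both pieces of the chord have
  length at least r / 2, and \<open>smooth_excess\<close> gives the claim.\<close>

lemma excess_near_line:
 assumes V: "a \<in> V" "z \<in> V" "b \<in> V" "o' \<in> V" "u \<in> V" and u: "N u = 1"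
  and \<eta>: "0 \<le> \<eta>" "\<eta> \<le> 1 / 20" and r: "0 < r"
  and a: "N (a - (o' + \<alpha> *\<^sub>R u)) \<le> \<eta> * r" and z: "N (z - (o' + \<zeta> *\<^sub>R u)) \<le> \<eta> * r" and b: "N (b - (o' + \<beta> *\<^sub>R u)) \<le> \<eta> * r"
  and sep: "r \<le> N (a - z)" "r \<le> N (z - b)" and btw: "N (a - z) < N (a - b)" "N (z - b) < N (a - b)"
 shows "N (a - z) + N (z - b) - N (a - b) \<le> Kbend * \<eta> powr q * r"
proof -
 define h where "h = \<eta> * r"
 have h: "0 \<le> h" "h \<le> r / 20" using \<eta> r mult_right_mono[OF \<eta>(2), of r] by (simp_all add: h_def)
 have az: "\<bar>N (a - z) - \<bar>\<alpha> - \<zeta>\<bar>\<bar> \<le> 2 * h" unfolding h_def by (rule line_coords[OF V(1,2,4,5) u a z])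
 have zb: "\<bar>N (z - b) - \<bar>\<zeta> - \<beta>\<bar>\<bar> \<le> 2 * h" unfolding h_def by (rule line_coords[OF V(2,3,4,5) u z b])
 have ab: "\<bar>N (a - b) - \<bar>\<alpha> - \<beta>\<bar>\<bar> \<le> 2 * h" unfolding h_def by (rule line_coords[OF V(1,3,4,5) u a b])
 have bt: "\<alpha> < \<zeta> \<and> \<zeta> < \<beta> \<or> \<beta> < \<zeta> \<and> \<zeta> < \<alpha>" by (rule between_reals[OF az zb ab h(2) r sep btw])
 define t where "t = (\<zeta> - \<alpha>) / (\<beta> - \<alpha>)"
 have ne: "\<beta> - \<alpha> \<noteq> 0" using bt by auto
 have t: "0 < t" "t < 1" using bt by (auto simp: t_def zero_less_divide_iff divide_less_eq)
 have "t * (\<beta> - \<alpha>) = \<zeta> - \<alpha>" using ne by (simp add: t_def)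
 then have \<zeta>: "\<zeta> = (1 - t) * \<alpha> + t * \<beta>" by (simp add: algebra_simps)
 define w where "w = b - a"
 define e where "e = z - a - t *\<^sub>R w"
 have wV: "w \<in> V" and eV: "e \<in> V" using V by (simp_all add: w_def e_def)
 define p1 where "p1 = z - (o' + \<zeta> *\<^sub>R u)"
 define p2 where "p2 = a - (o' + \<alpha> *\<^sub>R u)"
 define p3 where "p3 = b - (o' + \<beta> *\<^sub>R u)"
 have pV: "p1 \<in> V" "p2 \<in> V" "p3 \<in> V" using V by (simp_all add: p1_def p2_def p3_def)
 have "e = (p1 - (1 - t) *\<^sub>R p2) - t *\<^sub>R p3"
 proof -
  have z': "z = p1 + (o' + ((1 - t) * \<alpha> + t * \<beta>) *\<^sub>R u)" using \<zeta> by (simp add: p1_def)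
  have a': "a = p2 + (o' + \<alpha> *\<^sub>R u)" by (simp add: p2_def)
  have b': "b = p3 + (o' + \<beta> *\<^sub>R u)" by (simp add: p3_def)
  show ?thesis unfolding e_def w_def z' a' b' by (simp add: algebra_simps)
 qed
 also have "N ((p1 - (1 - t) *\<^sub>R p2) - t *\<^sub>R p3) \<le> N p1 + N ((1 - t) *\<^sub>R p2) + N (t *\<^sub>R p3)"
  using N_triangle[of "p1 - (1 - t) *\<^sub>R p2" "- (t *\<^sub>R p3)"] N_triangle[of p1 "- ((1 - t) *\<^sub>R p2)"] pV
   V_subspace by (simp add: subspace_neg)
 also have "N ((1 - t) *\<^sub>R p2) = (1 - t) * N p2" using pV t by (simp add: N_scale)
 also have "N (t *\<^sub>R p3) = t * N p3" using pV t by (simp add: N_scale)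
 also have "N p1 + (1 - t) * N p2 + t * N p3 \<le> h + (1 - t) * h + t * h"
  using z a b t unfolding h_def p1_def p2_def p3_def by (intro add_mono mult_left_mono) simp_all
 also have "h + (1 - t) * h + t * h = 2 * h" by (simp add: algebra_simps)
 finally have Ne: "N e \<le> 2 * h" .
 have za: "z - a = t *\<^sub>R w + e" by (simp add: e_def)
 have bz: "b - z = (1 - t) *\<^sub>R w - e" by (simp add: e_def w_def algebra_simps)
 have Nza: "N (a - z) = N (t *\<^sub>R w + e)" using N_commute[of a z] za by simp
 have Nbz: "N (z - b) = N ((1 - t) *\<^sub>R w - e)" using N_commute[of z b] bz by simp
 have Nab: "N (a - b) = N w" unfolding w_def by (rule N_commute)
 have Nw: "0 < N w" using btw(1) Nab N_nonneg[of "a - z"] by linarith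
 have m1: "r / 2 \<le> t * N w"
 proof -
  have "N (t *\<^sub>R w + e) \<le> N (t *\<^sub>R w) + N e" using wV eV by (intro N_triangle) simp_all
  moreover have "N (t *\<^sub>R w) = t * N w" using wV t by (simp add: N_scale)
  ultimately show ?thesis using sep(1) Nza Ne h r by linarith
 qed
 have m2: "r / 2 \<le> (1 - t) * N w"
 proof -
  have "N ((1 - t) *\<^sub>R w - e) \<le> N ((1 - t) *\<^sub>R w) + N e"
   using N_triangle[of "(1 - t) *\<^sub>R w" "- e"] wV eV V_subspace by (simp add: subspace_neg)
  moreover have "N ((1 - t) *\<^sub>R w) = (1 - t) * N w" using wV t by (simp add: N_scale)
  ultimately show ?thesis using sep(2) Nbz Ne h r by linarith
 qed
 have m: "r / 2 \<le> min t (1 - t) * N w" using m1 m2 by (simp add: min_def)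
 have "N (a - z) + N (z - b) - N (a - b) \<le> cS * N e powr q * (min t (1 - t) * N w) powr (1 - q)"
  using smooth_excess[OF wV eV Nw t] Nza Nbz Nab by linarith
 also have "\<dots> \<le> cS * (2 * h) powr q * (r / 2) powr (1 - q)"
 proof (intro mult_mono mult_left_mono)
  show "N e powr q \<le> (2 * h) powr q" using Ne q_gt by (intro powr_mono2) simp_all
  show "(min t (1 - t) * N w) powr (1 - q) \<le> (r / 2) powr (1 - q)" using m r q_gt by (intro powr_mono2') simp_all
 qed (use cS_nonneg in simp_all)
 also have "\<dots> = cS * (2 powr q * 2 powr (q - 1)) * (\<eta> powr q * r)"
 proof -
  have "(2 * h) powr q = 2 powr q * \<eta> powr q * r powr q" using \<eta> r by (simp add: h_def powr_mult)
  moreover have "(r / 2) powr (1 - q) = r powr (1 - q) * 2 powr (q - 1)"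
   using r by (simp add: powr_divide powr_diff)
  ultimately have "cS * (2 * h) powr q * (r / 2) powr (1 - q)
   = cS * (2 powr q * 2 powr (q - 1)) * (\<eta> powr q * (r powr q * r powr (1 - q)))" by (simp only: mult_ac)
  moreover have "r powr q * r powr (1 - q) = r" using r by (simp add: powr_add[symmetric])
  ultimately show ?thesis by simp
 qed
 also have "\<dots> \<le> Kbend * (\<eta> powr q * r)" unfolding Kbend_def using r by (intro mult_right_mono) simp_all
 finally show ?thesis by (simp add: mult.assoc)
qed

end

section \<open>From small beta numbers to flat points, and sufficiency\<close>

context lp_space
begin

text \<open>The tolerance r / 20 to a line makes coordinates accurate up to r / 10. A nearly optimal
  line yields the excess bound only for \<eta> above 2 A beta; letting \<eta> decrease to 2 A beta
  gives the bound with beta itself, in particular excess 0 for beta number 0.\<close>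

lemma flat_beta:
 assumes us: "unif_smooth_on (lp p) (lpnorm p) q c" and E: "E \<subseteq> lp p" and x: "x \<in> E" and r: "0 < r" and A: "240 \<le> A"
  and b: "2 * A * beta p E (lpcball p x (A * r)) < 1 / 20"
 shows "flat E x r (unif_smooth_on.Kbend q c * (2 * A * beta p E (lpcball p x (A * r))) powr q * r)"
proof -
 interpret us: unif_smooth_on "lp p" "lpnorm p" q c by (rule us)
 let ?b = "beta p E (lpcball p x (A * r))"
 have Ar: "0 < A * r" using A r by simp
 have b0: "0 \<le> 2 * A * ?b" using beta_nonneg[OF E x Ar] A by simp
 have near: "lpnorm p (y - x) \<le> A * r" if "lpnorm p (x - y) \<le> 240 * r" for y
 proof -
  have "240 * r \<le> A * r" using A r by (intro mult_right_mono) simp_all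
  then show ?thesis using that N_commute[of x y] by linarith
 qed
 have line: "\<exists>a w. a \<in> lp p \<and> w \<in> lp p \<and> lpnorm p w = 1 \<and>
   (\<forall>y\<in>E. lpnorm p (x - y) \<le> 240 * r \<longrightarrow> (\<exists>t. lpnorm p (y - (a + t *\<^sub>R w)) \<le> \<eta> * r))" if \<eta>: "2 * A * ?b < \<eta>" for \<eta>
 proof -
  have "(2 * A * ?b) * r < \<eta> * r" using \<eta> r by (rule mult_strict_right_mono)
  then have c: "?b * (2 * (A * r)) < \<eta> * r" by (simp add: mult_ac)
  obtain a w where aw: "a \<in> lp p" "w \<in> lp p" "lpnorm p w = 1"
   and pts: "\<And>y. y \<in> E \<Longrightarrow> lpnorm p (y - x) \<le> A * r \<Longrightarrow> \<exists>t. lpnorm p (y - (a + t *\<^sub>R w)) < \<eta> * r"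
   using beta_line[OF E x Ar c] by metis
  have "\<exists>t. lpnorm p (y - (a + t *\<^sub>R w)) \<le> \<eta> * r" if y: "y \<in> E" "lpnorm p (x - y) \<le> 240 * r" for y
  proof -
   obtain t where "lpnorm p (y - (a + t *\<^sub>R w)) < \<eta> * r" using pts[OF y(1) near[OF y(2)]] by (elim exE)
   then show ?thesis by (intro exI[of _ t]) simp
  qed
  then show ?thesis using aw by (intro exI[of _ a] exI[of _ w] conjI ballI impI) simp_all
 qed
 have EV: "y \<in> lp p" if "y \<in> E" for y using E that by (rule subsetD)
 have coord: "\<exists>\<pi>. \<forall>u\<in>E. \<forall>v\<in>E. lpnorm p (x - u) \<le> 240 * r \<longrightarrow> lpnorm p (x - v) \<le> 240 * r \<longrightarrow>
   \<bar>lpnorm p (u - v) - \<bar>\<pi> u - \<pi> v\<bar>\<bar> \<le> r / 10"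
 proof -
  obtain a w where aw: "a \<in> lp p" "w \<in> lp p" "lpnorm p w = 1"
   and pts: "\<forall>y\<in>E. lpnorm p (x - y) \<le> 240 * r \<longrightarrow> (\<exists>t. lpnorm p (y - (a + t *\<^sub>R w)) \<le> 1 / 20 * r)"
   using line[OF b] by (elim exE conjE)
  define \<pi> where "\<pi> y = (SOME t. lpnorm p (y - (a + t *\<^sub>R w)) \<le> 1 / 20 * r)" for y
  have \<pi>: "lpnorm p (y - (a + \<pi> y *\<^sub>R w)) \<le> 1 / 20 * r" if "y \<in> E" "lpnorm p (x - y) \<le> 240 * r" for y
   unfolding \<pi>_def by (rule someI_ex[OF mp[OF bspec[OF pts that(1)] that(2)]])
  have "\<bar>lpnorm p (u - v) - \<bar>\<pi> u - \<pi> v\<bar>\<bar> \<le> r / 10"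
   if "u \<in> E" "v \<in> E" "lpnorm p (x - u) \<le> 240 * r" "lpnorm p (x - v) \<le> 240 * r" for u v
   using line_coords[OF EV[OF that(1)] EV[OF that(2)] aw \<pi>[OF that(1,3)] \<pi>[OF that(2,4)]] by simp
  then show ?thesis by (intro exI[of _ \<pi>]) simp
 qed
 have exc: "lpnorm p (a - z) + lpnorm p (z - b) - lpnorm p (a - b) \<le> us.Kbend * (2 * A * ?b) powr q * r"
  if abz: "a \<in> E" "z \<in> E" "b \<in> E" and rng: "lpnorm p (x - a) \<le> 240 * r" "lpnorm p (x - z) \<le> 240 * r" "lpnorm p (x - b) \<le> 240 * r"
   and sep: "r \<le> lpnorm p (a - z)" "r \<le> lpnorm p (z - b)" and bt: "btw z a b" for a z b
 proof -
  have bt': "lpnorm p (a - z) < lpnorm p (a - b)" "lpnorm p (z - b) < lpnorm p (a - b)" using bt by (simp_all add: btw_def)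
  define gap where "gap = 1 / 20 - 2 * A * ?b"
  define \<eta> where "\<eta> n = 2 * A * ?b + gap / real (Suc n)" for n
  have gap: "0 < gap" using b by (simp add: gap_def)
  have \<eta>: "2 * A * ?b < \<eta> n" "\<eta> n \<le> 1 / 20" for n
  proof -
   have "gap / real (Suc n) \<le> gap / 1" using gap by (intro divide_left_mono) simp_all
   then have "\<eta> n \<le> 2 * A * ?b + gap / 1" unfolding \<eta>_def by (rule add_left_mono)
   then show "\<eta> n \<le> 1 / 20" by (simp add: gap_def)
   have "0 < gap / real (Suc n)" using gap by (intro divide_pos_pos) simp_all
   then show "2 * A * ?b < \<eta> n" unfolding \<eta>_def by (rule less_add_same_cancel1[THEN iffD2])
  qed
  have bound: "lpnorm p (a - z) + lpnorm p (z - b) - lpnorm p (a - b) \<le> us.Kbend * \<eta> n powr q * r" for n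
  proof -
   obtain o' w where ow: "o' \<in> lp p" "w \<in> lp p" "lpnorm p w = 1"
    and pts: "\<forall>y\<in>E. lpnorm p (x - y) \<le> 240 * r \<longrightarrow> (\<exists>t. lpnorm p (y - (o' + t *\<^sub>R w)) \<le> \<eta> n * r)"
    using line[OF \<eta>(1)[of n]] by (elim exE conjE)
   obtain \<alpha> where \<alpha>: "lpnorm p (a - (o' + \<alpha> *\<^sub>R w)) \<le> \<eta> n * r" using bspec[OF pts abz(1)] rng(1) by (elim impE exE)
   obtain \<zeta> where \<zeta>: "lpnorm p (z - (o' + \<zeta> *\<^sub>R w)) \<le> \<eta> n * r" using bspec[OF pts abz(2)] rng(2) by (elim impE exE)
   obtain \<beta> where \<beta>: "lpnorm p (b - (o' + \<beta> *\<^sub>R w)) \<le> \<eta> n * r" using bspec[OF pts abz(3)] rng(3) by (elim impE exE)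
   have "0 \<le> \<eta> n" using b0 \<eta>(1)[of n] by linarith
   then show ?thesis
    by (rule us.excess_near_line[OF EV[OF abz(1)] EV[OF abz(2)] EV[OF abz(3)] ow _ \<eta>(2) r \<alpha> \<zeta> \<beta> sep bt'])
  qed
  have lim: "(\<lambda>n. us.Kbend * \<eta> n powr q * r) \<longlonglongrightarrow> us.Kbend * (2 * A * ?b) powr q * r"
  proof (intro tendsto_mult tendsto_const)
   have "(\<lambda>n. gap / real (Suc n)) \<longlonglongrightarrow> 0" by (rule LIMSEQ_Suc[OF lim_const_over_n])
   then have "\<eta> \<longlonglongrightarrow> 2 * A * ?b + 0" unfolding \<eta>_def by (intro tendsto_add tendsto_const)
   then have l: "\<eta> \<longlonglongrightarrow> 2 * A * ?b" by simp
   show "(\<lambda>n. \<eta> n powr q) \<longlonglongrightarrow> (2 * A * ?b) powr q"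
   proof (rule tendsto_powr'[OF l tendsto_const])
    have "0 \<le> \<eta> n" for n using b0 \<eta>(1)[of n] by linarith
    then show "2 * A * ?b \<noteq> 0 \<or> 0 < q \<and> (\<forall>\<^sub>F n in sequentially. 0 \<le> \<eta> n)" using us.q_gt by simp
   qed
  qed
  show ?thesis by (rule LIMSEQ_le_const[OF lim]) (use bound in auto)
 qed
 show ?thesis unfolding flat_def using coord exc by simp
qed

lemma lip_curve:
 assumes uc: "unif_convex_on (lp p) (lpnorm p) s c" and h: "lip h" and L: "0 < L"
 shows "lp_curve p (h ` {0..L})" "H1 p (h ` {0..L}) \<le> ennreal L"
proof -
 interpret uc: unif_convex_on "lp p" "lpnorm p" s c by (rule uc)
 interpret cv: curve_on "lp p" "lpnorm p" s c h L by unfold_locales (rule h, rule L)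
 have "hcont \<delta> (h ` {0..L}) \<le> ennreal L" if "\<delta> > 0" for \<delta> using cv.hcont_G_le[OF that] by (simp add: cv.G_def)
 then show "H1 p (h ` {0..L}) \<le> ennreal L" unfolding H1_def H1_delta_eq by (intro SUP_least) simp
 have lip: "lpnorm p (\<lambda>i. h (s * L) i - h (t * L) i) < e" if "0 < e" "\<bar>s - t\<bar> < e / L" for s t e
 proof -
  have "lpnorm p (\<lambda>i. h (s * L) i - h (t * L) i) = lpnorm p (h (s * L) - h (t * L))" by (simp add: fun_diff_def)
  also have "\<dots> \<le> \<bar>s * L - t * L\<bar>" by (rule cv.g_lip)
  also have "\<dots> = \<bar>s - t\<bar> * L" using L by (simp add: left_diff_distrib[symmetric] abs_mult)
  also have "\<dots> < e" using that L by (simp add: pos_less_divide_eq)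
  finally show ?thesis .
 qed
 have im: "h ` {0..L} = (\<lambda>t. h (t * L)) ` {0..1}"
 proof -
  have "(\<lambda>t. t * L) ` {0..1} = {0..L}"
  proof (intro equalityI subsetI)
   fix t assume "t \<in> {0..L}"
   then show "t \<in> (\<lambda>t. t * L) ` {0..1}" using L by (intro image_eqI[of _ _ "t / L"]) (simp_all add: divide_le_eq)
  next
   fix t assume "t \<in> (\<lambda>t. t * L) ` {0..1}"
   then show "t \<in> {0..L}" using L by (auto simp: mult_left_le_one_le)
  qed
  then show ?thesis by (metis image_image)
 qed
 show "lp_curve p (h ` {0..L})" unfolding lp_curve_def
 proof (intro exI[of _ "\<lambda>t. h (t * L)"] conjI ballI allI impI im)
  show "(\<lambda>t. h (t * L)) ` {0..1} \<subseteq> lp p" by (intro image_subsetI) simp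
  show "\<exists>d>0. \<forall>s\<in>{0..1}. \<bar>s - t\<bar> < d \<longrightarrow> lpnorm p (\<lambda>i. h (s * L) i - h (t * L) i) < e" if "0 < e" for t e
   using lip[OF that] that L by (intro exI[of _ "e / L"]) simp
 qed
qed

lemma sufficiency:
 assumes us: "unif_smooth_on (lp p) (lpnorm p) q c" and uc: "unif_convex_on (lp p) (lpnorm p) s c'" and A: "240 \<le> A"
 shows "\<exists>C::real. \<forall>E X. E \<noteq> {} \<and> E \<subseteq> lp p \<and> multires_nets p E X \<and> Sfun p q E X A < \<infinity> \<longrightarrow>
  (\<exists>\<Gamma>. lp_curve p \<Gamma> \<and> E \<subseteq> \<Gamma> \<and> H1 p \<Gamma> \<le> ennreal C * Sfun p q E X A)"
proof -
 interpret us: unif_smooth_on "lp p" "lpnorm p" q c by (rule us)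
 have A0: "0 < A" using A by simp
 \<comment> \<open>With this value the condition \<theta> < \<epsilon> r says that 2 A beta < 1 /
   20, which is the hypothesis of \<open>flat_beta\<close>.\<close>
 define \<epsilon> where "\<epsilon> = us.Kbend * (1 / 20) powr q"
 have \<epsilon>: "0 < \<epsilon>" using us.Kbend_pos by (simp add: \<epsilon>_def)
 define K where "K = us.Kbend * (2 * A) powr q / (2 * A)"
 have K: "0 \<le> K" using us.Kbend_pos A0 by (simp add: K_def)
 define C where "C = 32 + 4 * (4 + 260 / \<epsilon>) * K"
 have C: "0 < C" using \<epsilon> K by (simp add: C_def add_pos_nonneg)
 have "\<exists>\<Gamma>. lp_curve p \<Gamma> \<and> E \<subseteq> \<Gamma> \<and> H1 p \<Gamma> \<le> ennreal C * Sfun p q E X A"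
  if E: "E \<noteq> {}" "E \<subseteq> lp p" and X: "multires_nets p E X" and fin: "Sfun p q E X A < \<infinity>" for E X
 proof -
  obtain S where S: "Sfun p q E X A = ennreal S" "0 \<le> S" using fin by (cases "Sfun p q E X A") auto
  have EV: "y \<in> lp p" if "y \<in> E" for y using E(2) that by (rule subsetD)
  have diam: "lpnorm p (x - y) \<le> S" if "x \<in> E" "y \<in> E" for x y
  proof -
   have "ediam E \<le> ennreal S" unfolding S(1)[symmetric] Sfun_def lpdiam_eq by simp
   then show ?thesis using N_le_ediam[OF that] S(2) by simp
  qed
  let ?b = "\<lambda>k x. bnum A E k x"
  have total: "(\<Sum>(k, x)\<in>F. ?b k x powr q * mesh k) \<le> S / (2 * A)" if "finite F" "F \<subseteq> {(k, x). x \<in> X k}" for F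
  proof -
   have "2 * A * (\<Sum>(k, x)\<in>F. ?b k x powr q * mesh k) \<le> S"
    using Sfun_ge[OF E(2) X A0 that, of q] S by (simp add: ennreal_le_iff)
   then show ?thesis using A0 by (simp add: field_simps)
  qed
  show ?thesis
  proof (cases "0 < S")
   \<comment> \<open>S bounds the diameter, so E is a single point. Its measure is 0, because the
     constant map is an admissible curve on [0, L] for every L > 0.\<close>
   case False
   obtain x where x: "x \<in> E" using E(1) by auto
   have "y = x" if "y \<in> E" for y
   proof -
    have "lpnorm p (y - x) = 0" using diam[OF that x] False N_nonneg[of "y - x"] by linarith
    then show ?thesis using N_eq_0[of "y - x"] EV[OF that] EV[OF x] by simp
   qed
   then have Ex: "E \<subseteq> {x}" by (intro subsetI) simp
   have lx: "lip (\<lambda>_. x)" using EV[OF x] by (auto simp: lip_def N_zero)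
   have im: "(\<lambda>_. x) ` {0..L} = {x}" if "0 < L" for L :: real using that by (auto intro!: image_eqI[of _ _ 0])
   have H1x: "H1 p {x} \<le> ennreal L" if "0 < L" for L
    using lip_curve(2)[OF uc lx that] unfolding im[OF that] .
   have "H1 p {x} \<le> 0"
   proof (rule ennreal_le_epsilon)
    fix e :: real assume "0 < e"
    from H1x[OF this] show "H1 p {x} \<le> 0 + ennreal e" by (simp only: add_0)
   qed
   moreover have "lp_curve p {x}" using lip_curve(1)[OF uc lx zero_less_one] unfolding im[OF zero_less_one] .
   ultimately show ?thesis using Ex by (intro exI[of _ "{x}"]) simp
  next
   case S0: True
   \<comment> \<open>The first scale satisfies S < r 0 \<le> 2 S: it exceeds the diameter, so the
     first net is a single point, and it costs only a multiple of S.\<close>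
   define k0 where "k0 = - (\<lfloor>log 2 S\<rfloor> + 1)"
   define r where "r n = 2 powr (- real_of_int (k0 + int n))" for n
   define Xn where "Xn n = X (k0 + int n)" for n
   define \<theta> where "\<theta> n x = us.Kbend * (2 * A * beta p E (lpcball p x (A * r n))) powr q * r n" for n x
   have r0: "0 < r n" for n by (simp add: r_def)
   have rh: "r n = 2 * r (Suc n)" for n
   proof -
    have "2 * r (Suc n) = 2 powr 1 * 2 powr (- real_of_int (k0 + int (Suc n)))" by (simp add: r_def)
    also have "\<dots> = 2 powr (1 + - real_of_int (k0 + int (Suc n)))" by (rule powr_add[symmetric])
    also have "1 + - real_of_int (k0 + int (Suc n)) = - real_of_int (k0 + int n)" by simp
    finally show ?thesis by (simp add: r_def)
   qed
   have rS: "S < r 0" "r 0 \<le> 2 * S"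
   proof -
    have e: "- real_of_int (k0 + int 0) = real_of_int \<lfloor>log 2 S\<rfloor> + 1" by (simp add: k0_def)
    have "2 powr (log 2 S) < r 0" unfolding r_def e by (intro powr_less_mono) (linarith, simp)
    then show "S < r 0" using S0 by simp
    have "r 0 \<le> 2 powr (log 2 S + 1)" unfolding r_def e by (intro powr_mono) simp_all
    also have "\<dots> = 2 * S" using S0 by (simp add: powr_add)
    finally show "r 0 \<le> 2 * S" .
   qed
   have XE: "Xn n \<subseteq> E" for n unfolding Xn_def by (rule nets(1)[OF X])
   have Xmono: "Xn n \<subseteq> Xn (Suc n)" for n using nets(2)[OF X, of "k0 + int n"] by (simp add: Xn_def algebra_simps)
   have Xsep: "r n \<le> lpnorm p (x - y)" if "x \<in> Xn n" "y \<in> Xn n" "x \<noteq> y" for n x y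
    using nets(3)[OF X, of x "k0 + int n" y] that by (simp add: Xn_def r_def)
   have Xnear: "\<exists>y\<in>Xn n. lpnorm p (y - x) < r n" if "x \<in> E" for n x
    using nets(4)[OF X that, of "k0 + int n"] by (simp add: Xn_def r_def)
   obtain x0 where x0: "x0 \<in> Xn 0" using Xnear E(1) by auto
   have X0: "Xn 0 = {x0}"
   proof (intro equalityI subsetI)
    fix y assume y: "y \<in> Xn 0"
    show "y \<in> {x0}"
    proof (rule ccontr)
     assume "y \<notin> {x0}"
     then have "r 0 \<le> lpnorm p (y - x0)" using Xsep[OF y x0] by simp
     also have "\<dots> \<le> S" using diam subsetD[OF XE y] subsetD[OF XE x0] by simp
     finally show False using rS(1) by simp
    qed
   qed (use x0 in simp)
   have \<theta>0: "0 \<le> \<theta> n x" for n x using us.Kbend_pos r0[of n] by (simp add: \<theta>_def)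
   have \<theta>_eq: "\<theta> n x = us.Kbend * (2 * A) powr q * (?b (k0 + int n) x powr q * 2 powr (- real_of_int (k0 + int n)))" if "x \<in> E" for n x
   proof -
    have "0 \<le> ?b (k0 + int n) x" using A0 by (intro beta_nonneg[OF E(2) that]) simp
    then show ?thesis unfolding \<theta>_def r_def using A0 by (simp add: powr_mult)
   qed
   have tot: "(\<Sum>(n, x)\<in>T. \<theta> n x) \<le> K * S" if T: "finite T" "\<And>n x. (n, x) \<in> T \<Longrightarrow> x \<in> Xn n" for T
   proof -
    let ?i = "\<lambda>(n, x). (k0 + int n, x)"
    have inj: "inj_on ?i T" by (rule inj_onI) auto
    have "(\<Sum>(n, x)\<in>T. \<theta> n x) = (\<Sum>(n, x)\<in>T. us.Kbend * (2 * A) powr q * (?b (k0 + int n) x powr q * 2 powr (- real_of_int (k0 + int n))))"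
    proof (rule sum.cong[OF refl])
     fix w assume w: "w \<in> T"
     obtain n x where nx: "w = (n, x)" by (cases w)
     have "x \<in> E" using subsetD[OF XE T(2)[OF w[unfolded nx]]] .
     from \<theta>_eq[OF this] show "(case w of (n, x) \<Rightarrow> \<theta> n x) = (case w of (n, x) \<Rightarrow> us.Kbend * (2 * A) powr q * (?b (k0 + int n) x powr q * 2 powr (- real_of_int (k0 + int n))))"
      unfolding nx prod.case .
    qed
    also have "\<dots> = us.Kbend * (2 * A) powr q * (\<Sum>(n, x)\<in>T. ?b (k0 + int n) x powr q * 2 powr (- real_of_int (k0 + int n)))"
     by (simp add: sum_distrib_left case_prod_unfold)
    also have "(\<Sum>(n, x)\<in>T. ?b (k0 + int n) x powr q * 2 powr (- real_of_int (k0 + int n))) = (\<Sum>(k, x)\<in>?i ` T. ?b k x powr q * mesh k)"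
     by (subst sum.reindex[OF inj]) (simp only: comp_def case_prod_unfold fst_conv snd_conv)
    also have "us.Kbend * (2 * A) powr q * \<dots> \<le> us.Kbend * (2 * A) powr q * (S / (2 * A))"
    proof (rule mult_left_mono[OF total])
     show "finite (?i ` T)" using T(1) by simp
     show "?i ` T \<subseteq> {(k, x). x \<in> X k}" using T(2) unfolding Xn_def by (intro image_subsetI) auto
    qed (use us.Kbend_pos in simp)
    finally show ?thesis by (simp add: K_def)
   qed
   have flat: "flat E x (r n) (\<theta> n x)" if x: "x \<in> Xn n" and less: "\<theta> n x < \<epsilon> * r n" for n x
   proof -
    have xE: "x \<in> E" using XE x by (rule subsetD)
    let ?bb = "2 * A * beta p E (lpcball p x (A * r n))"
    have "us.Kbend * (?bb powr q * r n) < us.Kbend * ((1 / 20) powr q * r n)" using less by (simp add: \<theta>_def \<epsilon>_def mult_ac)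
    then have "?bb powr q < (1 / 20) powr q" using us.Kbend_pos r0[of n] by simp
    have "?bb < 1 / 20"
    proof (rule ccontr)
     assume "\<not> ?bb < 1 / 20"
     then have "(1 / 20) powr q \<le> ?bb powr q" using us.q_gt by (intro powr_mono2) simp_all
     then show False using \<open>?bb powr q < (1 / 20) powr q\<close> by simp
    qed
    from flat_beta[OF us E(2) xE r0 A this] show ?thesis unfolding \<theta>_def .
   qed
   \<comment> \<open>The nets are finite only because the sum is. Points failing the flatness test
     cost at least \<epsilon> r each, so there are finitely many of them, and at most 11 of the
     others fit near one point of the coarser net.\<close>
   have Xfin: "finite (Xn n)" for n
   proof (induction n)
    case 0
    show ?case unfolding X0 by simp
   next
    case (Suc n)
    let ?m = "Suc n"
    show ?case
    proof (rule ccontr)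
     assume inf: "infinite (Xn ?m)"
     define Nb where "Nb x = {y \<in> Xn ?m. lpnorm p (x - y) < r n}" for x
     have "Xn ?m \<subseteq> (\<Union>x\<in>Xn n. Nb x)"
     proof
      fix y assume y: "y \<in> Xn ?m"
      obtain x where "x \<in> Xn n" "lpnorm p (x - y) < r n" using Xnear[OF subsetD[OF XE y], of n] by (elim bexE)
      then show "y \<in> (\<Union>x\<in>Xn n. Nb x)" using y unfolding Nb_def by auto
     qed
     then have "infinite (\<Union>x\<in>Xn n. Nb x)" using inf infinite_super by metis
     then obtain x where x: "x \<in> Xn n" "infinite (Nb x)" using Suc.IH by auto
     define NF where "NF = {y \<in> Xn ?m. \<epsilon> * r ?m \<le> \<theta> ?m y}"
     have "finite NF"
     proof (rule ccontr)
      assume infN: "infinite NF"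
      define k where "k = nat \<lceil>K * S / (\<epsilon> * r ?m)\<rceil> + 1"
      obtain T where T: "finite T" "card T = k" "T \<subseteq> NF" using infinite_arbitrarily_large[OF infN] by metis
      have e: "0 < \<epsilon> * r ?m" using \<epsilon> r0[of ?m] by simp
      have "real k * (\<epsilon> * r ?m) \<le> (\<Sum>y\<in>T. \<theta> ?m y)"
       unfolding T(2)[symmetric] by (rule sum_bounded_below) (use T(3) in \<open>auto simp: NF_def\<close>)
      also have "\<dots> = (\<Sum>(n, x)\<in>Pair ?m ` T. \<theta> n x)" by (subst sum.reindex) (auto intro: inj_onI)
      also have "\<dots> \<le> K * S" by (rule tot) (use T in \<open>auto simp: NF_def\<close>)
      finally have "real k \<le> K * S / (\<epsilon> * r ?m)" using e by (simp only: pos_le_divide_eq)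
      then show False unfolding k_def by linarith
     qed
     then have "infinite (Nb x - NF)" using x(2) by (rule Diff_infinite_finite)
     then obtain T where T: "finite T" "card T = 12" "T \<subseteq> Nb x - NF" using infinite_arbitrarily_large by metis
     obtain y where y: "y \<in> T" using T(2) by (metis card.empty ex_in_conv zero_neq_numeral)
     have TX: "u \<in> Xn ?m" "lpnorm p (x - u) < r n" "\<theta> ?m u < \<epsilon> * r ?m" if "u \<in> T" for u
      using subsetD[OF T(3) that] unfolding Nb_def NF_def by auto
     have xV: "x \<in> lp p" using EV[OF subsetD[OF XE x(1)]] .
     have TV: "u \<in> lp p" if "u \<in> T" for u using EV[OF subsetD[OF XE TX(1)[OF that]]] .
     have "card T \<le> 11"
     proof (rule flat_card_le[OF T(1) _ _ y flat[OF TX(1)[OF y] TX(3)[OF y]] r0 _ E(2)])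
      show "T \<subseteq> E" using TX(1) XE by (intro subsetI) auto
      show "separated (r ?m) T" unfolding separated_def using Xsep TX(1) by simp
      show "lpnorm p (y - u) \<le> 4 * r ?m" if "u \<in> T" for u
      proof -
       have "lpnorm p (y - u) \<le> lpnorm p (y - x) + lpnorm p (x - u)" using TV[OF y] TV[OF that] xV by (intro N_diff_triangle)
       then show ?thesis using TX(2)[OF y] TX(2)[OF that] N_commute[of y x] rh[of n] by linarith
      qed
     qed
     then show False using T(2) by simp
    qed
   qed
   interpret nt: net_tower "lp p" "\<lambda>x y. lpnorm p (x - y)" E Xn r \<theta> \<epsilon> x0
   proof unfold_locales
    show "E \<subseteq> lp p" by (rule E(2))
    show "finite (Xn j)" "Xn j \<subseteq> E" "Xn j \<subseteq> Xn (Suc j)" for j by (rule Xfin XE Xmono)+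
    show "separated (r j) (Xn j)" for j unfolding separated_def using Xsep by simp
    show "\<exists>x\<in>Xn j. lpnorm p (y - x) < r j" if y: "y \<in> Xn (Suc j)" for y j
    proof -
     obtain x where "x \<in> Xn j" "lpnorm p (x - y) < r j" using Xnear[OF subsetD[OF XE y], of j] by (elim bexE)
     then show ?thesis using N_commute[of x y] by (intro bexI[of _ x]) simp_all
    qed
    show "0 < r j" "r j = 2 * r (Suc j)" "0 \<le> \<theta> j x" "0 < \<epsilon>" "Xn 0 = {x0}" for j x by (rule r0 rh \<theta>0 \<epsilon> X0)+
    show "flat E x (r j) (\<theta> j x)" if "x \<in> Xn j" "\<theta> j x < \<epsilon> * r j" for x j by (rule flat[OF that])
   qed
   have graph: "\<exists>R. finite R \<and> sym R \<and> R \<subseteq> Xn n \<times> Xn n \<and> conn (Xn n) R \<and> wt R \<le> C * S" for n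
   proof -
    obtain R where R: "finite R" "sym R" "R \<subseteq> Xn n \<times> Xn n" "conn (Xn n) R"
     "wt R \<le> 16 * r 0 + 4 * (4 + 260 / \<epsilon>) * (\<Sum>j\<le>n. nt.\<Theta> j)" by (rule nt.spanning_graph)
    have "(\<Sum>j\<le>n. nt.\<Theta> j) = (\<Sum>(j, x)\<in>Sigma {..n} Xn. \<theta> j x)"
     unfolding nt.\<Theta>_def using Xfin by (intro sum.Sigma) simp_all
    also have "\<dots> \<le> K * S" by (rule tot) (use Xfin in auto)
    finally have "4 * (4 + 260 / \<epsilon>) * (\<Sum>j\<le>n. nt.\<Theta> j) \<le> 4 * (4 + 260 / \<epsilon>) * (K * S)"
     using \<epsilon> by (intro mult_left_mono) simp_all
    then have "wt R \<le> 32 * S + 4 * (4 + 260 / \<epsilon>) * (K * S)" using R(5) rS(2) by linarith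
    also have "\<dots> = C * S" by (simp add: C_def algebra_simps)
    finally show ?thesis using R by auto
   qed
   have rlim: "r \<longlonglongrightarrow> 0"
   proof -
    have "r n = r 0 * (1 / 2) ^ n" for n
    proof (induction n)
     case (Suc n)
     then show ?case using rh[of n] by simp
    qed simp
    then have "r = (\<lambda>n. r 0 * (1 / 2) ^ n)" by (intro ext)
    moreover have "(\<lambda>n. r 0 * (1 / 2) ^ n) \<longlonglongrightarrow> r 0 * 0" by (intro tendsto_mult tendsto_const LIMSEQ_power_zero) simp
    ultimately show ?thesis by simp
   qed
   have tb: "mtotally_bounded E" unfolding mtotally_bounded_def
   proof (intro allI impI)
    fix e :: real assume "0 < e"
    then have "eventually (\<lambda>n. r n < e) sequentially" using rlim by (auto dest: order_tendstoD)
    then obtain n where n: "r n < e" using eventually_happens trivial_limit_sequentially by blast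
    have "E \<subseteq> (\<Union>x\<in>Xn n. mball x e)"
    proof
     fix z assume z: "z \<in> E"
     obtain y where y: "y \<in> Xn n" "lpnorm p (y - z) < r n" using Xnear[OF z, of n] by (elim bexE)
     then have "z \<in> mball y e" using n EV[OF subsetD[OF XE y(1)]] EV[OF z] by (simp add: in_mball)
     then show "z \<in> (\<Union>x\<in>Xn n. mball x e)" using y(1) by auto
    qed
    with Xfin[of n] XE[of n] show "\<exists>K. finite K \<and> K \<subseteq> E \<and> E \<subseteq> (\<Union>x\<in>K. mball x e)"
     by (intro exI[of _ "Xn n"] conjI)
   qed
   have ne: "Xn n \<noteq> {}" for n using Xnear E(1) by auto
   obtain h where h: "lip h" "E \<subseteq> h ` {0..C * S}"
    by (rule curve_through_nets[OF mcomplete_lp[OF p_ge] E(2) tb Xfin XE ne Xnear rlim graph]) (assumption, rule that)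
   have CS: "0 < C * S" using C S0 by simp
   have "H1 p (h ` {0..C * S}) \<le> ennreal C * Sfun p q E X A"
    using lip_curve(2)[OF uc h(1) CS] C S by (simp add: ennreal_mult)
   then show ?thesis using lip_curve(1)[OF uc h(1) CS] h(2) by (intro exI[of _ "h ` {0..C * S}"]) simp
  qed
 qed
 then show ?thesis by (intro exI[of _ C]) auto
qed

end

theorem theorem1p4:
 shows
 "(\<forall>p A. 1 < p \<and> p \<le> 2 \<and> A \<ge> 240 \<longrightarrow> (\<exists>C::real. \<forall>E X.
   E \<noteq> {} \<and> E \<subseteq> lp p \<and> multires_nets p E X \<and> Sfun p p E X A < \<infinity> \<longrightarrow>
   (\<exists>\<Gamma>. lp_curve p \<Gamma> \<and> E \<subseteq> \<Gamma> \<and> H1 p \<Gamma> \<le> ennreal C * Sfun p p E X A)))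
\<and> (\<forall>p A. 1 < p \<and> p \<le> 2 \<and> A > 1 \<longrightarrow> (\<exists>C::real. \<forall>\<Sigma> X.
   \<Sigma> \<noteq> {} \<and> \<Sigma> \<subseteq> lp p \<and> lp_connected p \<Sigma> \<and> multires_nets p \<Sigma> X \<longrightarrow>
   Sfun p 2 \<Sigma> X A \<le> ennreal C * H1 p \<Sigma>))
\<and> (\<forall>p A. 2 \<le> p \<and> A \<ge> 240 \<longrightarrow> (\<exists>C::real. \<forall>E X.
   E \<noteq> {} \<and> E \<subseteq> lp p \<and> multires_nets p E X \<and> Sfun p 2 E X A < \<infinity> \<longrightarrow>
   (\<exists>\<Gamma>. lp_curve p \<Gamma> \<and> E \<subseteq> \<Gamma> \<and> H1 p \<Gamma> \<le> ennreal C * Sfun p 2 E X A)))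
\<and> (\<forall>p A. 2 \<le> p \<and> A > 1 \<longrightarrow> (\<exists>C::real. \<forall>\<Sigma> X.
   \<Sigma> \<noteq> {} \<and> \<Sigma> \<subseteq> lp p \<and> lp_connected p \<Sigma> \<and> multires_nets p \<Sigma> X \<longrightarrow>
   Sfun p p \<Sigma> X A \<le> ennreal C * H1 p \<Sigma>))"
proof (intro conjI allI impI; elim conjE)
 fix p A :: real assume p: "1 < p" "p \<le> 2" and A: "240 \<le> A"
 interpret lp_space p by unfold_locales (use p in simp)
 obtain c where "unif_convex_on (lp p) (lpnorm p) 2 c" using unif_convex_lp_le2[OF p] by (elim exE)
 from sufficiency[OF unif_smooth_lp_le2[OF p] this A] show "\<exists>C::real. \<forall>E X.
   E \<noteq> {} \<and> E \<subseteq> lp p \<and> multires_nets p E X \<and> Sfun p p E X A < \<infinity> \<longrightarrow>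
   (\<exists>\<Gamma>. lp_curve p \<Gamma> \<and> E \<subseteq> \<Gamma> \<and> H1 p \<Gamma> \<le> ennreal C * Sfun p p E X A)" .
next
 fix p A :: real assume p: "1 < p" "p \<le> 2" and A: "1 < A"
 interpret lp_space p by unfold_locales (use p in simp)
 obtain c where "unif_convex_on (lp p) (lpnorm p) 2 c" using unif_convex_lp_le2[OF p] by (elim exE)
 from necessity[OF this A] show "\<exists>C::real. \<forall>\<Sigma> X.
   \<Sigma> \<noteq> {} \<and> \<Sigma> \<subseteq> lp p \<and> lp_connected p \<Sigma> \<and> multires_nets p \<Sigma> X \<longrightarrow>
   Sfun p 2 \<Sigma> X A \<le> ennreal C * H1 p \<Sigma>" .
next
 fix p A :: real assume p: "2 \<le> p" and A: "240 \<le> A"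
 interpret lp_space p by unfold_locales (use p in simp)
 obtain K where "unif_smooth_on (lp p) (lpnorm p) 2 K" using unif_smooth_lp_ge2[OF p] by (elim exE)
 from sufficiency[OF this unif_convex_lp_ge2[OF p] A] show "\<exists>C::real. \<forall>E X.
   E \<noteq> {} \<and> E \<subseteq> lp p \<and> multires_nets p E X \<and> Sfun p 2 E X A < \<infinity> \<longrightarrow>
   (\<exists>\<Gamma>. lp_curve p \<Gamma> \<and> E \<subseteq> \<Gamma> \<and> H1 p \<Gamma> \<le> ennreal C * Sfun p 2 E X A)" .
next
 fix p A :: real assume p: "2 \<le> p" and A: "1 < A"
 interpret lp_space p by unfold_locales (use p in simp)
 from necessity[OF unif_convex_lp_ge2[OF p] A] show "\<exists>C::real. \<forall>\<Sigma> X.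
   \<Sigma> \<noteq> {} \<and> \<Sigma> \<subseteq> lp p \<and> lp_connected p \<Sigma> \<and> multires_nets p \<Sigma> X \<longrightarrow>
   Sfun p p \<Sigma> X A \<le> ennreal C * H1 p \<Sigma>" .
qed

end
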